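(* Let the plant and exosystem be as described in the context, and suppose Assumptions A1, A2, A3 and A4 of the context hold. Let $\mathbb{V}\subset\mathbb{R}^{n_v}$ and $\mathbb{W}\subset\mathbb{R}^{n_w}$ be compact sets containing the origin. Let $(M,N)$, $\Psi$, $\lambda$, $A_o$, $B$ be as in the context. Then there exist smooth positive functions $\rho_1,\dots,\rho_r:\mathbb{R}\to(0,\infty)$, a positive definite function $\pi_r:\mathbb{R}^{s+1}\to[0,\infty)$ and a real number $0<\sigma<1$ such that the following holds. For any $\epsilon>0$ there exists $\delta>0$ such that the event-triggered global robust practical output regulation problem (defined in the context) for the data $\mathbb{V},\mathbb{W},\epsilon$ is solved by the event-triggered output feedback control law $$u(t)=-\rho_r(\check\xi_r(t_k))\check\xi_r(t_k)+\Psi\eta(t_k),$$ $$\dot{\hat\xi}(t)=A_o\hat\xi(t)+\lambda e(t_k)+B\big(u(t)-\Psi\eta(t_k)\big),$$ $$\dot\eta(t)=M\eta(t)+Nu(t),\qquad t\in[t_k,t_{k+1}),\ k\in\mathbb{S},$$ where $$\check\xi_1(t)=e(t),\qquad \check\xi_{i+1}(t)=\hat\xi_{i+1}(t)+\rho_i(\check\xi_i(t))\check\xi_i(t),\quad i=1,\dots,r-1,$$ under the output-based event-triggered mechanism, with $t_0=0$, $$t_{k+1}=\inf\{t>t_k\;|\;\tilde\vartheta_r^2(t)+\pi_r(\tilde\chi(t))-\sigma^2\rho_r(\check\xi_r(t))\check\xi_r^2(t)\ge\delta^2\}.$$ Here, for $t\in[t_k,t_{k+1})$, $$\tilde\vartheta_r(t)=-\rho_r(\check\xi_r(t_k))\check\xi_r(t_k)+\rho_r(\check\xi_r(t))\check\xi_r(t),\qquad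 \tilde\chi(t)=\mathrm{col}\big(\eta(t_k)-\eta(t),\,e(t_k)-e(t)\big).$$
   Context: Notation: $\mathrm{col}(a_1,\dots,a_m)$ denotes the column vector obtained by stacking $a_1,\dots,a_m$. A function is positive definite if it vanishes at $0$ and is positive elsewhere. A class $\mathcal{K}_\infty$ function is a continuous, strictly increasing, unbounded function $[0,\infty)\to[0,\infty)$ vanishing at $0$. Plant ($r\ge1$ is the relative degree): $$\dot z=f(z,y,v,w),\quad \dot x_i=g_i(z,y,v,w)+x_{i+1}\ (i=1,\dots,r-1),\quad \dot x_r=g_r(z,y,v,w)+b(w)u,\quad y=x_1,$$ with state $z\in\mathbb{R}^{n_z}$, $x=\mathrm{col}(x_1,\dots,x_r)\in\mathbb{R}^r$, output $y\in\mathbb{R}$, input $u\in\mathbb{R}$, and uncertain constant vector $w\in\mathbb{R}^{n_w}$. The signal $v(t)\in\mathbb{R}^{n_v}$ is generated by the exosystem $\dot v=Sv$, $y_0=q(v,w)$. The regulated error is $e=y-y_0$. All functions are sufficiently smooth, $q(0,w)=0$, $f(0,0,0,w)=0$, $g_i(0,0,0,w)=0$, and $b(w)>0$ for all $w\in\mathbb{R}^{n_w}$. Assumption A1: all eigenvalues of $S$ are semi-simple with zero real parts. Assumption A2: there is a globally defined smooth function $\mathbf{z}:\mathbb{R}^{n_v}\times\mathbb{R}^{n_w}\to\mathbb{R}^{n_z}$ with $\mathbf{z}(0,w)=0$ and $\frac{\partial\mathbf{z}(v,w)}{\partial v}Sv=f(\mathbf{z}(v,w),q(v,w),v,w)$ for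 all $(v,w)$. Given A2, define $\mathbf{x}_1(v,w)=q(v,w)$, $\mathbf{x}_i(v,w)=\frac{\partial\mathbf{x}_{i-1}(v,w)}{\partial v}Sv-g_{i-1}(\mathbf{z}(v,w),q(v,w),v,w)$ for $i=2,\dots,r$, and $\mathbf{u}(v,w)=b^{-1}(w)\big(\frac{\partial\mathbf{x}_r(v,w)}{\partial v}Sv-g_r(\mathbf{z}(v,w),q(v,w),v,w)\big)$. Assumption A3: $\mathbf{u}(v,w)$ is a polynomial in $v$ with coefficients depending on $w$. Assumption A4: let $\bar f(\bar z,e,v,w)=f(\bar z+\mathbf{z}(v,w),e+q(v,w),v,w)-f(\mathbf{z}(v,w),q(v,w),v,w)$. For any compact $\Omega\subset\mathbb{R}^{n_v}\times\mathbb{R}^{n_w}$ there is a $\mathcal{C}^1$ function $V_0(\bar z)$ such that, for all $\mathrm{col}(v,w)\in\Omega$ and all $\bar z,e$, $\underline\alpha_0(\|\bar z\|)\le V_0(\bar z)\le\bar\alpha_0(\|\bar z\|)$ and $\frac{\partial V_0(\bar z)}{\partial\bar z}\bar f(\bar z,e,v,w)\le-\alpha_0(\|\bar z\|)+\gamma_0(e)$. Here $\gamma_0$ is a smooth positive definite function, $\underline\alpha_0,\bar\alpha_0,\alpha_0$ are class $\mathcal{K}_\infty$ functions, and $\limsup_{s\to0^+}s^2/\alpha_0(s)<\infty$. Internal model data: under A1–A3 there exist an integer $s$ and reals $\varrho_1,\dots,\varrho_s$ such that, along all exosystem trajectories and for all $w$, $\frac{d^s\mathbf{u}}{dt^s}=\varrho_1\mathbf{u}+\varrho_2\frac{d\mathbf{u}}{dt}+\cdots+\varrho_s\frac{d^{s-1}\mathbf{u}}{dt^{s-1}}$,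 and all roots of $\lambda^s-\varrho_1-\varrho_2\lambda-\cdots-\varrho_s\lambda^{s-1}$ are distinct with zero real part; fix these. Let $\Phi\in\mathbb{R}^{s\times s}$ be the companion matrix with ones on the superdiagonal, last row $(\varrho_1,\dots,\varrho_s)$ and zeros elsewhere, and let $\Gamma=[1,0,\dots,0]\in\mathbb{R}^{1\times s}$. Let $(M,N)$ be any controllable pair with $M\in\mathbb{R}^{s\times s}$ Hurwitz and $N\in\mathbb{R}^{s\times1}$, let $T$ be the unique nonsingular solution of $T\Phi-MT=N\Gamma$, and let $\Psi=\Gamma T^{-1}$. Observer data: $B=\mathrm{col}(0,\dots,0,1)\in\mathbb{R}^r$, and $\lambda=\mathrm{col}(\lambda_1,\dots,\lambda_r)$ is any vector such that the $r\times r$ matrix $A_o$ with first column $-\lambda$, ones on the superdiagonal and zeros elsewhere is Hurwitz. The controller state is $\eta\in\mathbb{R}^s$, $\hat\xi=\mathrm{col}(\hat\xi_1,\dots,\hat\xi_r)\in\mathbb{R}^r$. $\mathbb{S}\subseteq\{0,1,2,\dots\}$ denotes the index set of the triggering times $t_k$ generated by the event-triggered mechanism, with $t_0=0$. If there is no further triggering after some $t_k$, then $t_{k+1}=\infty$. Event-triggered global robust practical output regulation problem for data $\mathbb{V},\mathbb{W},\epsilon$: find a control law and event-triggered mechanism such that, for every exosystem trajectory $v$ with $v(t)\in\mathbb{V}$ for all $t\ge0$, every $w\in\mathbb{W}$, and all initial states $z(0),x(0),\eta(0),\hat\xi(0)$: (1) the trajectory of the closed-loop system exists and is bounded for all $t\ge0$;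 (2) $\limsup_{t\to\infty}|e(t)|\le\epsilon$. *)

theory Defs
  imports "HOL-Analysis.Analysis" "HOL-Computational_Algebra.Polynomial"
begin

text \<open>
  The dimensions \<open>r\<close> and \<open>s\<close> are the cardinalities of linearly ordered finite index types.
  \<open>pos\<close> is the 1-based position of an index and \<open>ix\<close> its inverse, so that
  \<open>x $ ix k\<close> is the \<open>k\<close>-th component \<open>x\<^sub>k\<close> for \<open>1 \<le> k \<le> CARD('n)\<close>. Families such as
  \<open>g\<^sub>i\<close> and \<open>\<rho>\<^sub>i\<close> are indexed by natural numbers, of which only \<open>1, \<dots>, r\<close> matter.
\<close>

definition pos :: "'n::{finite,linorder} \<Rightarrow> nat" where
  "pos i = card {..i}"

definition ix :: "nat \<Rightarrow> 'n::{finite,linorder}" where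
  "ix k = (THE i. pos i = k)"

lemma inj_pos: "inj (pos :: 'n::{finite,linorder} \<Rightarrow> nat)"
proof (rule linorder_injI)
  fix i j :: 'n
  assume "i < j"
  then have "{..i} \<subset> {..j}" by auto
  then have "pos i < pos j" by (simp add: pos_def psubset_card_mono)
  then show "pos i \<noteq> pos j" by simp
qed

lemma bij_betw_pos: "bij_betw pos (UNIV :: 'n::{finite,linorder} set) {1..CARD('n)}"
proof -
  have "range (pos :: 'n \<Rightarrow> nat) \<subseteq> {1..CARD('n)}"
    by (auto simp: pos_def Suc_le_eq card_gt_0_iff intro!: card_mono)
  moreover have "card (range (pos :: 'n \<Rightarrow> nat)) = CARD('n)"
    by (rule card_image) (rule inj_pos)
  ultimately have "range (pos :: 'n \<Rightarrow> nat) = {1..CARD('n)}"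
    by (intro card_subset_eq) auto
  with inj_pos show ?thesis by (simp add: bij_betw_def)
qed

lemma ix_pos [simp]: "ix (pos i) = i"
  unfolding ix_def using inj_pos by (auto dest: injD)

lemma pos_ix [simp]:
  assumes "1 \<le> k" "k \<le> CARD('n)"
  shows "pos (ix k :: 'n::{finite,linorder}) = k"
proof -
  from assms obtain i :: 'n where "pos i = k"
    using bij_betw_pos[where 'n='n] unfolding bij_betw_def by (metis atLeastAtMost_iff imageE)
  then show ?thesis by auto
qed

text \<open>
  Same types as \<open>real^'n\<close> and \<open>real^'n^'n\<close>, whose notation would require the sort of \<open>'n\<close>
  to be repeated at each occurrence.
\<close>

type_synonym 'n rvec = "(real, 'n) vec"
type_synonym 'n sqmat = "((real, 'n) vec, 'n) vec"

text \<open>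
  \<open>C_k k f\<close>: \<open>f\<close> is \<open>k\<close> times continuously differentiable. In finite dimensions it suffices that
  \<open>f\<close> is differentiable and that the derivative in every fixed direction is of class \<open>C\<^sup>k\<^sup>-\<^sup>1\<close>.
\<close>

primrec C_k :: "nat \<Rightarrow> ('a::euclidean_space \<Rightarrow> 'b::euclidean_space) \<Rightarrow> bool" where
  "C_k 0 f \<longleftrightarrow> continuous_on UNIV f"
| "C_k (Suc k) f \<longleftrightarrow>
     (\<forall>x. f differentiable (at x)) \<and> (\<forall>h. C_k k (\<lambda>x. frechet_derivative f (at x) h))"

definition smooth :: "('a::euclidean_space \<Rightarrow> 'b::euclidean_space) \<Rightarrow> bool" where
  "smooth f \<longleftrightarrow> (\<forall>k. C_k k f)"

definition pos_def_fun :: "('a::zero \<Rightarrow> real) \<Rightarrow> bool" where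
  "pos_def_fun h \<longleftrightarrow> h 0 = 0 \<and> (\<forall>x. x \<noteq> 0 \<longrightarrow> h x > 0)"

definition class_K_inf :: "(real \<Rightarrow> real) \<Rightarrow> bool" where
  "class_K_inf a \<longleftrightarrow> continuous_on {0..} a \<and> strict_mono_on {0..} a \<and>
     a 0 = 0 \<and> \<not> bdd_above (a ` {0..})"

text \<open>Polynomial in \<open>v\<close> with coefficients depending on \<open>w\<close>; the degree bound is uniform in \<open>w\<close>.\<close>

definition polynomial_in_fst :: "(real^'n \<Rightarrow> 'w \<Rightarrow> real) \<Rightarrow> bool" where
  "polynomial_in_fst p \<longleftrightarrow>
     (\<exists>d. \<exists>c :: ('n \<Rightarrow> nat) \<Rightarrow> 'w \<Rightarrow> real. \<forall>v w.
        p v w = (\<Sum>a\<in>{a. sum a UNIV \<le> d}. c a w * (\<Prod>i\<in>UNIV. (v $ i) ^ a i)))"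

definition cmat :: "real^'n^'m \<Rightarrow> complex^'n^'m" where
  "cmat A = (\<chi> i j. complex_of_real (A $ i $ j))"

definition eigenspace :: "real^'n^'n \<Rightarrow> complex \<Rightarrow> (complex^'n) set" where
  "eigenspace A \<mu> = {x. cmat A *v x = \<mu> *s x}"

definition eigenvalue :: "real^'n^'n \<Rightarrow> complex \<Rightarrow> bool" where
  "eigenvalue A \<mu> \<longleftrightarrow> (\<exists>x\<in>eigenspace A \<mu>. x \<noteq> 0)"

definition charpoly :: "real^'n^'n \<Rightarrow> complex poly" where
  "charpoly A = det (\<chi> i j. (if i = j then [:0, 1:] else 0) - [:cmat A $ i $ j:])"

definition semisimple_eigenvalue :: "real^'n^'n \<Rightarrow> complex \<Rightarrow> bool" where
  "semisimple_eigenvalue A \<mu> \<longleftrightarrow>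
     eigenvalue A \<mu> \<and> order \<mu> (charpoly A) = vec.dim (eigenspace A \<mu>)"

definition Hurwitz :: "real^'n^'n \<Rightarrow> bool" where
  "Hurwitz A \<longleftrightarrow> (\<forall>\<mu>. eigenvalue A \<mu> \<longrightarrow> Re \<mu> < 0)"

text \<open>Kalman's rank condition for the matrix with columns \<open>N, MN, \<dots>, M\<^sup>s\<^sup>-\<^sup>1N\<close>.\<close>

definition controllable :: "('s::{finite,linorder}) sqmat \<Rightarrow> 's rvec \<Rightarrow> bool" where
  "controllable M N \<longleftrightarrow>
     rank ((\<chi> i j. (((*v) M ^^ (pos j - 1)) N) $ i) :: 's sqmat) = CARD('s)"

text \<open>
  Solutions of the linear exosystem on \<open>[0, \<infinity>)\<close> extend uniquely to the whole line, so
  trajectories are taken on all of \<open>\<real>\<close>.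
\<close>

definition exo_trajectory :: "real^'nv^'nv \<Rightarrow> (real \<Rightarrow> real^'nv) \<Rightarrow> bool" where
  "exo_trajectory S v \<longleftrightarrow> (\<forall>t. (v has_vector_derivative (S *v v t)) (at t))"

text \<open>\<open>(\<partial>h(v,w)/\<partial>v) S v\<close>\<close>

definition exo_deriv ::
  "real^'nv^'nv \<Rightarrow> (real^'nv \<Rightarrow> 'w \<Rightarrow> 'b::real_normed_vector) \<Rightarrow> real^'nv \<Rightarrow> 'w \<Rightarrow> 'b" where
  "exo_deriv S h v w = frechet_derivative (\<lambda>v'. h v' w) (at v) (S *v v)"

text \<open>The value at index \<open>0\<close> is a dummy: indices start at \<open>1\<close>.\<close>

fun steady_x ::
  "(nat \<Rightarrow> real^'nz \<Rightarrow> real \<Rightarrow> real^'nv \<Rightarrow> 'w \<Rightarrow> real) \<Rightarrow> real^'nv^'nv \<Rightarrow>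
   (real^'nv \<Rightarrow> 'w \<Rightarrow> real) \<Rightarrow> (real^'nv \<Rightarrow> 'w \<Rightarrow> real^'nz) \<Rightarrow>
   nat \<Rightarrow> real^'nv \<Rightarrow> 'w \<Rightarrow> real" where
  "steady_x g S q zss 0 = (\<lambda>v w. 0)"
| "steady_x g S q zss (Suc 0) = q"
| "steady_x g S q zss (Suc (Suc i)) = (\<lambda>v w.
     exo_deriv S (steady_x g S q zss (Suc i)) v w - g (Suc i) (zss v w) (q v w) v w)"

definition steady_u ::
  "nat \<Rightarrow> (nat \<Rightarrow> real^'nz \<Rightarrow> real \<Rightarrow> real^'nv \<Rightarrow> 'w \<Rightarrow> real) \<Rightarrow> ('w \<Rightarrow> real) \<Rightarrow>
   real^'nv^'nv \<Rightarrow> (real^'nv \<Rightarrow> 'w \<Rightarrow> real) \<Rightarrow> (real^'nv \<Rightarrow> 'w \<Rightarrow> real^'nz) \<Rightarrow>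
   real^'nv \<Rightarrow> 'w \<Rightarrow> real" where
  "steady_u r g b S q zss v w = inverse (b w) *
     (exo_deriv S (steady_x g S q zss r) v w - g r (zss v w) (q v w) v w)"

definition assumption_A1 :: "real^'nv^'nv \<Rightarrow> bool" where
  "assumption_A1 S \<longleftrightarrow> (\<forall>\<mu>. eigenvalue S \<mu> \<longrightarrow> semisimple_eigenvalue S \<mu> \<and> Re \<mu> = 0)"

definition assumption_A2 ::
  "(real^'nz \<Rightarrow> real \<Rightarrow> real^'nv \<Rightarrow> real^'nw \<Rightarrow> real^'nz) \<Rightarrow> real^'nv^'nv \<Rightarrow>
   (real^'nv \<Rightarrow> real^'nw \<Rightarrow> real) \<Rightarrow> (real^'nv \<Rightarrow> real^'nw \<Rightarrow> real^'nz) \<Rightarrow> bool" where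
  "assumption_A2 f S q zss \<longleftrightarrow>
     smooth (\<lambda>(v, w). zss v w) \<and> (\<forall>w. zss 0 w = 0) \<and>
     (\<forall>v w. exo_deriv S zss v w = f (zss v w) (q v w) v w)"

definition f_bar ::
  "(real^'nz \<Rightarrow> real \<Rightarrow> real^'nv \<Rightarrow> real^'nw \<Rightarrow> real^'nz) \<Rightarrow>
   (real^'nv \<Rightarrow> real^'nw \<Rightarrow> real) \<Rightarrow> (real^'nv \<Rightarrow> real^'nw \<Rightarrow> real^'nz) \<Rightarrow>
   real^'nz \<Rightarrow> real \<Rightarrow> real^'nv \<Rightarrow> real^'nw \<Rightarrow> real^'nz" where
  "f_bar f q zss zb e v w =
     f (zb + zss v w) (e + q v w) v w - f (zss v w) (q v w) v w"

text \<open>The comparison functions, like \<open>V0\<close>, may depend on the compact set \<open>\<Omega>\<close>.\<close>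

definition assumption_A4 ::
  "(real^'nz \<Rightarrow> real \<Rightarrow> real^'nv \<Rightarrow> real^'nw \<Rightarrow> real^'nz) \<Rightarrow>
   (real^'nv \<Rightarrow> real^'nw \<Rightarrow> real) \<Rightarrow> (real^'nv \<Rightarrow> real^'nw \<Rightarrow> real^'nz) \<Rightarrow> bool" where
  "assumption_A4 f q zss \<longleftrightarrow>
     (\<forall>\<Omega> :: ((real^'nv) \<times> (real^'nw)) set. compact \<Omega> \<longrightarrow>
       (\<exists>V0 :: real^'nz \<Rightarrow> real. \<exists>alow aup a0 gam0 :: real \<Rightarrow> real.
          C_k 1 V0 \<and> class_K_inf alow \<and> class_K_inf aup \<and> class_K_inf a0 \<and>
          smooth gam0 \<and> pos_def_fun gam0 \<and>
          Limsup (at_right 0) (\<lambda>s. ereal (s\<^sup>2 / a0 s)) < \<infinity> \<and>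
          (\<forall>(v, w)\<in>\<Omega>. \<forall>zb e.
             alow (norm zb) \<le> V0 zb \<and> V0 zb \<le> aup (norm zb) \<and>
             frechet_derivative V0 (at zb) (f_bar f q zss zb e v w) \<le> - a0 (norm zb) + gam0 e)))"

definition im_poly :: "('s::{finite,linorder}) rvec \<Rightarrow> complex poly" where
  "im_poly rh = monom 1 CARD('s)
     - (\<Sum>j=1..CARD('s). monom (complex_of_real (rh $ ix j)) (j - 1))"

definition internal_model_coeffs ::
  "real^'nv^'nv \<Rightarrow> (real^'nv \<Rightarrow> 'w \<Rightarrow> real) \<Rightarrow> ('s::{finite,linorder}) rvec \<Rightarrow> bool" where
  "internal_model_coeffs S uss rh \<longleftrightarrow>
     (\<forall>v w t. exo_trajectory S v \<longrightarrow>
        (deriv ^^ CARD('s)) (\<lambda>\<tau>. uss (v \<tau>) w) t =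
        (\<Sum>j=1..CARD('s). rh $ ix j * (deriv ^^ (j - 1)) (\<lambda>\<tau>. uss (v \<tau>) w) t)) \<and>
     (\<forall>\<mu>. poly (im_poly rh) \<mu> = 0 \<longrightarrow> order \<mu> (im_poly rh) = 1 \<and> Re \<mu> = 0)"

definition Phi_mat :: "('s::{finite,linorder}) rvec \<Rightarrow> 's sqmat" where
  "Phi_mat rh = (\<chi> i j. if pos i = CARD('s) then rh $ j
                          else if pos j = pos i + 1 then 1 else 0)"

definition Gamma_row :: "('s::{finite,linorder}) rvec" where
  "Gamma_row = (\<chi> j. if pos j = 1 then 1 else 0)"

definition is_sylvester_solution ::
  "('s::{finite,linorder}) sqmat \<Rightarrow> 's rvec \<Rightarrow> 's rvec \<Rightarrow> 's sqmat \<Rightarrow> bool" where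
  "is_sylvester_solution M N rh T \<longleftrightarrow>
     T ** Phi_mat rh - M ** T = (\<chi> i j. N $ i * Gamma_row $ j)"

text \<open>The row \<open>\<Psi> = \<Gamma> T\<^sup>-\<^sup>1\<close> is kept as a vector, so that \<open>\<Psi>\<eta>\<close> is \<open>\<Psi> \<bullet> \<eta>\<close>.\<close>

definition Psi_row :: "('s::{finite,linorder}) sqmat \<Rightarrow> 's rvec" where
  "Psi_row T = Gamma_row v* matrix_inv T"

definition A_obs :: "('r::{finite,linorder}) rvec \<Rightarrow> 'r sqmat" where
  "A_obs lam = (\<chi> i j. if pos j = 1 then - lam $ i else if pos j = pos i + 1 then 1 else 0)"

definition B_obs :: "('r::{finite,linorder}) rvec" where
  "B_obs = (\<chi> i. if pos i = CARD('r) then 1 else 0)"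

definition x_field ::
  "(nat \<Rightarrow> real^'nz \<Rightarrow> real \<Rightarrow> real^'nv \<Rightarrow> real^'nw \<Rightarrow> real) \<Rightarrow> (real^'nw \<Rightarrow> real) \<Rightarrow>
   real^'nz \<Rightarrow> ('r::{finite,linorder}) rvec \<Rightarrow> real^'nv \<Rightarrow> real^'nw \<Rightarrow> real \<Rightarrow> 'r rvec" where
  "x_field g b z x v w u = (\<chi> i. g (pos i) z (x $ ix 1) v w
     + (if pos i < CARD('r) then x $ ix (pos i + 1) else b w * u))"

fun xi_check ::
  "(nat \<Rightarrow> real \<Rightarrow> real) \<Rightarrow> real \<Rightarrow> ('r::{finite,linorder}) rvec \<Rightarrow> nat \<Rightarrow> real" where
  "xi_check \<rho> e xi 0 = 0"
| "xi_check \<rho> e xi (Suc 0) = e"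
| "xi_check \<rho> e xi (Suc (Suc i)) =
     xi $ ix (Suc (Suc i)) + \<rho> (Suc i) (xi_check \<rho> e xi (Suc i)) * xi_check \<rho> e xi (Suc i)"

text \<open>
  Global trajectories on \<open>[0, \<infinity>)\<close> of the event-triggered closed loop, with triggering times
  \<open>tk\<close>. The index set of the triggering times is \<open>{k. tk k < \<infinity>}\<close>: the infimum of the empty set is \<open>\<infinity>\<close>, and once
  \<open>tk k = \<infinity>\<close> all later times are \<open>\<infinity>\<close>. The intervals \<open>[t\<^sub>k, t\<^sub>k\<^sub>+\<^sub>1)\<close> must cover \<open>[0, \<infinity>)\<close>, which
  excludes an accumulation of triggering times. States do not jump.
\<close>

definition closed_loop_trajectory ::
  "(real^'nz \<Rightarrow> real \<Rightarrow> real^'nv \<Rightarrow> real^'nw \<Rightarrow> real^'nz) \<Rightarrow>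
   (nat \<Rightarrow> real^'nz \<Rightarrow> real \<Rightarrow> real^'nv \<Rightarrow> real^'nw \<Rightarrow> real) \<Rightarrow>
   (real^'nw \<Rightarrow> real) \<Rightarrow> (real^'nv \<Rightarrow> real^'nw \<Rightarrow> real) \<Rightarrow>
   ('s::{finite,linorder}) sqmat \<Rightarrow> 's rvec \<Rightarrow> 's rvec \<Rightarrow> ('r::{finite,linorder}) rvec \<Rightarrow>
   (nat \<Rightarrow> real \<Rightarrow> real) \<Rightarrow> ('s rvec \<times> real \<Rightarrow> real) \<Rightarrow> real \<Rightarrow> real \<Rightarrow>
   (real \<Rightarrow> real^'nv) \<Rightarrow> real^'nw \<Rightarrow>
   (real \<Rightarrow> real^'nz) \<Rightarrow> (real \<Rightarrow> 'r rvec) \<Rightarrow>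
   (real \<Rightarrow> 's rvec) \<Rightarrow> (real \<Rightarrow> 'r rvec) \<Rightarrow> (nat \<Rightarrow> ereal) \<Rightarrow> bool" where
  "closed_loop_trajectory f g b q M N \<Psi> lam \<rho> \<pi>r \<sigma> \<delta> v w z x \<eta> xi tk \<longleftrightarrow>
    (let e = (\<lambda>t. x t $ ix 1 - q (v t) w);
         r = CARD('r);
         xc = (\<lambda>t. xi_check \<rho> (e t) (xi t) r);
         hold = (\<lambda>k. real_of_ereal (tk k));
         u = (\<lambda>k. - \<rho> r (xc (hold k)) * xc (hold k) + \<Psi> \<bullet> \<eta> (hold k));
         vartheta = (\<lambda>k t. - \<rho> r (xc (hold k)) * xc (hold k) + \<rho> r (xc t) * xc t);
         chi = (\<lambda>k t. (\<eta> (hold k) - \<eta> t, e (hold k) - e t));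
         I = (\<lambda>k. {t. tk k \<le> ereal t \<and> ereal t < tk (Suc k)})
     in
       continuous_on {0..} z \<and> continuous_on {0..} x \<and>
       continuous_on {0..} \<eta> \<and> continuous_on {0..} xi \<and>
       tk 0 = 0 \<and>
       (\<forall>k. tk (Suc k) = Inf {ereal t |t. tk k < ereal t \<and>
          (vartheta k t)\<^sup>2 + \<pi>r (chi k t) - \<sigma>\<^sup>2 * \<rho> r (xc t) * (xc t)\<^sup>2 \<ge> \<delta>\<^sup>2}) \<and>
       (\<forall>t\<ge>0. \<exists>k. t \<in> I k) \<and>
       (\<forall>k. \<forall>t\<in>I k.
          (z has_vector_derivative f (z t) (x t $ ix 1) (v t) w) (at t within I k) \<and>
          (x has_vector_derivative x_field g b (z t) (x t) (v t) w (u k)) (at t within I k) \<and>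
          (xi has_vector_derivative
             (A_obs lam *v xi t + e (hold k) *\<^sub>R lam
              + (u k - \<Psi> \<bullet> \<eta> (hold k)) *\<^sub>R B_obs)) (at t within I k) \<and>
          (\<eta> has_vector_derivative (M *v \<eta> t + u k *\<^sub>R N)) (at t within I k)))"

text \<open>
  ``The trajectory'': for each initial condition a global trajectory exists, and every such
  trajectory is bounded and satisfies the error bound.
\<close>

definition solves_practical_regulation ::
  "(real^'nz \<Rightarrow> real \<Rightarrow> real^'nv \<Rightarrow> real^'nw \<Rightarrow> real^'nz) \<Rightarrow>
   (nat \<Rightarrow> real^'nz \<Rightarrow> real \<Rightarrow> real^'nv \<Rightarrow> real^'nw \<Rightarrow> real) \<Rightarrow>
   (real^'nw \<Rightarrow> real) \<Rightarrow> (real^'nv \<Rightarrow> real^'nw \<Rightarrow> real) \<Rightarrow> real^'nv^'nv \<Rightarrow>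
   ('s::{finite,linorder}) sqmat \<Rightarrow> 's rvec \<Rightarrow> 's rvec \<Rightarrow> ('r::{finite,linorder}) rvec \<Rightarrow>
   (nat \<Rightarrow> real \<Rightarrow> real) \<Rightarrow> ('s rvec \<times> real \<Rightarrow> real) \<Rightarrow> real \<Rightarrow> real \<Rightarrow>
   (real^'nv) set \<Rightarrow> (real^'nw) set \<Rightarrow> real \<Rightarrow> bool" where
  "solves_practical_regulation f g b q S M N \<Psi> lam \<rho> \<pi>r \<sigma> \<delta> VV WW \<epsilon> \<longleftrightarrow>
    (\<forall>v w z0 x0 \<eta>0 xi0.
       exo_trajectory S v \<and> (\<forall>t\<ge>0. v t \<in> VV) \<and> w \<in> WW \<longrightarrow>
       (let is_traj = (\<lambda>z x \<eta> xi tk.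
              closed_loop_trajectory f g b q M N \<Psi> lam \<rho> \<pi>r \<sigma> \<delta> v w z x \<eta> xi tk \<and>
              z 0 = z0 \<and> x 0 = x0 \<and> \<eta> 0 = \<eta>0 \<and> xi 0 = xi0)
        in (\<exists>z x \<eta> xi tk. is_traj z x \<eta> xi tk) \<and>
           (\<forall>z x \<eta> xi tk. is_traj z x \<eta> xi tk \<longrightarrow>
              bounded ((\<lambda>t. (z t, x t, \<eta> t, xi t)) ` {0..}) \<and>
              Limsup at_top (\<lambda>t. ereal \<bar>x t $ ix 1 - q (v t) w\<bar>) \<le> ereal \<epsilon>)))"

end

theory Submission
  imports Defs "HOL-Computational_Algebra.Fundamental_Theorem_Algebra"
begin

text \<open>
  All quantities are measured against their steady state along the exosystem trajectory. The
  derivatives of the steady-state input satisfy a companion system; by the Sylvester equation \<open>T\<close>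
  maps them to a state \<open>\<theta>\<close> of the internal model \<open>(M, N)\<close> that is driven by the steady-state input
  itself, and \<open>\<Psi> \<theta>\<close> is that input (\<open>immersion_state_dynamics\<close>). In error coordinates the plant is
  then a perturbed chain of integrators, divided by the unknown \<open>b(w)\<close>. Subtracting a combination
  of the chain states from \<open>\<eta> - \<theta>\<close> removes the control from the error of the internal model, and a
  triangular change of coordinates puts the chain into observer form. What remains are two linear
  systems with the Hurwitz matrices \<open>M\<close> and \<open>A\<^sub>o\<close>, driven by the tracking error, the nonlinear
  perturbations and the sampling errors (\<open>canonical_form_dynamics\<close>, \<open>linear_error_dynamics\<close>).

  These two systems and the zero dynamics form a cascade. Quadratic Lyapunov functions of the
  former (\<open>Hurwitz_lyapunov_form\<close>) and the function \<open>V\<^sub>0\<close> with a changed supply rate add up to a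
  Lyapunov function whose only inputs are the tracking error and the sampling errors
  (\<open>cascade_lyapunov\<close>). The variables \<open>\<xi>\<^sub>1, \<dots>, \<xi>\<^sub>r\<close> of the controller (\<open>xi_check\<close>) are added one by
  one: the Lyapunov function \<open>V\<close> reached so far is replaced by \<open>V p(V)\<close> plus half the square of the
  new variable, where \<open>p\<close> grows so fast that all perturbations are dominated, and \<open>\<rho>\<^sub>i\<close> is a smooth
  function above the gains that this creates (\<open>backstepping_step\<close>, \<open>backstepping_chain\<close>). All gains
  are merely monotone functions, and \<open>smooth_majorant\<close> supplies the smooth ones. The derivative of
  the final Lyapunov function is at most \<open>- n\<^sup>2\<close>, where \<open>n\<close> is the size of the error, plus a multiple
  of the left-hand side of the triggering condition, that is, plus a multiple of \<open>\<delta>\<^sup>2\<close>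
  (\<open>stabilizing_design\<close>). It therefore decreases above a level that tends to \<open>0\<close> with \<open>\<delta>\<close>, which
  bounds all trajectories and makes the tracking error ultimately small
  (\<open>trajectory_bounded_and_regulated\<close>).

  Trajectories exist because the same estimate bounds them in advance. After the vector field has
  been truncated outside a large ball it is bounded and Lipschitz, and the triggering function is
  uniformly continuous and at most \<open>0\<close> immediately after a triggering time; so the triggering times
  are separated, and solutions with held values can be joined (\<open>event_triggered_solution\<close>). The
  bound shows that the solution never meets the truncation (\<open>closed_loop_exists\<close>).
\<close>

section \<open>Smooth functions\<close>

lemma C_k_SucI:
  assumes "\<And>x. (f has_derivative f' x) (at x)" "\<And>h. C_k k (\<lambda>x. f' x h)"
  shows "C_k (Suc k) f"
proof -
  have "frechet_derivative f (at x) = f' x" for x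
    using frechet_derivative_at[OF assms(1)] by simp
  with assms show ?thesis by (auto simp: differentiable_def)
qed

lemma C_k_SucE:
  assumes "C_k (Suc k) f"
  obtains f' where "\<And>x. (f has_derivative f' x) (at x)" "\<And>h. C_k k (\<lambda>x. f' x h)"
  using assms frechet_derivative_works[of f] that[of "\<lambda>x. frechet_derivative f (at x)"] by auto

lemma C_k_SucD: "C_k (Suc k) f \<Longrightarrow> C_k k f"
proof (induction k arbitrary: f)
  case 0
  then show ?case
    by (auto intro!: continuous_at_imp_continuous_on differentiable_imp_continuous_within)
next
  case (Suc k)
  from Suc.prems obtain f' where f': "\<And>x. (f has_derivative f' x) (at x)"
      "\<And>h. C_k (Suc k) (\<lambda>x. f' x h)" by (rule C_k_SucE) blast
  show ?case by (rule C_k_SucI[OF f'(1) Suc.IH[OF f'(2)]])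
qed

lemma C_k_const: "C_k k (\<lambda>x. c)"
proof (induction k arbitrary: c)
  case (Suc k)
  show ?case by (rule C_k_SucI[where f' = "\<lambda>x h. 0"]) (auto simp: Suc)
qed simp

lemma C_k_bounded_linear_comp: "bounded_linear L \<Longrightarrow> C_k k f \<Longrightarrow> C_k k (\<lambda>x. L (f x))"
proof (induction k arbitrary: f)
  case 0
  then show ?case by (simp add: bounded_linear.continuous_on)
next
  case (Suc k)
  from Suc.prems(2) obtain f' where f': "\<And>x. (f has_derivative f' x) (at x)"
      "\<And>h. C_k k (\<lambda>x. f' x h)" by (rule C_k_SucE) blast
  show ?case
    by (rule C_k_SucI[OF bounded_linear.has_derivative[OF Suc.prems(1) f'(1)]])
      (rule Suc.IH[OF Suc.prems(1) f'(2)])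
qed

lemma C_k_bounded_linear: 
  assumes "bounded_linear L" shows "C_k k L"
proof (cases k)
  case 0 then show ?thesis using linear_continuous_on[OF assms] by simp
next
  case (Suc l)
  show ?thesis unfolding Suc
    by (rule C_k_SucI[OF bounded_linear_imp_has_derivative[OF assms]]) (rule C_k_const)
qed

lemma C_k_add: "C_k k f \<Longrightarrow> C_k k g \<Longrightarrow> C_k k (\<lambda>x. f x + g x)"
proof (induction k arbitrary: f g)
  case 0 then show ?case by (simp add: continuous_on_add)
next
  case (Suc k)
  from Suc.prems(1) obtain f' where f': "\<And>x. (f has_derivative f' x) (at x)"
      "\<And>h. C_k k (\<lambda>x. f' x h)" by (rule C_k_SucE) blast
  from Suc.prems(2) obtain g' where g': "\<And>x. (g has_derivative g' x) (at x)"
      "\<And>h. C_k k (\<lambda>x. g' x h)" by (rule C_k_SucE) blast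
  show ?case by (rule C_k_SucI[OF has_derivative_add[OF f'(1) g'(1)]]) (intro Suc.IH f' g')
qed

lemma C_k_sum: "(\<And>i. i \<in> A \<Longrightarrow> C_k k (f i)) \<Longrightarrow> C_k k (\<lambda>x. \<Sum>i\<in>A. f i x)"
  by (induction A rule: infinite_finite_induct) (auto intro!: C_k_add C_k_const)

lemma C_k_scaleR:
  fixes f :: "'a::euclidean_space \<Rightarrow> real" and g :: "'a \<Rightarrow> 'b::euclidean_space"
  shows "C_k k f \<Longrightarrow> C_k k g \<Longrightarrow> C_k k (\<lambda>x. f x *\<^sub>R g x)"
proof (induction k arbitrary: f g)
  case 0 then show ?case by (simp add: continuous_on_scaleR)
next
  case (Suc k)
  from Suc.prems(1) obtain f' where f': "\<And>x. (f has_derivative f' x) (at x)"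
      "\<And>h. C_k k (\<lambda>x. f' x h)" by (rule C_k_SucE) blast
  from Suc.prems(2) obtain g' where g': "\<And>x. (g has_derivative g' x) (at x)"
      "\<And>h. C_k k (\<lambda>x. g' x h)" by (rule C_k_SucE) blast
  show ?case
    by (rule C_k_SucI[OF has_derivative_scaleR[OF f'(1) g'(1)]])
      (intro C_k_add Suc.IH f' g' C_k_SucD[OF Suc.prems(1)] C_k_SucD[OF Suc.prems(2)])
qed

lemma C_k_Pair: "C_k k f \<Longrightarrow> C_k k g \<Longrightarrow> C_k k (\<lambda>x. (f x, g x))"
proof (induction k arbitrary: f g)
  case 0 then show ?case by (simp add: continuous_on_Pair)
next
  case (Suc k)
  from Suc.prems(1) obtain f' where f': "\<And>x. (f has_derivative f' x) (at x)"
      "\<And>h. C_k k (\<lambda>x. f' x h)" by (rule C_k_SucE) blast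
  from Suc.prems(2) obtain g' where g': "\<And>x. (g has_derivative g' x) (at x)"
      "\<And>h. C_k k (\<lambda>x. g' x h)" by (rule C_k_SucE) blast
  show ?case by (rule C_k_SucI[OF has_derivative_Pair[OF f'(1) g'(1)]]) (intro Suc.IH f' g')
qed

lemma linear_eq_sum_Basis:
  fixes L :: "'a::euclidean_space \<Rightarrow> 'b::real_vector"
  assumes "linear L"
  shows "L u = (\<Sum>b\<in>Basis. (u \<bullet> b) *\<^sub>R L b)"
proof -
  have "L u = L (\<Sum>b\<in>Basis. (u \<bullet> b) *\<^sub>R b)" by (simp add: euclidean_representation)
  also have "\<dots> = (\<Sum>b\<in>Basis. (u \<bullet> b) *\<^sub>R L b)"
    by (simp add: linear_sum[OF assms] linear_scale[OF assms])
  finally show ?thesis .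
qed

text \<open>The chain rule writes a directional derivative of the composition as a sum over a basis of
  products, to which the induction hypothesis applies.\<close>

lemma C_k_compose:
  fixes f :: "'a::euclidean_space \<Rightarrow> 'b::euclidean_space" and g :: "'b \<Rightarrow> 'c::euclidean_space"
  shows "C_k k g \<Longrightarrow> C_k k f \<Longrightarrow> C_k k (\<lambda>x. g (f x))"
proof (induction k arbitrary: g)
  case 0
  then show ?case by (auto intro: continuous_on_compose2)
next
  case (Suc k)
  from Suc.prems(2) obtain f' where f': "\<And>x. (f has_derivative f' x) (at x)"
      "\<And>h. C_k k (\<lambda>x. f' x h)" by (rule C_k_SucE) blast
  from Suc.prems(1) obtain g' where g': "\<And>x. (g has_derivative g' x) (at x)"
      "\<And>h. C_k k (\<lambda>x. g' x h)" by (rule C_k_SucE) blast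
  have lin: "linear (g' y)" for y using g'(1) has_derivative_linear by blast
  have "C_k k (\<lambda>x. g' (f x) (f' x h))" for h
    unfolding linear_eq_sum_Basis[OF lin, of _ "f' _ h"]
    by (intro C_k_sum C_k_scaleR Suc.IH g' C_k_SucD[OF Suc.prems(2)]
        C_k_bounded_linear_comp[OF bounded_linear_inner_left f'(2)])
  with has_derivative_compose[OF f'(1) g'(1)] show ?case by (rule C_k_SucI)
qed

lemma smooth_C_k: "smooth f \<Longrightarrow> C_k k f" by (simp add: smooth_def)

lemma smooth_const: "smooth (\<lambda>x. c)" by (simp add: smooth_def C_k_const)
lemma smooth_bounded_linear: "bounded_linear L \<Longrightarrow> smooth L"
  by (simp add: smooth_def C_k_bounded_linear)
lemma smooth_add: "smooth f \<Longrightarrow> smooth g \<Longrightarrow> smooth (\<lambda>x. f x + g x)"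
  by (simp add: smooth_def C_k_add)
lemma smooth_sum: "(\<And>i. i \<in> A \<Longrightarrow> smooth (f i)) \<Longrightarrow> smooth (\<lambda>x. \<Sum>i\<in>A. f i x)"
  by (simp add: smooth_def C_k_sum)
lemma smooth_scaleR:
  fixes f :: "'a::euclidean_space \<Rightarrow> real" and g :: "'a \<Rightarrow> 'b::euclidean_space"
  shows "smooth f \<Longrightarrow> smooth g \<Longrightarrow> smooth (\<lambda>x. f x *\<^sub>R g x)"
  by (simp add: smooth_def C_k_scaleR)
lemma smooth_Pair: "smooth f \<Longrightarrow> smooth g \<Longrightarrow> smooth (\<lambda>x. (f x, g x))"
  by (simp add: smooth_def C_k_Pair)
lemma smooth_compose:
  fixes f :: "'a::euclidean_space \<Rightarrow> 'b::euclidean_space" and g :: "'b \<Rightarrow> 'c::euclidean_space"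
  shows "smooth g \<Longrightarrow> smooth f \<Longrightarrow> smooth (\<lambda>x. g (f x))"
  by (simp add: smooth_def C_k_compose)

lemma smooth_has_derivative:
  assumes "smooth f" shows "(f has_derivative frechet_derivative f (at x)) (at x)"
  using smooth_C_k[OF assms, of 1] by (simp add: frechet_derivative_works)

lemma smooth_continuous_on:
  assumes "smooth f" shows "continuous_on A f"
  using smooth_C_k[OF assms, of 0] by (auto intro: continuous_on_subset)

lemma smooth_frechet_derivative:
  assumes "smooth f" shows "smooth (\<lambda>x. frechet_derivative f (at x) h)"
  unfolding smooth_def using smooth_C_k[OF assms] C_k.simps(2)[of _ f] by blast

lemma smooth_frechet_derivative_along:
  assumes "smooth f" "smooth u"
  shows "smooth (\<lambda>x. frechet_derivative f (at x) (u x))"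
proof -
  have lin: "linear (frechet_derivative f (at y))" for y
    using smooth_has_derivative[OF assms(1)] has_derivative_linear by blast
  show ?thesis
    unfolding linear_eq_sum_Basis[OF lin, of _ "u _"]
    by (intro smooth_sum smooth_scaleR smooth_frechet_derivative assms
        smooth_compose[OF smooth_bounded_linear[OF bounded_linear_inner_left]])
qed

lemma smooth_deriv:
  fixes f :: "real \<Rightarrow> real"
  assumes "smooth f"
  shows "(f has_real_derivative deriv f x) (at x)" "smooth (deriv f)"
proof -
  have eq: "frechet_derivative f (at y) = (*) (frechet_derivative f (at y) 1)" for y
  proof
    fix u :: real
    have "linear (frechet_derivative f (at y))"
      using smooth_has_derivative[OF assms] has_derivative_linear by blast
    from linear_scale[OF this, of u 1]
    show "frechet_derivative f (at y) u = frechet_derivative f (at y) 1 * u" by simp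
  qed
  have der: "(f has_real_derivative frechet_derivative f (at y) 1) (at y)" for y
    using smooth_has_derivative[OF assms, of y] eq[of y] by (simp add: has_field_derivative_def)
  then have "deriv f = (\<lambda>y. frechet_derivative f (at y) 1)" using DERIV_imp_deriv by blast
  then show "(f has_real_derivative deriv f x) (at x)" "smooth (deriv f)"
    using der smooth_frechet_derivative[OF assms] by simp_all
qed

text \<open>On a ball the directional derivatives along a basis are bounded, hence so is the
  operator norm of the derivative.\<close>

lemma C_1_lipschitz_on_ball:
  fixes f :: "'a::euclidean_space \<Rightarrow> 'b::euclidean_space"
  assumes "C_k 1 f"
  obtains L where "L > 0" "\<And>x y. norm x \<le> R \<Longrightarrow> norm y \<le> R \<Longrightarrow> norm (f x - f y) \<le> L * norm (x - y)"
proof -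
  from assms obtain f' where f': "\<And>x. (f has_derivative f' x) (at x)"
      "\<And>h. C_k 0 (\<lambda>x. f' x h)" unfolding One_nat_def by (rule C_k_SucE) blast
  have "\<exists>B. \<forall>x\<in>cball 0 R. norm (f' x b) \<le> B" for b
  proof -
    have "compact ((\<lambda>x. f' x b) ` cball 0 R)"
      using f'(2)[of b] by (intro compact_continuous_image) (auto intro: continuous_on_subset)
    then show ?thesis by (meson bounded_iff compact_imp_bounded imageI)
  qed
  then obtain B where B: "\<And>b x. norm x \<le> R \<Longrightarrow> norm (f' x b) \<le> B b" by (metis mem_cball_0)
  define L where "L = (\<Sum>b\<in>Basis. \<bar>B b\<bar>) + 1"
  have "onorm (f' x) \<le> L" if "norm x \<le> R" for x
  proof (rule onorm_bound)
    show "0 \<le> L" by (auto simp: L_def intro!: add_nonneg_nonneg sum_nonneg)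
    fix u
    have lin: "linear (f' x)" using f'(1) has_derivative_linear by blast
    have "norm (f' x u) = norm (\<Sum>b\<in>Basis. (u \<bullet> b) *\<^sub>R f' x b)"
      by (subst linear_eq_sum_Basis[OF lin]) simp
    also have "\<dots> \<le> (\<Sum>b\<in>Basis. norm u * \<bar>B b\<bar>)"
    proof (rule sum_norm_le)
      fix b :: 'a assume "b \<in> Basis"
      then have "\<bar>u \<bullet> b\<bar> \<le> norm u" by (rule Basis_le_norm)
      moreover have "norm (f' x b) \<le> \<bar>B b\<bar>" using B[OF that, of b] by simp
      ultimately show "norm ((u \<bullet> b) *\<^sub>R f' x b) \<le> norm u * \<bar>B b\<bar>"
        unfolding norm_scaleR by (intro mult_mono) auto
    qed
    also have "\<dots> = (\<Sum>b\<in>Basis. \<bar>B b\<bar>) * norm u" by (simp add: sum_distrib_left mult.commute)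
    also have "\<dots> \<le> L * norm u" by (intro mult_right_mono) (auto simp: L_def)
    finally show "norm (f' x u) \<le> L * norm u" .
  qed
  then have "norm (f x - f y) \<le> L * norm (x - y)" if "norm x \<le> R" "norm y \<le> R" for x y
    using that by (intro differentiable_bound[of "cball 0 R" f f'])
      (auto intro: has_derivative_at_withinI f'(1))
  moreover have "L > 0" by (auto simp: L_def intro!: add_nonneg_pos sum_nonneg)
  ultimately show thesis using that by blast
qed

text \<open>An everywhere convergent power series is smooth, because term-wise differentiation
  stays within this class.\<close>

lemma C_k_power_series:
  fixes c :: "nat \<Rightarrow> real"
  assumes "\<And>x. summable (\<lambda>n. c n * x ^ n)"
  shows "C_k k (\<lambda>x. \<Sum>n. c n * x ^ n)"
  using assms
proof (induction k arbitrary: c)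
  case 0
  have "isCont (\<lambda>x. \<Sum>n. c n * x ^ n) x" for x
    using termdiffs_strong_converges_everywhere[OF 0] DERIV_isCont by blast
  then show ?case by (auto intro: continuous_at_imp_continuous_on)
next
  case (Suc k)
  have d: "((\<lambda>x. \<Sum>n. c n * x ^ n) has_derivative (\<lambda>h. (\<Sum>n. diffs c n * x ^ n) * h)) (at x)" for x
    using termdiffs_strong_converges_everywhere[OF Suc.prems] by (simp add: has_field_derivative_def)
  have "C_k k (\<lambda>x. h *\<^sub>R (\<Sum>n. diffs c n * x ^ n))" for h
    by (rule C_k_bounded_linear_comp[OF bounded_linear_scaleR_right])
      (rule Suc.IH, rule termdiff_converges_all[OF Suc.prems])
  then show ?case by (intro C_k_SucI[OF d]) (simp add: mult.commute)
qed

lemma smooth_id: "smooth (\<lambda>x. x)" by (rule smooth_bounded_linear[OF bounded_linear_ident])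

lemma smooth_times_id: "smooth \<rho> \<Longrightarrow> smooth (\<lambda>s::real. \<rho> s * s)"
  using smooth_scaleR[of \<rho> "\<lambda>s. s"] smooth_bounded_linear[OF bounded_linear_ident] by simp

lemma smooth_vec_lambda:
  fixes h :: "'n::finite \<Rightarrow> 'a::euclidean_space \<Rightarrow> real"
  assumes "\<And>i. smooth (h i)" shows "smooth (\<lambda>x. \<chi> i. h i x)"
proof -
  have "(\<chi> i. h i x) = (\<Sum>i\<in>UNIV. h i x *\<^sub>R axis i 1)" for x
    by (simp add: vec_eq_iff axis_def if_distrib[of "\<lambda>c. _ * c"] cong: if_cong)
  then show ?thesis by (simp only:) (intro smooth_sum smooth_scaleR assms smooth_const)
qed

lemmas smooth_linear_image = smooth_compose[OF smooth_bounded_linear]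
lemmas smooth_fst = smooth_linear_image[OF bounded_linear_fst]
  and smooth_snd = smooth_linear_image[OF bounded_linear_snd]
  and smooth_vec_nth = smooth_linear_image[OF bounded_linear_vec_nth]
  and smooth_matrix_vector = smooth_linear_image[OF matrix_vector_mul_bounded_linear]
  and smooth_inner_right = smooth_linear_image[OF bounded_linear_inner_right]

section \<open>Gains and their smooth majorants\<close>

text \<open>Estimates have the form \<open>\<psi>(m) m\<^sup>2\<close> with a factor \<open>\<psi>\<close> that may be any nonnegative monotone
  function on the half-line. Such factors are closed under sums, products and composition, and a
  smooth one can be found above each of them.\<close>

definition gain :: "(real \<Rightarrow> real) \<Rightarrow> bool" where
  "gain \<psi> \<longleftrightarrow> (\<forall>s\<ge>0. 0 \<le> \<psi> s) \<and> (\<forall>s t. 0 \<le> s \<longrightarrow> s \<le> t \<longrightarrow> \<psi> s \<le> \<psi> t)"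

text \<open>Gains that tend to \<open>0\<close> at \<open>0\<close> take the place of class \<open>K\<close> functions in comparing a
  Lyapunov function with the size of the state.\<close>

definition vanishing_gain :: "(real \<Rightarrow> real) \<Rightarrow> bool" where
  "vanishing_gain \<psi> \<longleftrightarrow> gain \<psi> \<and> (\<forall>\<epsilon>>0. \<exists>\<delta>>0. \<psi> \<delta> \<le> \<epsilon>)"

lemma gain_nonneg: "gain \<psi> \<Longrightarrow> 0 \<le> s \<Longrightarrow> 0 \<le> \<psi> s" by (simp add: gain_def)
lemma gain_mono: "gain \<psi> \<Longrightarrow> 0 \<le> s \<Longrightarrow> s \<le> t \<Longrightarrow> \<psi> s \<le> \<psi> t" by (simp add: gain_def)
lemma vanishing_gain_gain: "vanishing_gain \<psi> \<Longrightarrow> gain \<psi>" by (simp add: vanishing_gain_def)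

named_theorems gain_intros

lemma gain_const [gain_intros]: "0 \<le> c \<Longrightarrow> gain (\<lambda>s. c)" by (simp add: gain_def)
lemma gain_id [gain_intros]: "gain (\<lambda>s. s)" by (simp add: gain_def)
lemma gain_add [gain_intros]: "gain \<psi> \<Longrightarrow> gain \<phi> \<Longrightarrow> gain (\<lambda>s. \<psi> s + \<phi> s)"
  by (auto simp: gain_def add_mono)
lemma gain_mult [gain_intros]: "gain \<psi> \<Longrightarrow> gain \<phi> \<Longrightarrow> gain (\<lambda>s. \<psi> s * \<phi> s)"
  unfolding gain_def by (intro conjI allI impI mult_mono mult_nonneg_nonneg) auto
lemma gain_power [gain_intros]: "gain \<psi> \<Longrightarrow> gain (\<lambda>s. \<psi> s ^ k)"
  by (auto simp: gain_def power_mono)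
lemma gain_sqrt [gain_intros]: "gain \<psi> \<Longrightarrow> gain (\<lambda>s. sqrt (\<psi> s))"
  by (auto simp: gain_def)
lemma gain_divide [gain_intros]: "gain \<psi> \<Longrightarrow> 0 \<le> c \<Longrightarrow> gain (\<lambda>s. \<psi> s / c)"
  by (auto simp: gain_def divide_right_mono)
lemma gain_compose: "gain \<psi> \<Longrightarrow> gain \<phi> \<Longrightarrow> gain (\<lambda>s. \<psi> (\<phi> s))"
  by (auto simp: gain_def)

lemma vanishing_gain_id: "vanishing_gain (\<lambda>s. s)"
  by (auto simp: vanishing_gain_def gain_id)

lemma vanishing_gain_add:
  assumes "vanishing_gain \<psi>" "vanishing_gain \<phi>" shows "vanishing_gain (\<lambda>s. \<psi> s + \<phi> s)"
  unfolding vanishing_gain_def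
proof (intro conjI allI impI)
  show "gain (\<lambda>s. \<psi> s + \<phi> s)" using assms by (simp add: vanishing_gain_def gain_add)
  fix \<epsilon> :: real assume "\<epsilon> > 0"
  then obtain a b where ab: "a > 0" "\<psi> a \<le> \<epsilon> / 2" "b > 0" "\<phi> b \<le> \<epsilon> / 2"
    using assms unfolding vanishing_gain_def by (meson half_gt_zero)
  have "\<psi> (min a b) \<le> \<psi> a" "\<phi> (min a b) \<le> \<phi> b"
    using ab gain_mono[OF vanishing_gain_gain[OF assms(1)], of "min a b" a]
      gain_mono[OF vanishing_gain_gain[OF assms(2)], of "min a b" b] by auto
  with ab show "\<exists>\<delta>>0. \<psi> \<delta> + \<phi> \<delta> \<le> \<epsilon>" by (intro exI[of _ "min a b"]) auto
qed

lemma vanishing_gain_mult: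
  assumes "vanishing_gain \<psi>" "gain \<phi>" shows "vanishing_gain (\<lambda>s. \<psi> s * \<phi> s)"
  unfolding vanishing_gain_def
proof (intro conjI allI impI)
  show "gain (\<lambda>s. \<psi> s * \<phi> s)" using assms by (simp add: vanishing_gain_def gain_mult)
  fix \<epsilon> :: real assume "\<epsilon> > 0"
  have p1: "0 \<le> \<phi> 1" using assms by (simp add: gain_nonneg)
  with \<open>\<epsilon> > 0\<close> have "\<epsilon> / (\<phi> 1 + 1) > 0" by simp
  then obtain a where a: "a > 0" "\<psi> a \<le> \<epsilon> / (\<phi> 1 + 1)"
    using assms unfolding vanishing_gain_def by blast
  have g: "gain \<psi>" using assms by (simp add: vanishing_gain_def)
  have "\<psi> (min a 1) * \<phi> (min a 1) \<le> (\<epsilon> / (\<phi> 1 + 1)) * (\<phi> 1 + 1)"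
  proof (intro mult_mono)
    show "\<psi> (min a 1) \<le> \<epsilon> / (\<phi> 1 + 1)" using gain_mono[OF g, of "min a 1" a] a by auto
    show "\<phi> (min a 1) \<le> \<phi> 1 + 1" using gain_mono[OF assms(2), of "min a 1" 1] a by auto
    show "0 \<le> \<phi> (min a 1)" using gain_nonneg[OF assms(2)] a by auto
    show "0 \<le> \<epsilon> / (\<phi> 1 + 1)" using \<open>\<epsilon> / (\<phi> 1 + 1) > 0\<close> by simp
  qed
  also have "\<dots> = \<epsilon>" using p1 by simp
  finally show "\<exists>\<delta>>0. \<psi> \<delta> * \<phi> \<delta> \<le> \<epsilon>" using a by (intro exI[of _ "min a 1"]) auto
qed

lemma vanishing_gain_compose:
  assumes "vanishing_gain \<psi>" "vanishing_gain \<phi>" shows "vanishing_gain (\<lambda>s. \<psi> (\<phi> s))"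
  unfolding vanishing_gain_def
proof (intro conjI allI impI)
  show "gain (\<lambda>s. \<psi> (\<phi> s))" using assms by (simp add: vanishing_gain_def gain_compose)
  fix \<epsilon> :: real assume "\<epsilon> > 0"
  then obtain a where a: "a > 0" "\<psi> a \<le> \<epsilon>" using assms unfolding vanishing_gain_def by blast
  then obtain b where b: "b > 0" "\<phi> b \<le> a" using assms unfolding vanishing_gain_def by blast
  have "0 \<le> \<phi> b" using assms b by (simp add: vanishing_gain_def gain_nonneg)
  then have "\<psi> (\<phi> b) \<le> \<psi> a"
    using b by (intro gain_mono[OF vanishing_gain_gain[OF assms(1)]])
  with a b show "\<exists>\<delta>>0. \<psi> (\<phi> \<delta>) \<le> \<epsilon>" by (intro exI[of _ b]) auto
qed

lemma vanishing_gain_sqrt: "vanishing_gain (\<lambda>s. sqrt s)"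
  unfolding vanishing_gain_def
proof (intro conjI allI impI)
  show "gain (\<lambda>s. sqrt s)" by (intro gain_intros)
  fix \<epsilon> :: real assume "\<epsilon> > 0"
  then show "\<exists>\<delta>>0. sqrt \<delta> \<le> \<epsilon>" by (intro exI[of _ "\<epsilon>\<^sup>2"]) auto
qed

text \<open>A function that is bounded wherever the size function \<open>m\<close> is bounded is dominated by a
  gain of \<open>m\<close>: cumulate the bounds at the natural numbers.\<close>

lemma gain_of_local_bounds:
  fixes h m :: "'a \<Rightarrow> real"
  assumes "\<And>R::real. \<exists>L. \<forall>x\<in>X. m x \<le> R \<longrightarrow> h x \<le> L"
  obtains \<psi> where "gain \<psi>" "\<And>x. x \<in> X \<Longrightarrow> h x \<le> \<psi> (m x)"
proof -
  obtain L where L: "\<And>R x. x \<in> X \<Longrightarrow> m x \<le> R \<Longrightarrow> h x \<le> L R" using assms by metis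
  define \<psi> where "\<psi> s = (\<Sum>n\<le>nat \<lceil>s\<rceil>. \<bar>L (real n)\<bar>)" for s :: real
  have "gain \<psi>"
    unfolding gain_def \<psi>_def
    by (auto intro!: sum_nonneg sum_mono2) linarith
  moreover have "h x \<le> \<psi> (m x)" if "x \<in> X" for x
  proof -
    have "h x \<le> L (real (nat \<lceil>m x\<rceil>))" by (rule L[OF that]) linarith
    also have "\<dots> \<le> \<bar>L (real (nat \<lceil>m x\<rceil>))\<bar>" by simp
    also have "\<dots> \<le> \<psi> (m x)" unfolding \<psi>_def
      by (rule member_le_sum[where f = "\<lambda>n. \<bar>L (real n)\<bar>"]) auto
    finally show ?thesis .
  qed
  ultimately show thesis using that by blast
qed

lemma gain_of_continuous:
  fixes h :: "'a::euclidean_space \<Rightarrow> real"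
  assumes "continuous_on UNIV h"
  obtains \<psi> where "gain \<psi>" "\<And>x. \<bar>h x\<bar> \<le> \<psi> (norm x)"
proof -
  have "\<exists>L. \<forall>x\<in>UNIV. norm x \<le> R \<longrightarrow> \<bar>h x\<bar> \<le> L" for R
  proof -
    have "compact (h ` cball 0 R)"
      using assms by (intro compact_continuous_image) (auto intro: continuous_on_subset)
    then obtain B where "\<forall>y\<in>h ` cball 0 R. norm y \<le> B"
      using compact_imp_bounded bounded_iff by blast
    then show ?thesis by (intro exI[of _ B]) auto
  qed
  from gain_of_local_bounds[OF this] obtain \<psi> where "gain \<psi>" "\<forall>x. \<bar>h x\<bar> \<le> \<psi> (norm x)"
    by (metis UNIV_I)
  then show thesis using that by blast
qed

text \<open>The sum of the even monomials \<open>A\<^sub>n (x/(n+1))\<^sup>2\<^sup>m\<^sup>(\<^sup>n\<^sup>)\<close>, with \<open>m(n)\<close> growing fast enough,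
  converges everywhere, and its \<open>n\<close>-th summand alone is at least \<open>A\<^sub>n\<close> as soon as \<open>\<bar>x\<bar> \<ge> n+1\<close>.
  As the coefficients are nonnegative, the sum and its derivative are gains.\<close>

lemma smooth_majorant:
  assumes "gain \<psi>"
  obtains p p' where "smooth p" "\<And>x. 1 \<le> p x" "\<And>x. \<psi> \<bar>x\<bar> \<le> p x"
    "\<And>x. (p has_real_derivative p' x) (at x)" "gain p" "gain p'"
proof -
  \<comment> \<open>The \<open>n\<close>-th summand is responsible for \<open>n + 1 \<le> \<bar>x\<bar> \<le> n + 2\<close>.\<close>
  define A where "A n = 1 + \<psi> (real n + 2)" for n :: nat
  have A1: "1 \<le> A n" for n using gain_nonneg[OF assms] by (simp add: A_def)
  \<comment> \<open>This exponent makes the \<open>n\<close>-th summand at most \<open>2\<^sup>-\<^sup>n\<close> once \<open>2 \<bar>x\<bar> \<le> n + 1\<close>.\<close>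
  have "\<exists>N. 2 ^ n * A n \<le> (4::real) ^ N" for n
    using real_arch_pow[of 4 "2 ^ n * A n"] by (auto intro: less_imp_le)
  then obtain g where g: "\<And>n. 2 ^ n * A n \<le> (4::real) ^ g n" by metis
  define m where "m n = (\<Sum>k\<le>n. g k + 1)" for n
  have m_ge: "g n \<le> m n" for n
    using member_le_sum[of n "{..n}" "\<lambda>k. g k + 1"] by (simp add: m_def)
  define M where "M n = 2 * m n" for n
  have sM: "strict_mono M" by (rule strict_monoI_Suc) (simp add: M_def m_def)
  then have iM: "inj M" by (rule strict_mono_imp_inj_on)
  define c where "c j = (if j \<in> range M then A (inv M j) / real (inv M j + 1) ^ j else 0)" for j
  have cM: "c (M n) * x ^ M n = A n * (x / real (n + 1)) ^ M n" for n x
    by (simp add: c_def inv_f_f[OF iM] power_divide)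
  have "0 \<le> A n" for n using A1[of n] by simp
  then have c0: "0 \<le> c j" for j unfolding c_def by simp
  have sum: "summable (\<lambda>j. c j * x ^ j)" for x
  proof -
    have "\<forall>\<^sub>F n in sequentially. norm (c (M n) * x ^ M n) \<le> (1/2) ^ n"
      unfolding eventually_sequentially
    proof (intro exI[of _ "nat \<lceil>2 * \<bar>x\<bar>\<rceil>"] allI impI)
      fix n assume n: "nat \<lceil>2 * \<bar>x\<bar>\<rceil> \<le> n"
      then have "2 * \<bar>x\<bar> \<le> real (n + 1)" by linarith
      then have le: "\<bar>x\<bar> / real (n + 1) \<le> 1/2" by (simp add: field_simps)
      have "norm (c (M n) * x ^ M n) = A n * (\<bar>x\<bar> / real (n + 1)) ^ M n"
        unfolding cM using A1[of n] by (simp add: abs_mult power_abs)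
      also have "\<dots> \<le> A n * (1/2) ^ M n"
        using A1[of n] le by (intro mult_left_mono power_mono) auto
      also have "\<dots> = A n / 4 ^ m n" by (simp add: M_def power_mult power_divide)
      also have "\<dots> \<le> (1/2) ^ n"
      proof -
        have "2 ^ n * A n \<le> 4 ^ m n"
          using order_trans[OF g[of n] power_increasing[OF m_ge[of n]]] by simp
        then show ?thesis by (simp add: field_simps power_divide)
      qed
      finally show "norm (c (M n) * x ^ M n) \<le> (1/2) ^ n" .
    qed
    then have "summable (\<lambda>n. c (M n) * x ^ M n)"
      by (rule summable_comparison_test_ev) (simp add: summable_geometric)
    then show ?thesis
      using summable_mono_reindex[OF sM, of "\<lambda>j. c j * x ^ j"] by (simp add: c_def)
  qed
  define q where "q x = (\<Sum>j. c j * x ^ j)" for x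
  define p' where "p' x = (\<Sum>j. diffs c j * x ^ j)" for x
  define p where "p x = (1 + \<psi> 1) + q x" for x
  have term_le: "A n * (x / real (n + 1)) ^ M n \<le> q x" for n x
  proof -
    have nn: "0 \<le> c j * x ^ j" for j
    proof (cases "j \<in> range M")
      case True
      then have "even j" by (auto simp: M_def)
      then show ?thesis using c0[of j] by (simp add: zero_le_even_power)
    qed (simp add: c_def)
    have "(\<Sum>j\<in>{M n}. c j * x ^ j) \<le> q x"
      unfolding q_def by (rule sum_le_suminf[OF sum]) (auto simp: nn)
    then show ?thesis by (simp add: cM)
  qed
  have q0: "0 \<le> q x" for x
    using order_trans[OF _ term_le[of 0 x]] A1[of 0]
    by (auto simp: zero_le_mult_iff M_def zero_le_even_power)
  have sm: "smooth p"
  proof -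
    have "smooth q" unfolding smooth_def q_def using C_k_power_series[OF sum] by blast
    then show ?thesis unfolding p_def by (intro smooth_add smooth_const)
  qed
  have psi1: "0 \<le> \<psi> 1" using gain_nonneg[OF assms] by simp
  have ge: "\<psi> \<bar>x\<bar> \<le> p x" for x
  proof (cases "\<bar>x\<bar> \<le> 1")
    case True
    then have "\<psi> \<bar>x\<bar> \<le> \<psi> 1" using gain_mono[OF assms] by simp
    then show ?thesis using q0[of x] by (simp add: p_def)
  next
    case False
    define n where "n = nat \<lfloor>\<bar>x\<bar>\<rfloor> - 1"
    have n: "real (n + 1) \<le> \<bar>x\<bar>" "\<bar>x\<bar> \<le> real n + 2"
      unfolding n_def using False by linarith+
    have "\<psi> \<bar>x\<bar> \<le> A n" unfolding A_def using gain_mono[OF assms _ n(2)] by simp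
    also have "A n = A n * 1 ^ M n" by simp
    also have "\<dots> \<le> A n * (\<bar>x\<bar> / real (n + 1)) ^ M n"
      using n A1[of n] by (intro mult_left_mono power_mono) auto
    also have "\<dots> = A n * (x / real (n + 1)) ^ M n"
      by (simp add: M_def power_mult power_divide)
    also have "\<dots> \<le> q x" by (rule term_le)
    finally show ?thesis using psi1 by (simp add: p_def)
  qed
  have sum': "summable (\<lambda>j. diffs c j * x ^ j)" for x by (rule termdiff_converges_all[OF sum])
  have d0: "0 \<le> diffs c j" for j using c0 by (simp add: diffs_def)
  have gq: "gain q"
    unfolding gain_def q_def using c0
    by (intro conjI allI impI suminf_nonneg suminf_le sum) (auto intro!: mult_left_mono power_mono)
  have gp': "gain p'"
    unfolding gain_def p'_def using d0
    by (intro conjI allI impI suminf_nonneg suminf_le sum') (auto intro!: mult_left_mono power_mono)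
  show thesis
  proof (rule that[of p p'])
    show "1 \<le> p x" for x using q0[of x] psi1 by (simp add: p_def)
    show "gain p" unfolding p_def[abs_def] using psi1 gq by (intro gain_intros) auto
    show "(p has_real_derivative p' x) (at x)" for x
      unfolding p_def p'_def q_def
      using DERIV_add[OF DERIV_const termdiffs_strong_converges_everywhere[OF sum]] by simp
  qed (fact sm ge gp')+
qed

section \<open>Quadratic Lyapunov functions of Hurwitz matrices\<close>

text \<open>Composition of the operators \<open>A - \<mu>\<close>, the head of the list first.\<close>

fun shift_prod :: "complex^'n^'n \<Rightarrow> complex list \<Rightarrow> complex^'n \<Rightarrow> complex^'n" where
  "shift_prod A [] x = x"
| "shift_prod A (\<mu> # \<mu>s) x = shift_prod A \<mu>s (A *v x - \<mu> *s x)"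

lemma inner_vector_scalar_mult: "x \<bullet> (\<mu> *s x) = Re \<mu> * (norm x)\<^sup>2" for x :: "complex^'n"
proof -
  have "a \<bullet> (\<mu> * a) = Re \<mu> * (a \<bullet> a)" for a :: complex
    by (simp add: inner_complex_def algebra_simps)
  then show ?thesis
    by (simp add: power2_norm_eq_inner inner_vec_def vector_scalar_mult_def sum_distrib_left)
qed

lemma bounded_linear_cmatrix: "bounded_linear (\<lambda>x. A *v x)" for A :: "complex^'n^'m"
  by (rule linear_conv_bounded_linear[THEN iffD1], rule linearI)
    (simp_all add: matrix_vector_mult_def vec_eq_iff scaleR_sum_right distrib_left sum.distrib)

lemma bounded_linear_cscale: "bounded_linear (\<lambda>x. \<mu> *s x)" for \<mu> :: complex
  by (rule linear_conv_bounded_linear[THEN iffD1], rule linearI)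
    (simp_all add: vec_eq_iff algebra_simps)

lemma bounded_bilinear_lincomb:
  fixes B B' :: "'a::real_normed_vector \<Rightarrow> 'b::real_normed_vector \<Rightarrow> real"
  assumes "bounded_bilinear B" "bounded_bilinear B'"
  shows "bounded_bilinear (\<lambda>x y. a * B x y + b * B' x y)"
proof -
  interpret B: bounded_bilinear B by fact
  interpret B': bounded_bilinear B' by fact
  obtain K K' where K: "\<And>x y. norm (B x y) \<le> norm x * norm y * K"
    "\<And>x y. norm (B' x y) \<le> norm x * norm y * K'"
    using B.bounded B'.bounded by blast
  show ?thesis
  proof
    show "\<exists>K. \<forall>x y. norm (a * B x y + b * B' x y) \<le> norm x * norm y * K"
    proof (intro exI[of _ "\<bar>a\<bar> * K + \<bar>b\<bar> * K'"] allI)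
      fix x y
      have "norm (a * B x y + b * B' x y) \<le> \<bar>a\<bar> * norm (B x y) + \<bar>b\<bar> * norm (B' x y)"
        by (rule order_trans[OF norm_triangle_ineq]) (simp add: abs_mult)
      also have "\<dots> \<le> \<bar>a\<bar> * (norm x * norm y * K) + \<bar>b\<bar> * (norm x * norm y * K')"
        by (intro add_mono mult_left_mono K) auto
      finally show "norm (a * B x y + b * B' x y) \<le> norm x * norm y * (\<bar>a\<bar> * K + \<bar>b\<bar> * K')"
        by (simp add: algebra_simps)
    qed
  qed (simp_all add: B.add_left B'.add_left B.add_right B'.add_right B.scaleR_left B'.scaleR_left
      B.scaleR_right B'.scaleR_right algebra_simps)
qed

text \<open>Write \<open>A x = \<mu> x + L x\<close>. A form for the shorter list controls \<open>L x\<close>, and with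
  \<open>a = - 1 / Re \<mu>\<close> the form \<open>a (x \<bullet> y) + a\<^sup>2 B (L x) (L y)\<close> absorbs the cross term \<open>x \<bullet> L x\<close>.\<close>

lemma lyapunov_form_of_shift_prod:
  fixes A :: "complex^'n^'n"
  assumes "\<forall>\<mu>\<in>set \<mu>s. Re \<mu> < 0"
  shows "\<exists>B c. bounded_bilinear B \<and> (\<forall>x y. B x y = B y x) \<and> (0::real) < c \<and>
    (\<forall>x. shift_prod A \<mu>s x = 0 \<longrightarrow> c * (norm x)\<^sup>2 \<le> B x x \<and> 2 * B x (A *v x) \<le> - (norm x)\<^sup>2)"
  using assms
proof (induction \<mu>s)
  case Nil
  show ?case
    by (intro exI[of _ "\<lambda>x y. 0"] exI[of _ 1]) (auto intro!: bounded_bilinear.intro exI[of _ 0])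
next
  case (Cons \<mu> \<mu>s)
  then obtain B c where B: "bounded_bilinear B" "\<And>x y. B x y = B y x" "0 < c"
    "\<And>x. shift_prod A \<mu>s x = 0 \<Longrightarrow> c * (norm x)\<^sup>2 \<le> B x x \<and> 2 * B x (A *v x) \<le> - (norm x)\<^sup>2"
    by auto
  define a where "a = 1 / (- Re \<mu>)"
  have a: "a > 0" "a * Re \<mu> = - 1" using Cons.prems by (auto simp: a_def)
  define L where "L x = A *v x - \<mu> *s x" for x
  have L: "bounded_linear L"
    unfolding L_def by (intro bounded_linear_sub bounded_linear_cmatrix bounded_linear_cscale)
  have LA: "L (A *v x) = A *v L x" for x
    by (simp add: L_def matrix_vector_mult_diff_distrib vec.scale)
  define B' where "B' x y = a * (x \<bullet> y) + a\<^sup>2 * B (L x) (L y)" for x y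
  show ?case
  proof (intro exI[of _ B'] exI[of _ a] conjI allI impI)
    show "bounded_bilinear B'"
      unfolding B'_def
      by (rule bounded_bilinear_lincomb[OF bounded_bilinear_inner bounded_bilinear.comp[OF B(1) L L]])
    show "B' x y = B' y x" for x y by (simp add: B'_def inner_commute B(2)[of "L x"])
    show "0 < a" by (rule a)
    fix x assume "shift_prod A (\<mu> # \<mu>s) x = 0"
    then have "shift_prod A \<mu>s (L x) = 0" by (simp add: L_def)
    from B(4)[OF this] have y: "c * (norm (L x))\<^sup>2 \<le> B (L x) (L x)"
      "2 * B (L x) (A *v L x) \<le> - (norm (L x))\<^sup>2" by auto
    have "0 \<le> B (L x) (L x)" using y(1) B(3) by (smt (verit) mult_nonneg_nonneg zero_le_power2)
    then show "a * (norm x)\<^sup>2 \<le> B' x x" by (simp add: B'_def power2_norm_eq_inner)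
    have Ax: "A *v x = \<mu> *s x + L x" by (simp add: L_def)
    have "2 * B' x (A *v x) = 2 * a * (x \<bullet> (A *v x)) + a\<^sup>2 * (2 * B (L x) (A *v L x))"
      by (simp add: B'_def LA)
    also have "x \<bullet> (A *v x) = Re \<mu> * (norm x)\<^sup>2 + x \<bullet> L x"
      by (simp add: Ax inner_add_right inner_vector_scalar_mult)
    also have "2 * a * (Re \<mu> * (norm x)\<^sup>2 + x \<bullet> L x)
        = 2 * (a * Re \<mu>) * (norm x)\<^sup>2 + 2 * (a * (x \<bullet> L x))"
      by (simp add: algebra_simps)
    finally have 1: "2 * B' x (A *v x)
        = - 2 * (norm x)\<^sup>2 + 2 * (a * (x \<bullet> L x)) + a\<^sup>2 * (2 * B (L x) (A *v L x))"
      unfolding a(2) by simp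
    have "a * (x \<bullet> L x) \<le> a * (norm x * norm (L x))"
      by (rule mult_left_mono[OF norm_cauchy_schwarz]) (use a in simp)
    moreover have "2 * norm x * (a * norm (L x)) \<le> (norm x)\<^sup>2 + (a * norm (L x))\<^sup>2"
      by (rule sum_squares_bound)
    moreover have "a\<^sup>2 * (2 * B (L x) (A *v L x)) \<le> a\<^sup>2 * (- (norm (L x))\<^sup>2)"
      by (rule mult_left_mono[OF y(2)]) simp
    ultimately show "2 * B' x (A *v x) \<le> - (norm x)\<^sup>2"
      unfolding 1 by (simp add: power_mult_distrib algebra_simps)
  qed
qed

definition poly_action :: "complex^'n^'n \<Rightarrow> complex poly \<Rightarrow> complex^'n \<Rightarrow> complex^'n" where
  "poly_action A p x = (\<Sum>i\<le>degree p. coeff p i *s ((*v) A ^^ i) x)"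

lemma poly_action_eq:
  assumes "degree p \<le> n"
  shows "poly_action A p x = (\<Sum>i\<le>n. coeff p i *s ((*v) A ^^ i) x)"
  unfolding poly_action_def using assms
  by (intro sum.mono_neutral_left) (auto simp: coeff_eq_0)

lemma matpow_diff_scale:
  "((*v) A ^^ i) (x - c *s y) = ((*v) A ^^ i) x - c *s ((*v) A ^^ i) y" for A :: "complex^'n^'n"
  by (induction i) (simp_all add: matrix_vector_mult_diff_distrib vec.scale)

lemma poly_action_smult: "poly_action A (smult c p) x = c *s poly_action A p x"
  by (subst (1 2) poly_action_eq[of _ "degree p"])
    (auto simp: degree_smult_le vec.scale_sum_right vector_smult_assoc)

lemma poly_action_linear_factor:
  "poly_action A ([:- \<mu>, 1:] * q) x = poly_action A q (A *v x - \<mu> *s x)"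
proof -
  have "degree ([:- \<mu>, 1:] * q) \<le> Suc (degree q)"
    using degree_mult_le[of "[:- \<mu>, 1:]" q] by simp
  then have "poly_action A ([:- \<mu>, 1:] * q) x
      = (\<Sum>i\<le>Suc (degree q). coeff ([:- \<mu>, 1:] * q) i *s ((*v) A ^^ i) x)"
    by (rule poly_action_eq)
  also have "\<dots> = (\<Sum>i\<le>Suc (degree q). coeff (pCons 0 q) i *s ((*v) A ^^ i) x)
      - (\<Sum>i\<le>Suc (degree q). (\<mu> * coeff q i) *s ((*v) A ^^ i) x)"
    unfolding sum_subtractf[symmetric]
    by (intro sum.cong refl) (simp add: vec.scale_left_diff_distrib algebra_simps)
  also have "(\<Sum>i\<le>Suc (degree q). coeff (pCons 0 q) i *s ((*v) A ^^ i) x)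
      = (\<Sum>i\<le>degree q. coeff q i *s ((*v) A ^^ i) (A *v x))"
    by (subst sum.atMost_Suc_shift) (simp add: funpow_swap1)
  also have "(\<Sum>i\<le>Suc (degree q). (\<mu> * coeff q i) *s ((*v) A ^^ i) x)
      = (\<Sum>i\<le>degree q. coeff q i *s (\<mu> *s ((*v) A ^^ i) x))"
    by (simp add: coeff_eq_0 vector_smult_assoc mult.commute)
  finally show ?thesis
    by (simp add: poly_action_def matpow_diff_scale sum_subtractf vec.scale_right_diff_distrib)
qed

lemma poly_action_commute: "A *v poly_action A q x = poly_action A q (A *v x)"
  by (simp add: poly_action_def vec.sum vec.scale funpow_swap1)

lemma poly_action_diff_scale:
  "poly_action A q (x - c *s y) = poly_action A q x - c *s poly_action A q y"
  by (simp add: poly_action_def matpow_diff_scale sum_subtractf vec.scale_right_diff_distrib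
      vec.scale_sum_right vector_smult_assoc mult.commute)

lemma poly_action_prod_list:
  "poly_action A (\<Prod>\<mu>\<leftarrow>\<mu>s. [:- \<mu>, 1:]) x = shift_prod A \<mu>s x"
proof (induction \<mu>s arbitrary: x)
  case (Cons \<mu> \<mu>s)
  show ?case
    by (simp only: list.map prod_list.Cons poly_action_linear_factor Cons shift_prod.simps)
qed (simp add: poly_action_def)

text \<open>More powers of a matrix than the dimension of the matrix space are linearly dependent.\<close>

lemma exists_annihilating_poly: "\<exists>p. p \<noteq> 0 \<and> (\<forall>x. poly_action A p x = 0)"
  for A :: "complex^'n^'n"
proof -
  define P where "P i = (((**) A) ^^ i) (mat 1)" for i
  have P: "P i *v x = ((*v) A ^^ i) x" for i x
    by (induction i) (simp_all add: P_def matrix_vector_mul_assoc[symmetric])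
  define D where "D = DIM(complex^'n^'n)"
  have "\<exists>c::nat \<Rightarrow> real. (\<exists>i\<le>D. c i \<noteq> 0) \<and> (\<Sum>i\<le>D. c i *\<^sub>R P i) = 0"
  proof (cases "inj_on P {..D}")
    case True
    have "card (P ` {..D}) = Suc D" using card_image[OF True] by simp
    then have "dependent (P ` {..D})"
      using independent_bound[of "P ` {..D}"] by (auto simp: D_def)
    then obtain u v where u: "v \<in> P ` {..D}" "u v \<noteq> 0" "(\<Sum>v\<in>P ` {..D}. u v *\<^sub>R v) = 0"
      by (auto simp: real_vector.dependent_finite)
    from u(3) have "(\<Sum>i\<le>D. u (P i) *\<^sub>R P i) = 0" by (simp add: sum.reindex[OF True])
    with u show ?thesis by (intro exI[of _ "\<lambda>i. u (P i)"]) auto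
  next
    case False
    then obtain i j where ij: "i \<le> D" "j \<le> D" "i \<noteq> j" "P i = P j" by (auto simp: inj_on_def)
    define c where "c k = (if k = i then 1 else if k = j then -1 else 0 :: real)" for k
    have "(\<Sum>k\<le>D. c k *\<^sub>R P k) = (\<Sum>k\<in>{i, j}. c k *\<^sub>R P k)"
      using ij by (intro sum.mono_neutral_right) (auto simp: c_def)
    also have "\<dots> = 0" using ij by (simp add: c_def)
    finally show ?thesis using ij by (intro exI[of _ c]) (auto simp: c_def)
  qed
  then obtain c i where c: "i \<le> D" "c i \<noteq> 0" "(\<Sum>i\<le>D. c i *\<^sub>R P i) = 0" by blast
  define p where "p = (\<Sum>i\<le>D. monom (complex_of_real (c i)) i)"
  have cp: "coeff p k = (if k \<le> D then complex_of_real (c k) else 0)" for k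
    by (simp add: p_def coeff_sum)
  have dp: "degree p \<le> D" by (rule degree_le) (simp add: cp)
  have "poly_action A p x = 0" for x
  proof -
    have sc: "complex_of_real r *s y = r *\<^sub>R y" for r and y :: "complex^'n"
      by (simp add: vec_eq_iff scaleR_conv_of_real[where 'a = complex])
    have blv: "bounded_linear (\<lambda>Q. Q *v x)"
      by (rule linear_conv_bounded_linear[THEN iffD1], rule linearI)
        (simp_all add: matrix_vector_mult_def vec_eq_iff scaleR_sum_right distrib_right sum.distrib)
    have "poly_action A p x = (\<Sum>i\<le>D. c i *\<^sub>R (P i *v x))"
      by (simp add: poly_action_eq[OF dp] cp sc P)
    also have "\<dots> = (\<Sum>i\<le>D. c i *\<^sub>R P i) *v x"
      by (simp add: linear_sum[OF bounded_linear.linear[OF blv]] linear_scale[OF bounded_linear.linear[OF blv]])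
    finally show ?thesis by (simp add: c(3))
  qed
  moreover have "p \<noteq> 0" using cp[of i] c by auto
  ultimately show ?thesis by blast
qed

text \<open>For an annihilating polynomial of minimal degree, every root \<open>\<mu>\<close> is an eigenvalue: the
  quotient by the linear factor does not annihilate, and \<open>A - \<mu>\<close> kills its values.\<close>

lemma shift_prod_eigenvalues:
  fixes A :: "real^'n^'n"
  obtains \<mu>s where "\<And>\<mu>. \<mu> \<in> set \<mu>s \<Longrightarrow> eigenvalue A \<mu>" "\<And>x. shift_prod (cmat A) \<mu>s x = 0"
proof -
  let ?ann = "\<lambda>p. p \<noteq> 0 \<and> (\<forall>x. poly_action (cmat A) p x = 0)"
  obtain p where p: "?ann p" "\<And>q. ?ann q \<Longrightarrow> degree p \<le> degree q"
    using exists_annihilating_poly ex_has_least_nat[of ?ann _ degree] by metis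
  obtain Ms where Ms: "p = smult (lead_coeff p) (\<Prod>x\<in>#Ms. [:-x, 1:])"
    using alg_closed_imp_factorization p(1) by blast
  obtain \<mu>s where \<mu>s: "mset \<mu>s = Ms" using ex_mset by blast
  have pe: "p = smult (lead_coeff p) (\<Prod>\<mu>\<leftarrow>\<mu>s. [:- \<mu>, 1:])"
    by (subst Ms) (simp add: \<mu>s[symmetric] prod_mset_prod_list[symmetric])
  show thesis
  proof (rule that[of \<mu>s])
    fix \<mu> assume "\<mu> \<in> set \<mu>s"
    then have "poly (\<Prod>\<mu>\<leftarrow>\<mu>s. [:- \<mu>, 1:]) \<mu> = 0" by (induction \<mu>s) auto
    then have "poly p \<mu> = 0" by (subst pe) simp
    then obtain q where q: "p = [:- \<mu>, 1:] * q" unfolding poly_eq_0_iff_dvd by (rule dvdE)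
    have q0: "q \<noteq> 0" using p(1) q by auto
    then have "degree q < degree p" unfolding q by (subst degree_mult_eq) auto
    with p(2)[of q] q0 obtain x where x: "poly_action (cmat A) q x \<noteq> 0" by (metis leD)
    have "poly_action (cmat A) p x = 0" using p(1) by blast
    then have "cmat A *v poly_action (cmat A) q x - \<mu> *s poly_action (cmat A) q x = 0"
      unfolding q poly_action_linear_factor poly_action_diff_scale by (simp add: poly_action_commute)
    with x show "eigenvalue A \<mu>" unfolding eigenvalue_def eigenspace_def by auto
  next
    fix x
    have "poly_action (cmat A) p x = 0" using p(1) by blast
    then have "lead_coeff p *s shift_prod (cmat A) \<mu>s x = 0"
      by (subst (asm) pe) (simp add: poly_action_smult poly_action_prod_list)
    moreover have "lead_coeff p \<noteq> 0" using p(1) by simp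
    ultimately show "shift_prod (cmat A) \<mu>s x = 0" by (simp add: vec_eq_iff)
  qed
qed

text \<open>Real vectors embed isometrically into complex ones, where a product of factors \<open>A - \<mu>\<close>
  over eigenvalues \<open>\<mu>\<close> annihilates the whole space.\<close>

lemma Hurwitz_lyapunov_form:
  fixes A :: "real^'n^'n"
  assumes "Hurwitz A"
  obtains B c where "bounded_bilinear B" "\<And>x y. B x y = B y x" "(0::real) < c"
    "\<And>x. c * (norm x)\<^sup>2 \<le> B x x" "\<And>x. 2 * B x (A *v x) \<le> - (norm x)\<^sup>2"
proof -
  obtain \<mu>s where \<mu>s: "\<And>\<mu>. \<mu> \<in> set \<mu>s \<Longrightarrow> eigenvalue A \<mu>" "\<And>x. shift_prod (cmat A) \<mu>s x = 0"
    by (rule shift_prod_eigenvalues) blast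
  then have "\<forall>\<mu>\<in>set \<mu>s. Re \<mu> < 0" using assms by (auto simp: Hurwitz_def)
  from lyapunov_form_of_shift_prod[OF this, of "cmat A"] \<mu>s(2)
  obtain B c where B: "bounded_bilinear B" "\<And>x y. B x y = B y x" "(0::real) < c"
    "\<And>x. c * (norm x)\<^sup>2 \<le> B x x" "\<And>x. 2 * B x (cmat A *v x) \<le> - (norm x)\<^sup>2"
    by auto
  define J :: "real^'n \<Rightarrow> complex^'n" where "J x = (\<chi> i. complex_of_real (x $ i))" for x
  have J: "bounded_linear J"
    by (rule linear_conv_bounded_linear[THEN iffD1], rule linearI)
      (simp_all add: J_def vec_eq_iff scaleR_conv_of_real[where 'a = complex])
  have nJ: "norm (J x) = norm x" for x by (simp add: J_def norm_vec_def)
  have AJ: "cmat A *v J x = J (A *v x)" for x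
    by (simp add: J_def cmat_def vec_eq_iff matrix_vector_mult_def)
  show thesis
  proof (rule that[of "\<lambda>x y. B (J x) (J y)" c])
    show "bounded_bilinear (\<lambda>x y. B (J x) (J y))" by (rule bounded_bilinear.comp[OF B(1) J J])
    show "B (J x) (J y) = B (J y) (J x)" for x y by (rule B(2))
    show "0 < c" by (rule B(3))
    show "c * (norm x)\<^sup>2 \<le> B (J x) (J x)" for x using B(4)[of "J x"] by (simp add: nJ)
    show "2 * B (J x) (J (A *v x)) \<le> - (norm x)\<^sup>2" for x using B(5)[of "J x"] by (simp add: nJ AJ)
  qed
qed

section \<open>A single backstepping step\<close>

lemma gain_square_max:
  assumes "gain h" "0 \<le> a" "0 \<le> b"
  shows "h (max a b) * (max a b)\<^sup>2 \<le> h a * a\<^sup>2 + h b * b\<^sup>2"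
  using gain_nonneg[OF assms(1,2)] gain_nonneg[OF assms(1,3)] by (simp add: max_def)

text \<open>The bound \<open>(h(3 m) 3 m)\<^sup>2\<close> with the largest argument \<open>m\<close> is a function of one argument,
  hence at most the sum of its values at the three arguments.\<close>

lemma gain_square_sum3:
  assumes h: "gain h" and nn: "0 \<le> a" "0 \<le> b" "0 \<le> c"
    and x: "\<bar>x\<bar> \<le> h (a + b + c) * (a + b + c)"
  shows "x\<^sup>2 \<le> 9 * (h (3 * a))\<^sup>2 * a\<^sup>2 + 9 * (h (3 * b))\<^sup>2 * b\<^sup>2 + 9 * (h (3 * c))\<^sup>2 * c\<^sup>2"
proof -
  define k where "k s = 9 * (h (3 * s))\<^sup>2" for s
  have k: "gain k" unfolding k_def[abs_def]
    by (intro gain_mult gain_power gain_compose[OF h] gain_const gain_id) auto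
  define m where "m = max a (max b c)"
  have m: "a + b + c \<le> 3 * m" "0 \<le> m" using nn by (auto simp: m_def)
  have h0: "0 \<le> h (a + b + c)" using h nn by (simp add: gain_nonneg)
  have "\<bar>x\<bar> \<le> h (3 * m) * (3 * m)"
    using x m nn h0 gain_mono[OF h, of "a + b + c" "3 * m"]
    by (elim order_trans) (intro mult_mono, auto)
  then have "\<bar>x\<bar>\<^sup>2 \<le> (h (3 * m) * (3 * m))\<^sup>2" by (intro power_mono) auto
  then have "x\<^sup>2 \<le> k m * m\<^sup>2" by (simp add: k_def power_mult_distrib)
  also have "\<dots> \<le> k a * a\<^sup>2 + k (max b c) * (max b c)\<^sup>2"
    unfolding m_def by (rule gain_square_max[OF k]) (use nn in auto)
  also have "k (max b c) * (max b c)\<^sup>2 \<le> k b * b\<^sup>2 + k c * c\<^sup>2"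
    by (rule gain_square_max[OF k]) (use nn in auto)
  finally show ?thesis by (simp add: k_def)
qed

text \<open>Where \<open>A \<ge> 2 \<gamma>\<close>, half of the decay compensates the supply; elsewhere the factor \<open>\<kappa>\<close> is at
  most \<open>K\<close>.\<close>

lemma supply_change:
  fixes \<kappa> V' A \<gamma> K :: real
  assumes "V' \<le> - A + \<gamma>" "0 \<le> \<kappa>" "0 \<le> A" "0 \<le> \<gamma>" "0 \<le> K" "A < 2 * \<gamma> \<Longrightarrow> \<kappa> \<le> K"
  shows "\<kappa> * V' \<le> - (\<kappa> * A / 2) + K * \<gamma>"
proof (cases "A < 2 * \<gamma>")
  case True
  have "\<kappa> * V' \<le> \<kappa> * (- A + \<gamma>)" using assms by (intro mult_left_mono)
  moreover have "\<kappa> * \<gamma> \<le> K * \<gamma>" using assms True by (intro mult_right_mono) auto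
  moreover have "0 \<le> \<kappa> * A" using assms by simp
  ultimately show ?thesis by (simp add: algebra_simps)
next
  case False
  have "\<kappa> * V' \<le> \<kappa> * (- A / 2)" using assms False by (intro mult_left_mono) auto
  moreover have "0 \<le> K * \<gamma>" using assms by simp
  ultimately show ?thesis by (simp add: algebra_simps)
qed

text \<open>The function \<open>V p(V)\<close> has derivative \<open>\<kappa>(V) V'\<close> with \<open>\<kappa>(s) = p(s) + s p'(s)\<close>. Its decay
  dominates the part of the perturbation \<open>G\<close> that depends on \<open>n\<close>, because \<open>\<kappa>(V) \<ge> 4 + q(lw V)\<close>.
  By \<open>supply_change\<close> the factor \<open>\<kappa>(V)\<close> multiplies the supply only where \<open>n\<close>, and with it \<open>V\<close>, is
  bounded in terms of \<open>y\<close> and \<open>d\<close>; the resulting gain of \<open>y\<close> is dominated by \<open>\<rho>\<close>.\<close>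

lemma backstepping_step:
  assumes g: "gain \<psi>\<gamma>" "gain \<psi>\<pi>" "gain \<psi>G" "gain up" "gain lw"
    and \<beta>: "0 < \<beta>min" "\<beta>min \<le> \<beta>max"
  obtains p p' \<rho> \<psi>\<pi>' :: "real \<Rightarrow> real" where
    "\<And>x. 1 \<le> p x" "\<And>x. (p has_real_derivative p' x) (at x)" "gain p" "gain p'"
    "smooth \<rho>" "\<And>x. 1 \<le> \<rho> x" "gain \<psi>\<pi>'"
    "\<And>n y d V V' G \<beta> a. \<lbrakk>0 \<le> n; 0 \<le> d; 0 \<le> V; V \<le> up n; n \<le> lw V;
       V' \<le> - n\<^sup>2 + \<psi>\<gamma> \<bar>y\<bar> * y\<^sup>2 + \<psi>\<pi> d * d\<^sup>2;
       \<bar>G\<bar> \<le> \<psi>G (n + \<bar>y\<bar> + d) * (n + \<bar>y\<bar> + d); \<beta>min \<le> \<beta>; \<beta> \<le> \<beta>max\<rbrakk> \<Longrightarrow>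
       (p V + V * p' V) * V' + y * (\<beta> * (- \<rho> y * y + a) + G)
         \<le> - (n + \<bar>y\<bar>)\<^sup>2 - \<beta>min / 2 * \<rho> y * y\<^sup>2 + \<beta>max\<^sup>2 / 2 * a\<^sup>2 + \<psi>\<pi>' d * d\<^sup>2"
proof -
  define q where "q s = 9 * (\<psi>G (3 * s))\<^sup>2" for s
  have q: "gain q" unfolding q_def[abs_def]
    by (intro gain_mult gain_power gain_compose[OF g(3)] gain_const gain_id) auto
  have "gain (\<lambda>s. 4 + q (lw s))" by (intro gain_add gain_const gain_compose[OF q g(5)]) auto
  then obtain p p' where p: "\<And>x. 1 \<le> p x" "\<And>x. 4 + q (lw \<bar>x\<bar>) \<le> p x"
      "\<And>x. (p has_real_derivative p' x) (at x)" "gain p" "gain p'"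
    by (rule smooth_majorant) blast
  define \<kappa> where "\<kappa> s = p s + s * p' s" for s
  have \<kappa>: "gain \<kappa>" unfolding \<kappa>_def[abs_def] by (intro gain_add gain_mult gain_id p)
  define \<psi> where "\<psi> s = \<psi>\<gamma> s + \<psi>\<pi> s" for s
  have \<psi>: "gain \<psi>" unfolding \<psi>_def[abs_def] by (intro gain_add g)
  \<comment> \<open>If the supply exceeds half of the decay, then \<open>n \<le> R m\<close> for \<open>m = max \<bar>y\<bar> d\<close>.\<close>
  define R where "R s = 2 * s * sqrt (\<psi> s)" for s
  have R: "gain R" unfolding R_def[abs_def] by (intro gain_mult gain_const gain_id gain_sqrt \<psi>) auto
  define h where "h s = \<kappa> (up (R s)) * \<psi> s" for s
  have h: "gain h" unfolding h_def[abs_def]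
    by (intro gain_mult \<psi> gain_compose[OF \<kappa>] gain_compose[OF g(4)] R)
  have "gain (\<lambda>s. 2 / \<beta>min * (h s + 3 + q s / 2))"
    using \<beta> by (intro gain_mult gain_add gain_const gain_divide h q) auto
  then obtain \<rho> where \<rho>: "smooth \<rho>" "\<And>x. 1 \<le> \<rho> x"
      "\<And>x. 2 / \<beta>min * (h \<bar>x\<bar> + 3 + q \<bar>x\<bar> / 2) \<le> \<rho> x"
    by (rule smooth_majorant) blast
  define \<psi>\<pi>' where "\<psi>\<pi>' s = h s + q s / 2" for s
  have \<psi>\<pi>': "gain \<psi>\<pi>'" unfolding \<psi>\<pi>'_def[abs_def] by (intro gain_add gain_divide h q) auto
  have main: "(p V + V * p' V) * V' + y * (\<beta> * (- \<rho> y * y + a) + G)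
         \<le> - (n + \<bar>y\<bar>)\<^sup>2 - \<beta>min / 2 * \<rho> y * y\<^sup>2 + \<beta>max\<^sup>2 / 2 * a\<^sup>2 + \<psi>\<pi>' d * d\<^sup>2"
    if a: "0 \<le> n" "0 \<le> d" "0 \<le> V" "V \<le> up n" "n \<le> lw V"
      and V': "V' \<le> - n\<^sup>2 + \<psi>\<gamma> \<bar>y\<bar> * y\<^sup>2 + \<psi>\<pi> d * d\<^sup>2"
      and G: "\<bar>G\<bar> \<le> \<psi>G (n + \<bar>y\<bar> + d) * (n + \<bar>y\<bar> + d)" and b: "\<beta>min \<le> \<beta>" "\<beta> \<le> \<beta>max"
    for n y d V V' G \<beta> a
  proof -
    define m where "m = max \<bar>y\<bar> d"
    have m: "0 \<le> m" "\<bar>y\<bar> \<le> m" "d \<le> m" by (auto simp: m_def)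
    have \<psi>m: "0 \<le> \<psi> m" using gain_nonneg[OF \<psi> m(1)] .
    have \<psi>\<gamma>m: "\<psi>\<gamma> \<bar>y\<bar> * y\<^sup>2 \<le> \<psi>\<gamma> m * m\<^sup>2"
      using gain_mono[OF g(1) _ m(2)] gain_nonneg[OF g(1) m(1)] power_mono[OF m(2), of 2]
      by (intro mult_mono) auto
    have \<psi>\<pi>m: "\<psi>\<pi> d * d\<^sup>2 \<le> \<psi>\<pi> m * m\<^sup>2"
      using gain_mono[OF g(2) a(2) m(3)] gain_nonneg[OF g(2) m(1)] power_mono[OF m(3) a(2), of 2]
      by (intro mult_mono) auto
    have V'm: "V' \<le> - n\<^sup>2 + \<psi> m * m\<^sup>2"
      using V' \<psi>\<gamma>m \<psi>\<pi>m by (simp add: \<psi>_def algebra_simps)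
    have Rm: "0 \<le> R m" using gain_nonneg[OF R m(1)] .
    have "\<kappa> V * V' \<le> - (\<kappa> V * n\<^sup>2 / 2) + \<kappa> (up (R m)) * (\<psi> m * m\<^sup>2)"
    proof (rule supply_change[OF V'm])
      show "0 \<le> \<kappa> V" using gain_nonneg[OF \<kappa> a(3)] .
      show "0 \<le> \<kappa> (up (R m))" using gain_nonneg[OF \<kappa> gain_nonneg[OF g(4) Rm]] .
      show "0 \<le> \<psi> m * m\<^sup>2" using \<psi>m by simp
      assume "n\<^sup>2 < 2 * (\<psi> m * m\<^sup>2)"
      also have "\<dots> \<le> (R m)\<^sup>2" using \<psi>m by (simp add: R_def power_mult_distrib)
      finally have "n \<le> R m" using Rm by (meson less_imp_le power2_le_imp_le)
      then have "V \<le> up (R m)" using gain_mono[OF g(4) a(1)] a(4) by (meson order_trans)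
      then show "\<kappa> V \<le> \<kappa> (up (R m))" by (rule gain_mono[OF \<kappa> a(3)])
    qed simp
    also have "\<kappa> (up (R m)) * (\<psi> m * m\<^sup>2) = h m * m\<^sup>2" by (simp add: h_def)
    also have "h m * m\<^sup>2 \<le> h \<bar>y\<bar> * \<bar>y\<bar>\<^sup>2 + h d * d\<^sup>2"
      unfolding m_def by (rule gain_square_max[OF h]) (use a in auto)
    finally have 1: "\<kappa> V * V' \<le> - (\<kappa> V * n\<^sup>2 / 2) + (h \<bar>y\<bar> * y\<^sup>2 + h d * d\<^sup>2)" by simp
    have \<kappa>V: "4 + q n \<le> \<kappa> V"
    proof -
      have "q n \<le> q (lw V)" by (rule gain_mono[OF q a(1,5)])
      moreover have "4 + q (lw V) \<le> p V" using p(2)[of V] a(3) by simp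
      moreover have "0 \<le> V * p' V" using gain_nonneg[OF p(5) a(3)] a(3) by simp
      ultimately show ?thesis by (simp add: \<kappa>_def)
    qed
    have 2: "(4 + q n) * n\<^sup>2 \<le> \<kappa> V * n\<^sup>2" by (rule mult_right_mono[OF \<kappa>V]) simp
    have 3: "G\<^sup>2 \<le> q n * n\<^sup>2 + q \<bar>y\<bar> * y\<^sup>2 + q d * d\<^sup>2"
      using gain_square_sum3[OF g(3) a(1) _ a(2) G] by (simp add: q_def)
    have 4: "y * G \<le> y\<^sup>2 / 2 + G\<^sup>2 / 2" using sum_squares_bound[of y G] by simp
    have 5: "\<beta> * (y * a) \<le> y\<^sup>2 / 2 + \<beta>max\<^sup>2 / 2 * a\<^sup>2"
    proof -
      have "\<beta> * (y * a) \<le> y\<^sup>2 / 2 + (\<beta> * a)\<^sup>2 / 2"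
        using sum_squares_bound[of y "\<beta> * a"] by (simp add: algebra_simps)
      moreover have "(\<beta> * a)\<^sup>2 \<le> \<beta>max\<^sup>2 * a\<^sup>2"
        unfolding power_mult_distrib using b \<beta> by (intro mult_right_mono power_mono) auto
      ultimately show ?thesis by simp
    qed
    have 6: "\<beta>min * (\<rho> y * y\<^sup>2) \<le> \<beta> * (\<rho> y * y\<^sup>2)"
      using b \<rho>(2)[of y] by (intro mult_right_mono mult_nonneg_nonneg) auto
    have 7: "(h \<bar>y\<bar> + 3 + q \<bar>y\<bar> / 2) * y\<^sup>2 \<le> \<beta>min / 2 * \<rho> y * y\<^sup>2"
    proof (rule mult_right_mono)
      show "h \<bar>y\<bar> + 3 + q \<bar>y\<bar> / 2 \<le> \<beta>min / 2 * \<rho> y"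
        using \<rho>(3)[of y] \<beta> by (simp add: field_simps)
    qed simp
    have 8: "(n + \<bar>y\<bar>)\<^sup>2 \<le> 2 * n\<^sup>2 + 2 * y\<^sup>2"
      using sum_squares_bound[of n "\<bar>y\<bar>"] by (simp add: power2_sum)
    have 9: "(p V + V * p' V) * V' + y * (\<beta> * (- \<rho> y * y + a) + G)
       = \<kappa> V * V' + (- (\<beta> * (\<rho> y * y\<^sup>2)) + \<beta> * (y * a) + y * G)"
      by (simp add: \<kappa>_def algebra_simps power2_eq_square)
    show ?thesis
      unfolding 9 \<psi>\<pi>'_def using 1 2 3 4 5 6 7 8 by (simp add: algebra_simps)
  qed
  show thesis
    by (rule that[of p p' \<rho> \<psi>\<pi>']) (fact p(1) p(3) p(4) p(5) \<rho>(1) \<rho>(2) \<psi>\<pi>' main)+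
qed

section \<open>Barrier arguments with one-sided derivatives\<close>

text \<open>Otherwise \<open>\<phi>\<close> ends above a line through its initial value with slope \<open>- m\<close>, for some
  \<open>m < c\<close>. At the last time at which \<open>\<phi>\<close> is not above that line, the one-sided derivative pushes
  it below.\<close>

lemma decreasing_of_right_derivative:
  fixes \<phi> :: "real \<Rightarrow> real"
  assumes ab: "a \<le> b" and cont: "continuous_on {a..b} \<phi>"
    and der: "\<And>t. a \<le> t \<Longrightarrow> t < b \<Longrightarrow>
      \<exists>D h. h > 0 \<and> (\<phi> has_real_derivative D) (at t within {t..<t+h}) \<and> D \<le> - c"
  shows "\<phi> b \<le> \<phi> a - c * (b - a)"
proof (rule ccontr)
  assume neg: "\<not> ?thesis"
  then have "a < b" using ab by (cases "a = b") auto
  have "(\<phi> a - \<phi> b) / (b - a) < c" using neg \<open>a < b\<close> by (simp add: field_simps)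
  then obtain m where m: "m < c" "(\<phi> a - \<phi> b) / (b - a) < m" using dense by blast
  then have mb: "\<phi> a - \<phi> b < m * (b - a)" using \<open>a < b\<close> by (simp add: field_simps)
  define g where "g t = \<phi> t - \<phi> a + m * (t - a)" for t
  have gc: "continuous_on {a..b} g" unfolding g_def by (intro continuous_intros cont)
  have "compact ({a..b} \<inter> g -` {..0})"
    using continuous_closed_preimage[OF gc closed_atLeastAtMost closed_atMost]
    by (auto simp: compact_eq_bounded_closed intro: bounded_subset[OF bounded_closed_interval])
  moreover have "a \<in> {a..b} \<inter> g -` {..0}" using ab by (simp add: g_def)
  ultimately obtain s where s: "s \<in> {a..b} \<inter> g -` {..0}" "\<And>t. t \<in> {a..b} \<inter> g -` {..0} \<Longrightarrow> t \<le> s"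
    using compact_attains_sup[of "{a..b} \<inter> g -` {..0}"] by blast
  have "g b > 0" using mb by (simp add: g_def)
  with s have sb: "a \<le> s" "s < b" "g s \<le> 0" by (auto simp: less_le)
  from der[OF sb(1,2)] obtain D h where D: "h > 0" "(\<phi> has_real_derivative D) (at s within {s..<s+h})" "D \<le> - c"
    by blast
  have "(g has_real_derivative (D + m)) (at s within {s..<s+h})"
    unfolding g_def by (rule derivative_eq_intros D refl | simp)+
  moreover have "D + m < 0" using D m by simp
  ultimately obtain d where d: "d > 0" "\<And>k. k > 0 \<Longrightarrow> s + k \<in> {s..<s+h} \<Longrightarrow> k < d \<Longrightarrow> g (s + k) < g s"
    using has_real_derivative_neg_dec_right by blast
  define k where "k = min (min d h) (b - s) / 2"
  have "k > 0" "k < d" "k < h" "s + k \<le> b"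
    using d(1) D(1) sb unfolding k_def min_def by (auto simp: field_simps)
  then have "g (s + k) < g s" using d(2)[of k] by auto
  then have "s + k \<in> {a..b} \<inter> g -` {..0}" using sb \<open>k > 0\<close> \<open>s + k \<le> b\<close> by auto
  from s(2)[OF this] \<open>k > 0\<close> show False by simp
qed

text \<open>After the last time at which \<open>\<phi>\<close> is at most \<open>max (\<phi> a) U\<close> it could only decrease.\<close>

lemma bounded_by_barrier:
  fixes \<phi> :: "real \<Rightarrow> real"
  assumes ab: "a \<le> b" and cont: "continuous_on {a..b} \<phi>" and c: "0 < c"
    and der: "\<And>t. a \<le> t \<Longrightarrow> t < b \<Longrightarrow> \<phi> t > U \<Longrightarrow>
      \<exists>D h. h > 0 \<and> (\<phi> has_real_derivative D) (at t within {t..<t+h}) \<and> D \<le> - c"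
  shows "\<phi> b \<le> max (\<phi> a) U"
proof (rule ccontr)
  define B where "B = max (\<phi> a) U"
  assume "\<not> ?thesis"
  then have "\<phi> b > B" by (simp add: B_def not_le)
  have "compact ({a..b} \<inter> \<phi> -` {..B})"
    using continuous_closed_preimage[OF cont closed_atLeastAtMost closed_atMost]
    by (auto simp: compact_eq_bounded_closed intro: bounded_subset[OF bounded_closed_interval])
  moreover have "a \<in> {a..b} \<inter> \<phi> -` {..B}" using ab by (simp add: B_def)
  ultimately obtain s where s: "s \<in> {a..b} \<inter> \<phi> -` {..B}" "\<And>t. t \<in> {a..b} \<inter> \<phi> -` {..B} \<Longrightarrow> t \<le> s"
    using compact_attains_sup[of "{a..b} \<inter> \<phi> -` {..B}"] by blast
  have sb: "a \<le> s" "s < b" "\<phi> s \<le> B" using s \<open>\<phi> b > B\<close> by (auto simp: less_le)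
  have above: "\<phi> t > B" if "s < t" "t \<le> b" for t
    using s(2)[of t] that sb by force
  have "\<phi> b \<le> \<phi> t" if t: "s < t" "t \<le> b" for t
  proof -
    have "\<phi> b \<le> \<phi> t - c * (b - t)"
    proof (rule decreasing_of_right_derivative)
      fix \<tau> assume "t \<le> \<tau>" "\<tau> < b"
      then show "\<exists>D h. h > 0 \<and> (\<phi> has_real_derivative D) (at \<tau> within {\<tau>..<\<tau>+h}) \<and> D \<le> - c"
        using above[of \<tau>] t sb by (intro der) (auto simp: B_def)
    qed (use t sb in \<open>auto intro: continuous_on_subset[OF cont]\<close>)
    moreover have "0 \<le> c * (b - t)" using c t by simp
    ultimately show ?thesis by simp
  qed
  moreover have "((\<lambda>t. \<phi> t) \<longlongrightarrow> \<phi> s) (at s within {s<..b})"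
  proof (rule tendsto_within_subset)
    show "(\<phi> \<longlongrightarrow> \<phi> s) (at s within {a..b})"
      using cont sb by (auto simp: continuous_on_def)
  qed (use sb in auto)
  moreover have "at s within {s<..b} \<noteq> bot"
    using sb by (simp add: at_within_eq_bot_iff closure_greaterThanAtMost)
  ultimately have "\<phi> b \<le> \<phi> s"
    by (intro tendsto_lowerbound[of \<phi> "\<phi> s" "at s within {s<..b}"]) (auto simp: eventually_at_filter)
  then show False using sb \<open>\<phi> b > B\<close> by simp
qed

text \<open>A nonnegative function cannot decrease at a fixed rate for ever, and below the barrier it
  stays.\<close>

lemma eventually_below_barrier:
  fixes \<phi> :: "real \<Rightarrow> real"
  assumes cont: "continuous_on {0..} \<phi>" and c: "0 < c" and nonneg: "\<And>t. 0 \<le> t \<Longrightarrow> 0 \<le> \<phi> t"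
    and U: "0 \<le> U"
    and der: "\<And>t. 0 \<le> t \<Longrightarrow> \<phi> t > U \<Longrightarrow>
      \<exists>D h. h > 0 \<and> (\<phi> has_real_derivative D) (at t within {t..<t+h}) \<and> D \<le> - c"
  shows "\<exists>t0\<ge>0. \<forall>t\<ge>t0. \<phi> t \<le> U"
proof -
  have "\<exists>t0\<ge>0. \<phi> t0 \<le> U"
  proof (rule ccontr)
    assume no: "\<not> ?thesis"
    define b where "b = \<phi> 0 / c + 1"
    have b: "0 \<le> b" using nonneg[of 0] c by (simp add: b_def)
    have "\<phi> b \<le> \<phi> 0 - c * (b - 0)"
    proof (rule decreasing_of_right_derivative[OF b])
      fix t assume "0 \<le> t" "t < b"
      then show "\<exists>D h. h > 0 \<and> (\<phi> has_real_derivative D) (at t within {t..<t+h}) \<and> D \<le> - c"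
        using no by (intro der) auto
    qed (auto intro: continuous_on_subset[OF cont])
    also have "\<dots> < 0" using c by (simp add: b_def algebra_simps)
    finally show False using nonneg[OF b] by simp
  qed
  then obtain t0 where t0: "0 \<le> t0" "\<phi> t0 \<le> U" by blast
  have "\<phi> t \<le> U" if "t0 \<le> t" for t
  proof -
    have "\<phi> t \<le> max (\<phi> t0) U"
      using t0 that by (intro bounded_by_barrier[OF that _ c] der continuous_on_subset[OF cont]) auto
    then show ?thesis using t0 by simp
  qed
  with t0 show ?thesis by blast
qed

section \<open>Global solutions of event-triggered differential equations\<close>

lemma indefinite_integral_right:
  fixes h :: "real \<Rightarrow> 'a::banach"
  assumes h: "continuous_on {t0..} h" and t: "t0 \<le> t"
  shows "((\<lambda>u. integral {t0..u} h) has_vector_derivative h t) (at t within {t0..})"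
proof -
  have "((\<lambda>u. integral {t0..u} h) has_vector_derivative h t) (at t within {t0..t + 1})"
    using t by (intro integral_has_vector_derivative continuous_on_subset[OF h]) auto
  moreover have "at t within {t0..t + 1} = at t within {t0..}"
    by (rule at_within_nhd[of t "{..<t + 1}"]) auto
  ultimately show ?thesis by simp
qed

text \<open>With the weight \<open>exp (2 L (t - t\<^sub>0))\<close> the Picard operator is a contraction with factor
  \<open>1/2\<close> on all bounded continuous functions at once, which yields the solution on the whole
  half-line in a single step.\<close>

lemma global_picard:
  fixes F :: "real \<Rightarrow> 'a::banach \<Rightarrow> 'a"
  assumes L: "0 < L" and cont: "continuous_on ({t0..} \<times> UNIV) (\<lambda>(t, x). F t x)"
    and bd: "\<And>t x. t0 \<le> t \<Longrightarrow> norm (F t x) \<le> C"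
    and lip: "\<And>t x y. t0 \<le> t \<Longrightarrow> norm (F t x - F t y) \<le> L * norm (x - y)"
  obtains X where "X t0 = x0"
    "\<And>t. t0 \<le> t \<Longrightarrow> (X has_vector_derivative F t (X t)) (at t within {t0..})"
proof -
  define w where "w t = exp (2 * L * (t - t0))" for t
  define curve where "curve y t = x0 + w t *\<^sub>R apply_bcontfun y t" for y :: "real \<Rightarrow>\<^sub>C 'a" and t
  have curve_cont: "continuous_on {t0..} (\<lambda>s. F s (curve y s))" for y
  proof -
    have "continuous_on {t0..} (\<lambda>s. (s, curve y s))"
      unfolding curve_def w_def by (intro continuous_intros continuous_on_apply_bcontfun)
    from continuous_on_compose2[OF cont this] show ?thesis by auto
  qed
  define P where "P y t = integral {t0..max t t0} (\<lambda>s. F s (curve y s))" for y t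
  define T where "T y t = inverse (w (max t t0)) *\<^sub>R P y t" for y t
  have P_cont: "continuous_on UNIV (P y)" for y
  proof -
    have "continuous_on {t0..} (\<lambda>u. integral {t0..u} (\<lambda>s. F s (curve y s)))"
      using indefinite_integral_right[OF curve_cont]
      by (auto simp: continuous_on_eq_continuous_within intro: has_vector_derivative_continuous)
    then show ?thesis unfolding P_def
      by (rule continuous_on_compose2[of _ _ _ "\<lambda>t. max t t0"]) (auto intro!: continuous_intros)
  qed
  have C0: "0 \<le> C" using bd[of t0 x0] norm_ge_zero order_trans by blast
  have integrable: "(\<lambda>s. F s (curve y s)) integrable_on {t0..b}" for y b
    by (rule integrable_continuous_real) (auto intro: continuous_on_subset[OF curve_cont])
  have T_mem: "T y \<in> bcontfun" for y
  proof (rule bcontfun_normI)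
    show "continuous_on UNIV (T y)"
      unfolding T_def w_def by (intro continuous_intros P_cont) auto
    fix t
    define b where "b = max t t0"
    have b: "t0 \<le> b" by (simp add: b_def)
    have "norm (P y t) \<le> integral {t0..b} (\<lambda>s. C)"
      unfolding P_def b_def[symmetric]
      by (rule integral_norm_bound_integral[OF integrable]) (auto intro: bd)
    also have "\<dots> = C * (b - t0)" using b by simp
    finally have "norm (T y t) \<le> inverse (w b) * (C * (b - t0))"
      unfolding T_def b_def[symmetric] by (simp add: w_def)
    also have "\<dots> \<le> C / (2 * L)"
    proof -
      have "2 * L * (b - t0) \<le> w b" unfolding w_def using exp_ge_add_one_self[of "2 * L * (b - t0)"] by linarith
      then have "C * (2 * L * (b - t0)) \<le> C * w b" using C0 by (rule mult_left_mono)
      moreover have "w b > 0" by (simp add: w_def)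
      ultimately show ?thesis using L by (simp add: field_simps)
    qed
    finally show "norm (T y t) \<le> C / (2 * L)" .
  qed
  have contr: "dist (Bcontfun (T y1)) (Bcontfun (T y2)) \<le> 1/2 * dist y1 y2" for y1 y2
  proof (rule dist_bound)
    fix t
    define b where "b = max t t0"
    have b: "t0 \<le> b" by (simp add: b_def)
    define D where "D = dist y1 y2"
    have exp_int: "((\<lambda>s. L * w s * D) has_integral (w b * D / 2 - w t0 * D / 2)) {t0..b}"
    proof (rule fundamental_theorem_of_calculus[OF b])
      fix s
      have "((\<lambda>u. w u * D / 2) has_real_derivative (L * w s * D)) (at s within {t0..b})"
        unfolding w_def by (rule derivative_eq_intros refl | simp)+
      then show "((\<lambda>u. w u * D / 2) has_vector_derivative (L * w s * D)) (at s within {t0..b})"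
        by (simp add: has_real_derivative_iff_has_vector_derivative)
    qed
    have "norm (P y1 t - P y2 t)
        = norm (integral {t0..b} (\<lambda>s. F s (curve y1 s) - F s (curve y2 s)))"
      unfolding P_def b_def[symmetric] by (subst integral_diff[OF integrable integrable]) simp
    also have "\<dots> \<le> integral {t0..b} (\<lambda>s. L * w s * D)"
    proof (rule integral_norm_bound_integral)
      fix s assume s: "s \<in> {t0..b}"
      have "norm (F s (curve y1 s) - F s (curve y2 s)) \<le> L * norm (curve y1 s - curve y2 s)"
        using s by (intro lip) auto
      also have "norm (curve y1 s - curve y2 s) = w s * dist (apply_bcontfun y1 s) (apply_bcontfun y2 s)"
        by (simp add: curve_def w_def dist_norm scaleR_diff_right[symmetric])
      also have "\<dots> \<le> w s * D" unfolding D_def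
        by (intro mult_left_mono dist_bounded) (simp add: w_def)
      finally show "norm (F s (curve y1 s) - F s (curve y2 s)) \<le> L * w s * D" using L by (simp add: mult.assoc)
    qed (use exp_int in \<open>auto intro: integrable_diff integrable\<close>)
    also have "\<dots> = w b * D / 2 - w t0 * D / 2" by (rule integral_unique[OF exp_int])
    also have "\<dots> \<le> w b * D / 2" by (simp add: w_def D_def)
    finally have "norm (P y1 t - P y2 t) \<le> w b * (D / 2)" by simp
    then have "inverse (w b) * norm (P y1 t - P y2 t) \<le> D / 2"
      by (simp add: w_def field_simps)
    moreover have "dist (T y1 t) (T y2 t) = inverse (w b) * norm (P y1 t - P y2 t)"
      unfolding T_def b_def[symmetric] dist_norm by (simp add: w_def scaleR_diff_right[symmetric])
    ultimately show "dist (apply_bcontfun (Bcontfun (T y1)) t) (apply_bcontfun (Bcontfun (T y2)) t) \<le> 1/2 * dist y1 y2"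
      by (simp add: Bcontfun_inverse[OF T_mem] D_def)
  qed
  obtain y where y: "Bcontfun (T y) = y"
    using banach_fix_type[of "1/2" "\<lambda>y. Bcontfun (T y)"] contr by auto
  have yT: "apply_bcontfun y t = T y t" for t by (metis y Bcontfun_inverse[OF T_mem])
  have curve_eq: "curve y t = x0 + integral {t0..t} (\<lambda>s. F s (curve y s))" if "t0 \<le> t" for t
    using that by (subst curve_def) (simp add: yT T_def P_def w_def max_absorb1)
  show thesis
  proof (rule that[of "curve y"])
    show "curve y t0 = x0" by (subst curve_eq) auto
    fix t assume t: "t0 \<le> t"
    have "((\<lambda>u. x0 + integral {t0..u} (\<lambda>s. F s (curve y s))) has_vector_derivative
        F t (curve y t)) (at t within {t0..})"
      using indefinite_integral_right[OF curve_cont t] by (auto intro!: derivative_eq_intros)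
    then show "(curve y has_vector_derivative F t (curve y t)) (at t within {t0..})"
      by (rule has_vector_derivative_transform[rotated 2]) (use t curve_eq in auto)
  qed
qed

lemma norm_le_speed:
  fixes X :: "real \<Rightarrow> 'a::real_normed_vector"
  assumes "\<And>s. t0 \<le> s \<Longrightarrow> (X has_vector_derivative X' s) (at s within {t0..})"
    and "\<And>s. t0 \<le> s \<Longrightarrow> norm (X' s) \<le> C" and "t0 \<le> t"
  shows "norm (X t - X t0) \<le> C * (t - t0)"
proof -
  have "norm (X t - X t0) \<le> C * norm (t - t0)"
    using assms
    by (intro differentiable_bound[of "{t0..}" X "\<lambda>s h. h *\<^sub>R X' s"])
      (auto simp: has_vector_derivative_def onorm_scaleR_left onorm_id onorm_scaleR_left_lemma)
  then show ?thesis using assms(3) by simp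
qed

lemma Inf_first_time:
  assumes "P tm" "a < ereal tm" "\<And>t. a < ereal t \<Longrightarrow> t < tm \<Longrightarrow> \<not> P t"
  shows "Inf {ereal t |t. a < ereal t \<and> P t} = ereal tm"
  using assms by (intro antisym Inf_lower Inf_greatest) (auto simp: not_less[symmetric])

lemma first_time_dichotomy:
  fixes g :: "real \<Rightarrow> real"
  assumes cont: "continuous_on {a..} g" and h: "0 < h"
    and dwell: "\<And>t. a \<le> t \<Longrightarrow> t \<le> a + h \<Longrightarrow> g t < c"
  shows "(\<forall>t\<ge>a. g t < c) \<or> (\<exists>tm\<ge>a + h. g tm \<ge> c \<and> (\<forall>t. a \<le> t \<longrightarrow> t < tm \<longrightarrow> g t < c))"
proof (cases "\<forall>t\<ge>a. g t < c")
  case False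
  then obtain t1 where t1: "t1 \<ge> a" "g t1 \<ge> c" by (auto simp: not_less)
  define A where "A = {a..t1} \<inter> g -` {c..}"
  have "closed A" unfolding A_def
    by (rule continuous_closed_preimage[OF continuous_on_subset[OF cont]]) auto
  then have "compact A"
    by (auto simp: compact_eq_bounded_closed A_def intro: bounded_subset[OF bounded_closed_interval])
  moreover have "t1 \<in> A" using t1 by (simp add: A_def)
  ultimately obtain tm where tm: "tm \<in> A" "\<And>t. t \<in> A \<Longrightarrow> tm \<le> t"
    using compact_attains_inf[of A] by blast
  have "g t < c" if "a \<le> t" "t < tm" for t
    using tm that by (force simp: A_def not_le[symmetric])
  moreover have "a + h \<le> tm" using dwell[of tm] tm(1) by (force simp: A_def)
  ultimately show ?thesis using tm(1) by (auto simp: A_def)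
qed simp

lemma continuous_on_halfline:
  assumes "\<And>b. 0 \<le> b \<Longrightarrow> continuous_on {0..b::real} X"
  shows "continuous_on {0..} X"
  unfolding continuous_on_eq_continuous_within
proof
  fix t :: real assume t: "t \<in> {0..}"
  have "continuous (at t within {0..t + 1}) X"
    using assms[of "t + 1"] t by (auto simp: continuous_on_eq_continuous_within)
  moreover have "at t within {0..t + 1} = at t within {0..}"
    by (rule at_within_nhd[of t "{..<t + 1}"]) auto
  ultimately show "continuous (at t within {0..}) X" by simp
qed

text \<open>Each stage continues the curve from the next triggering time on by the solution with the
  values held there. The dwell time \<open>h\<close> leaves only finitely many triggering times before any
  given time, so that the stages are eventually constant on bounded intervals; a stage whose
  next triggering time is infinite is not changed any more.\<close>

lemma event_triggered_solution:
  fixes F :: "'a::banach \<Rightarrow> real \<Rightarrow> real \<Rightarrow> 'a \<Rightarrow> 'a" and Th :: "'a \<Rightarrow> real \<Rightarrow> real \<Rightarrow> 'a \<Rightarrow> real"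
  assumes L: "0 < L"
    and F_cont: "\<And>xh th. 0 \<le> th \<Longrightarrow> continuous_on ({0..} \<times> UNIV) (\<lambda>(t, x). F xh th t x)"
    and F_bd: "\<And>xh th t x. 0 \<le> th \<Longrightarrow> 0 \<le> t \<Longrightarrow> norm (F xh th t x) \<le> C"
    and F_lip: "\<And>xh th t x y. 0 \<le> th \<Longrightarrow> 0 \<le> t \<Longrightarrow> norm (F xh th t x - F xh th t y) \<le> L * norm (x - y)"
    and Th_cont: "\<And>xh th. 0 \<le> th \<Longrightarrow> continuous_on ({0..} \<times> UNIV) (\<lambda>(t, x). Th xh th t x)"
    and h: "0 < h"
    and dwell: "\<And>xh th t x. 0 \<le> th \<Longrightarrow> th \<le> t \<Longrightarrow> t \<le> th + h \<Longrightarrow> norm (x - xh) \<le> C * (t - th) \<Longrightarrow>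
      Th xh th t x < c"
  obtains X and tk :: "nat \<Rightarrow> ereal" where "X 0 = x0" "continuous_on {0..} X" "tk 0 = 0"
    "\<And>k. tk (Suc k) = Inf {ereal t |t. tk k < ereal t \<and>
        c \<le> Th (X (real_of_ereal (tk k))) (real_of_ereal (tk k)) t (X t)}"
    "\<And>t. 0 \<le> t \<Longrightarrow> \<exists>k. tk k \<le> ereal t \<and> ereal t < tk (Suc k)"
    "\<And>k t. tk k \<le> ereal t \<Longrightarrow> ereal t < tk (Suc k) \<Longrightarrow>
       (X has_vector_derivative F (X (real_of_ereal (tk k))) (real_of_ereal (tk k)) t (X t))
       (at t within {t. tk k \<le> ereal t \<and> ereal t < tk (Suc k)})"
proof -
  have "\<exists>Y. 0 \<le> th \<longrightarrow> Y th = xh \<and>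
      (\<forall>t\<ge>th. (Y has_vector_derivative F xh th t (Y t)) (at t within {th..}))" for xh th
  proof (cases "0 \<le> th")
    case True
    have "continuous_on ({th..} \<times> UNIV) (\<lambda>(t, x). F xh th t x)"
      by (rule continuous_on_subset[OF F_cont[OF True]]) (use True in auto)
    then obtain Y where "Y th = xh"
      "\<And>t. th \<le> t \<Longrightarrow> (Y has_vector_derivative F xh th t (Y t)) (at t within {th..})"
    proof (rule global_picard[OF L, where ?x0.0 = xh and C = C])
      show "norm (F xh th t x) \<le> C" if "th \<le> t" for t x using that True by (intro F_bd) auto
      show "norm (F xh th t x - F xh th t y) \<le> L * norm (x - y)" if "th \<le> t" for t x y
        using that True by (intro F_lip) auto
    qed blast
    then show ?thesis by blast
  qed simp
  note ex = this
  \<comment> \<open>The solution with the value \<open>xh\<close> held since the time \<open>th\<close>; arbitrary for negative \<open>th\<close>.\<close>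
  define sol where "sol xh th = (SOME Y. 0 \<le> th \<longrightarrow> Y th = xh \<and>
      (\<forall>t\<ge>th. (Y has_vector_derivative F xh th t (Y t)) (at t within {th..})))" for xh th
  have sol: "sol xh th th = xh"
    "\<And>t. th \<le> t \<Longrightarrow> (sol xh th has_vector_derivative F xh th t (sol xh th t)) (at t within {th..})"
    if "0 \<le> th" for xh th
    using someI_ex[OF ex[of th xh]] that unfolding sol_def by blast+
  have sol_cont: "continuous_on {th..} (sol xh th)" if "0 \<le> th" for xh th
    unfolding continuous_on_eq_continuous_within
    using has_vector_derivative_continuous[OF sol(2)[OF that]] by blast
  have sol_speed: "norm (sol xh th t - xh) \<le> C * (t - th)" if "0 \<le> th" "th \<le> t" for xh th t
    using norm_le_speed[of th "sol xh th" "\<lambda>s. F xh th s (sol xh th s)" C t] sol that F_bd by auto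
  define next_time where "next_time \<tau> \<phi> = Inf {ereal t |t. \<tau> < ereal t \<and>
      c \<le> Th (\<phi> (real_of_ereal \<tau>)) (real_of_ereal \<tau>) t (\<phi> t)}" for \<tau> :: ereal and \<phi> :: "real \<Rightarrow> 'a"
  define next_curve where "next_curve \<tau>' \<phi> = (if \<tau>' = \<infinity> then \<phi> else (\<lambda>t. if t \<le> real_of_ereal \<tau>' then \<phi> t
      else sol (\<phi> (real_of_ereal \<tau>')) (real_of_ereal \<tau>') t))" for \<tau>' :: ereal and \<phi> :: "real \<Rightarrow> 'a"
  define stage where "stage = rec_nat (0::ereal, sol x0 0)
      (\<lambda>_ (\<tau>, \<phi>). (next_time \<tau> \<phi>, next_curve (next_time \<tau> \<phi>) \<phi>))"
  define tk where "tk k = fst (stage k)" for k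
  define \<phi> where "\<phi> k = snd (stage k)" for k
  have tk0: "tk 0 = 0" and \<phi>0: "\<phi> 0 = sol x0 0" by (simp_all add: tk_def \<phi>_def stage_def)
  have tkS: "tk (Suc k) = next_time (tk k) (\<phi> k)" and \<phi>S: "\<phi> (Suc k) = next_curve (tk (Suc k)) (\<phi> k)" for k
    by (simp_all add: tk_def \<phi>_def stage_def case_prod_beta)
  let ?th = "\<lambda>k. real_of_ereal (tk k)"
  let ?g = "\<lambda>k t. Th (\<phi> k (?th k)) (?th k) t (\<phi> k t)"
  \<comment> \<open>Invariant of a stage: its curve is continuous and, from the last triggering time on, is the
     solution with the values held at that time.\<close>
  define inv where "inv k \<longleftrightarrow> 0 \<le> tk k \<and> continuous_on {0..} (\<phi> k) \<and>
      (tk k \<noteq> \<infinity> \<longrightarrow> (\<forall>t\<ge>?th k. \<phi> k t = sol (\<phi> k (?th k)) (?th k) t))" for k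
  have inv_pos: "0 \<le> tk k" and inv_cont: "continuous_on {0..} (\<phi> k)" if "inv k" for k
    using that unfolding inv_def by blast+
  have advance: "(tk (Suc k) = \<infinity> \<and> (tk k \<noteq> \<infinity> \<longrightarrow> (\<forall>t\<ge>?th k. ?g k t < c))) \<or>
      (\<exists>tm. tk k \<noteq> \<infinity> \<and> tk (Suc k) = ereal tm \<and> ?th k + h \<le> tm \<and> c \<le> ?g k tm \<and>
        (\<forall>t. ?th k \<le> t \<longrightarrow> t < tm \<longrightarrow> ?g k t < c))" if "inv k" for k
  proof (cases "tk k = \<infinity>")
    case True
    then show ?thesis by (simp add: tkS next_time_def top_ereal_def)
  next
    case False
    then have tk: "tk k = ereal (?th k)" and th: "0 \<le> ?th k"
      using inv_pos[OF that] by (auto simp: ereal_real real_of_ereal_pos)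
    have eq: "\<phi> k t = sol (\<phi> k (?th k)) (?th k) t" if "?th k \<le> t" for t
      using \<open>inv k\<close> False that unfolding inv_def by blast
    have c1: "continuous_on {?th k..} (?g k)"
    proof -
      have "continuous_on {?th k..} (\<lambda>t. (t, \<phi> k t))"
        using th by (intro continuous_intros continuous_on_subset[OF inv_cont[OF \<open>inv k\<close>]]) auto
      moreover have "(\<lambda>t. (t, \<phi> k t)) ` {?th k..} \<subseteq> {0..} \<times> UNIV" using th by auto
      ultimately show ?thesis
        using continuous_on_compose2[OF Th_cont[OF th, of "\<phi> k (?th k)"]] by force
    qed
    have tk_less: "tk k < ereal t \<longleftrightarrow> ?th k < t" for t by (metis tk less_ereal.simps(1))
    have dw: "?g k t < c" if "?th k \<le> t" "t \<le> ?th k + h" for t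
      using sol_speed[OF th that(1), of "\<phi> k (?th k)"] eq[OF that(1)]
      by (intro dwell[OF th that]) simp
    have "(\<forall>t\<ge>?th k. ?g k t < c) \<or> (\<exists>tm\<ge>?th k + h. c \<le> ?g k tm \<and>
        (\<forall>t. ?th k \<le> t \<longrightarrow> t < tm \<longrightarrow> ?g k t < c))"
      by (rule first_time_dichotomy[OF c1 h]) (rule dw)
    then show ?thesis
    proof (elim disjE exE conjE)
      assume none: "\<forall>t\<ge>?th k. ?g k t < c"
      then have "{ereal t |t. tk k < ereal t \<and> c \<le> ?g k t} = {}"
        unfolding tk_less by (smt (verit) Collect_empty_eq)
      then have "tk (Suc k) = \<infinity>" unfolding tkS next_time_def by (simp only: Inf_empty top_ereal_def)
      with none show ?thesis by blast
    next
      fix tm assume tm: "?th k + h \<le> tm" "c \<le> ?g k tm" "\<forall>t. ?th k \<le> t \<longrightarrow> t < tm \<longrightarrow> ?g k t < c"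
      have "tk (Suc k) = ereal tm"
        unfolding tkS next_time_def
      proof (rule Inf_first_time)
        show "tk k < ereal tm" using tm h by (simp add: tk_less)
        fix t assume "tk k < ereal t" "t < tm"
        then have "?th k \<le> t" by (simp add: tk_less)
        with tm(3) \<open>t < tm\<close> show "\<not> c \<le> ?g k t" by (simp add: not_le)
      qed (rule tm)
      with tm False show ?thesis by blast
    qed
  qed
  have ext: "\<phi> (Suc k) t = \<phi> k t" if i: "inv k" and le: "ereal t \<le> tk (Suc k)" for k t
  proof (cases "tk (Suc k) = \<infinity>")
    case False
    then obtain tm where "tk (Suc k) = ereal tm" using advance[OF i] by blast
    then show ?thesis using le by (simp add: \<phi>S next_curve_def)
  qed (simp add: \<phi>S next_curve_def)
  have inv: "inv k" for k
  proof (induction k)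
    case 0
    show ?case using sol(1)[of 0 x0] sol_cont[of 0 x0] by (simp add: inv_def tk0 \<phi>0)
  next
    case (Suc k)
    show ?case
    proof (cases "tk (Suc k) = \<infinity>")
      case True
      then show ?thesis using Suc by (simp add: inv_def \<phi>S next_curve_def)
    next
      case False
      then obtain tm where tm: "tk (Suc k) = ereal tm" "?th k + h \<le> tm" using advance[OF Suc] by blast
      have "0 \<le> ?th k" using inv_pos[OF Suc] by (simp add: real_of_ereal_pos)
      then have tm0: "0 \<le> tm" using tm h by simp
      have \<phi>S': "\<phi> (Suc k) = (\<lambda>t. if t \<le> tm then \<phi> k t else sol (\<phi> k tm) tm t)"
        by (auto simp: \<phi>S next_curve_def tm fun_eq_iff)
      have "continuous_on ({0..tm} \<union> {tm..}) (\<phi> (Suc k))"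
        unfolding \<phi>S'
      proof (rule continuous_on_cases)
        show "continuous_on {0..tm} (\<phi> k)" by (rule continuous_on_subset[OF inv_cont[OF Suc]]) auto
        show "continuous_on {tm..} (sol (\<phi> k tm) tm)" by (rule sol_cont[OF tm0])
        show "\<forall>x. x \<in> {0..tm} \<and> \<not> x \<le> tm \<or> x \<in> {tm..} \<and> x \<le> tm \<longrightarrow> \<phi> k x = sol (\<phi> k tm) tm x"
          using sol(1)[OF tm0] by auto
      qed auto
      moreover have "{0..tm} \<union> {tm..} = {0..}" using tm0 by auto
      ultimately have "continuous_on {0..} (\<phi> (Suc k))" by simp
      moreover have "\<forall>t\<ge>tm. \<phi> (Suc k) t = sol (\<phi> (Suc k) tm) tm t"
      proof (intro allI impI)
        fix t assume t: "tm \<le> t"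
        show "\<phi> (Suc k) t = sol (\<phi> (Suc k) tm) tm t"
          unfolding \<phi>S' using t sol(1)[OF tm0, of "\<phi> k tm"] by (cases "t = tm") auto
      qed
      moreover have "0 \<le> ereal tm" using tm0 by simp
      ultimately show ?thesis unfolding inv_def tm(1) real_of_ereal.simps by blast
    qed
  qed
  have th_pos: "0 \<le> ?th k" for k using inv_pos[OF inv] by (simp add: real_of_ereal_pos)
  have tk_real: "tk k = ereal (?th k)" if "tk k \<noteq> \<infinity>" for k
    using inv_pos[OF inv, of k] that by (auto simp: ereal_real)
  have tk_mono: "tk k \<le> tk (Suc k)" for k
  proof (cases "tk (Suc k) = \<infinity>")
    case False
    then obtain tm where tm: "tk k \<noteq> \<infinity>" "tk (Suc k) = ereal tm" "?th k + h \<le> tm"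
      using advance[OF inv, of k] by blast
    have "ereal (?th k) \<le> ereal tm" using tm(3) h by simp
    then show ?thesis unfolding tm(2) using tk_real[OF tm(1)] by simp
  qed simp
  have incr: "incseq tk" by (rule incseq_SucI) (rule tk_mono)
  have growth: "ereal (real k * h) \<le> tk k" for k
  proof (induction k)
    case (Suc k)
    show ?case
    proof (cases "tk (Suc k) = \<infinity>")
      case False
      then obtain tm where tm: "tk k \<noteq> \<infinity>" "tk (Suc k) = ereal tm" "?th k + h \<le> tm" using advance[OF inv, of k] by blast
      have "real k * h \<le> ?th k" using Suc tk_real[OF tm(1)] by (metis ereal_less_eq(3))
      then show ?thesis using tm by (simp add: algebra_simps)
    qed simp
  qed (simp add: tk0)
  have reach: "\<exists>k. ereal t < tk (Suc k)" for t
  proof -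
    obtain n where "t < real n * h" using reals_Archimedean3[OF h] by blast
    then have "ereal t < tk n" using growth[of n] by (meson less_ereal.simps(1) less_le_trans)
    then show ?thesis using tk_mono[of n] less_le_trans by blast
  qed
  have agree: "\<phi> j t = \<phi> k t" if "k \<le> j" "ereal t \<le> tk (Suc k)" for j k t
    using that(1)
  proof (induction j rule: dec_induct)
    case (step j)
    have "ereal t \<le> tk (Suc j)" using that(2) incseqD[OF incr, of "Suc k" "Suc j"] step by (meson Suc_le_mono order_trans)
    then show ?case using ext[OF inv] step by simp
  qed simp
  define X where "X t = \<phi> (LEAST k. ereal t < tk (Suc k)) t" for t
  have X_eq: "X t = \<phi> k t" if "ereal t \<le> tk (Suc k)" for k t
  proof -
    \<comment> \<open>Later stages agree with the one that defines \<open>X t\<close>, up to and including the triggering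
       time.\<close>
    define k0 where "k0 = (LEAST k. ereal t < tk (Suc k))"
    have k0: "ereal t < tk (Suc k0)" unfolding k0_def using reach[of t] by (rule LeastI_ex)
    show ?thesis
    proof (cases "k0 \<le> k")
      case True
      then show ?thesis unfolding X_def k0_def[symmetric] using agree[of k0 k t] k0 by (simp add: less_imp_le)
    next
      case False
      then show ?thesis unfolding X_def k0_def[symmetric] using agree[of k k0 t] that by simp
    qed
  qed
  have th_le: "ereal (?th k) \<le> tk (Suc k)" if "tk k \<noteq> \<infinity>" for k
    using tk_mono[of k] tk_real[OF that] by simp
  show thesis
  proof (rule that[of X tk])
    show "tk 0 = 0" by (rule tk0)
    show "X 0 = x0" using X_eq[of 0 0] sol(1)[of 0 x0] tk_mono[of 0] by (simp add: tk0 \<phi>0 zero_ereal_def)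
    show "continuous_on {0..} X"
    proof (rule continuous_on_halfline)
      fix b :: real assume "0 \<le> b"
      obtain k where k: "ereal b < tk (Suc k)" using reach by blast
      have "continuous_on {0..b} (\<phi> k)" by (rule continuous_on_subset[OF inv_cont[OF inv]]) auto
      moreover have "X t = \<phi> k t" if "t \<in> {0..b}" for t
        using that k by (intro X_eq) (meson atLeastAtMost_iff ereal_less_eq(3) less_imp_le order_trans)
      ultimately show "continuous_on {0..b} X" by (metis (no_types, lifting) continuous_on_cong)
    qed
    show "\<exists>k. tk k \<le> ereal t \<and> ereal t < tk (Suc k)" if "0 \<le> t" for t
    proof -
      define k0 where "k0 = (LEAST k. ereal t < tk (Suc k))"
      have k0: "ereal t < tk (Suc k0)" unfolding k0_def using reach[of t] by (rule LeastI_ex)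
      have "tk k0 \<le> ereal t"
      proof (cases k0)
        case 0 then show ?thesis using that by (simp add: tk0 zero_ereal_def)
      next
        case (Suc j)
        then show ?thesis using not_less_Least[of j "\<lambda>k. ereal t < tk (Suc k)"] by (simp add: k0_def not_less)
      qed
      with k0 show ?thesis by blast
    qed
    fix k
    show "tk (Suc k) = Inf {ereal t |t. tk k < ereal t \<and> c \<le> Th (X (?th k)) (?th k) t (X t)}"
    proof (cases "tk k = \<infinity>")
      case True
      then show ?thesis using tk_mono[of k] by (simp add: top_ereal_def)
    next
      case False
      have Xth: "X (?th k) = \<phi> k (?th k)" by (rule X_eq[OF th_le[OF False]])
      from advance[OF inv, of k] show ?thesis
      proof (elim disjE exE conjE)
        assume inf: "tk (Suc k) = \<infinity>" and "tk k \<noteq> \<infinity> \<longrightarrow> (\<forall>t\<ge>?th k. ?g k t < c)"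
        then have none: "?g k t < c" if "?th k \<le> t" for t using False that by blast
        have "{ereal t |t. tk k < ereal t \<and> c \<le> Th (X (?th k)) (?th k) t (X t)} = {}"
        proof -
          have "\<not> c \<le> Th (X (?th k)) (?th k) t (X t)" if "tk k < ereal t" for t
          proof -
            have "?th k \<le> t" using that tk_real[OF False] by (metis less_ereal.simps(1) less_imp_le)
            then show ?thesis using none[of t] X_eq[of t k] inf Xth by (simp add: not_le)
          qed
          then show ?thesis by blast
        qed
        then show ?thesis using inf by (simp only: Inf_empty top_ereal_def)
      next
        fix tm assume tm: "tk (Suc k) = ereal tm" "?th k + h \<le> tm" "c \<le> ?g k tm"
          "\<forall>t. ?th k \<le> t \<longrightarrow> t < tm \<longrightarrow> ?g k t < c"
        have "Inf {ereal t |t. tk k < ereal t \<and> c \<le> Th (X (?th k)) (?th k) t (X t)} = ereal tm"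
        proof (rule Inf_first_time)
          show "c \<le> Th (X (?th k)) (?th k) tm (X tm)" using tm X_eq[of tm k] Xth by simp
          show "tk k < ereal tm" using tk_real[OF False] tm(2) h by (metis less_ereal.simps(1) less_add_same_cancel1 less_le_trans)
          fix t assume t: "tk k < ereal t" "t < tm"
          have "?th k \<le> t" using t(1) tk_real[OF False] by (metis less_ereal.simps(1) less_imp_le)
          then show "\<not> c \<le> Th (X (?th k)) (?th k) t (X t)"
            using tm(4) t(2) X_eq[of t k] Xth tm(1) by (simp add: not_le)
        qed
        with tm show ?thesis by simp
      qed
    qed
    fix t assume t: "tk k \<le> ereal t" "ereal t < tk (Suc k)"
    then have fin: "tk k \<noteq> \<infinity>" by auto
    let ?I = "{t. tk k \<le> ereal t \<and> ereal t < tk (Suc k)}"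
    have sub: "?I \<subseteq> {?th k..}" using tk_real[OF fin] by (metis (no_types, lifting) atLeast_iff ereal_less_eq(3) mem_Collect_eq subsetI)
    have XI: "X s = sol (X (?th k)) (?th k) s" if "s \<in> ?I" for s
    proof -
      have "X s = \<phi> k s" using that by (intro X_eq) auto
      also have "\<dots> = sol (\<phi> k (?th k)) (?th k) s" using inv[of k] fin sub that unfolding inv_def by blast
      finally show ?thesis using X_eq[OF th_le[OF fin]] by simp
    qed
    have tI: "t \<in> ?I" using t by simp
    have "(sol (X (?th k)) (?th k) has_vector_derivative F (X (?th k)) (?th k) t (sol (X (?th k)) (?th k) t)) (at t within ?I)"
      by (rule has_vector_derivative_within_subset[OF sol(2)[OF th_pos]]) (use sub tI in auto)
    then show "(X has_vector_derivative F (X (?th k)) (?th k) t (X t)) (at t within ?I)"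
      unfolding XI[OF tI] by (rule has_vector_derivative_transform[rotated 2]) (use tI XI in auto)
  qed
qed

section \<open>The immersion of the steady-state input\<close>

lemma sum_pos: "(\<Sum>j\<in>UNIV. F (pos (j::'n::{finite,linorder}))) = (\<Sum>k=1..CARD('n). F k)"
  by (rule sum.reindex_bij_betw[OF bij_betw_pos])

lemma pos_ge_1: "1 \<le> pos (i::'n::{finite,linorder})" and pos_le_card: "pos i \<le> CARD('n)"
  using bij_betwE[OF bij_betw_pos[where 'n='n]] by auto

lemma pos_eq_iff: "1 \<le> k \<Longrightarrow> k \<le> CARD('n) \<Longrightarrow> pos (i::'n::{finite,linorder}) = k \<longleftrightarrow> i = ix k"
  by (metis ix_pos pos_ix)

lemma has_vector_derivative_vecI:
  fixes x :: "real \<Rightarrow> real^'n"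
  assumes "\<And>i. ((\<lambda>t. x t $ i) has_vector_derivative D $ i) (at t within A)"
  shows "(x has_vector_derivative D) (at t within A)"
proof -
  have "((\<lambda>t. x t \<bullet> b) has_derivative (\<lambda>h. h *\<^sub>R D \<bullet> b)) (at t within A)" if "b \<in> Basis" for b
    using that assms by (auto simp: Basis_vec_def inner_axis has_vector_derivative_def)
  then show ?thesis
    unfolding has_vector_derivative_def by (subst has_derivative_componentwise_within) blast
qed

text \<open>Polynomial expressions in the components of a trajectory. Along an exosystem trajectory
  they are closed under differentiation, so all the iterated derivatives exist and, where the
  trajectory is bounded, they are bounded.\<close>

inductive trajectory_poly :: "(real \<Rightarrow> real^'n) \<Rightarrow> (real \<Rightarrow> real) \<Rightarrow> bool" for v where
  const: "trajectory_poly v (\<lambda>t. c)"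
| comp: "trajectory_poly v (\<lambda>t. v t $ i)"
| add: "trajectory_poly v h \<Longrightarrow> trajectory_poly v k \<Longrightarrow> trajectory_poly v (\<lambda>t. h t + k t)"
| mult: "trajectory_poly v h \<Longrightarrow> trajectory_poly v k \<Longrightarrow> trajectory_poly v (\<lambda>t. h t * k t)"

lemma trajectory_poly_sum:
  "(\<And>a. a \<in> A \<Longrightarrow> trajectory_poly v (h a)) \<Longrightarrow> trajectory_poly v (\<lambda>t. \<Sum>a\<in>A. h a t)"
  by (induction A rule: infinite_finite_induct) (auto intro: trajectory_poly.intros)

lemma trajectory_poly_prod:
  "(\<And>a. a \<in> A \<Longrightarrow> trajectory_poly v (h a)) \<Longrightarrow> trajectory_poly v (\<lambda>t. \<Prod>a\<in>A. h a t)"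
  by (induction A rule: infinite_finite_induct) (auto intro: trajectory_poly.intros)

lemma trajectory_poly_power: "trajectory_poly v h \<Longrightarrow> trajectory_poly v (\<lambda>t. h t ^ k)"
  by (induction k) (auto intro: trajectory_poly.intros)

lemma trajectory_poly_polynomial:
  assumes "polynomial_in_fst p" shows "trajectory_poly v (\<lambda>t. p (v t) w)"
proof -
  obtain d and c :: "('a \<Rightarrow> nat) \<Rightarrow> 'b \<Rightarrow> real" where
    "\<And>v w. p v w = (\<Sum>a\<in>{a. sum a UNIV \<le> d}. c a w * (\<Prod>i\<in>UNIV. (v $ i) ^ a i))"
    using assms unfolding polynomial_in_fst_def by blast
  then show ?thesis
    by (auto intro!: trajectory_poly_sum trajectory_poly.mult trajectory_poly_prod
        trajectory_poly_power trajectory_poly.const trajectory_poly.comp)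
qed

lemma trajectory_poly_deriv:
  assumes v: "exo_trajectory S v" and h: "trajectory_poly v h"
  shows "trajectory_poly v (deriv h) \<and> (\<forall>t. (h has_real_derivative deriv h t) (at t))"
proof -
  have "\<exists>h'. trajectory_poly v h' \<and> (\<forall>t. (h has_real_derivative h' t) (at t))"
    using h
  proof induction
    case (const c)
    show ?case by (intro exI[of _ "\<lambda>t. 0"]) (auto intro: trajectory_poly.const)
  next
    case (comp i)
    have "((\<lambda>t. v t $ i) has_real_derivative (S *v v t) $ i) (at t)" for t
      using bounded_linear.has_vector_derivative[OF bounded_linear_vec_nth, of v "S *v v t" "at t" i] v
      by (simp add: exo_trajectory_def has_real_derivative_iff_has_vector_derivative)
    moreover have "trajectory_poly v (\<lambda>t. (S *v v t) $ i)"
      unfolding matrix_vector_mult_def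
      by (auto intro!: trajectory_poly_sum trajectory_poly.mult trajectory_poly.const trajectory_poly.comp)
    ultimately show ?case by blast
  next
    case (add h k)
    then obtain h' k' where "trajectory_poly v h'" "\<forall>t. (h has_real_derivative h' t) (at t)"
      "trajectory_poly v k'" "\<forall>t. (k has_real_derivative k' t) (at t)" by blast
    then show ?case
      by (intro exI[of _ "\<lambda>t. h' t + k' t"]) (auto intro!: trajectory_poly.add derivative_intros)
  next
    case (mult h k)
    then obtain h' k' where hk: "trajectory_poly v h'" "\<And>t. (h has_real_derivative h' t) (at t)"
      "trajectory_poly v k'" "\<And>t. (k has_real_derivative k' t) (at t)" by blast
    have "trajectory_poly v (\<lambda>t. h' t * k t + k' t * h t)"
      using hk mult by (intro trajectory_poly.add trajectory_poly.mult)
    then show ?case using DERIV_mult[OF hk(2) hk(4)] by blast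
  qed
  then obtain h' where h': "trajectory_poly v h'" "\<And>t. (h has_real_derivative h' t) (at t)" by blast
  then have "deriv h = h'" using DERIV_imp_deriv by blast
  with h' show ?thesis by simp
qed

lemma trajectory_poly_iterated_deriv:
  assumes "exo_trajectory S v" "trajectory_poly v h"
  shows "trajectory_poly v ((deriv ^^ j) h)"
    "(((deriv ^^ j) h) has_real_derivative (deriv ^^ Suc j) h t) (at t)"
proof -
  show "trajectory_poly v ((deriv ^^ j) h)" for j
    using trajectory_poly_deriv[OF assms(1)] assms(2) by (induction j) auto
  from trajectory_poly_deriv[OF assms(1) this[of j]]
  show "(((deriv ^^ j) h) has_real_derivative (deriv ^^ Suc j) h t) (at t)" by simp
qed

lemma trajectory_poly_bounded:
  assumes "bounded (v ` A)" "trajectory_poly v h"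
  obtains C where "\<And>t. t \<in> A \<Longrightarrow> \<bar>h t\<bar> \<le> C"
proof -
  obtain K where K: "\<And>t. t \<in> A \<Longrightarrow> norm (v t) \<le> K" using assms(1) by (auto simp: bounded_iff)
  have "\<exists>C. \<forall>t\<in>A. \<bar>h t\<bar> \<le> C" using assms(2)
  proof induction
    case (comp i)
    then show ?case using K component_le_norm_cart order_trans by blast
  next
    case (add h k)
    then obtain C D where "\<forall>t\<in>A. \<bar>h t\<bar> \<le> C" "\<forall>t\<in>A. \<bar>k t\<bar> \<le> D" by blast
    then show ?case by (intro exI[of _ "C + D"]) (fastforce intro: order_trans[OF abs_triangle_ineq])
  next
    case (mult h k)
    then obtain C D where "\<forall>t\<in>A. \<bar>h t\<bar> \<le> C" "\<forall>t\<in>A. \<bar>k t\<bar> \<le> D" by blast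
    then have "\<forall>t\<in>A. \<bar>h t * k t\<bar> \<le> C * D"
      unfolding abs_mult by (meson abs_ge_zero mult_mono order_trans)
    then show ?case by blast
  qed auto
  with that show thesis by blast
qed

text \<open>\<open>T (h, h', h'', \<dots>)\<close>: for the steady-state input \<open>h\<close> this is the steady state of the
  internal model.\<close>

definition immersion_state ::
  "('s::{finite,linorder}) sqmat \<Rightarrow> (real \<Rightarrow> real) \<Rightarrow> real \<Rightarrow> 's rvec" where
  "immersion_state T h t = T *v (\<chi> i. (deriv ^^ (pos i - 1)) h t)"

text \<open>The vector of derivatives of the steady-state input is a state of the companion system
  \<open>\<Phi>\<close>; the Sylvester equation turns \<open>T\<close> times it into a state of \<open>(M, N)\<close> driven by the
  steady-state input itself.\<close>

lemma immersion_state_dynamics: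
  fixes rh N :: "('s::{finite,linorder}) rvec" and M T :: "'s sqmat" and w :: 'w
  assumes v: "exo_trajectory S v" and poly: "polynomial_in_fst uss"
    and im: "internal_model_coeffs S uss rh"
    and T: "is_sylvester_solution M N rh T" "invertible T"
  defines "h \<equiv> \<lambda>t. uss (v t) w"
  shows "(immersion_state T h has_vector_derivative (M *v immersion_state T h t + h t *\<^sub>R N)) (at t)"
    and "Psi_row T \<bullet> immersion_state T h t = h t"
proof -
  have h: "trajectory_poly v h" unfolding h_def by (rule trajectory_poly_polynomial[OF poly])
  define \<tau> :: "real \<Rightarrow> 's rvec" where "\<tau> t = (\<chi> i. (deriv ^^ (pos i - 1)) h t)" for t
  have st: "immersion_state T h = (\<lambda>t. T *v \<tau> t)" by (simp add: immersion_state_def \<tau>_def fun_eq_iff)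
  have \<Phi>: "(Phi_mat rh *v \<tau> t) $ i = (deriv ^^ pos i) h t" for t and i :: 's
  proof (cases "pos i = CARD('s)")
    case True
    have "(Phi_mat rh *v \<tau> t) $ i = (\<Sum>j\<in>(UNIV::'s set). rh $ ix (pos j) * (deriv ^^ (pos j - 1)) h t)"
      by (simp add: matrix_vector_mult_def Phi_mat_def \<tau>_def True)
    also have "\<dots> = (\<Sum>k=1..CARD('s). rh $ ix k * (deriv ^^ (k - 1)) h t)"
      by (rule sum_pos)
    also have "\<dots> = (deriv ^^ CARD('s)) h t"
      using im v unfolding internal_model_coeffs_def h_def by (auto simp: fun_eq_iff)
    finally show ?thesis by (simp add: True)
  next
    case False
    then have lt: "pos i + 1 \<le> CARD('s)" using pos_le_card[of i] by simp
    have "(Phi_mat rh *v \<tau> t) $ i = (\<Sum>j\<in>(UNIV::'s set). if j = ix (pos i + 1) then (deriv ^^ (pos j - 1)) h t else 0)"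
      unfolding matrix_vector_mult_def Phi_mat_def \<tau>_def using False lt
      by (simp add: pos_eq_iff if_distrib[of "\<lambda>c. c * _"] cong: if_cong)
    also have "\<dots> = (deriv ^^ pos i) h t" using lt by simp
    finally show ?thesis .
  qed
  have \<tau>': "(\<tau> has_vector_derivative (Phi_mat rh *v \<tau> t)) (at t)" for t
  proof (rule has_vector_derivative_vecI)
    fix i :: 's
    have "(((deriv ^^ (pos i - 1)) h) has_real_derivative (deriv ^^ Suc (pos i - 1)) h t) (at t)"
      by (rule trajectory_poly_iterated_deriv(2)[OF v h])
    moreover have "Suc (pos i - 1) = pos i" using pos_ge_1[of i] by simp
    ultimately show "((\<lambda>t. \<tau> t $ i) has_vector_derivative (Phi_mat rh *v \<tau> t) $ i) (at t)"
      unfolding \<Phi> by (simp add: \<tau>_def has_real_derivative_iff_has_vector_derivative)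
  qed
  have \<Gamma>: "Gamma_row \<bullet> \<tau> t = h t" for t
  proof -
    have "Gamma_row \<bullet> \<tau> t = (\<Sum>j\<in>UNIV. if j = ix 1 then \<tau> t $ j else 0)"
      unfolding inner_vec_def Gamma_row_def
      by (simp add: pos_eq_iff if_distrib[of "\<lambda>c. c * _"] cong: if_cong)
    also have "\<dots> = h t" by (simp add: \<tau>_def)
    finally show ?thesis .
  qed
  have "T *v (Phi_mat rh *v \<tau> t) = M *v (T *v \<tau> t) + h t *\<^sub>R N"
  proof -
    have "T ** Phi_mat rh = M ** T + (\<chi> i j. N $ i * Gamma_row $ j)"
      using T(1) unfolding is_sylvester_solution_def by (simp add: algebra_simps)
    then have "T *v (Phi_mat rh *v \<tau> t) = (M ** T + (\<chi> i j. N $ i * Gamma_row $ j)) *v \<tau> t"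
      by (simp add: matrix_vector_mul_assoc)
    also have "\<dots> = M *v (T *v \<tau> t) + (\<chi> i j. N $ i * Gamma_row $ j) *v \<tau> t"
      by (simp add: matrix_vector_mult_add_rdistrib matrix_vector_mul_assoc)
    also have "(\<chi> i j. N $ i * Gamma_row $ j) *v \<tau> t = (Gamma_row \<bullet> \<tau> t) *\<^sub>R N"
      by (simp add: vec_eq_iff matrix_vector_mult_def inner_vec_def sum_distrib_left sum_distrib_right algebra_simps)
    finally show ?thesis by (simp add: \<Gamma>)
  qed
  moreover have "((\<lambda>t. T *v \<tau> t) has_vector_derivative T *v (Phi_mat rh *v \<tau> t)) (at t)"
    by (rule bounded_linear.has_vector_derivative[OF matrix_vector_mul_bounded_linear \<tau>'])
  ultimately show "(immersion_state T h has_vector_derivative (M *v immersion_state T h t + h t *\<^sub>R N)) (at t)"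
    unfolding st by simp
  have "matrix_inv T ** T = mat 1" 
    using T(2) unfolding invertible_def matrix_inv_def by (metis (mono_tags, lifting) someI_ex)
  then show "Psi_row T \<bullet> immersion_state T h t = h t"
    unfolding st Psi_row_def by (simp add: dot_lmul_matrix matrix_vector_mul_assoc \<Gamma>)
qed

lemma immersion_state_bounded:
  fixes T :: "('s::{finite,linorder}) sqmat"
  assumes v: "exo_trajectory S v" "bounded (v ` A)" and poly: "polynomial_in_fst uss"
  shows "bounded (immersion_state T (\<lambda>t. uss (v t) w) ` A)"
proof -
  define h where "h t = uss (v t) w" for t
  have h: "trajectory_poly v h" unfolding h_def by (rule trajectory_poly_polynomial[OF poly])
  have "\<exists>C. \<forall>t\<in>A. \<bar>(deriv ^^ j) h t\<bar> \<le> C" for j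
    using trajectory_poly_bounded[OF v(2) trajectory_poly_iterated_deriv(1)[OF v(1) h, of j]] by metis
  then obtain C where C: "\<And>j t. t \<in> A \<Longrightarrow> \<bar>(deriv ^^ j) h t\<bar> \<le> C j" by metis
  have "bounded ((\<lambda>t. (\<chi> i. (deriv ^^ (pos i - 1)) h t) :: 's rvec) ` A)"
    unfolding bounded_iff
  proof (intro exI ballI)
    fix x :: "'s rvec" assume "x \<in> (\<lambda>t. \<chi> i. (deriv ^^ (pos i - 1)) h t) ` A"
    then obtain t where t: "t \<in> A" "x = (\<chi> i. (deriv ^^ (pos i - 1)) h t)" by blast
    have "norm x \<le> (\<Sum>i\<in>UNIV. \<bar>x $ i\<bar>)" by (rule norm_le_l1_cart)
    also have "\<dots> \<le> (\<Sum>i\<in>(UNIV::'s set). C (pos i - 1))" by (rule sum_mono) (use t C in simp)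
    finally show "norm x \<le> (\<Sum>i\<in>(UNIV::'s set). C (pos i - 1))" .
  qed
  from bounded_linear_image[OF this matrix_vector_mul_bounded_linear[of T]]
  show ?thesis by (simp add: immersion_state_def h_def[symmetric] image_image)
qed

section \<open>Lyapunov functions of cascades\<close>

lemma class_K_inf_strict: "class_K_inf a \<Longrightarrow> 0 \<le> s \<Longrightarrow> s < t \<Longrightarrow> a s < a t"
  by (auto simp: class_K_inf_def strict_mono_on_def)

lemma class_K_inf_mono: "class_K_inf a \<Longrightarrow> 0 \<le> s \<Longrightarrow> s \<le> t \<Longrightarrow> a s \<le> a t"
  using class_K_inf_strict[of a s t] by (cases "s = t") auto

lemma class_K_inf_nonneg: "class_K_inf a \<Longrightarrow> 0 \<le> s \<Longrightarrow> 0 \<le> a s"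
  using class_K_inf_mono[of a 0 s] by (auto simp: class_K_inf_def)

lemma class_K_inf_pos: "class_K_inf a \<Longrightarrow> 0 < s \<Longrightarrow> 0 < a s"
  using class_K_inf_strict[of a 0 s] by (auto simp: class_K_inf_def)

lemma class_K_inf_vanishing_gain:
  assumes "class_K_inf a" shows "vanishing_gain a"
  unfolding vanishing_gain_def
proof (intro conjI allI impI)
  show "gain a" unfolding gain_def
    using class_K_inf_mono[OF assms] class_K_inf_nonneg[OF assms] by blast
  fix \<epsilon> :: real assume \<epsilon>: "\<epsilon> > 0"
  have "continuous_on {0..} a" "a 0 = 0" using assms by (auto simp: class_K_inf_def)
  then obtain d where d: "d > 0" "\<And>x. 0 \<le> x \<Longrightarrow> dist x 0 < d \<Longrightarrow> dist (a x) 0 < \<epsilon>"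
    using \<epsilon> unfolding continuous_on_iff by (metis atLeast_iff order_refl)
  then have "dist (a (d / 2)) 0 < \<epsilon>" using d(2)[of "d / 2"] by simp
  then show "\<exists>\<delta>>0. a \<delta> \<le> \<epsilon>"
    using d(1) by (intro exI[of _ "d / 2"]) (auto simp: dist_real_def)
qed

text \<open>The supremum of a sublevel set is a generalised inverse that is monotone by construction.\<close>

lemma class_K_inf_inverse_gain:
  assumes a: "class_K_inf a"
  obtains lw where "vanishing_gain lw" "\<And>\<nu> s. 0 \<le> \<nu> \<Longrightarrow> a \<nu> \<le> s \<Longrightarrow> \<nu> \<le> lw s"
proof -
  define A where "A s = {\<nu>. 0 \<le> \<nu> \<and> a \<nu> \<le> s}" for s
  have bdd: "bdd_above (A s)" for s
  proof -
    obtain m where m: "0 \<le> m" "s < a m"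
      using a by (force simp: class_K_inf_def bdd_above_def not_le)
    have "\<nu> \<le> m" if "\<nu> \<in> A s" for \<nu>
      using class_K_inf_mono[OF a m(1), of \<nu>] that m(2) by (force simp: A_def)
    then show ?thesis by (rule bdd_aboveI)
  qed
  have A0: "0 \<in> A s" if "0 \<le> s" for s using that a by (simp add: A_def class_K_inf_def)
  define lw where "lw s = Sup (A s)" for s
  have up: "\<nu> \<le> lw s" if "0 \<le> \<nu>" "a \<nu> \<le> s" for \<nu> s
    unfolding lw_def by (rule cSup_upper[OF _ bdd]) (use that in \<open>simp add: A_def\<close>)
  have "gain lw" unfolding gain_def
  proof (intro conjI allI impI)
    fix s :: real assume s: "0 \<le> s"
    show "0 \<le> lw s" using up[of 0 s] s a by (simp add: class_K_inf_def)
    fix t assume "s \<le> t"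
    then show "lw s \<le> lw t" unfolding lw_def
      by (intro cSup_subset_mono bdd) (use A0[OF s] in \<open>auto simp: A_def\<close>)
  qed
  moreover have "\<exists>\<delta>>0. lw \<delta> \<le> \<epsilon>" if \<epsilon>: "0 < \<epsilon>" for \<epsilon>
  proof (intro exI conjI)
    show "0 < a \<epsilon>" by (rule class_K_inf_pos[OF a \<epsilon>])
    show "lw (a \<epsilon>) \<le> \<epsilon>" unfolding lw_def
    proof (rule cSup_least)
      show "A (a \<epsilon>) \<noteq> {}" using A0[of "a \<epsilon>"] class_K_inf_pos[OF a \<epsilon>] by force
      fix \<nu> assume "\<nu> \<in> A (a \<epsilon>)"
      then show "\<nu> \<le> \<epsilon>" using class_K_inf_strict[OF a, of \<epsilon> \<nu>] \<epsilon> by (force simp: A_def)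
    qed
  qed
  ultimately have "vanishing_gain lw" by (simp add: vanishing_gain_def)
  with up that show thesis by blast
qed

text \<open>Near \<open>0\<close> the quotient \<open>\<nu>\<^sup>2 / a(\<nu>)\<close> is bounded by the assumption on its upper limit, and
  away from \<open>0\<close> the denominator is bounded below by monotonicity.\<close>

lemma square_le_gain_times_class_K_inf:
  assumes a: "class_K_inf a" and lim: "Limsup (at_right 0) (\<lambda>s. ereal (s\<^sup>2 / a s)) < \<infinity>"
  obtains \<tau> where "gain \<tau>" "\<And>\<nu>. 0 \<le> \<nu> \<Longrightarrow> \<nu>\<^sup>2 \<le> \<tau> \<nu> * a \<nu>"
proof -
  obtain c :: nat where "Limsup (at_right 0) (\<lambda>s. ereal (s\<^sup>2 / a s)) < ereal (real c)"
    using less_PInf_Ex_of_nat lim by auto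
  then have "\<forall>\<^sub>F s in at_right 0. ereal (s\<^sup>2 / a s) < ereal (real c)" by (rule Limsup_lessD)
  then have "\<forall>\<^sub>F s in at_right 0. s\<^sup>2 / a s < real c" by simp
  then obtain d where d: "d > 0" "\<And>s. 0 < s \<Longrightarrow> s < d \<Longrightarrow> s\<^sup>2 / a s < real c"
    by (auto simp: eventually_at_right_field)
  define \<tau> where "\<tau> s = real c + s\<^sup>2 / a (d / 2)" for s
  have ad: "0 < a (d / 2)" using class_K_inf_pos[OF a] d by simp
  have "gain \<tau>" unfolding \<tau>_def[abs_def]
    using ad by (intro gain_add gain_const gain_divide gain_power gain_id) auto
  moreover have "\<nu>\<^sup>2 \<le> \<tau> \<nu> * a \<nu>" if \<nu>: "0 \<le> \<nu>" for \<nu>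
  proof -
    consider "\<nu> = 0" | "0 < \<nu>" "\<nu> < d" | "d \<le> \<nu>" using \<nu> by linarith
    then show ?thesis
    proof cases
      case 1 then show ?thesis using a by (simp add: class_K_inf_def)
    next
      case 2
      have an: "0 < a \<nu>" using class_K_inf_pos[OF a 2(1)] .
      then have "\<nu>\<^sup>2 \<le> real c * a \<nu>" using d(2)[OF 2] by (simp add: field_simps)
      also have "\<dots> \<le> \<tau> \<nu> * a \<nu>" unfolding \<tau>_def using an ad by (intro mult_right_mono) auto
      finally show ?thesis .
    next
      case 3
      have "a (d / 2) \<le> a \<nu>" using class_K_inf_mono[OF a, of "d / 2" \<nu>] 3 d by simp
      then have "\<nu>\<^sup>2 * a (d / 2) \<le> \<nu>\<^sup>2 * a \<nu>" by (rule mult_left_mono) simp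
      then have "\<nu>\<^sup>2 \<le> \<nu>\<^sup>2 / a (d / 2) * a \<nu>" using ad by (simp add: field_simps)
      also have "\<dots> \<le> \<tau> \<nu> * a \<nu>" unfolding \<tau>_def
        using class_K_inf_nonneg[OF a \<nu>] by (intro mult_right_mono) auto
      finally show ?thesis .
    qed
  qed
  ultimately show thesis using that by blast
qed

text \<open>The derivative vanishes at the minimum \<open>0\<close> and is locally Lipschitz, so that \<open>h(e) / e\<^sup>2\<close>
  is bounded on bounded sets.\<close>

lemma pos_def_quadratic_bound:
  fixes h :: "real \<Rightarrow> real"
  assumes h: "smooth h" "pos_def_fun h"
  obtains \<psi> where "gain \<psi>" "\<And>e. h e \<le> \<psi> \<bar>e\<bar> * e\<^sup>2"
proof -
  define h' where "h' = deriv h"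
  have der: "(h has_real_derivative h' y) (at y)" for y
    unfolding h'_def by (rule smooth_deriv(1)[OF h(1)])
  have "h' 0 = 0"
    using h(2) by (intro DERIV_local_min[OF der, of 1]) (auto simp: pos_def_fun_def, metis less_imp_le order_refl)
  have Lip: "\<exists>L. \<forall>e\<in>UNIV. \<bar>e\<bar> \<le> R \<longrightarrow> h e / e\<^sup>2 \<le> L" for R
  proof -
    have "C_k 1 h'" unfolding h'_def by (rule smooth_C_k[OF smooth_deriv(2)[OF h(1)]])
    then obtain L where L: "L > 0" "\<And>x y. norm x \<le> R \<Longrightarrow> norm y \<le> R \<Longrightarrow> norm (h' x - h' y) \<le> L * norm (x - y)"
      using C_1_lipschitz_on_ball[of h' R] by metis
    have "h e / e\<^sup>2 \<le> L" if e: "\<bar>e\<bar> \<le> R" for e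
    proof (cases "e = 0")
      case False
      have "norm (h e - h 0) \<le> (L * \<bar>e\<bar>) * norm (e - 0)"
      proof (rule field_differentiable_bound[of "{-\<bar>e\<bar>..\<bar>e\<bar>}" h h'])
        fix y assume y: "y \<in> {-\<bar>e\<bar>..\<bar>e\<bar>}"
        show "(h has_field_derivative h' y) (at y within {-\<bar>e\<bar>..\<bar>e\<bar>})"
          by (rule has_field_derivative_at_within[OF der])
        have "norm (h' y - h' 0) \<le> L * norm (y - 0)" using y e by (intro L(2)) auto
        also have "\<dots> \<le> L * \<bar>e\<bar>" using y L(1) by (intro mult_left_mono) auto
        finally show "norm (h' y) \<le> L * \<bar>e\<bar>" using \<open>h' 0 = 0\<close> by simp
      qed auto
      moreover have "h 0 = 0" using h(2) by (simp add: pos_def_fun_def)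
      ultimately have "h e \<le> L * e\<^sup>2" by (simp add: power2_eq_square mult.assoc)
      then show ?thesis using False by (simp add: field_simps)
    qed (use L(1) in simp)
    then show ?thesis by blast
  qed
  from gain_of_local_bounds[of UNIV abs "\<lambda>e. h e / e\<^sup>2", OF Lip]
  obtain \<psi> where \<psi>: "gain \<psi>" "\<And>e. h e / e\<^sup>2 \<le> \<psi> \<bar>e\<bar>" by (metis UNIV_I)
  have "h e \<le> \<psi> \<bar>e\<bar> * e\<^sup>2" for e
    using \<psi>(2)[of e] h(2) by (cases "e = 0") (auto simp: pos_def_fun_def field_simps)
  with \<psi>(1) that show thesis by blast
qed

lemma quadratic_form_derivative:
  fixes B :: "real^'n \<Rightarrow> real^'n \<Rightarrow> real" and x :: "real \<Rightarrow> real^'n"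
  assumes B: "bounded_bilinear B" "\<And>x y. B x y = B y x" "\<And>x. 2 * B x (A *v x) \<le> - (norm x)\<^sup>2"
    and K: "\<And>x y. \<bar>B x y\<bar> \<le> K * norm x * norm y"
    and x: "(x has_vector_derivative (A *v x t + h)) (at t within I)"
  shows "((\<lambda>\<tau>. B (x \<tau>) (x \<tau>)) has_real_derivative (2 * B (x t) (A *v x t + h))) (at t within I)"
    and "2 * B (x t) (A *v x t + h) \<le> - (norm (x t))\<^sup>2 / 2 + 2 * K\<^sup>2 * (norm h)\<^sup>2"
proof -
  show "((\<lambda>\<tau>. B (x \<tau>) (x \<tau>)) has_real_derivative (2 * B (x t) (A *v x t + h))) (at t within I)"
    using bounded_bilinear.has_vector_derivative[OF B(1) x x] B(2)[of "x t"]
    by (simp add: has_real_derivative_iff_has_vector_derivative)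
  have "B (x t) (A *v x t + h) = B (x t) (A *v x t) + B (x t) h"
    by (rule bounded_bilinear.add_right[OF B(1)])
  moreover have "2 * B (x t) h \<le> (norm (x t))\<^sup>2 / 2 + 2 * K\<^sup>2 * (norm h)\<^sup>2"
  proof -
    have "2 * B (x t) h \<le> 2 * (K * norm (x t) * norm h)" using K[of "x t" h] by simp
    also have "\<dots> = 2 * (norm (x t) / sqrt 2) * (sqrt 2 * (K * norm h))" by simp
    also have "\<dots> \<le> (norm (x t) / sqrt 2)\<^sup>2 + (sqrt 2 * (K * norm h))\<^sup>2" by (rule sum_squares_bound)
    also have "\<dots> = (norm (x t))\<^sup>2 / 2 + 2 * K\<^sup>2 * (norm h)\<^sup>2" by (simp add: power_divide power_mult_distrib)
    finally show ?thesis .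
  qed
  ultimately show "2 * B (x t) (A *v x t + h) \<le> - (norm (x t))\<^sup>2 / 2 + 2 * K\<^sup>2 * (norm h)\<^sup>2"
    using B(3)[of "x t"] by simp
qed

lemma bilinear_bound_const:
  fixes B :: "real^'n \<Rightarrow> real^'n \<Rightarrow> real"
  assumes "bounded_bilinear B"
  obtains K where "0 \<le> K" "\<And>x y. \<bar>B x y\<bar> \<le> K * norm x * norm y"
  using bounded_bilinear.nonneg_bounded[OF assms] that by (auto simp: mult.assoc mult.commute mult.left_commute)

text \<open>The weights repay each other. The third system costs a multiple of \<open>a\<^sup>2\<close>, which the weight
  \<open>k\<close> of the second one pays; both cost a multiple of \<open>G\<^sup>2\<close>, whose share in \<open>\<nu>\<^sup>2\<close> is paid by
  \<open>Q\<close>.\<close>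

lemma lyapunov_sum_inequality:
  fixes V1' V2' V3' Q C K e d G \<nu> a c h1 h2 k \<phi>\<nu> \<phi>e H :: real
  assumes V1: "V1' \<le> - Q + H * e\<^sup>2"
    and V2: "V2' \<le> - a\<^sup>2 / 2 + 2 * K\<^sup>2 * h1\<^sup>2" and V3: "V3' \<le> - c\<^sup>2 / 2 + 2 * K\<^sup>2 * h2\<^sup>2"
    and h1: "0 \<le> h1" "h1 \<le> C * (\<bar>e\<bar> + G)" and h2: "0 \<le> h2" "h2 \<le> C * (\<bar>e\<bar> + d + a + G)"
    and nn: "0 \<le> \<nu>" "0 \<le> a" "0 \<le> c" "0 \<le> d" "0 \<le> G"
    and G: "G\<^sup>2 \<le> \<phi>\<nu> * \<nu>\<^sup>2 + \<phi>e * e\<^sup>2"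
    and k: "k = 6 + 96 * K\<^sup>2 * C\<^sup>2"
    and Q: "3 * \<nu>\<^sup>2 + (4 * k * K\<^sup>2 * C\<^sup>2 + 48 * K\<^sup>2 * C\<^sup>2) * \<phi>\<nu> * \<nu>\<^sup>2 \<le> Q"
  shows "V1' + k * V2' + 6 * V3' \<le> - (\<nu> + a + c)\<^sup>2
     + (H + (4 * k * K\<^sup>2 * C\<^sup>2 + 48 * K\<^sup>2 * C\<^sup>2) * (1 + \<phi>e)) * e\<^sup>2 + 48 * K\<^sup>2 * C\<^sup>2 * d\<^sup>2"
proof -
  define J where "J = K\<^sup>2 * C\<^sup>2"
  have J: "0 \<le> J" by (simp add: J_def)
  have "0 \<le> k" unfolding k by simp
  have "h1\<^sup>2 \<le> (C * (\<bar>e\<bar> + G))\<^sup>2" using h1 by (intro power_mono) auto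
  also have "\<dots> \<le> C\<^sup>2 * (2 * e\<^sup>2 + 2 * G\<^sup>2)"
  proof -
    have "(\<bar>e\<bar> + G)\<^sup>2 \<le> 2 * e\<^sup>2 + 2 * G\<^sup>2"
      using sum_squares_bound[of "\<bar>e\<bar>" G] by (simp add: power2_sum)
    then show ?thesis unfolding power_mult_distrib by (intro mult_left_mono) auto
  qed
  finally have "K\<^sup>2 * h1\<^sup>2 \<le> K\<^sup>2 * (C\<^sup>2 * (2 * e\<^sup>2 + 2 * G\<^sup>2))" by (rule mult_left_mono) simp
  then have 1: "V2' \<le> - a\<^sup>2 / 2 + 4 * J * (e\<^sup>2 + G\<^sup>2)" using V2 by (simp add: J_def algebra_simps)
  have "h2\<^sup>2 \<le> (C * (\<bar>e\<bar> + d + a + G))\<^sup>2" using h2 by (intro power_mono) auto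
  also have "\<dots> \<le> C\<^sup>2 * (4 * (e\<^sup>2 + d\<^sup>2 + a\<^sup>2 + G\<^sup>2))"
  proof -
    have "(\<bar>e\<bar> + d + a + G)\<^sup>2 \<le> 4 * (e\<^sup>2 + d\<^sup>2 + a\<^sup>2 + G\<^sup>2)"
      using sum_squares_bound[of "\<bar>e\<bar>" d] sum_squares_bound[of "\<bar>e\<bar>" a] sum_squares_bound[of "\<bar>e\<bar>" G]
        sum_squares_bound[of d a] sum_squares_bound[of d G] sum_squares_bound[of a G]
      by (simp add: power2_eq_square algebra_simps)
    then show ?thesis unfolding power_mult_distrib by (intro mult_left_mono) auto
  qed
  finally have "K\<^sup>2 * h2\<^sup>2 \<le> K\<^sup>2 * (C\<^sup>2 * (4 * (e\<^sup>2 + d\<^sup>2 + a\<^sup>2 + G\<^sup>2)))" by (rule mult_left_mono) simp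
  then have 2: "V3' \<le> - c\<^sup>2 / 2 + 8 * J * (e\<^sup>2 + d\<^sup>2 + a\<^sup>2 + G\<^sup>2)" using V3 by (simp add: J_def algebra_simps)
  have 3: "k * V2' \<le> k * (- a\<^sup>2 / 2 + 4 * J * (e\<^sup>2 + G\<^sup>2))" by (rule mult_left_mono[OF 1 \<open>0 \<le> k\<close>])
  have ka: "k * (a\<^sup>2 / 2) = 3 * a\<^sup>2 + 48 * J * a\<^sup>2" unfolding k J_def by (simp add: algebra_simps)
  define L where "L = 4 * k * J + 48 * J"
  have L: "0 \<le> L" using J \<open>0 \<le> k\<close> by (simp add: L_def)
  have 4: "L * G\<^sup>2 \<le> L * (\<phi>\<nu> * \<nu>\<^sup>2 + \<phi>e * e\<^sup>2)" by (rule mult_left_mono[OF G L])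
  have 5: "V1' + k * V2' + 6 * V3' \<le> - Q + H * e\<^sup>2 - 3 * a\<^sup>2 - 3 * c\<^sup>2 + L * e\<^sup>2 + L * G\<^sup>2 + 48 * J * d\<^sup>2"
    using V1 2 3 ka by (simp add: L_def algebra_simps add_divide_distrib)
  have 6: "(\<nu> + a + c)\<^sup>2 \<le> 3 * (\<nu>\<^sup>2 + a\<^sup>2 + c\<^sup>2)"
    using sum_squares_bound[of \<nu> a] sum_squares_bound[of \<nu> c] sum_squares_bound[of a c]
    by (simp add: power2_eq_square algebra_simps)
  have L': "4 * k * K\<^sup>2 * C\<^sup>2 + 48 * K\<^sup>2 * C\<^sup>2 = L" by (simp add: L_def J_def)
  have J': "48 * K\<^sup>2 * C\<^sup>2 = 48 * J" by (simp add: J_def)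
  show ?thesis
    using 4 5 6 Q unfolding L' unfolding J' by (simp add: algebra_simps)
qed

text \<open>The composite Lyapunov function: the storage function of the zero dynamics with a changed
  supply rate, plus quadratic forms for the two Hurwitz subsystems that it drives.\<close>

lemma cascade_lyapunov:
  fixes M :: "real^'s^'s" and A :: "real^'r^'r" and V0 :: "real^'nz \<Rightarrow> real"
  assumes MH: "Hurwitz M" and AH: "Hurwitz A"
    and V0: "C_k 1 V0" and K: "class_K_inf alow" "class_K_inf aup" "class_K_inf a0"
    and gam: "smooth gam0" "pos_def_fun gam0"
    and lim: "Limsup (at_right 0) (\<lambda>s. ereal (s\<^sup>2 / a0 s)) < \<infinity>"
    and low: "\<And>zb. alow (norm zb) \<le> V0 zb" and up: "\<And>zb. V0 zb \<le> aup (norm zb)"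
    and C: "0 \<le> C" and \<psi>g: "gain \<psi>g"
  obtains Vb \<psi>\<gamma> \<psi>\<pi> upb lwb where "gain \<psi>\<gamma>" "gain \<psi>\<pi>" "vanishing_gain upb" "vanishing_gain lwb"
    "\<And>zb p x. 0 \<le> Vb zb p x \<and> Vb zb p x \<le> upb (norm zb + norm p + norm x) \<and>
        norm zb + norm p + norm x \<le> lwb (Vb zb p x)"
    "\<And>zb (p :: real \<Rightarrow> real^'s) (x :: real \<Rightarrow> real^'r) zb' h1 h2 e d G t I.
       \<lbrakk>(zb has_vector_derivative zb') (at t within I);
        frechet_derivative V0 (at (zb t)) zb' \<le> - a0 (norm (zb t)) + gam0 e;
        (p has_vector_derivative (M *v p t + h1)) (at t within I);
        (x has_vector_derivative (A *v x t + h2)) (at t within I);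
        norm h1 \<le> C * (\<bar>e\<bar> + G); norm h2 \<le> C * (\<bar>e\<bar> + d + norm (p t) + G);
        0 \<le> d; 0 \<le> G; G \<le> \<psi>g (norm (zb t) + \<bar>e\<bar>) * (norm (zb t) + \<bar>e\<bar>)\<rbrakk> \<Longrightarrow>
       \<exists>D. ((\<lambda>\<tau>. Vb (zb \<tau>) (p \<tau>) (x \<tau>)) has_real_derivative D) (at t within I) \<and>
         D \<le> - (norm (zb t) + norm (p t) + norm (x t))\<^sup>2 + \<psi>\<gamma> \<bar>e\<bar> * e\<^sup>2 + \<psi>\<pi> d * d\<^sup>2"
    "continuous_on UNIV (\<lambda>(zb, p, x). Vb zb p x)"
proof -
  obtain BM cM where BM: "bounded_bilinear BM" "\<And>x y. BM x y = BM y x" "(0::real) < cM"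
    "\<And>x. cM * (norm x)\<^sup>2 \<le> BM x x" "\<And>x. 2 * BM x (M *v x) \<le> - (norm x)\<^sup>2"
    by (rule Hurwitz_lyapunov_form[OF MH]) blast
  obtain BA cA where BA: "bounded_bilinear BA" "\<And>x y. BA x y = BA y x" "(0::real) < cA"
    "\<And>x. cA * (norm x)\<^sup>2 \<le> BA x x" "\<And>x. 2 * BA x (A *v x) \<le> - (norm x)\<^sup>2"
    by (rule Hurwitz_lyapunov_form[OF AH]) blast
  obtain KM where KM: "0 \<le> KM" "\<And>x y. \<bar>BM x y\<bar> \<le> KM * norm x * norm y"
    using bilinear_bound_const[OF BM(1)] by metis
  obtain KA where KA: "0 \<le> KA" "\<And>x y. \<bar>BA x y\<bar> \<le> KA * norm x * norm y"
    using bilinear_bound_const[OF BA(1)] by metis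
  define K where "K = max KM KA"
  have K0: "0 \<le> K" using KM by (simp add: K_def)
  have KMK: "\<bar>BM x y\<bar> \<le> K * norm x * norm y" for x y
    by (rule order_trans[OF KM(2)]) (auto simp: K_def intro!: mult_right_mono)
  have KAK: "\<bar>BA x y\<bar> \<le> K * norm x * norm y" for x y
    by (rule order_trans[OF KA(2)]) (auto simp: K_def intro!: mult_right_mono)
  obtain lw0 where lw0: "vanishing_gain lw0" "\<And>\<nu> s. 0 \<le> \<nu> \<Longrightarrow> alow \<nu> \<le> s \<Longrightarrow> \<nu> \<le> lw0 s"
    using class_K_inf_inverse_gain[OF K(1)] by metis
  obtain lwa where lwa: "vanishing_gain lwa" "\<And>\<nu> s. 0 \<le> \<nu> \<Longrightarrow> a0 \<nu> \<le> s \<Longrightarrow> \<nu> \<le> lwa s"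
    using class_K_inf_inverse_gain[OF K(3)] by metis
  obtain \<tau> where \<tau>: "gain \<tau>" "\<And>\<nu>. 0 \<le> \<nu> \<Longrightarrow> \<nu>\<^sup>2 \<le> \<tau> \<nu> * a0 \<nu>"
    using square_le_gain_times_class_K_inf[OF K(3) lim] by metis
  obtain \<psi>e where \<psi>e: "gain \<psi>e" "\<And>e. gam0 e \<le> \<psi>e \<bar>e\<bar> * e\<^sup>2"
    using pos_def_quadratic_bound[OF gam] by metis
  have aup: "vanishing_gain aup" by (rule class_K_inf_vanishing_gain[OF K(2)])
  have gaup: "gain aup" and glw0: "gain lw0" and glwa: "gain lwa"
    using aup lw0 lwa by (auto simp: vanishing_gain_def)
  have V00: "0 \<le> V0 zb" for zb
    using low[of zb] class_K_inf_nonneg[OF K(1), of "norm zb"] by simp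
  define \<phi> where "\<phi> s = 4 * (\<psi>g (2 * s))\<^sup>2" for s
  have \<phi>: "gain \<phi>" unfolding \<phi>_def[abs_def]
    by (intro gain_mult gain_power gain_compose[OF \<psi>g] gain_const gain_id) auto
  define k where "k = 6 + 96 * K\<^sup>2 * C\<^sup>2"
  define L where "L = 4 * k * K\<^sup>2 * C\<^sup>2 + 48 * K\<^sup>2 * C\<^sup>2"
  have k0: "0 < k" by (simp add: k_def add_pos_nonneg)
  have L0: "0 \<le> L" using k0 by (simp add: L_def)
  \<comment> \<open>With \<open>q\<close> above this gain, \<open>\<kappa>(V) a0(\<nu>) / 2\<close> is at least \<open>(3 + L \<phi>(\<nu>)) \<nu>\<^sup>2\<close>.\<close>
  have "gain (\<lambda>s. 2 * \<tau> (lw0 s) * (3 + L * \<phi> (lw0 s)))"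
    using L0 by (intro gain_mult gain_add gain_const gain_compose[OF \<tau>(1) glw0] gain_compose[OF \<phi> glw0]) auto
  then obtain q q' where q: "\<And>x. 1 \<le> q x" "\<And>x. 2 * \<tau> (lw0 \<bar>x\<bar>) * (3 + L * \<phi> (lw0 \<bar>x\<bar>)) \<le> q x"
      "\<And>x. (q has_real_derivative q' x) (at x)" "gain q" "gain q'" "smooth q"
    by (rule smooth_majorant) blast
  define \<kappa> where "\<kappa> s = q s + s * q' s" for s
  have \<kappa>: "gain \<kappa>" unfolding \<kappa>_def[abs_def] by (intro gain_add gain_mult gain_id q)
  define Vb where "Vb zb p x = V0 zb * q (V0 zb) + k * BM p p + 6 * BA x x"
    for zb :: "real^'nz" and p :: "real^'s" and x :: "real^'r"
  \<comment> \<open>A bound of \<open>\<kappa>(V)\<close> where the decay \<open>a0(\<nu>)\<close> is less than twice the supply \<open>\<gamma>\<^sub>0(e)\<close>.\<close>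
  define \<omega> where "\<omega> s = \<kappa> (aup (lwa (2 * (\<psi>e s * s\<^sup>2))))" for s
  have \<omega>: "gain \<omega>" unfolding \<omega>_def[abs_def]
    by (intro gain_compose[OF \<kappa>] gain_compose[OF gaup] gain_compose[OF glwa] gain_mult gain_const \<psi>e gain_power gain_id) auto
  define \<psi>\<gamma> where "\<psi>\<gamma> s = \<omega> s * \<psi>e s + L * (1 + \<phi> s)" for s
  have \<psi>\<gamma>: "gain \<psi>\<gamma>" unfolding \<psi>\<gamma>_def[abs_def]
    using L0 by (intro gain_add gain_mult gain_const \<omega> \<psi>e \<phi>) auto
  define upb where "upb s = aup s * q (aup s) + (k * K + 6 * K) * s\<^sup>2" for s
  define lwb where "lwb s = lw0 s + sqrt (s * (1 / (k * cM))) + sqrt (s * (1 / (6 * cA)))" for s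
  have upb: "vanishing_gain upb" unfolding upb_def[abs_def] power2_eq_square
    using k0 K0
    by (intro vanishing_gain_add vanishing_gain_mult[OF aup gain_compose[OF q(4) gaup]])
      (subst mult.commute, intro vanishing_gain_mult vanishing_gain_id gain_id gain_const, auto)
  have lwb: "vanishing_gain lwb" unfolding lwb_def[abs_def]
    using k0 BM(3) BA(3)
    by (intro vanishing_gain_add lw0 vanishing_gain_compose[OF vanishing_gain_sqrt] vanishing_gain_mult vanishing_gain_id gain_const) auto
  have BM0: "0 \<le> BM p p" for p
    by (rule order_trans[OF _ BM(4)]) (use BM(3) in simp)
  have BA0: "0 \<le> BA p p" for p
    by (rule order_trans[OF _ BA(4)]) (use BA(3) in simp)
  have bounds: "0 \<le> Vb zb p x \<and> Vb zb p x \<le> upb (norm zb + norm p + norm x) \<and>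
        norm zb + norm p + norm x \<le> lwb (Vb zb p x)" for zb p x
  proof (intro conjI)
    have Vq: "V0 zb \<le> V0 zb * q (V0 zb)" using mult_left_mono[OF q(1)[of "V0 zb"] V00[of zb]] by simp
    have kB: "0 \<le> k * BM p p" using k0 BM0[of p] by simp
    show nn: "0 \<le> Vb zb p x" unfolding Vb_def using kB BA0[of x] V00[of zb] Vq by linarith
    define n where "n = norm zb + norm p + norm x"
    have n: "0 \<le> n" "norm zb \<le> n" "norm p \<le> n" "norm x \<le> n" by (auto simp: n_def)
    have "V0 zb \<le> aup n" using up[of zb] gain_mono[OF gaup norm_ge_zero n(2)] by simp
    then have 1: "V0 zb * q (V0 zb) \<le> aup n * q (aup n)"
      using V00[of zb] gain_mono[OF q(4) V00[of zb]] gain_nonneg[OF q(4) V00[of zb]]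
      by (intro mult_mono) (auto intro: order_trans)
    have 2: "BM p p \<le> K * n\<^sup>2"
    proof -
      have "BM p p \<le> K * (norm p * norm p)" using KMK[of p p] by (simp add: mult.assoc)
      also have "\<dots> \<le> K * (n * n)" using n K0 by (intro mult_left_mono mult_mono) auto
      finally show ?thesis by (simp add: power2_eq_square)
    qed
    have 3: "BA x x \<le> K * n\<^sup>2"
    proof -
      have "BA x x \<le> K * (norm x * norm x)" using KAK[of x x] by (simp add: mult.assoc)
      also have "\<dots> \<le> K * (n * n)" using n K0 by (intro mult_left_mono mult_mono) auto
      finally show ?thesis by (simp add: power2_eq_square)
    qed
    have 4: "k * BM p p \<le> k * (K * n\<^sup>2)" using 2 k0 by (intro mult_left_mono) auto
    show "Vb zb p x \<le> upb (norm zb + norm p + norm x)"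
      unfolding n_def[symmetric] Vb_def upb_def using 1 3 4 by (simp add: algebra_simps)
    define s where "s = Vb zb p x"
    have s: "0 \<le> s" using nn by (simp add: s_def)
    have "V0 zb \<le> s" unfolding s_def Vb_def using kB BA0[of x] Vq by linarith
    then have a: "norm zb \<le> lw0 s" using low[of zb] by (intro lw0(2)) auto
    have kBs: "k * BM p p \<le> s" unfolding s_def Vb_def using BA0[of x] V00[of zb] Vq by linarith
    have ABs: "6 * BA x x \<le> s" unfolding s_def Vb_def using kB V00[of zb] Vq by linarith
    have b: "norm p \<le> sqrt (s * (1 / (k * cM)))"
    proof (rule real_le_rsqrt)
      have "k * (cM * (norm p)\<^sup>2) \<le> k * BM p p" using BM(4)[of p] k0 by (intro mult_left_mono) auto
      then have "(k * cM) * (norm p)\<^sup>2 \<le> s" using kBs by (simp add: mult.assoc)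
      then show "(norm p)\<^sup>2 \<le> s * (1 / (k * cM))"
        using k0 BM(3) by (simp add: pos_le_divide_eq mult.commute)
    qed
    have c: "norm x \<le> sqrt (s * (1 / (6 * cA)))"
    proof (rule real_le_rsqrt)
      have "(6 * cA) * (norm x)\<^sup>2 \<le> s" using ABs BA(4)[of x] by simp
      then show "(norm x)\<^sup>2 \<le> s * (1 / (6 * cA))"
        using BA(3) by (simp add: pos_le_divide_eq mult.commute)
    qed
    show "norm zb + norm p + norm x \<le> lwb (Vb zb p x)"
      unfolding s_def[symmetric] lwb_def using a b c by simp
  qed
  have V0d: "(V0 has_derivative frechet_derivative V0 (at y)) (at y)" for y
    using V0 by (simp add: frechet_derivative_works)
  have deriv: "\<exists>D. ((\<lambda>\<tau>. Vb (zb \<tau>) (p \<tau>) (x \<tau>)) has_real_derivative D) (at t within I) \<and>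
         D \<le> - (norm (zb t) + norm (p t) + norm (x t))\<^sup>2 + \<psi>\<gamma> \<bar>e\<bar> * e\<^sup>2 + 48 * K\<^sup>2 * C\<^sup>2 * d\<^sup>2"
    if zb: "(zb has_vector_derivative zb') (at t within I)"
      and zb': "frechet_derivative V0 (at (zb t)) zb' \<le> - a0 (norm (zb t)) + gam0 e"
      and p: "(p has_vector_derivative (M *v p t + h1)) (at t within I)"
      and x: "(x has_vector_derivative (A *v x t + h2)) (at t within I)"
      and h1: "norm h1 \<le> C * (\<bar>e\<bar> + G)" and h2: "norm h2 \<le> C * (\<bar>e\<bar> + d + norm (p t) + G)"
      and d: "0 \<le> d" and G: "0 \<le> G" "G \<le> \<psi>g (norm (zb t) + \<bar>e\<bar>) * (norm (zb t) + \<bar>e\<bar>)"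
    for zb p x zb' h1 h2 e d G t I
  proof -
    define \<nu> where "\<nu> = norm (zb t)"
    have \<nu>: "0 \<le> \<nu>" by (simp add: \<nu>_def)
    define V where "V = V0 (zb t)"
    define V' where "V' = frechet_derivative V0 (at (zb t)) zb'"
    have lin: "linear (frechet_derivative V0 (at (zb t)))" using V0d has_derivative_linear by blast
    have dV0: "((\<lambda>\<tau>. V0 (zb \<tau>)) has_real_derivative V') (at t within I)"
    proof -
      have "((\<lambda>\<tau>. V0 (zb \<tau>)) has_derivative (\<lambda>h. frechet_derivative V0 (at (zb t)) (h *\<^sub>R zb'))) (at t within I)"
        using zb V0d[of "zb t"] unfolding has_vector_derivative_def by (rule has_derivative_compose)
      then show ?thesis
        by (simp add: has_field_derivative_def V'_def linear_scale[OF lin] mult.commute[of _ "frechet_derivative V0 (at (zb t)) zb'"])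
    qed
    have dV: "((\<lambda>\<tau>. V0 (zb \<tau>) * q (V0 (zb \<tau>))) has_real_derivative (\<kappa> V * V')) (at t within I)"
    proof -
      have "((\<lambda>\<tau>. q (V0 (zb \<tau>))) has_real_derivative (q' V * V')) (at t within I)"
        unfolding V_def by (rule DERIV_chain2[OF q(3) dV0])
      from DERIV_mult[OF dV0 this] show ?thesis
        by (simp add: \<kappa>_def V_def algebra_simps)
    qed
    note dp = quadratic_form_derivative[OF BM(1,2,5) KMK p]
    note dx = quadratic_form_derivative[OF BA(1,2,5) KAK x]
    have total: "((\<lambda>\<tau>. Vb (zb \<tau>) (p \<tau>) (x \<tau>)) has_real_derivative
        (\<kappa> V * V' + k * (2 * BM (p t) (M *v p t + h1)) + 6 * (2 * BA (x t) (A *v x t + h2)))) (at t within I)"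
      unfolding Vb_def by (intro DERIV_add DERIV_cmult dV dp(1) dx(1))
    have V0V: "0 \<le> V" by (simp add: V_def V00)
    have \<gamma>0: "0 \<le> gam0 e" using gam(2) by (cases "e = 0") (auto simp: pos_def_fun_def less_imp_le)
    have "\<kappa> V * V' \<le> - (\<kappa> V * a0 \<nu> / 2) + \<omega> \<bar>e\<bar> * gam0 e"
    proof (rule supply_change)
      show "V' \<le> - a0 \<nu> + gam0 e" using zb' by (simp add: V'_def \<nu>_def)
      show "0 \<le> \<kappa> V" using gain_nonneg[OF \<kappa> V0V] .
      show "0 \<le> a0 \<nu>" using class_K_inf_nonneg[OF K(3) \<nu>] .
      show "0 \<le> \<omega> \<bar>e\<bar>" using gain_nonneg[OF \<omega>] by simp
      assume "a0 \<nu> < 2 * gam0 e"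
      also have "\<dots> \<le> 2 * (\<psi>e \<bar>e\<bar> * \<bar>e\<bar>\<^sup>2)" using \<psi>e(2)[of e] by simp
      finally have "\<nu> \<le> lwa (2 * (\<psi>e \<bar>e\<bar> * \<bar>e\<bar>\<^sup>2))" using \<nu> by (intro lwa(2)) auto
      then have "aup \<nu> \<le> aup (lwa (2 * (\<psi>e \<bar>e\<bar> * \<bar>e\<bar>\<^sup>2)))" using gain_mono[OF gaup \<nu>] by simp
      moreover have "V \<le> aup \<nu>" using up[of "zb t"] by (simp add: V_def \<nu>_def)
      ultimately show "\<kappa> V \<le> \<omega> \<bar>e\<bar>" unfolding \<omega>_def by (intro gain_mono[OF \<kappa> V0V]) simp
    qed (fact \<gamma>0)
    moreover have "\<omega> \<bar>e\<bar> * gam0 e \<le> \<omega> \<bar>e\<bar> * (\<psi>e \<bar>e\<bar> * e\<^sup>2)"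
      using gain_nonneg[OF \<omega>, of "\<bar>e\<bar>"] by (intro mult_left_mono \<psi>e) auto
    ultimately have 1: "\<kappa> V * V' \<le> - (\<kappa> V * a0 \<nu> / 2) + (\<omega> \<bar>e\<bar> * \<psi>e \<bar>e\<bar>) * e\<^sup>2" by (simp add: mult.assoc)
    have Q: "3 * \<nu>\<^sup>2 + L * \<phi> \<nu> * \<nu>\<^sup>2 \<le> \<kappa> V * a0 \<nu> / 2"
    proof -
      have le: "\<nu> \<le> lw0 V" using low[of "zb t"] \<nu> by (intro lw0(2)) (auto simp: V_def \<nu>_def)
      have 1: "\<tau> \<nu> \<le> \<tau> (lw0 V)" by (rule gain_mono[OF \<tau>(1) \<nu> le])
      have 2: "\<phi> \<nu> \<le> \<phi> (lw0 V)" by (rule gain_mono[OF \<phi> \<nu> le])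
      have 3: "0 \<le> \<tau> \<nu>" "0 \<le> \<phi> \<nu>" using gain_nonneg[OF \<tau>(1) \<nu>] gain_nonneg[OF \<phi> \<nu>] by auto
      have "2 * \<tau> \<nu> * (3 + L * \<phi> \<nu>) \<le> 2 * \<tau> (lw0 V) * (3 + L * \<phi> (lw0 V))"
        using 1 2 3 L0 by (intro mult_mono add_mono order_refl) auto
      also have "\<dots> \<le> q V" using q(2)[of V] V0V by simp
      also have "\<dots> \<le> \<kappa> V" using V0V gain_nonneg[OF q(5) V0V] by (simp add: \<kappa>_def)
      finally have "2 * \<tau> \<nu> * (3 + L * \<phi> \<nu>) * a0 \<nu> \<le> \<kappa> V * a0 \<nu>"
        by (rule mult_right_mono) (rule class_K_inf_nonneg[OF K(3) \<nu>])
      moreover have "(3 + L * \<phi> \<nu>) * \<nu>\<^sup>2 \<le> (3 + L * \<phi> \<nu>) * (\<tau> \<nu> * a0 \<nu>)"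
        using \<tau>(2)[OF \<nu>] 3 L0 by (intro mult_left_mono) auto
      ultimately show ?thesis by (simp add: algebra_simps)
    qed
    have G2: "G\<^sup>2 \<le> \<phi> \<nu> * \<nu>\<^sup>2 + \<phi> \<bar>e\<bar> * e\<^sup>2"
    proof -
      define m where "m = max \<nu> \<bar>e\<bar>"
      have m: "\<nu> + \<bar>e\<bar> \<le> 2 * m" "0 \<le> m" using \<nu> by (auto simp: m_def)
      have "\<psi>g (\<nu> + \<bar>e\<bar>) * (\<nu> + \<bar>e\<bar>) \<le> \<psi>g (2 * m) * (2 * m)"
        using gain_mono[OF \<psi>g _ m(1)] gain_nonneg[OF \<psi>g, of "2 * m"] m \<nu> by (intro mult_mono) auto
      then have "G \<le> \<psi>g (2 * m) * (2 * m)" using G(2) by (simp add: \<nu>_def)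
      then have "G\<^sup>2 \<le> (\<psi>g (2 * m) * (2 * m))\<^sup>2" using G(1) by (intro power_mono)
      also have "\<dots> = \<phi> m * m\<^sup>2" by (simp add: \<phi>_def power_mult_distrib)
      also have "\<dots> \<le> \<phi> \<nu> * \<nu>\<^sup>2 + \<phi> \<bar>e\<bar> * \<bar>e\<bar>\<^sup>2" unfolding m_def by (rule gain_square_max[OF \<phi> \<nu>]) simp
      finally show ?thesis by simp
    qed
    have "\<kappa> V * V' + k * (2 * BM (p t) (M *v p t + h1)) + 6 * (2 * BA (x t) (A *v x t + h2))
        \<le> - (\<nu> + norm (p t) + norm (x t))\<^sup>2
          + (\<omega> \<bar>e\<bar> * \<psi>e \<bar>e\<bar> + (4 * k * K\<^sup>2 * C\<^sup>2 + 48 * K\<^sup>2 * C\<^sup>2) * (1 + \<phi> \<bar>e\<bar>)) * e\<^sup>2 + 48 * K\<^sup>2 * C\<^sup>2 * d\<^sup>2"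
      by (rule lyapunov_sum_inequality[OF 1 dp(2) dx(2) norm_ge_zero h1 norm_ge_zero h2 \<nu>
            norm_ge_zero norm_ge_zero d G(1) G2 k_def])
        (use Q in \<open>simp add: L_def\<close>)
    with total show ?thesis unfolding \<nu>_def \<psi>\<gamma>_def L_def by blast
  qed
  have cont: "continuous_on UNIV (\<lambda>(zb, p, x). Vb zb p x)"
  proof -
    have cV0: "continuous_on UNIV V0" using C_k_SucD[of 0 V0] V0 by simp
    have cq: "continuous_on UNIV q" by (rule smooth_continuous_on[OF q(6)])
    show ?thesis unfolding Vb_def case_prod_unfold
      by (intro continuous_intros continuous_on_compose2[OF cV0] continuous_on_compose2[OF cq]
          bounded_bilinear.continuous_on[OF BM(1)] bounded_bilinear.continuous_on[OF BA(1)]) auto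
  qed
  show thesis
    by (rule that[of \<psi>\<gamma> "\<lambda>s. 48 * K\<^sup>2 * C\<^sup>2" upb lwb Vb])
      (fact \<psi>\<gamma> upb lwb bounds deriv cont gain_const | (rule gain_const, simp))+
qed

section \<open>The backstepping recursion\<close>

text \<open>The number \<open>n\<close> is the size of the subsystem in front of the chain \<open>y\<^sub>1, \<dots>, y\<^sub>k\<close>.\<close>

definition chain_size :: "nat \<Rightarrow> real \<Rightarrow> (nat \<Rightarrow> real) \<Rightarrow> real" where
  "chain_size k n y = n + (\<Sum>i=1..k. \<bar>y i\<bar>)"

text \<open>The perturbation of \<open>y\<^sub>1\<close> is bounded by a gain. Those of the later variables consist of
  the observer correction and of the derivative of the preceding virtual control
  \<open>\<rho>\<^sub>i\<^sub>-\<^sub>1(y\<^sub>i\<^sub>-\<^sub>1) y\<^sub>i\<^sub>-\<^sub>1\<close>.\<close>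

definition perturbation_bound :: "(real \<Rightarrow> real) \<Rightarrow> real \<Rightarrow> (nat \<Rightarrow> real \<Rightarrow> real) \<Rightarrow> real \<Rightarrow> real \<Rightarrow>
    (nat \<Rightarrow> real) \<Rightarrow> (nat \<Rightarrow> real) \<Rightarrow> (nat \<Rightarrow> real) \<Rightarrow> nat \<Rightarrow> bool" where
  "perturbation_bound \<psi>1 C \<rho> n d y y' G i \<longleftrightarrow>
     (if i = 1 then \<bar>G 1\<bar> \<le> \<psi>1 (n + \<bar>y 1\<bar> + d) * (n + \<bar>y 1\<bar> + d)
      else \<bar>G i\<bar> \<le> C * (n + \<bar>y 1\<bar> + d) + \<bar>deriv (\<lambda>s. \<rho> (i - 1) s * s) (y (i - 1)) * y' (i - 1)\<bar>)"

text \<open>The term \<open>a\<^sub>i\<close> is what the virtual control of the \<open>i\<close>-th variable fails to realise: the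
  next variable, and for \<open>i = k\<close> an external input. The entry \<open>a\<^sub>0 = y\<^sub>1\<close> is the input of the
  subsystem in front of the chain.\<close>

definition chain_equations :: "(real \<Rightarrow> real) \<Rightarrow> real \<Rightarrow> real \<Rightarrow> real \<Rightarrow> nat \<Rightarrow> (nat \<Rightarrow> real \<Rightarrow> real) \<Rightarrow>
    real \<Rightarrow> real \<Rightarrow> (nat \<Rightarrow> real) \<Rightarrow> (nat \<Rightarrow> real) \<Rightarrow> (nat \<Rightarrow> real) \<Rightarrow> (nat \<Rightarrow> real) \<Rightarrow> (nat \<Rightarrow> real) \<Rightarrow> bool" where
  "chain_equations \<psi>1 C \<beta>min \<beta>max k \<rho> n d y y' G \<beta> a \<longleftrightarrow>
     (\<forall>i\<in>{1..k}. y' i = \<beta> i * (- \<rho> i (y i) * y i + a i) + G i \<and> \<beta>min \<le> \<beta> i \<and> \<beta> i \<le> \<beta>max \<and>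
        perturbation_bound \<psi>1 C \<rho> n d y y' G i) \<and>
     (\<forall>i<k. a i = y (i + 1))"

lemma chain_size_Suc: "chain_size (Suc k) n y = chain_size k n y + \<bar>y (Suc k)\<bar>"
  by (simp add: chain_size_def)

lemma chain_size_nonneg: "0 \<le> n \<Longrightarrow> 0 \<le> chain_size k n y"
  by (simp add: chain_size_def add_nonneg_nonneg sum_nonneg)

lemma le_chain_size: "n \<le> chain_size k n y"
  by (simp add: chain_size_def sum_nonneg)

lemma component_le_chain_size:
  assumes "0 \<le> n" "i \<in> {1..k}" shows "\<bar>y i\<bar> \<le> chain_size k n y"
  using member_le_sum[of i "{1..k}" "\<lambda>i. \<bar>y i\<bar>"] assms by (simp add: chain_size_def)

lemma chain_size_1: "n + \<bar>y 1\<bar> \<le> chain_size (Suc k) n y"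
  using member_le_sum[of 1 "{1..Suc k}" "\<lambda>i. \<bar>y i\<bar>"] by (simp add: chain_size_def)

lemma chain_equations_fun_upd:
  assumes "chain_equations \<psi>1 C \<beta>min \<beta>max (Suc k) (\<rho>(Suc k := \<rho>n)) n d y y' G \<beta> a"
  shows "chain_equations \<psi>1 C \<beta>min \<beta>max k \<rho> n d y y' G \<beta> a"
    "perturbation_bound \<psi>1 C \<rho> n d y y' G (Suc k)" "a k = y (Suc k)"
    "y' (Suc k) = \<beta> (Suc k) * (- \<rho>n (y (Suc k)) * y (Suc k) + a (Suc k)) + G (Suc k)"
    "\<beta>min \<le> \<beta> (Suc k)" "\<beta> (Suc k) \<le> \<beta>max"
proof -
  have pb: "perturbation_bound \<psi>1 C (\<rho>(Suc k := \<rho>n)) n d y y' G i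
      = perturbation_bound \<psi>1 C \<rho> n d y y' G i" if "1 \<le> i" "i \<le> Suc k" for i
    using that by (auto simp: perturbation_bound_def)
  show "chain_equations \<psi>1 C \<beta>min \<beta>max k \<rho> n d y y' G \<beta> a"
    using assms pb unfolding chain_equations_def by (auto split: if_splits)
  show "perturbation_bound \<psi>1 C \<rho> n d y y' G (Suc k)"
    using assms pb[of "Suc k"] unfolding chain_equations_def by auto
  show "a k = y (Suc k)" "\<beta>min \<le> \<beta> (Suc k)" "\<beta> (Suc k) \<le> \<beta>max"
    "y' (Suc k) = \<beta> (Suc k) * (- \<rho>n (y (Suc k)) * y (Suc k) + a (Suc k)) + G (Suc k)"
    using assms unfolding chain_equations_def by auto
qed

text \<open>Everything that one stage of the recursion has to hand to the next one. The Lyapunov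
  function \<open>W\<close> extends a function \<open>V\<close> of the subsystem in front of the chain, and \<open>d\<close> is the
  size of the sampling errors. The perturbation of the next variable is bounded here because it
  involves the derivatives of the variables treated so far.\<close>

locale backstepping_stage =
  fixes \<psi>\<gamma> \<psi>0 \<psi>1 :: "real \<Rightarrow> real" and C \<beta>min \<beta>max :: real and up0 lw0 :: "real \<Rightarrow> real" and k :: nat
    and \<rho> :: "nat \<Rightarrow> real \<Rightarrow> real" and W :: "real \<Rightarrow> (nat \<Rightarrow> real) \<Rightarrow> real"
    and \<psi>a \<psi>\<pi> up lw \<psi>G :: "real \<Rightarrow> real"
  assumes gain_smooth: "\<And>i. i \<in> {1..k} \<Longrightarrow> smooth (\<rho> i)"
    and gain_ge_1: "\<And>i s. i \<in> {1..k} \<Longrightarrow> 1 \<le> \<rho> i s"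
    and \<psi>a: "gain \<psi>a" and \<psi>\<pi>: "gain \<psi>\<pi>" and up: "vanishing_gain up" and lw: "vanishing_gain lw"
    and \<psi>G: "gain \<psi>G"
    and size: "\<And>n V y. 0 \<le> n \<Longrightarrow> 0 \<le> V \<Longrightarrow> V \<le> up0 n \<Longrightarrow> n \<le> lw0 V \<Longrightarrow>
        0 \<le> W V y \<and> W V y \<le> up (chain_size k n y) \<and> chain_size k n y \<le> lw (W V y)"
    and decay: "\<And>V V' ys y' t I n d G \<beta> a.
        0 \<le> n \<Longrightarrow> 0 \<le> d \<Longrightarrow> 0 \<le> V t \<Longrightarrow> V t \<le> up0 n \<Longrightarrow> n \<le> lw0 (V t) \<Longrightarrow>
        (V has_real_derivative V') (at t within I) \<Longrightarrow>
        V' \<le> - n\<^sup>2 + \<psi>\<gamma> \<bar>a 0\<bar> * (a 0)\<^sup>2 + \<psi>0 d * d\<^sup>2 \<Longrightarrow>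
        \<forall>i\<in>{1..k}. (ys i has_real_derivative y' i) (at t within I) \<Longrightarrow>
        chain_equations \<psi>1 C \<beta>min \<beta>max k \<rho> n d (\<lambda>i. ys i t) y' G \<beta> a \<Longrightarrow>
        \<exists>D. ((\<lambda>\<tau>. W (V \<tau>) (\<lambda>i. ys i \<tau>)) has_real_derivative D) (at t within I) \<and>
           D \<le> - (chain_size k n (\<lambda>i. ys i t))\<^sup>2
             - (if k = 0 then 0 else \<beta>min / 2 * \<rho> k (ys k t) * (ys k t)\<^sup>2)
             + \<psi>a \<bar>a k\<bar> * (a k)\<^sup>2 + \<psi>\<pi> d * d\<^sup>2"
    and perturbation: "\<And>n d y y' G \<beta> a. 0 \<le> n \<Longrightarrow> 0 \<le> d \<Longrightarrow>
        chain_equations \<psi>1 C \<beta>min \<beta>max k \<rho> n d y y' G \<beta> a \<Longrightarrow>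
        perturbation_bound \<psi>1 C \<rho> n d y y' G (Suc k) \<Longrightarrow> a k = y (Suc k) \<Longrightarrow>
        \<bar>G (Suc k)\<bar> \<le> \<psi>G (chain_size (Suc k) n y + d) * (chain_size (Suc k) n y + d)"
    and cont: "\<And>V ys A. continuous_on A V \<Longrightarrow> \<forall>i\<in>{1..k}. continuous_on A (ys i) \<Longrightarrow>
        continuous_on A (\<lambda>\<tau>::real. W (V \<tau>) (\<lambda>i. ys i \<tau>))"
    and last_gain: "0 < k \<Longrightarrow> \<psi>a = (\<lambda>s. \<beta>max\<^sup>2 / 2)"

text \<open>The gain \<open>\<rho>\<^sub>k\<^sub>+\<^sub>1\<close> is fixed by \<open>backstepping_step\<close> before the perturbation of the variable
  after it is estimated, since that perturbation contains the derivative of \<open>\<rho>\<^sub>k\<^sub>+\<^sub>1(y) y\<close>.\<close>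

lemma backstepping_chain:
  assumes g: "gain \<psi>\<gamma>" "gain \<psi>0" "gain \<psi>1" "vanishing_gain up0" "vanishing_gain lw0"
    and \<beta>: "0 < \<beta>min" "\<beta>min \<le> \<beta>max" and C: "0 \<le> C"
  shows "\<exists>\<rho> W \<psi>a \<psi>\<pi> up lw \<psi>G.
    backstepping_stage \<psi>\<gamma> \<psi>0 \<psi>1 C \<beta>min \<beta>max up0 lw0 k \<rho> W \<psi>a \<psi>\<pi> up lw \<psi>G"
proof (induction k)
  case 0
  have "backstepping_stage \<psi>\<gamma> \<psi>0 \<psi>1 C \<beta>min \<beta>max up0 lw0 0 (\<lambda>_ _. 1) (\<lambda>V y. V) \<psi>\<gamma> \<psi>0 up0 lw0 \<psi>1"
    by unfold_locales (use g in \<open>auto simp: chain_size_def perturbation_bound_def\<close>)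
  then show ?case by blast
next
  case (Suc k)
  then obtain \<rho> W \<psi>a \<psi>\<pi> up lw \<psi>G where
    st: "backstepping_stage \<psi>\<gamma> \<psi>0 \<psi>1 C \<beta>min \<beta>max up0 lw0 k \<rho> W \<psi>a \<psi>\<pi> up lw \<psi>G" by blast
  interpret st: backstepping_stage \<psi>\<gamma> \<psi>0 \<psi>1 C \<beta>min \<beta>max up0 lw0 k \<rho> W \<psi>a \<psi>\<pi> up lw \<psi>G by (rule st)
  note gg = st.\<psi>a st.\<psi>\<pi> st.up st.lw st.\<psi>G
  have gup: "gain up" and glw: "gain lw" using gg by (auto simp: vanishing_gain_def)
  obtain p p' \<rho>n \<psi>\<pi>' where p: "\<And>x. 1 \<le> p x" "\<And>x. (p has_real_derivative p' x) (at x)" "gain p" "gain p'"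
    and \<rho>n: "smooth \<rho>n" "\<And>x. 1 \<le> \<rho>n x" and \<psi>\<pi>': "gain \<psi>\<pi>'"
    and step: "\<And>n y d V V' G \<beta> a. \<lbrakk>0 \<le> n; 0 \<le> d; 0 \<le> V; V \<le> up n; n \<le> lw V;
       V' \<le> - n\<^sup>2 + \<psi>a \<bar>y\<bar> * y\<^sup>2 + \<psi>\<pi> d * d\<^sup>2;
       \<bar>G\<bar> \<le> \<psi>G (n + \<bar>y\<bar> + d) * (n + \<bar>y\<bar> + d); \<beta>min \<le> \<beta>; \<beta> \<le> \<beta>max\<rbrakk> \<Longrightarrow>
       (p V + V * p' V) * V' + y * (\<beta> * (- \<rho>n y * y + a) + G)
         \<le> - (n + \<bar>y\<bar>)\<^sup>2 - \<beta>min / 2 * \<rho>n y * y\<^sup>2 + \<beta>max\<^sup>2 / 2 * a\<^sup>2 + \<psi>\<pi>' d * d\<^sup>2"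
    by (rule backstepping_step[OF gg(1,2,5) gup glw \<beta>]) blast
  define \<rho>' where "\<rho>' = \<rho>(Suc k := \<rho>n)"
  define W' where "W' V y = W V y * p (W V y) + (y (Suc k))\<^sup>2 / 2" for V y
  define up' where "up' s = up s * p (up s) + s * (s / 2)" for s
  define lw' where "lw' s = lw s + sqrt (s * 2)" for s
  have up': "vanishing_gain up'" unfolding up'_def[abs_def]
    by (intro vanishing_gain_add vanishing_gain_mult gg gain_compose[OF p(3) gup] vanishing_gain_id gain_divide gain_id) auto
  have lw': "vanishing_gain lw'" unfolding lw'_def[abs_def]
    by (intro vanishing_gain_add gg vanishing_gain_compose[OF vanishing_gain_sqrt] vanishing_gain_mult vanishing_gain_id gain_const) auto
  have "smooth (\<lambda>s. \<rho>n s *\<^sub>R s)" by (intro smooth_scaleR \<rho>n smooth_bounded_linear bounded_linear_ident)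
  then have sm: "smooth (\<lambda>s. \<rho>n s * s)" by simp
  obtain \<psi>D where \<psi>D: "gain \<psi>D" "\<And>x. \<bar>deriv (\<lambda>s. \<rho>n s * s) x\<bar> \<le> \<psi>D (norm x)"
    using gain_of_continuous[OF smooth_continuous_on[OF smooth_deriv(2)[OF sm]]] by metis
  obtain \<psi>R where \<psi>R: "gain \<psi>R" "\<And>x. \<bar>\<rho>n x\<bar> \<le> \<psi>R (norm x)"
    using gain_of_continuous[OF smooth_continuous_on[OF \<rho>n(1)]] by metis
  define \<psi>G' where "\<psi>G' s = C + \<psi>D s * (\<beta>max * (\<psi>R s + 1) + \<psi>G s)" for s
  have \<psi>G': "gain \<psi>G'" unfolding \<psi>G'_def[abs_def]
    using \<beta> C by (intro gain_add gain_mult gain_const \<psi>D \<psi>R gg) auto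
  have size': "0 \<le> W' V y \<and> W' V y \<le> up' (chain_size (Suc k) n y) \<and> chain_size (Suc k) n y \<le> lw' (W' V y)"
    if h: "0 \<le> n" "0 \<le> V" "V \<le> up0 n" "n \<le> lw0 V" for n V y
  proof -
    define w where "w = W V y"
    define m where "m = chain_size (Suc k) n y"
    have w: "0 \<le> w" "w \<le> up (chain_size k n y)" "chain_size k n y \<le> lw w" using st.size[OF h] by (auto simp: w_def)
    have m: "chain_size k n y \<le> m" "\<bar>y (Suc k)\<bar> \<le> m" "0 \<le> chain_size k n y"
      using chain_size_nonneg[OF h(1)] by (auto simp: m_def chain_size_Suc)
    have wm: "w \<le> up m" using w gain_mono[OF gup m(3,1)] by simp
    have "w * p w \<le> up m * p (up m)"
      using wm w gain_mono[OF p(3) w(1) wm] gain_nonneg[OF p(3) w(1)] by (intro mult_mono) auto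
    moreover have "(y (Suc k))\<^sup>2 \<le> m\<^sup>2" using m by (simp add: abs_le_square_iff[symmetric])
    ultimately have 1: "W' V y \<le> up' m" by (simp add: W'_def up'_def w_def power2_eq_square)
    have wp: "w \<le> w * p w" using mult_left_mono[OF p(1)[of w] w(1)] by simp
    have 2: "0 \<le> W' V y" using w wp unfolding W'_def w_def[symmetric] by simp
    have "w \<le> W' V y"
      using wp zero_le_power2[of "y (Suc k)"] unfolding W'_def w_def[symmetric] by linarith
    then have "chain_size k n y \<le> lw (W' V y)" using w gain_mono[OF glw w(1)] by (meson order_trans)
    moreover have "\<bar>y (Suc k)\<bar> \<le> sqrt (W' V y * 2)"
      by (rule real_le_rsqrt) (use w wp in \<open>simp add: W'_def w_def[symmetric]\<close>)
    ultimately have "m \<le> lw' (W' V y)" by (simp add: m_def lw'_def chain_size_Suc)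
    with 1 2 show ?thesis by (simp add: m_def)
  qed
  have deriv': "\<exists>D. ((\<lambda>\<tau>. W' (V \<tau>) (\<lambda>i. ys i \<tau>)) has_real_derivative D) (at t within I) \<and>
           D \<le> - (chain_size (Suc k) n (\<lambda>i. ys i t))\<^sup>2
             - \<beta>min / 2 * \<rho>n (ys (Suc k) t) * (ys (Suc k) t)\<^sup>2
             + \<beta>max\<^sup>2 / 2 * (a (Suc k))\<^sup>2 + \<psi>\<pi>' d * d\<^sup>2"
    if h: "0 \<le> n" "0 \<le> d" "0 \<le> V t" "V t \<le> up0 n" "n \<le> lw0 (V t)"
      and V: "(V has_real_derivative V') (at t within I)"
      and V': "V' \<le> - n\<^sup>2 + \<psi>\<gamma> \<bar>a 0\<bar> * (a 0)\<^sup>2 + \<psi>0 d * d\<^sup>2"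
      and ys: "\<forall>i\<in>{1..Suc k}. (ys i has_real_derivative y' i) (at t within I)"
      and eqs: "chain_equations \<psi>1 C \<beta>min \<beta>max (Suc k) \<rho>' n d (\<lambda>i. ys i t) y' G \<beta> a"
    for V V' ys y' t I n d G \<beta> a
  proof -
    note eq = chain_equations_fun_upd[OF eqs[unfolded \<rho>'_def]]
    have "\<exists>D. ((\<lambda>\<tau>. W (V \<tau>) (\<lambda>i. ys i \<tau>)) has_real_derivative D) (at t within I) \<and>
           D \<le> - (chain_size k n (\<lambda>i. ys i t))\<^sup>2
             - (if k = 0 then 0 else \<beta>min / 2 * \<rho> k (ys k t) * (ys k t)\<^sup>2)
             + \<psi>a \<bar>a k\<bar> * (a k)\<^sup>2 + \<psi>\<pi> d * d\<^sup>2"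
    proof (rule st.decay[where V = V and ys = ys and V' = V' and y' = y' and G = G and \<beta> = \<beta>])
      show "\<forall>i\<in>{1..k}. (ys i has_real_derivative y' i) (at t within I)" using ys by auto
    qed (fact h V V' eq(1))+
    then obtain D where D: "((\<lambda>\<tau>. W (V \<tau>) (\<lambda>i. ys i \<tau>)) has_real_derivative D) (at t within I)"
      "D \<le> - (chain_size k n (\<lambda>i. ys i t))\<^sup>2
             - (if k = 0 then 0 else \<beta>min / 2 * \<rho> k (ys k t) * (ys k t)\<^sup>2)
             + \<psi>a \<bar>a k\<bar> * (a k)\<^sup>2 + \<psi>\<pi> d * d\<^sup>2" by blast
    have "0 \<le> (if k = 0 then 0 else \<beta>min / 2 * \<rho> k (ys k t) * (ys k t)\<^sup>2)"
    proof (cases "k = 0")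
      case False
      then have "1 \<le> \<rho> k (ys k t)" using st.gain_ge_1 by auto
      then show ?thesis using \<beta> by simp
    qed simp
    with D(2) have D2: "D \<le> - (chain_size k n (\<lambda>i. ys i t))\<^sup>2
        + \<psi>a \<bar>ys (Suc k) t\<bar> * (ys (Suc k) t)\<^sup>2 + \<psi>\<pi> d * d\<^sup>2" using eq(3) by simp
    define w where "w = W (V t) (\<lambda>i. ys i t)"
    have w: "0 \<le> w" "w \<le> up (chain_size k n (\<lambda>i. ys i t))" "chain_size k n (\<lambda>i. ys i t) \<le> lw w"
      using st.size[OF h(1,3,4,5)] by (auto simp: w_def)
    have GG: "\<bar>G (Suc k)\<bar> \<le> \<psi>G (chain_size k n (\<lambda>i. ys i t) + \<bar>ys (Suc k) t\<bar> + d)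
        * (chain_size k n (\<lambda>i. ys i t) + \<bar>ys (Suc k) t\<bar> + d)"
      using st.perturbation[OF h(1,2) eq(1,2,3)] by (simp add: chain_size_Suc)
    note ineq = step[OF chain_size_nonneg[OF h(1)] h(2) w D2 GG eq(5,6), where a = "a (Suc k)"]
    have dk: "(ys (Suc k) has_real_derivative y' (Suc k)) (at t within I)" using ys by auto
    have dp: "((\<lambda>\<tau>. p (W (V \<tau>) (\<lambda>i. ys i \<tau>))) has_real_derivative (p' w * D)) (at t within I)"
      unfolding w_def by (rule DERIV_chain2[OF p(2) D(1)])
    have dq: "((\<lambda>\<tau>. (ys (Suc k) \<tau>)\<^sup>2 / 2) has_real_derivative (ys (Suc k) t * y' (Suc k))) (at t within I)"
      by (rule derivative_eq_intros dk refl | simp)+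
    have "((\<lambda>\<tau>. W' (V \<tau>) (\<lambda>i. ys i \<tau>)) has_real_derivative
        ((p w + w * p' w) * D + ys (Suc k) t * y' (Suc k))) (at t within I)"
      using DERIV_add[OF DERIV_mult[OF D(1) dp] dq] unfolding W'_def by (simp add: w_def algebra_simps)
    with ineq show ?thesis unfolding eq(4) by (auto simp: chain_size_Suc)
  qed
  have Gb': "\<bar>G (Suc (Suc k))\<bar> \<le> \<psi>G' (chain_size (Suc (Suc k)) n y + d) * (chain_size (Suc (Suc k)) n y + d)"
    if h: "0 \<le> n" "0 \<le> d"
      and eqs: "chain_equations \<psi>1 C \<beta>min \<beta>max (Suc k) \<rho>' n d y y' G \<beta> a"
      and pb: "perturbation_bound \<psi>1 C \<rho>' n d y y' G (Suc (Suc k))" and a: "a (Suc k) = y (Suc (Suc k))"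
    for n d y y' G \<beta> a
  proof -
    note eq = chain_equations_fun_upd[OF eqs[unfolded \<rho>'_def]]
    define m1 where "m1 = chain_size (Suc k) n y + d"
    define m where "m = chain_size (Suc (Suc k)) n y + d"
    have yk: "\<bar>y (Suc k)\<bar> \<le> chain_size (Suc k) n y"
      by (rule component_le_chain_size[OF h(1)]) simp
    have m: "0 \<le> m1" "m1 \<le> m" "\<bar>y (Suc k)\<bar> \<le> m" "\<bar>y (Suc (Suc k))\<bar> \<le> m" "n + \<bar>y 1\<bar> + d \<le> m" "0 \<le> m"
      using h(2) chain_size_nonneg[OF h(1), of "Suc k" y] yk
        chain_size_Suc[of "Suc k" n y] chain_size_1[of n y k]
      unfolding m_def m1_def by linarith+
    have G1: "\<bar>G (Suc k)\<bar> \<le> \<psi>G m * m"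
    proof -
      have "\<bar>G (Suc k)\<bar> \<le> \<psi>G m1 * m1" using st.perturbation[OF h eq(1,2,3)] by (simp add: m1_def)
      also have "\<dots> \<le> \<psi>G m * m"
        using m gain_mono[OF gg(5) m(1,2)] gain_nonneg[OF gg(5) m(6)] by (intro mult_mono) auto
      finally show ?thesis .
    qed
    have R1: "\<bar>\<rho>n (y (Suc k))\<bar> \<le> \<psi>R m" and D1: "\<bar>deriv (\<lambda>s. \<rho>n s * s) (y (Suc k))\<bar> \<le> \<psi>D m"
      using \<psi>R(2)[of "y (Suc k)"] \<psi>D(2)[of "y (Suc k)"] gain_mono[OF \<psi>R(1) _ m(3)] gain_mono[OF \<psi>D(1) _ m(3)] by auto
    have 0: "0 \<le> \<psi>R m" "0 \<le> \<psi>D m" "0 \<le> \<psi>G m"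
      using gain_nonneg[OF \<psi>R(1) m(6)] gain_nonneg[OF \<psi>D(1) m(6)] gain_nonneg[OF gg(5) m(6)] by auto
    have y': "\<bar>y' (Suc k)\<bar> \<le> (\<beta>max * (\<psi>R m + 1) + \<psi>G m) * m"
    proof -
      have "\<bar>- \<rho>n (y (Suc k)) * y (Suc k) + a (Suc k)\<bar> \<le> \<bar>\<rho>n (y (Suc k))\<bar> * \<bar>y (Suc k)\<bar> + \<bar>y (Suc (Suc k))\<bar>"
        unfolding a abs_mult[symmetric] using abs_triangle_ineq[of "- \<rho>n (y (Suc k)) * y (Suc k)" "y (Suc (Suc k))"] by simp
      also have "\<dots> \<le> \<psi>R m * m + m" using R1 m 0 by (intro add_mono mult_mono) auto
      finally have le: "\<bar>- \<rho>n (y (Suc k)) * y (Suc k) + a (Suc k)\<bar> \<le> \<psi>R m * m + m" .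
      have "\<bar>y' (Suc k)\<bar> \<le> \<bar>\<beta> (Suc k)\<bar> * \<bar>- \<rho>n (y (Suc k)) * y (Suc k) + a (Suc k)\<bar> + \<bar>G (Suc k)\<bar>"
        unfolding eq(4) abs_mult[symmetric] by (rule abs_triangle_ineq)
      also have "\<dots> \<le> \<beta>max * (\<psi>R m * m + m) + \<psi>G m * m"
        using le G1 eq(5,6) \<beta> by (intro add_mono mult_mono) auto
      finally show ?thesis by (simp add: algebra_simps)
    qed
    have "\<bar>G (Suc (Suc k))\<bar> \<le> C * (n + \<bar>y 1\<bar> + d) + \<bar>deriv (\<lambda>s. \<rho>n s * s) (y (Suc k)) * y' (Suc k)\<bar>"
      using pb by (simp add: perturbation_bound_def \<rho>'_def)
    also have "\<dots> \<le> C * m + \<psi>D m * ((\<beta>max * (\<psi>R m + 1) + \<psi>G m) * m)"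
      unfolding abs_mult using C m D1 y' 0 by (intro add_mono mult_left_mono mult_mono) auto
    also have "\<dots> = \<psi>G' m * m" by (simp add: \<psi>G'_def algebra_simps)
    finally show ?thesis by (simp add: m_def)
  qed
  have cont': "continuous_on A (\<lambda>\<tau>. W' (V \<tau>) (\<lambda>i. ys i \<tau>))"
    if "continuous_on A V" "\<forall>i\<in>{1..Suc k}. continuous_on A (ys i)" for V :: "real \<Rightarrow> real" and ys and A
  proof -
    have "continuous_on UNIV p"
      using p(2) DERIV_isCont by (intro continuous_at_imp_continuous_on) blast
    moreover have W: "continuous_on A (\<lambda>\<tau>. W (V \<tau>) (\<lambda>i. ys i \<tau>))"
      by (rule st.cont) (use that in auto)
    ultimately have "continuous_on A (\<lambda>\<tau>. p (W (V \<tau>) (\<lambda>i. ys i \<tau>)))"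
      by (rule continuous_on_compose2) simp
    moreover have "continuous_on A (\<lambda>\<tau>. (ys (Suc k) \<tau>)\<^sup>2 / 2)"
      using that(2) by (intro continuous_intros) auto
    ultimately show ?thesis unfolding W'_def using W by (intro continuous_on_add continuous_on_mult)
  qed
  have "backstepping_stage \<psi>\<gamma> \<psi>0 \<psi>1 C \<beta>min \<beta>max up0 lw0 (Suc k) \<rho>' W' (\<lambda>s. \<beta>max\<^sup>2 / 2) \<psi>\<pi>' up' lw' \<psi>G'"
  proof
    show "smooth (\<rho>' i)" "1 \<le> \<rho>' i s" if "i \<in> {1..Suc k}" for i s
      using st.gain_smooth[of i] st.gain_ge_1[of i s] \<rho>n that by (auto simp: \<rho>'_def le_Suc_eq)
    show "gain (\<lambda>s. \<beta>max\<^sup>2 / 2)" by (rule gain_const) simp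
    have "(if Suc k = 0 then 0 else \<beta>min / 2 * \<rho>' (Suc k) s * s\<^sup>2) = \<beta>min / 2 * \<rho>n s * s\<^sup>2" for s
      by (simp add: \<rho>'_def)
    note if_eq = this
    fix V V' ys y' t I n d G \<beta> a
    assume "0 \<le> n" "0 \<le> d" "0 \<le> V t" "V t \<le> up0 n" "n \<le> lw0 (V t)"
      "(V has_real_derivative V') (at t within I)"
      "V' \<le> - n\<^sup>2 + \<psi>\<gamma> \<bar>a 0\<bar> * (a 0)\<^sup>2 + \<psi>0 d * d\<^sup>2"
      "\<forall>i\<in>{1..Suc k}. (ys i has_real_derivative y' i) (at t within I)"
      "chain_equations \<psi>1 C \<beta>min \<beta>max (Suc k) \<rho>' n d (\<lambda>i. ys i t) y' G \<beta> a"
    then show "\<exists>D. ((\<lambda>\<tau>. W' (V \<tau>) (\<lambda>i. ys i \<tau>)) has_real_derivative D) (at t within I) \<and>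
           D \<le> - (chain_size (Suc k) n (\<lambda>i. ys i t))\<^sup>2
             - (if Suc k = 0 then 0 else \<beta>min / 2 * \<rho>' (Suc k) (ys (Suc k) t) * (ys (Suc k) t)\<^sup>2)
             + \<beta>max\<^sup>2 / 2 * (a (Suc k))\<^sup>2 + \<psi>\<pi>' d * d\<^sup>2"
      unfolding if_eq by (rule deriv')
  qed (rule size' Gb' cont' \<psi>\<pi>' up' lw' \<psi>G' refl; assumption)+
  then show ?case by blast
qed

section \<open>Observer coordinates of a chain of integrators\<close>

text \<open>For \<open>c\<^sub>k = \<Psi> M\<^sup>k N\<close> these coordinates bring a chain of integrators whose input contains
  \<open>\<Psi> P\<close>, with \<open>P\<close> a state of \<open>(M, N)\<close>, into observer form: \<open>Y\<^sub>0\<close> enters the \<open>k\<close>-th equation with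
  the factor \<open>c\<^sub>k\<close>.\<close>

definition observer_coord :: "(nat \<Rightarrow> real) \<Rightarrow> (nat \<Rightarrow> real) \<Rightarrow> nat \<Rightarrow> real" where
  "observer_coord c Y k = Y k - (\<Sum>j<k. c (k - 1 - j) * Y j)"

lemma observer_coord_add: "observer_coord c (\<lambda>j. Y j + Z j) k = observer_coord c Y k + observer_coord c Z k"
  by (simp add: observer_coord_def algebra_simps sum.distrib)

lemma observer_coord_cong: "(\<And>j. j \<le> k \<Longrightarrow> Y j = Z j) \<Longrightarrow> observer_coord c Y k = observer_coord c Z k"
  by (simp add: observer_coord_def)

lemma observer_coord_shift:
  "observer_coord c (\<lambda>j. Y (Suc j)) k = observer_coord c Y (Suc k) + c k * Y 0"
  unfolding observer_coord_def by (subst sum.lessThan_Suc_shift) simp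

text \<open>The change of coordinates is triangular with ones on the diagonal, so it can be inverted
  recursively.\<close>

lemma observer_coord_inverse_bound:
  obtains R where "\<And>Y. (\<And>j. j \<le> k \<Longrightarrow> \<bar>observer_coord c Y j\<bar> \<le> B) \<Longrightarrow> \<bar>Y k\<bar> \<le> R"
proof -
  have "\<exists>R. \<forall>Y. (\<forall>j\<le>k. \<bar>observer_coord c Y j\<bar> \<le> B) \<longrightarrow> \<bar>Y k\<bar> \<le> R"
  proof (induction k rule: less_induct)
    case (less k)
    then obtain R where R: "\<And>i Y. i < k \<Longrightarrow> (\<forall>j\<le>i. \<bar>observer_coord c Y j\<bar> \<le> B) \<Longrightarrow> \<bar>Y i\<bar> \<le> R i"
      by metis
    have "\<bar>Y k\<bar> \<le> B + (\<Sum>j<k. \<bar>c (k - 1 - j)\<bar> * R j)" if Y: "\<forall>j\<le>k. \<bar>observer_coord c Y j\<bar> \<le> B" for Y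
    proof -
      have "Y k = observer_coord c Y k + (\<Sum>j<k. c (k - 1 - j) * Y j)" by (simp add: observer_coord_def)
      also have "\<bar>\<dots>\<bar> \<le> \<bar>observer_coord c Y k\<bar> + \<bar>\<Sum>j<k. c (k - 1 - j) * Y j\<bar>" by (rule abs_triangle_ineq)
      also have "\<bar>\<Sum>j<k. c (k - 1 - j) * Y j\<bar> \<le> (\<Sum>j<k. \<bar>c (k - 1 - j)\<bar> * R j)"
      proof (rule order_trans[OF sum_abs sum_mono])
        fix j assume "j \<in> {..<k}"
        then have "\<bar>Y j\<bar> \<le> R j" using Y by (intro R) auto
        then show "\<bar>c (k - 1 - j) * Y j\<bar> \<le> \<bar>c (k - 1 - j)\<bar> * R j"
          unfolding abs_mult by (intro mult_left_mono) auto
      qed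
      finally show ?thesis using Y by force
    qed
    then show ?case by blast
  qed
  with that show thesis by blast
qed

lemma observer_coord_abs_le:
  assumes "\<And>j. j \<le> k \<Longrightarrow> \<bar>Y j\<bar> \<le> B"
  shows "\<bar>observer_coord c Y k\<bar> \<le> (1 + (\<Sum>j<k. \<bar>c j\<bar>)) * B"
proof -
  have "\<bar>observer_coord c Y k\<bar> \<le> \<bar>Y k\<bar> + \<bar>\<Sum>j<k. c (k - 1 - j) * Y j\<bar>"
    unfolding observer_coord_def by (rule abs_triangle_ineq4)
  also have "\<bar>\<Sum>j<k. c (k - 1 - j) * Y j\<bar> \<le> (\<Sum>j<k. \<bar>c (k - 1 - j)\<bar> * B)"
    by (rule order_trans[OF sum_abs sum_mono]) (use assms in \<open>auto simp: abs_mult intro!: mult_left_mono\<close>)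
  also have "(\<Sum>j<k. \<bar>c (k - 1 - j)\<bar> * B) = (\<Sum>j<k. \<bar>c j\<bar>) * B"
    unfolding sum_distrib_right using sum.nat_diff_reindex[of "\<lambda>j. \<bar>c j\<bar> * B" k] by simp
  finally show ?thesis using assms[of k] by (simp add: algebra_simps)
qed

text \<open>\<open>Y\<close> lists the states of the chain at time \<open>t\<close>, followed by its input \<open>Y\<^sub>r\<close>, which is also
  the input of the system \<open>P\<close>. In \<open>P - \<Sum>\<^sub>k X\<^sub>k M\<^sup>r\<^sup>-\<^sup>1\<^sup>-\<^sup>k N\<close> the inputs of the two systems
  cancel and the sum telescopes down to \<open>Y\<^sub>0\<close>. The last observer coordinate of \<open>Y\<close> is the input
  of the chain with \<open>\<Psi> P\<close> removed, up to \<open>\<Psi> E\<close>.\<close>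

lemma canonical_form_dynamics:
  fixes M :: "real^'s^'s" and N \<Psi> :: "real^'s" and X :: "nat \<Rightarrow> real \<Rightarrow> real" and P :: "real \<Rightarrow> real^'s"
  defines "Nk \<equiv> \<lambda>k. ((*v) M ^^ k) N" and "c \<equiv> \<lambda>k. \<Psi> \<bullet> ((*v) M ^^ k) N"
  assumes X_all: "\<forall>k<r. (X k has_real_derivative (Y (Suc k) + \<gamma> k)) (at t within I)"
    and Y_all: "\<forall>k<r. Y k = X k t"
    and P: "(P has_vector_derivative (M *v P t + Y r *\<^sub>R N)) (at t within I)"
  defines "E \<equiv> \<lambda>\<tau>. P \<tau> - (\<Sum>k<r. X k \<tau> *\<^sub>R Nk (r - 1 - k))"
  shows "(E has_vector_derivative (M *v E t + (Y 0 *\<^sub>R Nk r - (\<Sum>k<r. \<gamma> k *\<^sub>R Nk (r - 1 - k))))) (at t within I)"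
    and "k < r \<Longrightarrow> ((\<lambda>\<tau>. observer_coord c (\<lambda>j. X j \<tau>) k) has_real_derivative
        (observer_coord c Y (Suc k) + (c k * Y 0 + observer_coord c \<gamma> k))) (at t within I)"
    and "observer_coord c Y r = Y r - \<Psi> \<bullet> P t + \<Psi> \<bullet> E t"
proof -
  have X: "(X k has_real_derivative (Y (Suc k) + \<gamma> k)) (at t within I)"
    and Y: "Y k = X k t" if "k < r" for k
    using X_all Y_all that by blast+
  have NkS: "Nk (Suc k) = M *v Nk k" for k by (simp add: Nk_def)
  have "((\<lambda>\<tau>. \<Sum>k<r. X k \<tau> *\<^sub>R Nk (r - 1 - k)) has_vector_derivative
      (\<Sum>k<r. (Y (Suc k) + \<gamma> k) *\<^sub>R Nk (r - 1 - k))) (at t within I)"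
  proof (rule has_vector_derivative_sum)
    fix k assume "k \<in> {..<r}"
    then have "(X k has_vector_derivative (Y (Suc k) + \<gamma> k)) (at t within I)"
      using X by (simp add: has_real_derivative_iff_has_vector_derivative)
    from bounded_linear.has_vector_derivative[OF bounded_linear_scaleR_left this]
    show "((\<lambda>\<tau>. X k \<tau> *\<^sub>R Nk (r - 1 - k)) has_vector_derivative (Y (Suc k) + \<gamma> k) *\<^sub>R Nk (r - 1 - k)) (at t within I)" .
  qed
  from has_vector_derivative_diff[OF P this]
  have E: "(E has_vector_derivative (M *v P t + Y r *\<^sub>R N - (\<Sum>k<r. (Y (Suc k) + \<gamma> k) *\<^sub>R Nk (r - 1 - k)))) (at t within I)"
    by (simp add: E_def)
  have shift: "Y r *\<^sub>R N + M *v (\<Sum>k<r. Y k *\<^sub>R Nk (r - 1 - k)) = Y 0 *\<^sub>R Nk r + (\<Sum>k<r. Y (Suc k) *\<^sub>R Nk (r - 1 - k))"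
  proof -
    have "M *v (\<Sum>k<r. Y k *\<^sub>R Nk (r - 1 - k)) = (\<Sum>k<r. Y k *\<^sub>R Nk (r - k))"
      unfolding linear_sum[OF matrix_vector_mul_linear]
    proof (rule sum.cong[OF refl])
      fix k assume "k \<in> {..<r}"
      then have "r - k = Suc (r - 1 - k)" by auto
      then show "M *v (Y k *\<^sub>R Nk (r - 1 - k)) = Y k *\<^sub>R Nk (r - k)"
        by (simp add: NkS linear_scale[OF matrix_vector_mul_linear])
    qed
    moreover have "(\<Sum>k<r. Y k *\<^sub>R Nk (r - k)) + Y r *\<^sub>R N = (\<Sum>k<Suc r. Y k *\<^sub>R Nk (r - k))"
      by (simp add: Nk_def)
    moreover have "(\<Sum>k<Suc r. Y k *\<^sub>R Nk (r - k)) = Y 0 *\<^sub>R Nk r + (\<Sum>k<r. Y (Suc k) *\<^sub>R Nk (r - 1 - k))"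
      by (subst sum.lessThan_Suc_shift) simp
    ultimately show ?thesis by (metis add.commute)
  qed
  have EtY: "E t = P t - (\<Sum>k<r. Y k *\<^sub>R Nk (r - 1 - k))" using Y by (simp add: E_def)
  have "M *v P t + Y r *\<^sub>R N - (\<Sum>k<r. (Y (Suc k) + \<gamma> k) *\<^sub>R Nk (r - 1 - k))
      = M *v E t + (Y 0 *\<^sub>R Nk r - (\<Sum>k<r. \<gamma> k *\<^sub>R Nk (r - 1 - k)))"
    using shift unfolding EtY matrix_vector_mult_diff_distrib
    by (simp add: scaleR_add_left sum.distrib algebra_simps)
  with E show "(E has_vector_derivative (M *v E t + (Y 0 *\<^sub>R Nk r - (\<Sum>k<r. \<gamma> k *\<^sub>R Nk (r - 1 - k))))) (at t within I)"
    by simp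
  show "((\<lambda>\<tau>. observer_coord c (\<lambda>j. X j \<tau>) k) has_real_derivative
        (observer_coord c Y (Suc k) + (c k * Y 0 + observer_coord c \<gamma> k))) (at t within I)" if k: "k < r"
  proof -
    have "((\<lambda>\<tau>. observer_coord c (\<lambda>j. X j \<tau>) k) has_real_derivative
        observer_coord c (\<lambda>j. Y (Suc j) + \<gamma> j) k) (at t within I)"
      unfolding observer_coord_def using k
      by (intro DERIV_diff DERIV_sum DERIV_cmult X) auto
    then show ?thesis by (simp add: observer_coord_add observer_coord_shift add.assoc)
  qed
  have "\<Psi> \<bullet> (\<Sum>k<r. Y k *\<^sub>R Nk (r - 1 - k)) = (\<Sum>k<r. c (r - 1 - k) * Y k)"
    by (simp add: inner_sum_right c_def Nk_def mult.commute)
  then show "observer_coord c Y r = Y r - \<Psi> \<bullet> P t + \<Psi> \<bullet> E t"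
    unfolding EtY observer_coord_def by (simp add: inner_diff_right)
qed

lemma observer_matrix_nth:
  fixes lam x :: "('r::{finite,linorder}) rvec"
  shows "(A_obs lam *v x) $ i = - lam $ i * x $ ix 1 + (if pos i < CARD('r) then x $ ix (pos i + 1) else 0)"
proof -
  have "(A_obs lam *v x) $ i = (\<Sum>j\<in>UNIV. (if j = ix 1 then - lam $ i * x $ j else 0)
      + (if pos i < CARD('r) \<and> j = ix (pos i + 1) then x $ j else 0))"
    unfolding matrix_vector_mult_def A_obs_def vec_lambda_beta
  proof (rule sum.cong[OF refl])
    fix j :: 'r
    have 1: "pos j = 1 \<longleftrightarrow> j = ix 1" by (rule pos_eq_iff) auto
    have 2: "pos j = pos i + 1 \<longleftrightarrow> pos i < CARD('r) \<and> j = ix (pos i + 1)"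
    proof (cases "pos i < CARD('r)")
      case True then show ?thesis using pos_eq_iff[of "pos i + 1" j] by simp
    next
      case False then show ?thesis using pos_le_card[of j] by simp
    qed
    have 3: "\<not> (pos j = 1 \<and> pos j = pos i + 1)" using pos_ge_1[of i] by simp
    show "(if pos j = 1 then - lam $ i else if pos j = pos i + 1 then 1 else 0) * x $ j
        = (if j = ix 1 then - lam $ i * x $ j else 0)
          + (if pos i < CARD('r) \<and> j = ix (pos i + 1) then x $ j else 0)"
      unfolding 1[symmetric] 2[symmetric] using 3 by auto
  qed
  then show ?thesis by (cases "pos i < CARD('r)") (simp_all add: sum.distrib)
qed

text \<open>The derivative of \<open>xi_check\<close> in the direction \<open>(e', xi')\<close>; the entry at \<open>0\<close> is a dummy.\<close>

fun xi_rate :: "(nat \<Rightarrow> real \<Rightarrow> real) \<Rightarrow> real \<Rightarrow> ('r::{finite,linorder}) rvec \<Rightarrow> real \<Rightarrow> 'r rvec \<Rightarrow> nat \<Rightarrow> real" where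
  "xi_rate \<rho> e xi e' xi' 0 = 0"
| "xi_rate \<rho> e xi e' xi' (Suc 0) = e'"
| "xi_rate \<rho> e xi e' xi' (Suc (Suc i)) = xi' $ ix (Suc (Suc i))
     + deriv (\<lambda>s. \<rho> (Suc i) s * s) (xi_check \<rho> e xi (Suc i)) * xi_rate \<rho> e xi e' xi' (Suc i)"

lemma xi_check_derivative:
  fixes xi :: "real \<Rightarrow> ('r::{finite,linorder}) rvec"
  assumes e: "(e has_real_derivative e') (at t within I)"
    and xi: "(xi has_vector_derivative xi') (at t within I)"
    and \<rho>: "\<And>j. 1 \<le> j \<Longrightarrow> j < i \<Longrightarrow> smooth (\<rho> j)"
  shows "((\<lambda>\<tau>. xi_check \<rho> (e \<tau>) (xi \<tau>) i) has_real_derivative xi_rate \<rho> (e t) (xi t) e' xi' i) (at t within I)"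
  using \<rho>
proof (induction i rule: induct_nat_012)
  case 1 then show ?case using e by simp
next
  case (ge2 i)
  have IH: "((\<lambda>\<tau>. xi_check \<rho> (e \<tau>) (xi \<tau>) (Suc i)) has_real_derivative xi_rate \<rho> (e t) (xi t) e' xi' (Suc i)) (at t within I)"
    by (rule ge2.IH(2)) (use ge2.prems in auto)
  have "smooth (\<lambda>s. \<rho> (Suc i) s * s)" using ge2.prems[of "Suc i"] by (intro smooth_times_id) auto
  from DERIV_chain2[OF smooth_deriv(1)[OF this] IH]
  have "((\<lambda>\<tau>. \<rho> (Suc i) (xi_check \<rho> (e \<tau>) (xi \<tau>) (Suc i)) * xi_check \<rho> (e \<tau>) (xi \<tau>) (Suc i)) has_real_derivative
      deriv (\<lambda>s. \<rho> (Suc i) s * s) (xi_check \<rho> (e t) (xi t) (Suc i)) * xi_rate \<rho> (e t) (xi t) e' xi' (Suc i)) (at t within I)" .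
  moreover have "((\<lambda>\<tau>. xi \<tau> $ ix (Suc (Suc i))) has_real_derivative xi' $ ix (Suc (Suc i))) (at t within I)"
    using bounded_linear.has_vector_derivative[OF bounded_linear_vec_nth xi]
    by (simp add: has_real_derivative_iff_has_vector_derivative)
  ultimately show ?case by (auto intro: DERIV_add)
qed auto

section \<open>The plant in error coordinates\<close>

text \<open>The relative degree is a parameter of its own, to be used as a number apart from the index
  type.\<close>

locale output_regulation_plant =
  fixes f :: "real^'nz \<Rightarrow> real \<Rightarrow> real^'nv \<Rightarrow> real^'nw \<Rightarrow> real^'nz"
    and g :: "nat \<Rightarrow> real^'nz \<Rightarrow> real \<Rightarrow> real^'nv \<Rightarrow> real^'nw \<Rightarrow> real"
    and b :: "real^'nw \<Rightarrow> real"
    and q :: "real^'nv \<Rightarrow> real^'nw \<Rightarrow> real"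
    and S :: "real^'nv^'nv"
    and zss :: "real^'nv \<Rightarrow> real^'nw \<Rightarrow> real^'nz"
    and rh N :: "('s::{finite,linorder}) rvec"
    and M T :: "'s sqmat"
    and lam :: "('r::{finite,linorder}) rvec"
    and VV :: "(real^'nv) set"
    and WW :: "(real^'nw) set"
    and r :: nat
  assumes r_card: "r = CARD('r)"
    and f_smooth: "smooth (\<lambda>(z, y, v, w). f z y v w)"
    and g_smooth: "\<And>i. i \<in> {1..r} \<Longrightarrow> smooth (\<lambda>(z, y, v, w). g i z y v w)"
    and b_smooth: "smooth b"
    and q_smooth: "smooth (\<lambda>(v, w). q v w)"
    and b_pos: "\<And>w. b w > 0"
    and A2: "assumption_A2 f S q zss"
    and A3: "polynomial_in_fst (steady_u r g b S q zss)"
    and A4: "assumption_A4 f q zss"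
    and im_coeffs: "internal_model_coeffs S (steady_u r g b S q zss) rh"
    and M_Hurwitz: "Hurwitz M"
    and T_solution: "is_sylvester_solution M N rh T"
    and T_nonsingular: "invertible T"
    and lam_Hurwitz: "Hurwitz (A_obs lam)"
    and VV: "compact VV" "VV \<noteq> {}"
    and WW: "compact WW" "WW \<noteq> {}"
begin

abbreviation "\<Psi> \<equiv> Psi_row T"
abbreviation "uss \<equiv> steady_u r g b S q zss"
abbreviation "xss \<equiv> steady_x g S q zss"

definition Nk :: "nat \<Rightarrow> 's rvec" where "Nk k = ((*v) M ^^ k) N"
definition ck :: "nat \<Rightarrow> real" where "ck k = \<Psi> \<bullet> ((*v) M ^^ k) N"

text \<open>The chain of integrators in error coordinates, scaled by the unknown input gain and
  counted from \<open>0\<close>.\<close>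

definition scaled :: "real^'nv \<Rightarrow> real^'nw \<Rightarrow> 'r rvec \<Rightarrow> nat \<Rightarrow> real" where
  "scaled v w x k = (x $ ix (Suc k) - xss (Suc k) v w) / b w"

text \<open>The argument \<open>th\<close> is the steady state of the internal model. The sum frees the dynamics of
  this error from the control, see \<open>canonical_form_dynamics\<close>.\<close>

definition im_error :: "'s rvec \<Rightarrow> real^'nv \<Rightarrow> real^'nw \<Rightarrow> 'r rvec \<Rightarrow> 's rvec \<Rightarrow> 's rvec" where
  "im_error th v w x \<eta> = \<eta> - th - (\<Sum>k<r. scaled v w x k *\<^sub>R Nk (r - 1 - k))"

text \<open>The state of the observer estimates the scaled chain in observer coordinates.\<close>

definition obs_error :: "real^'nv \<Rightarrow> real^'nw \<Rightarrow> 'r rvec \<Rightarrow> 'r rvec \<Rightarrow> 'r rvec" where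
  "obs_error v w x xi = (\<chi> i. observer_coord ck (scaled v w x) (pos i - 1) - xi $ i)"

definition drift :: "real^'nv \<Rightarrow> real^'nw \<Rightarrow> real^'nz \<Rightarrow> real \<Rightarrow> nat \<Rightarrow> real" where
  "drift v w z y k = (g (Suc k) z y v w - g (Suc k) (zss v w) (q v w) v w) / b w"

definition im_state :: "(real \<Rightarrow> real^'nv) \<Rightarrow> real^'nw \<Rightarrow> real \<Rightarrow> 's rvec" where
  "im_state v w = immersion_state T (\<lambda>t. uss (v t) w)"

lemma r_pos: "0 < r" by (simp add: r_card)

lemma smooth_q: "smooth (\<lambda>v. q v w)"
  using smooth_compose[OF q_smooth smooth_Pair[OF smooth_id smooth_const[of w]]] by simp

lemma smooth_zss: "smooth (\<lambda>v. zss v w)"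
proof -
  have "smooth (\<lambda>(v, w). zss v w)" using A2 by (simp add: assumption_A2_def)
  from smooth_compose[OF this smooth_Pair[OF smooth_id smooth_const[of w]]] show ?thesis by simp
qed

lemma smooth_xss: "1 \<le> k \<Longrightarrow> k \<le> r \<Longrightarrow> smooth (\<lambda>v. xss k v w)"
proof (induction k rule: induct_nat_012)
  case 1 then show ?case using smooth_q by simp
next
  case (ge2 k)
  have IH: "smooth (\<lambda>v. xss (Suc k) v w)" using ge2 by simp
  have "smooth (\<lambda>v. frechet_derivative (\<lambda>v'. xss (Suc k) v' w) (at v) (S *v v))"
    by (intro smooth_frechet_derivative_along IH smooth_bounded_linear matrix_vector_mul_bounded_linear)
  moreover have "smooth (\<lambda>v. g (Suc k) (zss v w) (q v w) v w)"
    using smooth_compose[OF g_smooth[of "Suc k"] smooth_Pair[OF smooth_zss smooth_Pair[OF smooth_q smooth_Pair[OF smooth_id smooth_const[of w]]]]] ge2.prems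
    by simp
  ultimately have "smooth (\<lambda>v. frechet_derivative (\<lambda>v'. xss (Suc k) v' w) (at v) (S *v v)
      + (- 1) *\<^sub>R g (Suc k) (zss v w) (q v w) v w)"
    by (intro smooth_add smooth_scaleR smooth_const)
  then show ?case by (simp add: exo_deriv_def)
qed simp

lemma exo_chain_rule:
  fixes h :: "real^'nv \<Rightarrow> real^'nw \<Rightarrow> 'b::euclidean_space"
  assumes "exo_trajectory S v" "smooth (\<lambda>v. h v w)"
  shows "((\<lambda>\<tau>. h (v \<tau>) w) has_vector_derivative exo_deriv S h (v t) w) (at t within I)"
proof -
  have lin: "linear (frechet_derivative (\<lambda>v. h v w) (at (v t)))"
    using smooth_has_derivative[OF assms(2)] has_derivative_linear by blast
  have "(v has_derivative (\<lambda>u. u *\<^sub>R (S *v v t))) (at t within I)"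
    using assms(1) unfolding exo_trajectory_def has_vector_derivative_def
    by (blast intro: has_derivative_at_withinI)
  from has_derivative_compose[OF this smooth_has_derivative[OF assms(2)]]
  show ?thesis by (simp add: has_vector_derivative_def exo_deriv_def linear_scale[OF lin])
qed

lemma zero_dynamics_error:
  assumes v: "exo_trajectory S v"
    and z: "(z has_vector_derivative f (z t) y (v t) w) (at t within I)"
  shows "((\<lambda>\<tau>. z \<tau> - zss (v \<tau>) w) has_vector_derivative
     f_bar f q zss (z t - zss (v t) w) (y - q (v t) w) (v t) w) (at t within I)"
  using has_vector_derivative_diff[OF z exo_chain_rule[where h = zss and w = w, OF v smooth_zss]] A2
  by (simp add: assumption_A2_def f_bar_def)

lemma scaled_dynamics:
  assumes v: "exo_trajectory S v" and k: "k < r"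
    and x: "(x has_vector_derivative x_field g b z (x t) (v t) w u) (at t within I)"
  shows "((\<lambda>\<tau>. scaled (v \<tau>) w (x \<tau>) k) has_real_derivative
     ((if Suc k < r then scaled (v t) w (x t) (Suc k) else u - uss (v t) w)
       + drift (v t) w z (x t $ ix 1) k)) (at t within I)"
proof -
  have pk: "pos (ix (Suc k) :: 'r) = Suc k" using k by (simp add: r_card)
  have "((\<lambda>\<tau>. x \<tau> $ ix (Suc k)) has_vector_derivative
      g (Suc k) z (x t $ ix 1) (v t) w + (if Suc k < r then x t $ ix (Suc k + 1) else b w * u)) (at t within I)"
    using bounded_linear.has_vector_derivative[OF bounded_linear_vec_nth x, of "ix (Suc k)"]
    by (simp add: x_field_def pk r_card cong: if_cong)
  from has_vector_derivative_diff[OF this exo_chain_rule[where h = "xss (Suc k)" and w = w, OF v smooth_xss]] k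
  have "((\<lambda>\<tau>. x \<tau> $ ix (Suc k) - xss (Suc k) (v \<tau>) w) has_real_derivative
      g (Suc k) z (x t $ ix 1) (v t) w + (if Suc k < r then x t $ ix (Suc k + 1) else b w * u)
        - exo_deriv S (xss (Suc k)) (v t) w) (at t within I)"
    by (simp add: has_real_derivative_iff_has_vector_derivative)
  from DERIV_cdivide[OF this, of "b w"]
  have d: "((\<lambda>\<tau>. scaled (v \<tau>) w (x \<tau>) k) has_real_derivative
      (g (Suc k) z (x t $ ix 1) (v t) w + (if Suc k < r then x t $ ix (Suc k + 1) else b w * u)
        - exo_deriv S (xss (Suc k)) (v t) w) / b w) (at t within I)"
    by (simp add: scaled_def)
  have bw: "b w \<noteq> 0" using b_pos[of w] by simp
  show ?thesis
  proof (cases "Suc k < r")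
    case True
    then show ?thesis using d by (simp add: scaled_def drift_def add_divide_distrib diff_divide_distrib algebra_simps)
  next
    case False
    then have "Suc k = r" using k by simp
    have "(g (Suc k) z (x t $ ix 1) (v t) w + b w * u - exo_deriv S (xss (Suc k)) (v t) w) / b w
        = u - uss (v t) w + drift (v t) w z (x t $ ix 1) k"
      using bw unfolding steady_u_def drift_def \<open>Suc k = r\<close>[symmetric] by (simp add: field_simps)
    then show ?thesis using d False by simp
  qed
qed

lemma im_state_dynamics:
  assumes v: "exo_trajectory S v"
  shows "(im_state v w has_vector_derivative (M *v im_state v w t + uss (v t) w *\<^sub>R N)) (at t within I)"
    "\<Psi> \<bullet> im_state v w t = uss (v t) w"
  using immersion_state_dynamics[OF v A3 im_coeffs T_solution T_nonsingular, of w t]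
  unfolding im_state_def by (auto intro: has_vector_derivative_at_within)

text \<open>The input perturbations of the two linear error systems; \<open>\<eta>h\<close> and \<open>eh\<close> are sampled values.\<close>

definition im_input :: "real^'nv \<Rightarrow> real^'nw \<Rightarrow> real^'nz \<Rightarrow> 'r rvec \<Rightarrow> 's rvec" where
  "im_input v w z x = scaled v w x 0 *\<^sub>R Nk r - (\<Sum>k<r. drift v w z (x $ ix 1) k *\<^sub>R Nk (r - 1 - k))"

definition obs_input :: "'s rvec \<Rightarrow> real^'nv \<Rightarrow> real^'nw \<Rightarrow> real^'nz \<Rightarrow> 'r rvec \<Rightarrow> 's rvec \<Rightarrow> 's rvec \<Rightarrow> real \<Rightarrow> 'r rvec" where
  "obs_input th v w z x \<eta> \<eta>h eh = (\<chi> i. lam $ i * (scaled v w x 0 - eh)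
      + (ck (pos i - 1) * scaled v w x 0 + observer_coord ck (drift v w z (x $ ix 1)) (pos i - 1))
      + (if pos i = r then \<Psi> \<bullet> (\<eta>h - \<eta>) + \<Psi> \<bullet> im_error th v w x \<eta> else 0))"

text \<open>Since \<open>\<Psi> \<theta>\<close> is the steady-state input, the last observer coordinate is \<open>u - \<Psi> \<eta>\<close> plus \<open>\<Psi>\<close>
  times the error of the internal model. The observer uses the sampled \<open>\<eta>h\<close> instead, which adds
  \<open>\<Psi> (\<eta>h - \<eta>)\<close>.\<close>

lemma linear_error_dynamics:
  assumes v: "exo_trajectory S v"
    and x: "(x has_vector_derivative x_field g b z (x t) (v t) w u) (at t within I)"
    and \<eta>: "(\<eta> has_vector_derivative (M *v \<eta> t + u *\<^sub>R N)) (at t within I)"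
    and xi: "(xi has_vector_derivative (A_obs lam *v xi t + eh *\<^sub>R lam + (u - \<Psi> \<bullet> \<eta>h) *\<^sub>R B_obs)) (at t within I)"
  shows "((\<lambda>\<tau>. im_error (im_state v w \<tau>) (v \<tau>) w (x \<tau>) (\<eta> \<tau>)) has_vector_derivative
      (M *v im_error (im_state v w t) (v t) w (x t) (\<eta> t) + im_input (v t) w z (x t))) (at t within I)"
    and "((\<lambda>\<tau>. obs_error (v \<tau>) w (x \<tau>) (xi \<tau>)) has_vector_derivative
      (A_obs lam *v obs_error (v t) w (x t) (xi t)
        + obs_input (im_state v w t) (v t) w z (x t) (\<eta> t) \<eta>h eh)) (at t within I)"
    and "((\<lambda>\<tau>. scaled (v \<tau>) w (x \<tau>) 0) has_real_derivative
      ((if 1 < r then (obs_error (v t) w (x t) (xi t) + xi t) $ ix 2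
        else (u - \<Psi> \<bullet> \<eta>h) + (\<Psi> \<bullet> (\<eta>h - \<eta> t) + \<Psi> \<bullet> im_error (im_state v w t) (v t) w (x t) (\<eta> t)))
       + (ck 0 * scaled (v t) w (x t) 0 + drift (v t) w z (x t $ ix 1) 0))) (at t within I)"
proof -
  define Y where "Y k = (if k < r then scaled (v t) w (x t) k else u - uss (v t) w)" for k
  define \<gamma> where "\<gamma> = drift (v t) w z (x t $ ix 1)"
  have \<gamma>_eq: "drift (v t) w z (x t $ ix (Suc 0)) = \<gamma>" by (simp add: \<gamma>_def)
  define P where "P \<tau> = \<eta> \<tau> - im_state v w \<tau>" for \<tau>
  define E where "E \<tau> = im_error (im_state v w \<tau>) (v \<tau>) w (x \<tau>) (\<eta> \<tau>)" for \<tau>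
  have X: "\<forall>k<r. ((\<lambda>\<tau>. scaled (v \<tau>) w (x \<tau>) k) has_real_derivative (Y (Suc k) + \<gamma> k)) (at t within I)"
    using scaled_dynamics[OF v _ x] by (simp add: Y_def \<gamma>_def)
  have YX: "\<forall>k<r. Y k = scaled (v t) w (x t) k" by (simp add: Y_def)
  have P: "(P has_vector_derivative (M *v P t + Y r *\<^sub>R N)) (at t within I)"
    using has_vector_derivative_diff[OF \<eta> im_state_dynamics(1)[OF v, of w t I]]
    unfolding P_def Y_def by (simp add: matrix_vector_mult_diff_distrib algebra_simps)
  note can1 = canonical_form_dynamics(1)[where X = "\<lambda>k \<tau>. scaled (v \<tau>) w (x \<tau>) k", OF X YX P]
    and can23 = canonical_form_dynamics(2,3)[where X = "\<lambda>k \<tau>. scaled (v \<tau>) w (x \<tau>) k" and \<Psi> = \<Psi>, OF X YX P]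
  have E_eq: "(\<lambda>\<tau>. P \<tau> - (\<Sum>k<r. scaled (v \<tau>) w (x \<tau>) k *\<^sub>R ((*v) M ^^ (r - 1 - k)) N)) = E"
    by (simp add: E_def im_error_def P_def Nk_def fun_eq_iff)
  have ck_eq: "(\<lambda>k. \<Psi> \<bullet> ((*v) M ^^ k) N) = ck" by (simp add: ck_def fun_eq_iff)
  have Y0: "Y 0 = scaled (v t) w (x t) 0" using r_pos by (simp add: Y_def)
  show "((\<lambda>\<tau>. im_error (im_state v w \<tau>) (v \<tau>) w (x \<tau>) (\<eta> \<tau>)) has_vector_derivative
      (M *v im_error (im_state v w t) (v t) w (x t) (\<eta> t) + im_input (v t) w z (x t))) (at t within I)"
    using can1 unfolding E_eq fun_cong[OF E_eq, of t] unfolding E_def im_input_def Nk_def Y0[symmetric] \<gamma>_def[symmetric] .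
  have can3: "observer_coord ck Y r = (u - \<Psi> \<bullet> \<eta>h) + (\<Psi> \<bullet> (\<eta>h - \<eta> t) + \<Psi> \<bullet> E t)"
  proof -
    have "observer_coord ck Y r = Y r - \<Psi> \<bullet> P t + \<Psi> \<bullet> E t"
      using can23(2) unfolding ck_eq fun_cong[OF E_eq, of t] .
    also have "Y r - \<Psi> \<bullet> P t = u - \<Psi> \<bullet> \<eta> t"
      using im_state_dynamics(2)[OF v, of w t] by (simp add: Y_def P_def inner_diff_right)
    finally show ?thesis by (simp add: inner_diff_right)
  qed
  have oc: "observer_coord ck Y k = observer_coord ck (scaled (v t) w (x t)) k" if "k < r" for k
    by (rule observer_coord_cong) (use that in \<open>simp add: Y_def\<close>)
  have can2: "((\<lambda>\<tau>. observer_coord ck (scaled (v \<tau>) w (x \<tau>)) k) has_real_derivative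
        (observer_coord ck Y (Suc k) + (ck k * Y 0 + observer_coord ck \<gamma> k))) (at t within I)" if "k < r" for k
    using can23(1)[OF that] unfolding ck_eq by (simp add: ck_def)
  show "((\<lambda>\<tau>. obs_error (v \<tau>) w (x \<tau>) (xi \<tau>)) has_vector_derivative
      (A_obs lam *v obs_error (v t) w (x t) (xi t)
        + obs_input (im_state v w t) (v t) w z (x t) (\<eta> t) \<eta>h eh)) (at t within I)"
  proof (rule has_vector_derivative_vecI)
    fix i :: 'r
    define k where "k = pos i - 1"
    have k: "k < r" "pos i = Suc k" using pos_ge_1[of i] pos_le_card[of i] by (auto simp: k_def r_card)
    have d1: "((\<lambda>\<tau>. observer_coord ck (scaled (v \<tau>) w (x \<tau>)) k) has_vector_derivative
        (observer_coord ck Y (Suc k) + (ck k * Y 0 + observer_coord ck \<gamma> k))) (at t within I)"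
      using can2[OF k(1)] by (simp add: has_real_derivative_iff_has_vector_derivative)
    have d2: "((\<lambda>\<tau>. xi \<tau> $ i) has_vector_derivative
        (A_obs lam *v xi t) $ i + eh * lam $ i + (u - \<Psi> \<bullet> \<eta>h) * B_obs $ i) (at t within I)"
      using bounded_linear.has_vector_derivative[OF bounded_linear_vec_nth xi, of i] by simp
    have p1: "pos (ix 1 :: 'r) = 1" by simp
    have o1: "obs_error (v t) w (x t) (xi t) $ ix 1 = Y 0 - xi t $ ix 1"
      by (simp add: obs_error_def p1 observer_coord_def Y0)
    have eq: "observer_coord ck Y (Suc k) + (ck k * Y 0 + observer_coord ck \<gamma> k)
        - ((A_obs lam *v xi t) $ i + eh * lam $ i + (u - \<Psi> \<bullet> \<eta>h) * B_obs $ i)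
      = (A_obs lam *v obs_error (v t) w (x t) (xi t)
        + obs_input (im_state v w t) (v t) w z (x t) (\<eta> t) \<eta>h eh) $ i"
    proof (cases "Suc k < r")
      case True
      then have "pos (ix (Suc (Suc k)) :: 'r) = Suc (Suc k)" by (simp add: r_card)
      then have "obs_error (v t) w (x t) (xi t) $ ix (Suc (Suc k)) = observer_coord ck Y (Suc k) - xi t $ ix (Suc (Suc k))"
        using oc[OF True] by (simp add: obs_error_def)
      then show ?thesis
        using True unfolding vector_add_component observer_matrix_nth o1 obs_input_def
        by (simp add: k(2) r_card[symmetric] B_obs_def Y0[symmetric] \<gamma>_eq algebra_simps)
    next
      case False
      then have kr: "Suc k = r" "r - Suc 0 = k" using k by auto
      then show ?thesis
        unfolding vector_add_component observer_matrix_nth o1 obs_input_def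
        by (simp add: k(2) r_card[symmetric] B_obs_def Y0[symmetric] \<gamma>_eq can3 E_def algebra_simps)
    qed
    show "((\<lambda>\<tau>. obs_error (v \<tau>) w (x \<tau>) (xi \<tau>) $ i) has_vector_derivative
      (A_obs lam *v obs_error (v t) w (x t) (xi t)
        + obs_input (im_state v w t) (v t) w z (x t) (\<eta> t) \<eta>h eh) $ i) (at t within I)"
      using has_vector_derivative_diff[OF d1 d2] unfolding eq by (simp add: obs_error_def k_def)
  qed
  have oc1: "observer_coord ck Y 1 = (if 1 < r then (obs_error (v t) w (x t) (xi t) + xi t) $ ix 2
        else (u - \<Psi> \<bullet> \<eta>h) + (\<Psi> \<bullet> (\<eta>h - \<eta> t) + \<Psi> \<bullet> E t))"
  proof (cases "1 < r")
    case True
    then have "pos (ix 2 :: 'r) = 2" by (simp add: r_card)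
    then show ?thesis using True oc[of 1] by (simp add: obs_error_def)
  next
    case False
    then have "r = 1" using r_pos by simp
    then show ?thesis using can3 by simp
  qed
  show "((\<lambda>\<tau>. scaled (v \<tau>) w (x \<tau>) 0) has_real_derivative
      ((if 1 < r then (obs_error (v t) w (x t) (xi t) + xi t) $ ix 2
        else (u - \<Psi> \<bullet> \<eta>h) + (\<Psi> \<bullet> (\<eta>h - \<eta> t) + \<Psi> \<bullet> im_error (im_state v w t) (v t) w (x t) (\<eta> t)))
       + (ck 0 * scaled (v t) w (x t) 0 + drift (v t) w z (x t $ ix 1) 0))) (at t within I)"
    using can2[OF r_pos] unfolding One_nat_def[symmetric] oc1
    by (cases "1 < r") (simp_all add: observer_coord_def Y0 \<gamma>_eq E_def)
qed

section \<open>Bounds of the perturbations\<close>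

definition growth :: "real^'nv \<Rightarrow> real^'nw \<Rightarrow> real^'nz \<Rightarrow> real \<Rightarrow> real" where
  "growth v w z y = (\<Sum>k<r. \<bar>g (Suc k) z y v w - g (Suc k) (zss v w) (q v w) v w\<bar>)"

lemma b_bounds:
  obtains bmin bmax where "0 < bmin" "bmin \<le> bmax" "\<And>w. w \<in> WW \<Longrightarrow> bmin \<le> b w \<and> b w \<le> bmax"
proof -
  have c: "continuous_on WW b" by (rule smooth_continuous_on[OF b_smooth])
  obtain w1 where w1: "w1 \<in> WW" "\<forall>w\<in>WW. b w1 \<le> b w" using continuous_attains_inf[OF WW c] by blast
  obtain w2 where w2: "w2 \<in> WW" "\<forall>w\<in>WW. b w \<le> b w2" using continuous_attains_sup[OF WW c] by blast
  show thesis by (rule that[of "b w1" "b w2"]) (use w1 w2 b_pos in auto)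
qed

text \<open>The quotient of \<open>growth\<close> by the size of the error is bounded on bounded sets: there the
  functions \<open>g\<^sub>i\<close> are Lipschitz, and the steady state ranges over a compact set.\<close>

lemma growth_gain:
  obtains \<psi> where "gain \<psi>" "\<And>v w z y. v \<in> VV \<Longrightarrow> w \<in> WW \<Longrightarrow>
    growth v w z y \<le> \<psi> (norm (z - zss v w) + \<bar>y - q v w\<bar>) * (norm (z - zss v w) + \<bar>y - q v w\<bar>)"
proof -
  have sz: "smooth (\<lambda>(v, w). zss v w)" using A2 by (simp add: assumption_A2_def)
  have "continuous_on (VV \<times> WW) (\<lambda>p. (zss (fst p) (snd p), q (fst p) (snd p), p))"
    using smooth_continuous_on[OF sz] smooth_continuous_on[OF q_smooth]
    by (intro continuous_intros) (auto simp: case_prod_unfold)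
  then have "compact ((\<lambda>p. (zss (fst p) (snd p), q (fst p) (snd p), p)) ` (VV \<times> WW))"
    by (rule compact_continuous_image) (intro compact_Times VV WW)
  then obtain B where "\<forall>x\<in>(\<lambda>p. (zss (fst p) (snd p), q (fst p) (snd p), p)) ` (VV \<times> WW). norm x \<le> B"
    using compact_imp_bounded bounded_iff by blast
  then have B: "norm (zss v w, q v w, v, w) \<le> B" if "v \<in> VV" "w \<in> WW" for v w using that by force
  define m where "m p = (case p of (v, w, z, y) \<Rightarrow> norm (z - zss v w) + \<bar>y - q v w\<bar>)" for p
  define h where "h p = (case p of (v, w, z, y) \<Rightarrow> growth v w z y / m (v, w, z, y))" for p
  have m0: "0 \<le> m p" for p by (auto simp: m_def split: prod.split)
  have "\<exists>L. \<forall>p\<in>VV \<times> WW \<times> UNIV. m p \<le> R \<longrightarrow> h p \<le> L" for R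
  proof -
    have "\<exists>L>0. \<forall>x y. norm x \<le> B + R \<longrightarrow> norm y \<le> B + R \<longrightarrow>
        norm ((case x of (z, y, v, w) \<Rightarrow> g (Suc k) z y v w) - (case y of (z, y, v, w) \<Rightarrow> g (Suc k) z y v w)) \<le> L * norm (x - y)"
      if "k < r" for k
    proof -
      have "C_k 1 (\<lambda>(z, y, v, w). g (Suc k) z y v w)" using g_smooth[of "Suc k"] that by (intro smooth_C_k) auto
      from C_1_lipschitz_on_ball[OF this, of "B + R"] show ?thesis by metis
    qed
    then obtain L where L: "\<And>k. k < r \<Longrightarrow> L k > 0" "\<And>k x y. k < r \<Longrightarrow> norm x \<le> B + R \<Longrightarrow> norm y \<le> B + R \<Longrightarrow>
        norm ((case x of (z, y, v, w) \<Rightarrow> g (Suc k) z y v w) - (case y of (z, y, v, w) \<Rightarrow> g (Suc k) z y v w)) \<le> L k * norm (x - y)"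
      by metis
    have "h p \<le> (\<Sum>k<r. L k)" if p: "p \<in> VV \<times> WW \<times> UNIV" "m p \<le> R" for p
    proof -
      obtain v w z y where p': "p = (v, w, z, y)" "v \<in> VV" "w \<in> WW" using p(1) by auto
      have d: "norm ((z, y, v, w) - (zss v w, q v w, v, w)) \<le> m p"
        using norm_Pair_le[of "z - zss v w" "(y - q v w, 0 :: real^'nv, 0 :: real^'nw)"]
          norm_Pair_le[of "y - q v w" "(0 :: real^'nv, 0 :: real^'nw)"]
        by (simp add: m_def p' norm_Pair)
      have n1: "norm (zss v w, q v w, v, w) \<le> B + R" using B[OF p'(2,3)] p(2) m0[of p] by simp
      have n2: "norm (z, y, v, w) \<le> B + R"
        using norm_triangle_sub[of "(z, y, v, w)" "(zss v w, q v w, v, w)"] B[OF p'(2,3)] p(2) d by simp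
      have "growth v w z y \<le> (\<Sum>k<r. L k * m p)" unfolding growth_def
      proof (rule sum_mono)
        fix k assume k: "k \<in> {..<r}"
        then have "\<bar>g (Suc k) z y v w - g (Suc k) (zss v w) (q v w) v w\<bar> \<le> L k * norm ((z, y, v, w) - (zss v w, q v w, v, w))"
          using L(2)[OF _ n2 n1, of k] by simp
        also have "\<dots> \<le> L k * m p" using L(1)[of k] k d by (intro mult_left_mono) auto
        finally show "\<bar>g (Suc k) z y v w - g (Suc k) (zss v w) (q v w) v w\<bar> \<le> L k * m p" .
      qed
      then have gm: "growth v w z y \<le> (\<Sum>k<r. L k) * m p" by (simp add: sum_distrib_right)
      have "0 \<le> (\<Sum>k<r. L k)" using L(1) by (intro sum_nonneg) (auto simp: less_imp_le)
      with gm show ?thesis using m0[of p] unfolding h_def p' by (auto simp: p' divide_le_eq less_le)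
    qed
    then show ?thesis by blast
  qed
  from gain_of_local_bounds[of "VV \<times> WW \<times> UNIV" m h, OF this]
  obtain \<psi> where \<psi>: "gain \<psi>" "\<And>p. p \<in> VV \<times> WW \<times> UNIV \<Longrightarrow> h p \<le> \<psi> (m p)" by metis
  show thesis
  proof (rule that[OF \<psi>(1)])
    fix v w z y assume vw: "v \<in> VV" "w \<in> WW"
    show "growth v w z y \<le> \<psi> (norm (z - zss v w) + \<bar>y - q v w\<bar>) * (norm (z - zss v w) + \<bar>y - q v w\<bar>)"
    proof (cases "m (v, w, z, y) = 0")
      case True
      then have "norm (z - zss v w) = 0" "\<bar>y - q v w\<bar> = 0"
        unfolding m_def using norm_ge_zero[of "z - zss v w"] by (auto simp: add_nonneg_eq_0_iff)
      then have "z = zss v w" "y = q v w" by auto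
      then show ?thesis by (simp add: growth_def)
    next
      case False
      then have "0 < m (v, w, z, y)" using m0[of "(v, w, z, y)"] by simp
      then show ?thesis using \<psi>(2)[of "(v, w, z, y)"] vw by (simp add: h_def m_def divide_le_eq)
    qed
  qed
qed

lemma growth_nonneg: "0 \<le> growth v w z y"
  by (simp add: growth_def sum_nonneg)

lemma drift_le:
  assumes "k < r" "0 < bmin" "bmin \<le> b w"
  shows "\<bar>drift v w z y k\<bar> \<le> growth v w z y / bmin"
proof -
  have "\<bar>g (Suc k) z y v w - g (Suc k) (zss v w) (q v w) v w\<bar> \<le> growth v w z y"
    unfolding growth_def using assms(1)
    by (intro member_le_sum[of k "{..<r}" "\<lambda>k. \<bar>g (Suc k) z y v w - g (Suc k) (zss v w) (q v w) v w\<bar>"]) auto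
  then show ?thesis unfolding drift_def abs_divide using assms b_pos[of w]
    by (intro frac_le) auto
qed

lemma scaled_0: "scaled v w x 0 = (x $ ix 1 - q v w) / b w"
  by (simp add: scaled_def)

text \<open>The constant is uniform in the uncertain parameter, which enters through the lower bound
  of \<open>b\<close> alone.\<close>

lemma input_bounds:
  assumes bmin: "0 < bmin"
  obtains C where "0 \<le> C"
    "\<And>v w z x. bmin \<le> b w \<Longrightarrow>
       norm (im_input v w z x) \<le> C * (\<bar>x $ ix 1 - q v w\<bar> + growth v w z (x $ ix 1))"
    "\<And>th v w z x \<eta> \<eta>h eh d. bmin \<le> b w \<Longrightarrow> norm (\<eta>h - \<eta>) \<le> d \<Longrightarrow> \<bar>eh - (x $ ix 1 - q v w)\<bar> \<le> d \<Longrightarrow>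
       norm (obs_input th v w z x \<eta> \<eta>h eh)
         \<le> C * (\<bar>x $ ix 1 - q v w\<bar> + d + norm (im_error th v w x \<eta>) + growth v w z (x $ ix 1))"
proof -
  define Co where "Co k = 1 + (\<Sum>j<k. \<bar>ck j\<bar>)" for k
  define Ci where "Ci i = \<bar>lam $ i\<bar> * (1 / bmin + 1) + \<bar>ck (pos i - 1)\<bar> / bmin + Co (pos i - 1) / bmin + norm \<Psi>" for i :: 'r
  define C1 where "C1 = norm (Nk r) / bmin + (\<Sum>k<r. norm (Nk (r - 1 - k)) / bmin)"
  have Co0: "0 \<le> Co k" for k by (simp add: Co_def sum_nonneg add_nonneg_nonneg)
  have Ci0: "0 \<le> Ci i" for i unfolding Ci_def using bmin Co0[of "pos i - 1"] by simp
  have C10: "0 \<le> C1" unfolding C1_def using bmin by (simp add: sum_nonneg)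
  define C where "C = C1 + (\<Sum>i\<in>UNIV. Ci i)"
  have C: "0 \<le> C" "C1 \<le> C" "(\<Sum>i\<in>UNIV. Ci i) \<le> C" using C10 Ci0 by (auto simp: C_def sum_nonneg)
  have s0: "\<bar>scaled v w x 0\<bar> \<le> \<bar>x $ ix 1 - q v w\<bar> / bmin" if "bmin \<le> b w" for v w x
    unfolding scaled_0 abs_divide using that bmin b_pos[of w] by (intro frac_le) auto
  show thesis
  proof (rule that[OF C(1)])
    fix v w z and x :: "'r rvec" assume bw: "bmin \<le> b w"
    define e G where "e = \<bar>x $ ix 1 - q v w\<bar>" and "G = growth v w z (x $ ix 1)"
    have eG: "0 \<le> e" "0 \<le> G" by (auto simp: e_def G_def growth_nonneg)
    have "norm (im_input v w z x) \<le> norm (scaled v w x 0 *\<^sub>R Nk r)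
        + norm (\<Sum>k<r. drift v w z (x $ ix 1) k *\<^sub>R Nk (r - 1 - k))"
      unfolding im_input_def by (rule norm_triangle_ineq4)
    also have "norm (scaled v w x 0 *\<^sub>R Nk r) \<le> (e / bmin) * norm (Nk r)"
      unfolding norm_scaleR using s0[OF bw, of v x] by (intro mult_right_mono) (auto simp: e_def)
    also have "norm (\<Sum>k<r. drift v w z (x $ ix 1) k *\<^sub>R Nk (r - 1 - k)) \<le> (\<Sum>k<r. (G / bmin) * norm (Nk (r - 1 - k)))"
    proof (rule sum_norm_le)
      fix k assume "k \<in> {..<r}"
      then have "\<bar>drift v w z (x $ ix 1) k\<bar> \<le> G / bmin" unfolding G_def by (intro drift_le bmin bw) auto
      then show "norm (drift v w z (x $ ix 1) k *\<^sub>R Nk (r - 1 - k)) \<le> (G / bmin) * norm (Nk (r - 1 - k))"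
        unfolding norm_scaleR real_norm_def by (rule mult_right_mono) simp
    qed
    also have "\<dots> = (\<Sum>k<r. norm (Nk (r - 1 - k)) / bmin) * G"
      unfolding sum_distrib_right by (rule sum.cong) simp_all
    also have "(e / bmin) * norm (Nk r) + (\<Sum>k<r. norm (Nk (r - 1 - k)) / bmin) * G \<le> C1 * (e + G)"
    proof -
      have "0 \<le> norm (Nk r) / bmin * G" "0 \<le> (\<Sum>k<r. norm (Nk (r - 1 - k)) / bmin) * e"
        using eG bmin by (auto intro!: mult_nonneg_nonneg sum_nonneg)
      then show ?thesis unfolding C1_def by (simp add: algebra_simps add_divide_distrib)
    qed
    also have "\<dots> \<le> C * (e + G)" using C eG by (intro mult_right_mono) auto
    finally show "norm (im_input v w z x) \<le> C * (\<bar>x $ ix 1 - q v w\<bar> + growth v w z (x $ ix 1))"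
      by (simp add: e_def G_def)
  next
    fix th v w z and x :: "'r rvec" and \<eta> \<eta>h :: "'s rvec" and eh d :: real assume bw: "bmin \<le> b w" and d: "norm (\<eta>h - \<eta>) \<le> d" "\<bar>eh - (x $ ix 1 - q v w)\<bar> \<le> d"
    define e G p where "e = \<bar>x $ ix 1 - q v w\<bar>" and "G = growth v w z (x $ ix 1)" and "p = norm (im_error th v w x \<eta>)"
    have nn: "0 \<le> e" "0 \<le> G" "0 \<le> p" "0 \<le> d" using order_trans[OF norm_ge_zero d(1)] by (auto simp: e_def G_def p_def growth_nonneg)
    define s where "s = e + d + p + G"
    have s: "0 \<le> s" "e \<le> s" "d \<le> s" "p \<le> s" "G \<le> s" "e + d \<le> s" "d + p \<le> s" using nn by (auto simp: s_def)
    have comp: "\<bar>obs_input th v w z x \<eta> \<eta>h eh $ i\<bar> \<le> Ci i * s" for i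
    proof -
      let ?k = "pos i - 1"
      have k: "?k < r" using pos_ge_1[of i] pos_le_card[of i] by (simp add: r_card)
      have a: "\<bar>lam $ i * (scaled v w x 0 - eh)\<bar> \<le> \<bar>lam $ i\<bar> * ((1 / bmin + 1) * s)"
        unfolding abs_mult
      proof (rule mult_left_mono)
        have "\<bar>eh\<bar> \<le> e + d" using d(2) by (simp add: e_def)
        then have "\<bar>scaled v w x 0 - eh\<bar> \<le> e / bmin + (e + d)" using s0[OF bw, of v x] by (simp add: e_def)
        also have "\<dots> \<le> s / bmin + s" using s bmin by (intro add_mono divide_right_mono) auto
        finally show "\<bar>scaled v w x 0 - eh\<bar> \<le> (1 / bmin + 1) * s" by (simp add: algebra_simps)
      qed simp
      have "e / bmin \<le> s / bmin" using s bmin by (intro divide_right_mono) auto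
      then have b: "\<bar>ck ?k * scaled v w x 0\<bar> \<le> \<bar>ck ?k\<bar> * (s / bmin)"
        unfolding abs_mult using s0[OF bw, of v x] by (intro mult_left_mono) (auto simp: e_def)
      have "\<bar>observer_coord ck (drift v w z (x $ ix 1)) ?k\<bar> \<le> Co ?k * (G / bmin)"
        unfolding Co_def by (rule observer_coord_abs_le) (use drift_le[OF _ bmin bw] k in \<open>auto simp: G_def\<close>)
      also have "\<dots> \<le> Co ?k * (s / bmin)" using s bmin Co0 by (intro mult_left_mono divide_right_mono) auto
      finally have c: "\<bar>observer_coord ck (drift v w z (x $ ix 1)) ?k\<bar> \<le> Co ?k * (s / bmin)" .
      have "\<bar>\<Psi> \<bullet> (\<eta>h - \<eta>)\<bar> \<le> norm \<Psi> * d" using Cauchy_Schwarz_ineq2[of \<Psi> "\<eta>h - \<eta>"] d(1)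
        by (meson mult_left_mono norm_ge_zero order_trans)
      moreover have "\<bar>\<Psi> \<bullet> im_error th v w x \<eta>\<bar> \<le> norm \<Psi> * p" unfolding p_def by (rule Cauchy_Schwarz_ineq2)
      ultimately have "\<bar>\<Psi> \<bullet> (\<eta>h - \<eta>) + \<Psi> \<bullet> im_error th v w x \<eta>\<bar> \<le> norm \<Psi> * (d + p)" by (simp add: distrib_left)
      also have "\<dots> \<le> norm \<Psi> * s" using s by (intro mult_left_mono) auto
      finally have f: "\<bar>if pos i = r then \<Psi> \<bullet> (\<eta>h - \<eta>) + \<Psi> \<bullet> im_error th v w x \<eta> else 0\<bar> \<le> norm \<Psi> * s"
        using s by auto
      have Cis: "Ci i * s = \<bar>lam $ i\<bar> * ((1 / bmin + 1) * s) + (\<bar>ck ?k\<bar> * (s / bmin) + Co ?k * (s / bmin)) + norm \<Psi> * s"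
        unfolding Ci_def by (simp add: algebra_simps)
      have split: "obs_input th v w z x \<eta> \<eta>h eh $ i = lam $ i * (scaled v w x 0 - eh)
          + (ck ?k * scaled v w x 0 + observer_coord ck (drift v w z (x $ ix 1)) ?k)
          + (if pos i = r then \<Psi> \<bullet> (\<eta>h - \<eta>) + \<Psi> \<bullet> im_error th v w x \<eta> else 0)"
        by (simp add: obs_input_def)
      have tri: "\<bar>A + (B + C) + F\<bar> \<le> a' + (b' + c') + f'"
        if "\<bar>A\<bar> \<le> a'" "\<bar>B\<bar> \<le> b'" "\<bar>C\<bar> \<le> c'" "\<bar>F\<bar> \<le> f'" for A B C F a' b' c' f' :: real
        using that by linarith
      show ?thesis unfolding Cis split by (rule tri[OF a b c f])
    qed
    have "norm (obs_input th v w z x \<eta> \<eta>h eh) \<le> (\<Sum>i\<in>UNIV. \<bar>obs_input th v w z x \<eta> \<eta>h eh $ i\<bar>)" by (rule norm_le_l1_cart)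
    also have "\<dots> \<le> (\<Sum>i\<in>UNIV. Ci i * s)" by (rule sum_mono) (rule comp)
    also have "\<dots> = (\<Sum>i\<in>UNIV. Ci i) * s" by (simp add: sum_distrib_right)
    also have "\<dots> \<le> C * s" using C s by (intro mult_right_mono) auto
    finally show "norm (obs_input th v w z x \<eta> \<eta>h eh)
         \<le> C * (\<bar>x $ ix 1 - q v w\<bar> + d + norm (im_error th v w x \<eta>) + growth v w z (x $ ix 1))"
      by (simp add: s_def e_def G_def p_def)
  qed
qed

section \<open>The chain of virtual controls\<close>

text \<open>The derivative of the tracking error is \<open>b(w)\<close> times the second state of the scaled chain,
  which is the estimate \<open>\<xi>\<^sub>2\<close> up to the observer error, or the control if \<open>r = 1\<close>. The other
  variables are differentiated along the observer, where only the correction term, with factor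
  \<open>\<lambda>\<^sub>i\<close>, is a perturbation. The last input \<open>a\<^sub>r\<close> is the sampling error of the control.\<close>

lemma controller_chain:
  fixes bmin bmax d eh u t :: real and w :: "real^'nw" and v :: "real \<Rightarrow> real^'nv" and z :: "real^'nz"
    and x xi :: "real \<Rightarrow> 'r rvec" and \<eta> :: "real \<Rightarrow> 's rvec" and \<eta>h :: "'s rvec"
    and \<rho> :: "nat \<Rightarrow> real \<Rightarrow> real" and \<psi>g :: "real \<Rightarrow> real"
  assumes bnd: "0 < bmin" "bmin \<le> b w" "b w \<le> bmax"
    and v: "exo_trajectory S v"
    and \<rho>: "\<forall>i\<in>{1..r}. smooth (\<rho> i)"
    and x: "(x has_vector_derivative x_field g b z (x t) (v t) w u) (at t within I)"
    and \<eta>: "(\<eta> has_vector_derivative (M *v \<eta> t + u *\<^sub>R N)) (at t within I)"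
    and xi: "(xi has_vector_derivative (A_obs lam *v xi t + eh *\<^sub>R lam + (u - \<Psi> \<bullet> \<eta>h) *\<^sub>R B_obs)) (at t within I)"
    and d: "norm (\<eta>h - \<eta> t) \<le> d" "\<bar>eh - (x t $ ix 1 - q (v t) w)\<bar> \<le> d"
    and growth: "growth (v t) w z (x t $ ix 1)
      \<le> \<psi>g (norm (z - zss (v t) w) + \<bar>x t $ ix 1 - q (v t) w\<bar>) * (norm (z - zss (v t) w) + \<bar>x t $ ix 1 - q (v t) w\<bar>)"
    and \<psi>g: "gain \<psi>g"
  defines "e \<equiv> \<lambda>\<tau>. x \<tau> $ ix 1 - q (v \<tau>) w"
    and "n \<equiv> norm (z - zss (v t) w) + norm (im_error (im_state v w t) (v t) w (x t) (\<eta> t))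
      + norm (obs_error (v t) w (x t) (xi t))"
    and "y \<equiv> \<lambda>i. xi_check \<rho> (x t $ ix 1 - q (v t) w) (xi t) i"
  shows "\<exists>y' G. (\<forall>i\<in>{1..r}. ((\<lambda>\<tau>. xi_check \<rho> (e \<tau>) (xi \<tau>) i) has_real_derivative y' i) (at t within I)) \<and>
    chain_equations (\<lambda>s. (bmax * (norm \<Psi> + 1) + \<bar>ck 0\<bar>) + \<psi>g s) (norm lam * (2 + 1 / bmin)) (min bmin 1) (max bmax 1) r \<rho>
      n d y y' G (\<lambda>i. if i = 1 then b w else 1)
      (\<lambda>i. if i = 0 then e t else if i < r then y (Suc i) else u - \<Psi> \<bullet> \<eta>h + \<rho> r (y r) * y r)"
proof -
  have y_eq: "y i = xi_check \<rho> (e t) (xi t) i" for i by (simp add: y_def e_def)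
  define p where "p = im_error (im_state v w t) (v t) w (x t) (\<eta> t)"
  define o' where "o' = obs_error (v t) w (x t) (xi t)"
  define xi' where "xi' = A_obs lam *v xi t + eh *\<^sub>R lam + (u - \<Psi> \<bullet> \<eta>h) *\<^sub>R B_obs"
  \<comment> \<open>\<open>e' / b(w)\<close> splits into the realised control \<open>U 1\<close>, the observer error \<open>R\<close> (for \<open>r = 1\<close>
     errors of the internal model instead) and the perturbation \<open>\<delta>\<close>.\<close>
  define \<delta> where "\<delta> = ck 0 * scaled (v t) w (x t) 0 + drift (v t) w z (x t $ ix 1) 0"
  define R where "R = (if 1 < r then o' $ ix 2 else \<Psi> \<bullet> (\<eta>h - \<eta> t) + \<Psi> \<bullet> p)"
  define U where "U i = (if i < r then xi t $ ix (Suc i) else u - \<Psi> \<bullet> \<eta>h)" for i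
  define e' where "e' = b w * (U 1 + R + \<delta>)"
  define a where "a i = (if i = 0 then e t else if i < r then y (Suc i) else u - \<Psi> \<bullet> \<eta>h + \<rho> r (y r) * y r)" for i
  have bw: "0 < b w" using b_pos .
  have e: "(e has_real_derivative e') (at t within I)"
  proof -
    have "((\<lambda>\<tau>. scaled (v \<tau>) w (x \<tau>) 0) has_real_derivative (U 1 + R + \<delta>)) (at t within I)"
    proof -
      have "Suc 1 = (2::nat)" by simp
      then have "U 1 + R + \<delta> = (if 1 < r then (o' + xi t) $ ix 2 else (u - \<Psi> \<bullet> \<eta>h)
          + (\<Psi> \<bullet> (\<eta>h - \<eta> t) + \<Psi> \<bullet> p)) + \<delta>"
        unfolding U_def R_def by (cases "1 < r") (simp_all only: if_True if_False vector_add_component add.commute add.assoc)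
      then show ?thesis
        using linear_error_dynamics(3)[OF v x \<eta> xi] unfolding \<delta>_def p_def o'_def by (simp only:)
    qed
    from DERIV_cmult[OF this, of "b w"] show ?thesis
      unfolding e'_def e_def scaled_0 using bw by simp
  qed
  define y' where "y' = xi_rate \<rho> (e t) (xi t) e' xi'"
  have y'_deriv: "((\<lambda>\<tau>. xi_check \<rho> (e \<tau>) (xi \<tau>) i) has_real_derivative y' i) (at t within I)" if "i \<in> {1..r}" for i
    unfolding y'_def by (rule xi_check_derivative[OF e xi[folded xi'_def]]) (use that \<rho> in auto)
  define G where "G i = y' i - (if i = 1 then b w else 1) * (- \<rho> i (y i) * y i + a i)" for i
  have y1: "y (Suc 0) = e t" by (simp add: y_eq)
  have yS: "y (Suc i) = xi t $ ix (Suc i) + \<rho> i (y i) * y i" if "1 \<le> i" for i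
    using that by (cases i) (simp_all add: y_eq)
  have virtual: "- \<rho> i (y i) * y i + a i = U i" if "i \<in> {1..r}" for i
    using that yS[of i] by (auto simp: a_def U_def)
  have xi'_nth: "xi' $ ix i = - lam $ ix i * xi t $ ix 1 + eh * lam $ ix i + U i" if "i \<in> {1..r}" for i
  proof -
    have "pos (ix i :: 'r) = i" using that by (simp add: r_card)
    then show ?thesis using that unfolding xi'_def vector_add_component observer_matrix_nth U_def
      by (auto simp: B_obs_def r_card)
  qed
  have nn: "0 \<le> d" "0 \<le> norm \<Psi>" using order_trans[OF norm_ge_zero d(1)] by auto
  have n: "norm (z - zss (v t) w) \<le> n" "norm p \<le> n" "norm o' \<le> n" "0 \<le> n" "norm p + norm o' \<le> n"
    by (auto simp: n_def p_def o'_def)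
  have et: "x t $ ix 1 - q (v t) w = e t" by (simp add: e_def)
  define m where "m = n + \<bar>y 1\<bar> + d"
  have m: "0 \<le> m" "n + d \<le> m" "\<bar>e t\<bar> \<le> m" using nn n by (auto simp: m_def y1)
  have G1: "\<bar>G 1\<bar> \<le> ((bmax * (norm \<Psi> + 1) + \<bar>ck 0\<bar>) + \<psi>g m) * m"
  proof -
    have "G 1 = b w * R + b w * \<delta>"
    proof -
      have "y' 1 = e'" by (simp add: y'_def)
      then show ?thesis unfolding G_def using virtual[of 1] r_pos by (simp add: e'_def algebra_simps)
    qed
    moreover have "\<bar>b w * R\<bar> \<le> bmax * ((norm \<Psi> + 1) * m)"
    proof -
      have "\<bar>R\<bar> \<le> (norm \<Psi> + 1) * m"
      proof (cases "1 < r")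
        case True
        have "\<bar>o' $ ix 2\<bar> \<le> m" using component_le_norm_cart[of o' "ix 2"] n m nn by linarith
        also have "m \<le> (norm \<Psi> + 1) * m" using m by (simp add: distrib_right)
        finally show ?thesis using True by (simp add: R_def)
      next
        case False
        have "\<bar>\<Psi> \<bullet> (\<eta>h - \<eta> t)\<bar> \<le> norm \<Psi> * d"
          by (rule order_trans[OF Cauchy_Schwarz_ineq2 mult_left_mono[OF d(1)]]) simp
        moreover have "\<bar>\<Psi> \<bullet> p\<bar> \<le> norm \<Psi> * n"
          by (rule order_trans[OF Cauchy_Schwarz_ineq2 mult_left_mono[OF n(2)]]) simp
        ultimately have "\<bar>R\<bar> \<le> norm \<Psi> * (n + d)" using False by (simp add: R_def distrib_left)
        also have "\<dots> \<le> norm \<Psi> * m" using m by (intro mult_left_mono) auto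
        also have "\<dots> \<le> (norm \<Psi> + 1) * m" using m by (intro mult_right_mono) auto
        finally show ?thesis .
      qed
      then show ?thesis unfolding abs_mult using bw bnd m by (intro mult_mono) auto
    qed
    moreover have "\<bar>b w * \<delta>\<bar> \<le> \<bar>ck 0\<bar> * m + \<psi>g m * m"
    proof -
      define gr where "gr = g 1 z (x t $ ix 1) (v t) w - g 1 (zss (v t) w) (q (v t) w) (v t) w"
      have "b w * \<delta> = ck 0 * e t + gr"
        using bw unfolding \<delta>_def scaled_0 et gr_def drift_def by (simp add: field_simps)
      moreover have "\<bar>gr\<bar> \<le> growth (v t) w z (x t $ ix 1)"
        unfolding growth_def gr_def using r_pos
        member_le_sum[of 0 "{..<r}" "\<lambda>k. \<bar>g (Suc k) z (x t $ ix 1) (v t) w - g (Suc k) (zss (v t) w) (q (v t) w) (v t) w\<bar>"] by simp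
      moreover have "growth (v t) w z (x t $ ix 1) \<le> \<psi>g m * m"
      proof -
        have le: "norm (z - zss (v t) w) + \<bar>e t\<bar> \<le> m" using n nn by (simp add: m_def y1)
        have "\<psi>g (norm (z - zss (v t) w) + \<bar>e t\<bar>) * (norm (z - zss (v t) w) + \<bar>e t\<bar>) \<le> \<psi>g m * m"
          using le gain_mono[OF \<psi>g _ le] gain_nonneg[OF \<psi>g m(1)] by (intro mult_mono) auto
        then show ?thesis using growth unfolding et by simp
      qed
      moreover have "\<bar>ck 0 * e t\<bar> \<le> \<bar>ck 0\<bar> * m" unfolding abs_mult using m by (intro mult_left_mono) auto
      ultimately show ?thesis by linarith
    qed
    ultimately have "\<bar>G 1\<bar> \<le> bmax * ((norm \<Psi> + 1) * m) + (\<bar>ck 0\<bar> * m + \<psi>g m * m)" by linarith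
    then show ?thesis by (simp add: algebra_simps)
  qed
  have Gi: "\<bar>G i\<bar> \<le> norm lam * (2 + 1 / bmin) * m + \<bar>deriv (\<lambda>s. \<rho> (i - 1) s * s) (y (i - 1)) * y' (i - 1)\<bar>"
    if i: "i \<in> {1..r}" "i \<noteq> 1" for i
  proof -
    obtain j where j: "i = Suc (Suc j)" using i by (metis One_nat_def atLeastAtMost_iff not0_implies_Suc not_one_le_zero)
    define D where "D = deriv (\<lambda>s. \<rho> (i - 1) s * s) (y (i - 1)) * y' (i - 1)"
    have "y' i = xi' $ ix i + D" by (simp add: j y'_def D_def y_eq)
    then have "G i = lam $ ix i * (eh - xi t $ ix 1) + D"
      unfolding G_def virtual[OF i(1)] xi'_nth[OF i(1)] using i(2) by (simp add: algebra_simps)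
    moreover have "\<bar>lam $ ix i * (eh - xi t $ ix 1)\<bar> \<le> norm lam * ((2 + 1 / bmin) * m)"
    proof -
      have "pos (ix 1 :: 'r) = 1" by simp
      then have o1: "o' $ ix 1 = scaled (v t) w (x t) 0 - xi t $ ix 1"
        by (simp add: o'_def obs_error_def observer_coord_def)
      have "\<bar>scaled (v t) w (x t) 0\<bar> \<le> m / bmin"
        unfolding scaled_0 abs_divide et using bnd bw m by (intro frac_le) auto
      moreover have "\<bar>o' $ ix 1\<bar> \<le> n" using component_le_norm_cart[of o' "ix 1"] n by linarith
      moreover have "\<bar>eh\<bar> \<le> \<bar>e t\<bar> + d" using d(2) unfolding et by linarith
      ultimately have "\<bar>eh - xi t $ ix 1\<bar> \<le> (\<bar>e t\<bar> + d) + (m / bmin + n)" using o1 by linarith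
      also have "\<dots> \<le> (2 + 1 / bmin) * m" using n nn by (simp add: m_def y1 algebra_simps add_divide_distrib)
      finally show ?thesis
        unfolding abs_mult by (intro mult_mono component_le_norm_cart) auto
    qed
    ultimately show ?thesis unfolding D_def[symmetric] mult.assoc by linarith
  qed
  have "chain_equations (\<lambda>s. (bmax * (norm \<Psi> + 1) + \<bar>ck 0\<bar>) + \<psi>g s) (norm lam * (2 + 1 / bmin)) (min bmin 1) (max bmax 1) r \<rho>
      n d y y' G (\<lambda>i. if i = 1 then b w else 1) a"
    unfolding chain_equations_def perturbation_bound_def
  proof (intro conjI ballI allI impI)
    fix i assume i: "i \<in> {1..r}"
    show "y' i = (if i = 1 then b w else 1) * (- \<rho> i (y i) * y i + a i) + G i" by (simp add: G_def)
    show "min bmin 1 \<le> (if i = 1 then b w else 1)" "(if i = 1 then b w else 1) \<le> max bmax 1" using bnd by auto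
    show "if i = 1 then \<bar>G 1\<bar> \<le> ((bmax * (norm \<Psi> + 1) + \<bar>ck 0\<bar>) + \<psi>g (n + \<bar>y 1\<bar> + d)) * (n + \<bar>y 1\<bar> + d)
       else \<bar>G i\<bar> \<le> norm lam * (2 + 1 / bmin) * (n + \<bar>y 1\<bar> + d)
         + \<bar>deriv (\<lambda>s. \<rho> (i - 1) s * s) (y (i - 1)) * y' (i - 1)\<bar>"
      using G1 Gi[OF i] unfolding m_def by auto
  next
    fix i assume "i < r"
    then show "a i = y (i + 1)" using y1 by (auto simp: a_def)
  qed
  with y'_deriv show ?thesis unfolding a_def[abs_def] by blast
qed

section \<open>The Lyapunov function of the closed loop\<close>

definition error_size :: "(nat \<Rightarrow> real \<Rightarrow> real) \<Rightarrow> 's rvec \<Rightarrow> real^'nv \<Rightarrow> real^'nw \<Rightarrow>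
    real^'nz \<Rightarrow> 'r rvec \<Rightarrow> 's rvec \<Rightarrow> 'r rvec \<Rightarrow> real" where
  "error_size \<rho> th v w z x \<eta> xi = chain_size r
     (norm (z - zss v w) + norm (im_error th v w x \<eta>) + norm (obs_error v w x xi))
     (\<lambda>i. xi_check \<rho> (x $ ix 1 - q v w) xi i)"

lemma zero_dynamics_storage:
  obtains V0 alow aup a0 gam0 where "C_k 1 V0" "class_K_inf alow" "class_K_inf aup" "class_K_inf a0"
    "smooth gam0" "pos_def_fun gam0" "Limsup (at_right 0) (\<lambda>s. ereal (s\<^sup>2 / a0 s)) < \<infinity>"
    "\<And>zb. alow (norm zb) \<le> V0 zb" "\<And>zb. V0 zb \<le> aup (norm zb)"
    "\<And>v w zb e. v \<in> VV \<Longrightarrow> w \<in> WW \<Longrightarrow>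
       frechet_derivative V0 (at zb) (f_bar f q zss zb e v w) \<le> - a0 (norm zb) + gam0 e"
proof -
  have "compact (VV \<times> WW)" by (intro compact_Times VV WW)
  from A4[unfolded assumption_A4_def, THEN spec, THEN mp, OF this]
  obtain V0 alow aup a0 gam0 where st: "C_k 1 V0" "class_K_inf alow" "class_K_inf aup" "class_K_inf a0"
    "smooth gam0" "pos_def_fun gam0" "Limsup (at_right 0) (\<lambda>s. ereal (s\<^sup>2 / a0 s)) < \<infinity>"
    "\<forall>(v, w)\<in>VV \<times> WW. \<forall>zb e. alow (norm zb) \<le> V0 zb \<and> V0 zb \<le> aup (norm zb) \<and>
       frechet_derivative V0 (at zb) (f_bar f q zss zb e v w) \<le> - a0 (norm zb) + gam0 e"
    by (elim exE conjE) (rule that)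
  obtain v1 w1 where "v1 \<in> VV" "w1 \<in> WW" using VV WW by blast
  show thesis
  proof (rule that[OF st(1-7)])
    fix zb
    show "alow (norm zb) \<le> V0 zb" "V0 zb \<le> aup (norm zb)"
      using st(8) \<open>v1 \<in> VV\<close> \<open>w1 \<in> WW\<close> by blast+
  next
    fix v w zb e assume "v \<in> VV" "w \<in> WW"
    then show "frechet_derivative V0 (at zb) (f_bar f q zss zb e v w) \<le> - a0 (norm zb) + gam0 e"
      using st(8) by blast
  qed
qed

lemma error_coordinates_continuous:
  assumes "exo_trajectory S v" "continuous_on A z" "continuous_on A x" "continuous_on A \<eta>" "continuous_on A xi"
  shows "continuous_on A (\<lambda>\<tau>. z \<tau> - zss (v \<tau>) w)"
    "continuous_on A (\<lambda>\<tau>. im_error (im_state v w \<tau>) (v \<tau>) w (x \<tau>) (\<eta> \<tau>))"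
    "continuous_on A (\<lambda>\<tau>. obs_error (v \<tau>) w (x \<tau>) (xi \<tau>))"
    "continuous_on A (\<lambda>\<tau>. x \<tau> $ ix 1 - q (v \<tau>) w)"
proof -
  have v: "continuous_on A v"
    using assms(1) unfolding exo_trajectory_def
    by (meson continuous_at_imp_continuous_on has_vector_derivative_continuous)
  have th: "continuous_on A (im_state v w)"
    using im_state_dynamics(1)[OF assms(1)]
    by (meson continuous_on_eq_continuous_within has_vector_derivative_continuous)
  have c: "continuous_on A (\<lambda>\<tau>. h (v \<tau>))" if "smooth h" for h :: "real^'nv \<Rightarrow> 'c::euclidean_space"
    by (rule continuous_on_compose2[OF smooth_continuous_on[OF that, of UNIV] v]) simp
  have s: "continuous_on A (\<lambda>\<tau>. scaled (v \<tau>) w (x \<tau>) k)" if "k < r" for k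
    unfolding scaled_def using that b_pos[of w] assms(3)
    by (intro continuous_intros c smooth_xss) auto
  show "continuous_on A (\<lambda>\<tau>. z \<tau> - zss (v \<tau>) w)" by (intro continuous_intros assms c smooth_zss)
  show "continuous_on A (\<lambda>\<tau>. x \<tau> $ ix 1 - q (v \<tau>) w)" by (intro continuous_intros assms c smooth_q)
  show "continuous_on A (\<lambda>\<tau>. im_error (im_state v w \<tau>) (v \<tau>) w (x \<tau>) (\<eta> \<tau>))"
    unfolding im_error_def by (intro continuous_intros assms th s) auto
  show "continuous_on A (\<lambda>\<tau>. obs_error (v \<tau>) w (x \<tau>) (xi \<tau>))"
    unfolding obs_error_def
  proof (rule continuous_on_vec_lambda)
    fix i :: 'r
    have i: "pos i - 1 < r" using pos_ge_1[of i] pos_le_card[of i] by (simp add: r_card)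
    have "continuous_on A (\<lambda>\<tau>. xi \<tau> $ i)" by (intro continuous_intros assms)
    moreover have "continuous_on A (\<lambda>\<tau>. observer_coord ck (scaled (v \<tau>) w (x \<tau>)) (pos i - 1))"
      unfolding observer_coord_def
      by (intro continuous_on_diff continuous_on_sum continuous_on_mult continuous_on_const s) (use i in auto)
    ultimately show "continuous_on A (\<lambda>\<tau>. observer_coord ck (scaled (v \<tau>) w (x \<tau>)) (pos i - 1) - xi \<tau> $ i)"
      by (rule continuous_on_diff[rotated])
  qed
qed

lemma xi_check_continuous:
  assumes "\<And>j. 1 \<le> j \<Longrightarrow> j < i \<Longrightarrow> smooth (\<rho> j)" "continuous_on A e" "continuous_on A xi"
  shows "continuous_on A (\<lambda>\<tau>. xi_check \<rho> (e \<tau>) (xi \<tau> :: 'r rvec) i)"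
  using assms(1)
proof (induction i rule: induct_nat_012)
  case 1 then show ?case using assms(2) by simp
next
  case (ge2 i)
  have IH: "continuous_on A (\<lambda>\<tau>. xi_check \<rho> (e \<tau>) (xi \<tau> :: 'r rvec) (Suc i))"
    by (rule ge2.IH(2)) (use ge2.prems in auto)
  have "continuous_on UNIV (\<rho> (Suc i))" by (rule smooth_continuous_on) (use ge2.prems in auto)
  then have "continuous_on A (\<lambda>\<tau>. \<rho> (Suc i) (xi_check \<rho> (e \<tau>) (xi \<tau> :: 'r rvec) (Suc i)))"
    by (rule continuous_on_compose2[OF _ IH]) simp
  moreover have "continuous_on A (\<lambda>\<tau>. xi \<tau> $ ix (Suc (Suc i)))" by (intro continuous_intros assms(3))
  ultimately show ?case
    unfolding xi_check.simps using IH by (intro continuous_on_add continuous_on_mult)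
qed simp

end

text \<open>A controller together with a Lyapunov function \<open>LW\<close> of the closed loop, evaluated at the
  steady state of the internal model, the exosystem state, the parameter and the states. The
  gains \<open>up\<close> and \<open>lw\<close> compare it with the size of the error; \<open>\<eta>h\<close>, \<open>eh\<close> and \<open>yh\<close> are sampled
  values.\<close>

locale regulated_design = output_regulation_plant f g b q S zss rh N M T lam VV WW r
  for f :: "real^'nz \<Rightarrow> real \<Rightarrow> real^'nv \<Rightarrow> real^'nw \<Rightarrow> real^'nz"
    and g b q S zss and rh N :: "('s::{finite,linorder}) rvec" and M T
    and lam :: "('r::{finite,linorder}) rvec" and VV WW r +
  fixes \<rho> :: "nat \<Rightarrow> real \<Rightarrow> real" and \<pi>r :: "'s rvec \<times> real \<Rightarrow> real" and \<sigma> c :: real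
    and up lw :: "real \<Rightarrow> real"
    and LW :: "'s rvec \<Rightarrow> real^'nv \<Rightarrow> real^'nw \<Rightarrow> real^'nz \<Rightarrow> 'r rvec \<Rightarrow> 's rvec \<Rightarrow> 'r rvec \<Rightarrow> real"
  assumes \<rho>: "\<forall>i\<in>{1..r}. smooth (\<rho> i) \<and> (\<forall>a. \<rho> i a > 0)"
    and \<pi>r: "pos_def_fun \<pi>r" "continuous_on UNIV \<pi>r" and \<sigma>: "0 < \<sigma>" "\<sigma> < 1" and c: "0 < c"
    and up: "vanishing_gain up" and lw: "vanishing_gain lw"
    and LW_size: "\<And>th v w z x \<eta> xi. 0 \<le> LW th v w z x \<eta> xi \<and> LW th v w z x \<eta> xi \<le> up (error_size \<rho> th v w z x \<eta> xi) \<and>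
       error_size \<rho> th v w z x \<eta> xi \<le> lw (LW th v w z x \<eta> xi)"
    and LW_cont: "\<And>v w z x \<eta> xi A. exo_trajectory S v \<Longrightarrow> continuous_on A z \<Longrightarrow> continuous_on A x \<Longrightarrow>
       continuous_on A \<eta> \<Longrightarrow> continuous_on A xi \<Longrightarrow>
       continuous_on A (\<lambda>\<tau>. LW (im_state v w \<tau>) (v \<tau>) w (z \<tau>) (x \<tau>) (\<eta> \<tau>) (xi \<tau>))"
    and LW_decay: "\<And>v w z x \<eta> xi t I \<delta> \<eta>h eh yh. exo_trajectory S v \<Longrightarrow> v t \<in> VV \<Longrightarrow> w \<in> WW \<Longrightarrow>
       (z has_vector_derivative f (z t) (x t $ ix 1) (v t) w) (at t within I) \<Longrightarrow>
       (x has_vector_derivative x_field g b (z t) (x t) (v t) w (- \<rho> r yh * yh + \<Psi> \<bullet> \<eta>h)) (at t within I) \<Longrightarrow>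
       (\<eta> has_vector_derivative (M *v \<eta> t + (- \<rho> r yh * yh + \<Psi> \<bullet> \<eta>h) *\<^sub>R N)) (at t within I) \<Longrightarrow>
       (xi has_vector_derivative (A_obs lam *v xi t + eh *\<^sub>R lam
          + ((- \<rho> r yh * yh + \<Psi> \<bullet> \<eta>h) - \<Psi> \<bullet> \<eta>h) *\<^sub>R B_obs)) (at t within I) \<Longrightarrow>
       (let e = x t $ ix 1 - q (v t) w; y = xi_check \<rho> e (xi t) r in
          (- \<rho> r yh * yh + \<rho> r y * y)\<^sup>2 + \<pi>r (\<eta>h - \<eta> t, eh - e) - \<sigma>\<^sup>2 * \<rho> r y * y\<^sup>2 < \<delta>\<^sup>2) \<Longrightarrow>
       \<exists>D. ((\<lambda>\<tau>. LW (im_state v w \<tau>) (v \<tau>) w (z \<tau>) (x \<tau>) (\<eta> \<tau>) (xi \<tau>)) has_real_derivative D) (at t within I) \<and>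
          D \<le> - (error_size \<rho> (im_state v w t) (v t) w (z t) (x t) (\<eta> t) (xi t))\<^sup>2 + c * \<delta>\<^sup>2"

context output_regulation_plant
begin

text \<open>The last input of the chain is the sampling error of the control, and its gain is the
  constant \<open>c = \<beta>\<^sub>m\<^sub>a\<^sub>x\<^sup>2 / 2\<close>. The triggering condition can thus be inserted: \<open>\<pi>\<^sub>r\<close> is so large
  that \<open>c \<pi>\<^sub>r\<close> dominates the effect of the other sampling errors, and \<open>\<sigma>\<close> so small that the
  damping of the last variable pays for the term with \<open>\<sigma>\<^sup>2\<close>.\<close>

lemma stabilizing_design:
  "\<exists>\<rho> \<pi>r \<sigma> c up lw LW. regulated_design f g b q S zss rh N M T lam VV WW r \<rho> \<pi>r \<sigma> c up lw LW"
proof -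
  obtain bmin bmax where bb: "0 < bmin" "bmin \<le> bmax" "\<And>w. w \<in> WW \<Longrightarrow> bmin \<le> b w \<and> b w \<le> bmax"
    by (rule b_bounds) blast
  obtain \<psi>g where \<psi>g: "gain \<psi>g" "\<And>v w z y. v \<in> VV \<Longrightarrow> w \<in> WW \<Longrightarrow>
    growth v w z y \<le> \<psi>g (norm (z - zss v w) + \<bar>y - q v w\<bar>) * (norm (z - zss v w) + \<bar>y - q v w\<bar>)"
    by (rule growth_gain) blast
  obtain V0 alow aup a0 gam0 where st: "C_k 1 V0" "class_K_inf alow" "class_K_inf aup" "class_K_inf a0"
    "smooth gam0" "pos_def_fun gam0" "Limsup (at_right 0) (\<lambda>s. ereal (s\<^sup>2 / a0 s)) < \<infinity>"
    "\<And>zb. alow (norm zb) \<le> V0 zb" "\<And>zb. V0 zb \<le> aup (norm zb)"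
    "\<And>v w zb e. v \<in> VV \<Longrightarrow> w \<in> WW \<Longrightarrow>
       frechet_derivative V0 (at zb) (f_bar f q zss zb e v w) \<le> - a0 (norm zb) + gam0 e"
    by (rule zero_dynamics_storage) blast
  obtain C where C: "0 \<le> C"
    "\<And>v w z x. bmin \<le> b w \<Longrightarrow>
       norm (im_input v w z x) \<le> C * (\<bar>x $ ix 1 - q v w\<bar> + growth v w z (x $ ix 1))"
    "\<And>th v w z x \<eta> \<eta>h eh d. bmin \<le> b w \<Longrightarrow> norm (\<eta>h - \<eta>) \<le> d \<Longrightarrow> \<bar>eh - (x $ ix 1 - q v w)\<bar> \<le> d \<Longrightarrow>
       norm (obs_input th v w z x \<eta> \<eta>h eh)
         \<le> C * (\<bar>x $ ix 1 - q v w\<bar> + d + norm (im_error th v w x \<eta>) + growth v w z (x $ ix 1))"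
    by (rule input_bounds[OF bb(1)]) blast
  obtain Vb \<psi>\<gamma> \<psi>0 upb lwb where casc: "gain \<psi>\<gamma>" "gain \<psi>0" "vanishing_gain upb" "vanishing_gain lwb"
    and Vb: "\<And>zb (p :: 's rvec) (x :: 'r rvec). 0 \<le> Vb zb p x \<and> Vb zb p x \<le> upb (norm zb + norm p + norm x) \<and>
        norm zb + norm p + norm x \<le> lwb (Vb zb p x)"
    and Vb_deriv: "\<And>zb (p :: real \<Rightarrow> 's rvec) (x :: real \<Rightarrow> 'r rvec) zb' h1 h2 e d G t I.
       \<lbrakk>(zb has_vector_derivative zb') (at t within I);
        frechet_derivative V0 (at (zb t)) zb' \<le> - a0 (norm (zb t)) + gam0 e;
        (p has_vector_derivative (M *v p t + h1)) (at t within I);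
        (x has_vector_derivative (A_obs lam *v x t + h2)) (at t within I);
        norm h1 \<le> C * (\<bar>e\<bar> + G); norm h2 \<le> C * (\<bar>e\<bar> + d + norm (p t) + G);
        0 \<le> d; 0 \<le> G; G \<le> \<psi>g (norm (zb t) + \<bar>e\<bar>) * (norm (zb t) + \<bar>e\<bar>)\<rbrakk> \<Longrightarrow>
       \<exists>D. ((\<lambda>\<tau>. Vb (zb \<tau>) (p \<tau>) (x \<tau>)) has_real_derivative D) (at t within I) \<and>
         D \<le> - (norm (zb t) + norm (p t) + norm (x t))\<^sup>2 + \<psi>\<gamma> \<bar>e\<bar> * e\<^sup>2 + \<psi>0 d * d\<^sup>2"
    and Vb_cont: "continuous_on UNIV (\<lambda>(zb, p, x). Vb zb p x)"
    by (rule cascade_lyapunov[OF M_Hurwitz lam_Hurwitz st(1-9) C(1) \<psi>g(1)]) blast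
  \<comment> \<open>The constants that appear in \<open>controller_chain\<close>.\<close>
  define K1 where "K1 = bmax * (norm \<Psi> + 1) + \<bar>ck 0\<bar>"
  define CL where "CL = norm lam * (2 + 1 / bmin)"
  define \<beta>min \<beta>max where "\<beta>min = min bmin 1" and "\<beta>max = max bmax 1"
  have \<beta>: "0 < \<beta>min" "\<beta>min \<le> \<beta>max" "1 \<le> \<beta>max" using bb by (auto simp: \<beta>min_def \<beta>max_def)
  have K10: "0 \<le> K1" using bb by (simp add: K1_def)
  have \<psi>1: "gain (\<lambda>s. K1 + \<psi>g s)" by (intro gain_add gain_const K10 \<psi>g)
  have CL0: "0 \<le> CL" using bb by (simp add: CL_def)
  obtain \<rho> W \<psi>a \<psi>\<pi> up lw \<psi>G where
    stage: "backstepping_stage \<psi>\<gamma> \<psi>0 (\<lambda>s. K1 + \<psi>g s) CL \<beta>min \<beta>max upb lwb r \<rho> W \<psi>a \<psi>\<pi> up lw \<psi>G"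
    using backstepping_chain[OF casc(1,2) \<psi>1 casc(3,4) \<beta>(1,2) CL0] by blast
  interpret chain: backstepping_stage \<psi>\<gamma> \<psi>0 "\<lambda>s. K1 + \<psi>g s" CL \<beta>min \<beta>max upb lwb r \<rho> W \<psi>a \<psi>\<pi> up lw \<psi>G
    by (rule stage)
  define c where "c = \<beta>max\<^sup>2 / 2"
  have c: "0 < c" using \<beta> by (simp add: c_def)
  obtain p p' where p: "smooth p" "\<And>x. 1 \<le> p x" "\<And>x. \<psi>\<pi> \<bar>x\<bar> \<le> p x"
    by (rule smooth_majorant[OF chain.\<psi>\<pi>]) blast
  define \<pi>r where "\<pi>r X = p (norm X) * (norm X)\<^sup>2 / c" for X :: "'s rvec \<times> real"
  \<comment> \<open>Then \<open>c \<sigma>\<^sup>2 \<le> \<beta>\<^sub>m\<^sub>i\<^sub>n / 2\<close>, the factor of the damping of the last variable.\<close>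
  define \<sigma> where "\<sigma> = min (1/2) (\<beta>min / \<beta>max\<^sup>2)"
  have \<sigma>: "0 < \<sigma>" "\<sigma> < 1" using \<beta> by (auto simp: \<sigma>_def)
  have c_sigma: "c * \<sigma>\<^sup>2 \<le> \<beta>min / 2"
  proof -
    have "\<sigma>\<^sup>2 \<le> \<sigma> * 1" unfolding power2_eq_square using \<sigma> by (intro mult_left_mono) auto
    also have "\<dots> \<le> \<beta>min / \<beta>max\<^sup>2" by (simp add: \<sigma>_def)
    finally have "c * \<sigma>\<^sup>2 \<le> c * (\<beta>min / \<beta>max\<^sup>2)" using c by (intro mult_left_mono) auto
    also have "\<dots> = \<beta>min / 2" using \<beta> by (simp add: c_def)
    finally show ?thesis .
  qed
  define LW where "LW th v w z x \<eta> xi = W (Vb (z - zss v w) (im_error th v w x \<eta>) (obs_error v w x xi))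
      (\<lambda>i. xi_check \<rho> (x $ ix 1 - q v w) xi i)" for th v w z x \<eta> xi
  have rho_pos: "\<forall>i\<in>{1..r}. smooth (\<rho> i) \<and> (\<forall>a. \<rho> i a > 0)"
    using chain.gain_smooth chain.gain_ge_1 by (auto intro: less_le_trans[OF zero_less_one])
  have pi_pd: "pos_def_fun \<pi>r"
  proof -
    have "0 < p s" for s by (rule less_le_trans[OF zero_less_one p(2)])
    then show ?thesis unfolding pos_def_fun_def \<pi>r_def using c by simp
  qed
  have pi_cont: "continuous_on UNIV \<pi>r"
  proof -
    have "continuous_on UNIV (\<lambda>X::'s rvec \<times> real. p (norm X))"
      by (rule continuous_on_compose2[OF smooth_continuous_on[OF p(1), of UNIV]]) (intro continuous_on_norm continuous_on_id, simp)
    moreover have "continuous_on UNIV (\<lambda>X::'s rvec \<times> real. (norm X)\<^sup>2 / c)"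
      by (simp only: divide_inverse) (intro continuous_on_mult continuous_on_power continuous_on_norm continuous_on_id continuous_on_const)
    ultimately have "continuous_on UNIV (\<lambda>X::'s rvec \<times> real. p (norm X) * ((norm X)\<^sup>2 / c))"
      by (rule continuous_on_mult)
    then show ?thesis unfolding \<pi>r_def[abs_def] by simp
  qed
  have sizes: "0 \<le> LW th v w z x \<eta> xi \<and> LW th v w z x \<eta> xi \<le> up (error_size \<rho> th v w z x \<eta> xi) \<and>
       error_size \<rho> th v w z x \<eta> xi \<le> lw (LW th v w z x \<eta> xi)" for th v w z x \<eta> xi
    unfolding LW_def error_size_def using Vb by (intro chain.size) auto
  have cont: "continuous_on A (\<lambda>\<tau>. LW (im_state v w \<tau>) (v \<tau>) w (z \<tau>) (x \<tau>) (\<eta> \<tau>) (xi \<tau>))"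
    if h: "exo_trajectory S v" "continuous_on A z" "continuous_on A x" "continuous_on A \<eta>" "continuous_on A xi"
    for v w z x \<eta> xi A
  proof -
    note ec = error_coordinates_continuous[OF h]
    have "continuous_on A (\<lambda>\<tau>. Vb (z \<tau> - zss (v \<tau>) w) (im_error (im_state v w \<tau>) (v \<tau>) w (x \<tau>) (\<eta> \<tau>)) (obs_error (v \<tau>) w (x \<tau>) (xi \<tau>)))"
      using continuous_on_compose2[OF Vb_cont continuous_on_Pair[OF ec(1) continuous_on_Pair[OF ec(2) ec(3)]]] by simp
    then show ?thesis unfolding LW_def
      by (rule chain.cont) (intro ballI xi_check_continuous[OF _ ec(4) h(5)], use chain.gain_smooth in auto)
  qed
  have decay: "\<exists>D. ((\<lambda>\<tau>. LW (im_state v w \<tau>) (v \<tau>) w (z \<tau>) (x \<tau>) (\<eta> \<tau>) (xi \<tau>)) has_real_derivative D) (at t within I) \<and>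
          D \<le> - (error_size \<rho> (im_state v w t) (v t) w (z t) (x t) (\<eta> t) (xi t))\<^sup>2 + c * \<delta>\<^sup>2"
    if v: "exo_trajectory S v" "v t \<in> VV" and w: "w \<in> WW"
      and z: "(z has_vector_derivative f (z t) (x t $ ix 1) (v t) w) (at t within I)"
      and x: "(x has_vector_derivative x_field g b (z t) (x t) (v t) w (- \<rho> r yh * yh + \<Psi> \<bullet> \<eta>h)) (at t within I)"
      and \<eta>: "(\<eta> has_vector_derivative (M *v \<eta> t + (- \<rho> r yh * yh + \<Psi> \<bullet> \<eta>h) *\<^sub>R N)) (at t within I)"
      and xi: "(xi has_vector_derivative (A_obs lam *v xi t + eh *\<^sub>R lam
          + ((- \<rho> r yh * yh + \<Psi> \<bullet> \<eta>h) - \<Psi> \<bullet> \<eta>h) *\<^sub>R B_obs)) (at t within I)"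
      and trig: "let e = x t $ ix 1 - q (v t) w; y = xi_check \<rho> e (xi t) r in
          (- \<rho> r yh * yh + \<rho> r y * y)\<^sup>2 + \<pi>r (\<eta>h - \<eta> t, eh - e) - \<sigma>\<^sup>2 * \<rho> r y * y\<^sup>2 < \<delta>\<^sup>2"
    for v w z x \<eta> xi t I \<delta> \<eta>h eh yh
  proof -
    define u where "u = - \<rho> r yh * yh + \<Psi> \<bullet> \<eta>h"
    define e where "e \<tau> = x \<tau> $ ix 1 - q (v \<tau>) w" for \<tau>
    define y where "y i = xi_check \<rho> (e t) (xi t) i" for i
    define d where "d = norm (\<eta>h - \<eta> t, eh - e t)"
    define n where "n = norm (z t - zss (v t) w) + norm (im_error (im_state v w t) (v t) w (x t) (\<eta> t))
      + norm (obs_error (v t) w (x t) (xi t))"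
    define a where "a i = (if i = 0 then e t else if i < r then y (Suc i) else u - \<Psi> \<bullet> \<eta>h + \<rho> r (y r) * y r)" for i
    have d: "norm (\<eta>h - \<eta> t) \<le> d" "\<bar>eh - e t\<bar> \<le> d" "0 \<le> d"
      using norm_fst_le[of "\<eta>h - \<eta> t" "eh - e t"] norm_snd_le[of "eh - e t" "\<eta>h - \<eta> t"] by (auto simp: d_def)
    have bw: "bmin \<le> b w" "b w \<le> bmax" using bb(3)[OF w] by auto
    note lin = linear_error_dynamics[OF v(1) x \<eta> xi]
    note gr = \<psi>g(2)[OF v(2) w, of "z t" "x t $ ix 1"]
    define Vt where "Vt \<tau> = Vb (z \<tau> - zss (v \<tau>) w) (im_error (im_state v w \<tau>) (v \<tau>) w (x \<tau>) (\<eta> \<tau>)) (obs_error (v \<tau>) w (x \<tau>) (xi \<tau>))" for \<tau>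
    have "\<exists>D. (Vt has_real_derivative D) (at t within I) \<and>
         D \<le> - n\<^sup>2 + \<psi>\<gamma> \<bar>e t\<bar> * (e t)\<^sup>2 + \<psi>0 d * d\<^sup>2"
      unfolding Vt_def[abs_def] n_def
    proof (rule Vb_deriv)
      show "((\<lambda>\<tau>. z \<tau> - zss (v \<tau>) w) has_vector_derivative
          f_bar f q zss (z t - zss (v t) w) (x t $ ix 1 - q (v t) w) (v t) w) (at t within I)"
        by (rule zero_dynamics_error[OF v(1) z])
      show "frechet_derivative V0 (at (z t - zss (v t) w))
          (f_bar f q zss (z t - zss (v t) w) (x t $ ix 1 - q (v t) w) (v t) w) \<le> - a0 (norm (z t - zss (v t) w)) + gam0 (e t)"
        unfolding e_def by (rule st(10)[OF v(2) w])
      show "norm (im_input (v t) w (z t) (x t)) \<le> C * (\<bar>e t\<bar> + growth (v t) w (z t) (x t $ ix 1))"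
        unfolding e_def by (rule C(2)[OF bw(1)])
      show "norm (obs_input (im_state v w t) (v t) w (z t) (x t) (\<eta> t) \<eta>h eh)
          \<le> C * (\<bar>e t\<bar> + d + norm (im_error (im_state v w t) (v t) w (x t) (\<eta> t)) + growth (v t) w (z t) (x t $ ix 1))"
        unfolding e_def by (rule C(3)[OF bw(1) d(1) d(2)[unfolded e_def]])
      show "growth (v t) w (z t) (x t $ ix 1) \<le> \<psi>g (norm (z t - zss (v t) w) + \<bar>e t\<bar>) * (norm (z t - zss (v t) w) + \<bar>e t\<bar>)"
        unfolding e_def by (rule gr)
    qed (fact lin(1) lin(2) d(3) growth_nonneg)+
    then obtain D0 where D0: "(Vt has_real_derivative D0) (at t within I)"
      "D0 \<le> - n\<^sup>2 + \<psi>\<gamma> \<bar>a 0\<bar> * (a 0)\<^sup>2 + \<psi>0 d * d\<^sup>2" by (auto simp: a_def)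
    have sm: "\<forall>i\<in>{1..r}. smooth (\<rho> i)" using chain.gain_smooth by blast
    obtain y' G where y': "\<forall>i\<in>{1..r}. ((\<lambda>\<tau>. xi_check \<rho> (e \<tau>) (xi \<tau>) i) has_real_derivative y' i) (at t within I)"
      and ch: "chain_equations (\<lambda>s. K1 + \<psi>g s) CL \<beta>min \<beta>max r \<rho> n d y y' G (\<lambda>i. if i = 1 then b w else 1) a"
      using controller_chain[OF bb(1) bw v(1) sm x \<eta> xi d(1) d(2)[unfolded e_def] gr \<psi>g(1)]
      unfolding K1_def CL_def \<beta>min_def \<beta>max_def n_def a_def[abs_def] y_def[abs_def] e_def u_def by blast
    have "\<exists>D. ((\<lambda>\<tau>. W (Vt \<tau>) (\<lambda>i. xi_check \<rho> (e \<tau>) (xi \<tau>) i)) has_real_derivative D) (at t within I) \<and>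
           D \<le> - (chain_size r n y)\<^sup>2 - (if r = 0 then 0 else \<beta>min / 2 * \<rho> r (y r) * (y r)\<^sup>2)
             + \<psi>a \<bar>a r\<bar> * (a r)\<^sup>2 + \<psi>\<pi> d * d\<^sup>2"
      unfolding y_def[abs_def]
    proof (rule chain.decay[where ys = "\<lambda>i \<tau>. xi_check \<rho> (e \<tau>) (xi \<tau>) i" and V = Vt and y' = y' and G = G and \<beta> = "\<lambda>i. if i = 1 then b w else 1"])
      show "0 \<le> n" by (simp add: n_def)
      show "0 \<le> Vt t" "Vt t \<le> upb n" "n \<le> lwb (Vt t)" using Vb by (auto simp: Vt_def n_def)
      show "\<forall>i\<in>{1..r}. ((\<lambda>\<tau>. xi_check \<rho> (e \<tau>) (xi \<tau>) i) has_real_derivative y' i) (at t within I)"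
        by (rule y')
      show "chain_equations (\<lambda>s. K1 + \<psi>g s) CL \<beta>min \<beta>max r \<rho> n d (\<lambda>i. xi_check \<rho> (e t) (xi t) i) y' G (\<lambda>i. if i = 1 then b w else 1) a"
        using ch unfolding y_def[abs_def] .
    qed (fact d(3) D0)+
    then obtain D where D: "((\<lambda>\<tau>. W (Vt \<tau>) (\<lambda>i. xi_check \<rho> (e \<tau>) (xi \<tau>) i)) has_real_derivative D) (at t within I)"
      "D \<le> - (chain_size r n y)\<^sup>2 - \<beta>min / 2 * \<rho> r (y r) * (y r)\<^sup>2 + c * (a r)\<^sup>2 + \<psi>\<pi> d * d\<^sup>2"
      using r_pos chain.last_gain[OF r_pos] by (auto simp: c_def)
    have ar: "a r = - \<rho> r yh * yh + \<rho> r (y r) * y r" using r_pos by (simp add: a_def u_def)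
    have "(a r)\<^sup>2 + \<pi>r (\<eta>h - \<eta> t, eh - e t) - \<sigma>\<^sup>2 * \<rho> r (y r) * (y r)\<^sup>2 < \<delta>\<^sup>2"
      using trig unfolding ar Let_def y_def e_def .
    then have "c * ((a r)\<^sup>2 + \<pi>r (\<eta>h - \<eta> t, eh - e t) - \<sigma>\<^sup>2 * \<rho> r (y r) * (y r)\<^sup>2) \<le> c * \<delta>\<^sup>2"
      using c by (intro mult_left_mono) auto
    then have 1: "c * (a r)\<^sup>2 + c * \<pi>r (\<eta>h - \<eta> t, eh - e t) - (c * \<sigma>\<^sup>2) * (\<rho> r (y r) * (y r)\<^sup>2) \<le> c * \<delta>\<^sup>2"
      by (simp add: algebra_simps)
    have "0 \<le> \<rho> r (y r) * (y r)\<^sup>2" using rho_pos r_pos by (auto intro!: mult_nonneg_nonneg simp: less_imp_le)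
    then have 2: "(c * \<sigma>\<^sup>2) * (\<rho> r (y r) * (y r)\<^sup>2) \<le> \<beta>min / 2 * (\<rho> r (y r) * (y r)\<^sup>2)" by (rule mult_right_mono[OF c_sigma])
    have "c * \<pi>r (\<eta>h - \<eta> t, eh - e t) = p d * d\<^sup>2" using c by (simp add: \<pi>r_def d_def)
    moreover have "\<psi>\<pi> d * d\<^sup>2 \<le> p d * d\<^sup>2" using p(3)[of d] d(3) by (intro mult_right_mono) auto
    ultimately have "D \<le> - (chain_size r n y)\<^sup>2 + c * \<delta>\<^sup>2" using D(2) 1 2 by (simp add: mult.assoc)
    moreover have "(\<lambda>\<tau>. W (Vt \<tau>) (\<lambda>i. xi_check \<rho> (e \<tau>) (xi \<tau>) i)) = (\<lambda>\<tau>. LW (im_state v w \<tau>) (v \<tau>) w (z \<tau>) (x \<tau>) (\<eta> \<tau>) (xi \<tau>))"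
      by (simp add: LW_def Vt_def e_def fun_eq_iff)
    moreover have "chain_size r n y = error_size \<rho> (im_state v w t) (v t) w (z t) (x t) (\<eta> t) (xi t)"
      by (simp add: error_size_def n_def y_def[abs_def] e_def)
    ultimately show ?thesis using D(1) by auto
  qed
  have "regulated_design f g b q S zss rh N M T lam VV WW r \<rho> \<pi>r \<sigma> c up lw LW"
    by unfold_locales
      (fact rho_pos pi_pd pi_cont \<sigma> c chain.up chain.lw sizes | (rule cont; assumption) | (rule decay; assumption))+
  then show ?thesis by blast
qed

section \<open>Practical stability\<close>

text \<open>The error coordinates are undone one after the other: the estimates are recovered from
  \<open>xi_check\<close>, the chain from the observer coordinates, the state of the internal model from its
  error. The steady states are bounded along the exosystem trajectory.\<close>

lemma error_size_bounds_state:
  fixes v :: "real \<Rightarrow> real^'nv" and w :: "real^'nw" and c :: real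
  assumes v: "exo_trajectory S v" "\<And>t. 0 \<le> t \<Longrightarrow> v t \<in> VV"
    and \<rho>: "\<forall>i\<in>{1..r}. smooth (\<rho> i)" and c: "0 \<le> c"
  obtains R where "\<And>t z x \<eta> xi. 0 \<le> t \<Longrightarrow> error_size \<rho> (im_state v w t) (v t) w z x \<eta> xi \<le> c \<Longrightarrow>
     norm (z, x, \<eta>, xi) \<le> R"
proof -
  have bounded_VV: "\<exists>B. \<forall>u\<in>VV. norm (h u) \<le> B" if "smooth h" for h :: "real^'nv \<Rightarrow> 'c::euclidean_space"
  proof -
    have "compact (h ` VV)" by (rule compact_continuous_image[OF smooth_continuous_on[OF that] VV(1)])
    then show ?thesis by (meson bounded_iff compact_imp_bounded imageI)
  qed
  obtain Bz where Bz: "\<forall>u\<in>VV. norm (zss u w) \<le> Bz" using bounded_VV[OF smooth_zss] by blast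
  have "\<exists>B. k < r \<longrightarrow> (\<forall>u\<in>VV. \<bar>xss (Suc k) u w\<bar> \<le> B)" for k
    using bounded_VV[OF smooth_xss[of "Suc k" w]] by (auto simp: Suc_le_eq)
  then obtain Bs where Bs: "\<And>k u. k < r \<Longrightarrow> u \<in> VV \<Longrightarrow> \<bar>xss (Suc k) u w\<bar> \<le> Bs k" by metis
  have "bounded (v ` {0..})" by (rule bounded_subset[OF compact_imp_bounded[OF VV(1)]]) (use v(2) in auto)
  from immersion_state_bounded[OF v(1) this A3, of T w]
  obtain Bt where Bt: "\<And>t. 0 \<le> t \<Longrightarrow> norm (im_state v w t) \<le> Bt"
    unfolding im_state_def bounded_iff by auto
  have "\<exists>Q. i \<in> {1..r} \<longrightarrow> (\<forall>s. \<bar>s\<bar> \<le> c \<longrightarrow> \<bar>\<rho> i s * s\<bar> \<le> Q)" for i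
  proof (cases "i \<in> {1..r}")
    case True
    then obtain \<psi> where \<psi>: "gain \<psi>" "\<And>s. \<bar>\<rho> i s * s\<bar> \<le> \<psi> (norm s)"
      using gain_of_continuous[OF smooth_continuous_on[OF smooth_times_id[of "\<rho> i"]]] \<rho> by metis
    have "\<bar>\<rho> i s * s\<bar> \<le> \<psi> c" if "\<bar>s\<bar> \<le> c" for s
      using \<psi>(2)[of s] gain_mono[OF \<psi>(1), of "\<bar>s\<bar>" c] that by simp
    then show ?thesis by blast
  qed blast
  then obtain Q where Q: "\<And>i s. i \<in> {1..r} \<Longrightarrow> \<bar>s\<bar> \<le> c \<Longrightarrow> \<bar>\<rho> i s * s\<bar> \<le> Q i" by metis
  define Bx where "Bx = c + c / b w + (\<Sum>i=1..r. \<bar>Q i\<bar>)"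
  have "\<exists>R. \<forall>Y. (\<forall>j\<le>k. \<bar>observer_coord ck Y j\<bar> \<le> c + Bx) \<longrightarrow> \<bar>Y k\<bar> \<le> R" for k
    using observer_coord_inverse_bound[of k ck "c + Bx"] by metis
  then obtain Rk where Rk: "\<And>k Y. (\<forall>j\<le>k. \<bar>observer_coord ck Y j\<bar> \<le> c + Bx) \<Longrightarrow> \<bar>Y k\<bar> \<le> Rk k" by metis
  have bw: "0 < b w" by (rule b_pos)
  define Rx where "Rx = (\<Sum>i\<in>(UNIV::'r set). b w * Rk (pos i - 1) + Bs (pos i - 1))"
  define Re where "Re = c + Bt + (\<Sum>k<r. Rk k * norm (Nk (r - 1 - k)))"
  define Rxi where "Rxi = (\<Sum>i\<in>(UNIV::'r set). Bx)"
  show thesis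
  proof (rule that)
    fix t z x \<eta> xi assume t: "0 \<le> t" and size: "error_size \<rho> (im_state v w t) (v t) w z x \<eta> xi \<le> c"
    define y where "y = (\<lambda>i. xi_check \<rho> (x $ ix 1 - q (v t) w) xi i)"
    define n where "n = norm (z - zss (v t) w) + norm (im_error (im_state v w t) (v t) w x \<eta>) + norm (obs_error (v t) w x xi)"
    have n0: "0 \<le> n" by (simp add: n_def)
    have nc: "chain_size r n y \<le> c" using size by (simp add: error_size_def n_def y_def)
    have "n \<le> c" using le_chain_size[of n r y] nc by linarith
    then have zc: "norm (z - zss (v t) w) \<le> c" and pc: "norm (im_error (im_state v w t) (v t) w x \<eta>) \<le> c"
      and oc: "norm (obs_error (v t) w x xi) \<le> c" by (auto simp: n_def intro: order_trans[rotated])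
    have yc: "\<bar>y i\<bar> \<le> c" if "i \<in> {1..r}" for i using component_le_chain_size[OF n0 that, of y] nc by linarith
    have vt: "v t \<in> VV" by (rule v(2)[OF t])
    have Z: "norm z \<le> c + Bz" using norm_triangle_sub[of z "zss (v t) w"] zc Bz vt by (smt (verit))
    have occ: "\<bar>obs_error (v t) w x xi $ i\<bar> \<le> c" for i using component_le_norm_cart[of "obs_error (v t) w x xi" i] oc by linarith
    have sumQ: "\<bar>Q i\<bar> \<le> (\<Sum>i=1..r. \<bar>Q i\<bar>)" if "i \<in> {1..r}" for i
      using member_le_sum[of i "{1..r}" "\<lambda>i. \<bar>Q i\<bar>"] that by simp
    have sumQ0: "0 \<le> (\<Sum>i=1..r. \<bar>Q i\<bar>)" by (simp add: sum_nonneg)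
    have cb: "0 \<le> c / b w" using c bw by simp
    have xi_le: "\<bar>xi $ ix k\<bar> \<le> Bx" if k: "k \<in> {1..r}" for k
    proof (cases "k = 1")
      case True
      have "pos (ix 1 :: 'r) = 1" by simp
      then have "xi $ ix 1 = scaled (v t) w x 0 - obs_error (v t) w x xi $ ix 1"
        by (simp add: obs_error_def observer_coord_def)
      moreover have "\<bar>scaled (v t) w x 0\<bar> \<le> c / b w"
      proof -
        have "\<bar>x $ ix 1 - q (v t) w\<bar> \<le> c" using yc[of 1] r_pos by (simp add: y_def)
        then show ?thesis using bw unfolding scaled_0 abs_divide by (intro frac_le) auto
      qed
      ultimately show ?thesis using occ[of "ix 1"] sumQ0 unfolding True Bx_def by linarith
    next
      case False
      then obtain j where j: "k = Suc (Suc j)" using k by (metis One_nat_def atLeastAtMost_iff not0_implies_Suc not_one_le_zero)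
      have j1: "Suc j \<in> {1..r}" using k j by auto
      have "xi $ ix k = y k - \<rho> (Suc j) (y (Suc j)) * y (Suc j)" by (simp add: y_def j)
      moreover have "\<bar>\<rho> (Suc j) (y (Suc j)) * y (Suc j)\<bar> \<le> \<bar>Q (Suc j)\<bar>" using Q[OF j1 yc[OF j1]] by linarith
      ultimately show ?thesis using yc[OF k] sumQ[OF j1] cb unfolding Bx_def by linarith
    qed
    have ixp: "\<exists>k\<in>{1..r}. i = ix k" for i :: 'r
      using pos_ge_1[of i] pos_le_card[of i] by (intro bexI[of _ "pos i"]) (auto simp: r_card)
    have XI: "norm xi \<le> Rxi"
    proof -
      have "norm xi \<le> (\<Sum>i\<in>UNIV. \<bar>xi $ i\<bar>)" by (rule norm_le_l1_cart)
      also have "\<dots> \<le> Rxi" unfolding Rxi_def by (rule sum_mono) (use ixp xi_le in metis)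
      finally show ?thesis .
    qed
    have oc_le: "\<bar>observer_coord ck (scaled (v t) w x) j\<bar> \<le> c + Bx" if "j < r" for j
    proof -
      have "pos (ix (Suc j) :: 'r) = Suc j" using that by (simp add: r_card)
      then have "observer_coord ck (scaled (v t) w x) j = obs_error (v t) w x xi $ ix (Suc j) + xi $ ix (Suc j)"
        by (simp add: obs_error_def)
      then show ?thesis using occ[of "ix (Suc j)"] xi_le[of "Suc j"] that by simp
    qed
    have sc: "\<bar>scaled (v t) w x k\<bar> \<le> Rk k" if "k < r" for k by (rule Rk) (use oc_le that in auto)
    have Xc: "\<bar>x $ ix (Suc k)\<bar> \<le> b w * Rk k + Bs k" if k: "k < r" for k
    proof -
      have "x $ ix (Suc k) = b w * scaled (v t) w x k + xss (Suc k) (v t) w" using bw by (simp add: scaled_def)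
      moreover have "\<bar>b w * scaled (v t) w x k\<bar> \<le> b w * Rk k" unfolding abs_mult using sc[OF k] bw by simp
      ultimately show ?thesis using Bs[OF k vt] by linarith
    qed
    have X: "norm x \<le> Rx"
    proof -
      have "norm x \<le> (\<Sum>i\<in>UNIV. \<bar>x $ i\<bar>)" by (rule norm_le_l1_cart)
      also have "\<dots> \<le> Rx" unfolding Rx_def
      proof (rule sum_mono)
        fix i :: 'r
        have "pos i - 1 < r" "ix (Suc (pos i - 1)) = i" using pos_ge_1[of i] pos_le_card[of i] by (auto simp: r_card)
        then show "\<bar>x $ i\<bar> \<le> b w * Rk (pos i - 1) + Bs (pos i - 1)" using Xc[of "pos i - 1"] by simp
      qed
      finally show ?thesis .
    qed
    have E: "norm \<eta> \<le> Re"
    proof -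
      have "\<eta> = im_error (im_state v w t) (v t) w x \<eta> + im_state v w t + (\<Sum>k<r. scaled (v t) w x k *\<^sub>R Nk (r - 1 - k))"
        by (simp add: im_error_def)
      then have "norm \<eta> = norm (im_error (im_state v w t) (v t) w x \<eta> + im_state v w t
          + (\<Sum>k<r. scaled (v t) w x k *\<^sub>R Nk (r - 1 - k)))" by (rule arg_cong)
      also have "\<dots> \<le> norm (im_error (im_state v w t) (v t) w x \<eta> + im_state v w t)
          + norm (\<Sum>k<r. scaled (v t) w x k *\<^sub>R Nk (r - 1 - k))" by (rule norm_triangle_ineq)
      also have "\<dots> \<le> norm (im_error (im_state v w t) (v t) w x \<eta>) + norm (im_state v w t)
          + norm (\<Sum>k<r. scaled (v t) w x k *\<^sub>R Nk (r - 1 - k))" by (intro add_right_mono norm_triangle_ineq)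
      finally have split: "norm \<eta> \<le> norm (im_error (im_state v w t) (v t) w x \<eta>) + norm (im_state v w t)
          + norm (\<Sum>k<r. scaled (v t) w x k *\<^sub>R Nk (r - 1 - k))" .
      have rest: "norm (\<Sum>k<r. scaled (v t) w x k *\<^sub>R Nk (r - 1 - k)) \<le> (\<Sum>k<r. Rk k * norm (Nk (r - 1 - k)))"
      proof (rule sum_norm_le)
        fix k assume "k \<in> {..<r}"
        then show "norm (scaled (v t) w x k *\<^sub>R Nk (r - 1 - k)) \<le> Rk k * norm (Nk (r - 1 - k))"
          unfolding norm_scaleR real_norm_def by (intro mult_right_mono sc) auto
      qed
      show ?thesis unfolding Re_def
        by (rule order_trans[OF split add_mono[OF add_mono[OF pc Bt[OF t]] rest]])
    qed
    show "norm (z, x, \<eta>, xi) \<le> (c + Bz) + (Rx + (Re + Rxi))"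
      using norm_Pair_le[of z "(x, \<eta>, xi)"] norm_Pair_le[of x "(\<eta>, xi)"] norm_Pair_le[of \<eta> xi] X E XI Z by linarith
  qed
qed

end

context regulated_design
begin

definition storage :: "(real \<Rightarrow> real^'nv) \<Rightarrow> real^'nw \<Rightarrow> (real \<Rightarrow> real^'nz) \<Rightarrow> (real \<Rightarrow> 'r rvec) \<Rightarrow>
    (real \<Rightarrow> 's rvec) \<Rightarrow> (real \<Rightarrow> 'r rvec) \<Rightarrow> real \<Rightarrow> real" where
  "storage v w z x \<eta> xi \<tau> = LW (im_state v w \<tau>) (v \<tau>) w (z \<tau>) (x \<tau>) (\<eta> \<tau>) (xi \<tau>)"

text \<open>The closed loop holds to the right of \<open>t\<close>, with some sampled values for which the
  triggering condition has not been met. Trajectories of the closed loop and those of a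
  truncated one inside the ball have this in common, so that the Lyapunov estimate covers both.\<close>

definition controlled_at :: "real \<Rightarrow> (real \<Rightarrow> real^'nv) \<Rightarrow> real^'nw \<Rightarrow> (real \<Rightarrow> real^'nz) \<Rightarrow> (real \<Rightarrow> 'r rvec) \<Rightarrow>
    (real \<Rightarrow> 's rvec) \<Rightarrow> (real \<Rightarrow> 'r rvec) \<Rightarrow> real \<Rightarrow> bool" where
  "controlled_at \<delta> v w z x \<eta> xi t \<longleftrightarrow> (\<exists>\<eta>h eh yh h. 0 < h \<and>
     (z has_vector_derivative f (z t) (x t $ ix 1) (v t) w) (at t within {t..<t+h}) \<and>
     (x has_vector_derivative x_field g b (z t) (x t) (v t) w (- \<rho> r yh * yh + \<Psi> \<bullet> \<eta>h)) (at t within {t..<t+h}) \<and>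
     (\<eta> has_vector_derivative (M *v \<eta> t + (- \<rho> r yh * yh + \<Psi> \<bullet> \<eta>h) *\<^sub>R N)) (at t within {t..<t+h}) \<and>
     (xi has_vector_derivative (A_obs lam *v xi t + eh *\<^sub>R lam
          + ((- \<rho> r yh * yh + \<Psi> \<bullet> \<eta>h) - \<Psi> \<bullet> \<eta>h) *\<^sub>R B_obs)) (at t within {t..<t+h}) \<and>
     (let e = x t $ ix 1 - q (v t) w; y = xi_check \<rho> e (xi t) r in
          (- \<rho> r yh * yh + \<rho> r y * y)\<^sup>2 + \<pi>r (\<eta>h - \<eta> t, eh - e) - \<sigma>\<^sup>2 * \<rho> r y * y\<^sup>2 < \<delta>\<^sup>2))"

text \<open>Above this level the size of the error exceeds \<open>sqrt (2 c) \<delta>\<close>, and its square is at least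
  twice \<open>c \<delta>\<^sup>2\<close>.\<close>

definition level :: "real \<Rightarrow> real" where "level \<delta> = up (sqrt (2 * c) * \<delta>)"

lemma storage_decreases:
  assumes v: "exo_trajectory S v" "v t \<in> VV" "w \<in> WW" and \<delta>: "0 < \<delta>"
    and ctrl: "controlled_at \<delta> v w z x \<eta> xi t" and above: "storage v w z x \<eta> xi t > level \<delta>"
  shows "\<exists>D h. h > 0 \<and> (storage v w z x \<eta> xi has_real_derivative D) (at t within {t..<t+h}) \<and> D \<le> - (c * \<delta>\<^sup>2)"
proof -
  define n where "n = error_size \<rho> (im_state v w t) (v t) w (z t) (x t) (\<eta> t) (xi t)"
  from ctrl obtain \<eta>h eh yh h where h: "0 < h"
     "(z has_vector_derivative f (z t) (x t $ ix 1) (v t) w) (at t within {t..<t+h})"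
     "(x has_vector_derivative x_field g b (z t) (x t) (v t) w (- \<rho> r yh * yh + \<Psi> \<bullet> \<eta>h)) (at t within {t..<t+h})"
     "(\<eta> has_vector_derivative (M *v \<eta> t + (- \<rho> r yh * yh + \<Psi> \<bullet> \<eta>h) *\<^sub>R N)) (at t within {t..<t+h})"
     "(xi has_vector_derivative (A_obs lam *v xi t + eh *\<^sub>R lam
          + ((- \<rho> r yh * yh + \<Psi> \<bullet> \<eta>h) - \<Psi> \<bullet> \<eta>h) *\<^sub>R B_obs)) (at t within {t..<t+h})"
     "let e = x t $ ix 1 - q (v t) w; y = xi_check \<rho> e (xi t) r in
          (- \<rho> r yh * yh + \<rho> r y * y)\<^sup>2 + \<pi>r (\<eta>h - \<eta> t, eh - e) - \<sigma>\<^sup>2 * \<rho> r y * y\<^sup>2 < \<delta>\<^sup>2"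
    unfolding controlled_at_def by (elim exE conjE) (rule that)
  from LW_decay[OF v h(2-6)] obtain D where
    D: "(storage v w z x \<eta> xi has_real_derivative D) (at t within {t..<t+h})" "D \<le> - n\<^sup>2 + c * \<delta>\<^sup>2"
    unfolding storage_def[abs_def] n_def by blast
  have n0: "0 \<le> n" unfolding n_def error_size_def by (rule chain_size_nonneg) simp
  have s0: "0 \<le> sqrt (2 * c) * \<delta>" using c \<delta> by simp
  have "sqrt (2 * c) * \<delta> < n"
  proof (rule ccontr)
    assume "\<not> ?thesis"
    then have "up n \<le> level \<delta>" unfolding level_def
      using gain_mono[OF vanishing_gain_gain[OF up] n0] by simp
    moreover have "storage v w z x \<eta> xi t \<le> up n" using LW_size unfolding storage_def n_def by blast
    ultimately show False using above by simp
  qed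
  then have "(sqrt (2 * c) * \<delta>)\<^sup>2 \<le> n\<^sup>2" using s0 by (intro power_mono) auto
  then have "2 * c * \<delta>\<^sup>2 \<le> n\<^sup>2" using c by (simp add: power_mult_distrib)
  then have "D \<le> - (c * \<delta>\<^sup>2)" using D(2) by simp
  with h(1) D(1) show ?thesis by blast
qed

lemma level_nonneg: "0 < \<delta> \<Longrightarrow> 0 \<le> level \<delta>"
  unfolding level_def by (rule gain_nonneg[OF vanishing_gain_gain[OF up]]) (use c in simp)

lemma storage_bounded:
  assumes v: "exo_trajectory S v" "\<And>t. 0 \<le> t \<Longrightarrow> v t \<in> VV" "w \<in> WW" and \<delta>: "0 < \<delta>" and T: "0 \<le> T1"
    and cont: "continuous_on {0..T1} z" "continuous_on {0..T1} x" "continuous_on {0..T1} \<eta>" "continuous_on {0..T1} xi"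
    and ctrl: "\<And>t. 0 \<le> t \<Longrightarrow> t < T1 \<Longrightarrow> controlled_at \<delta> v w z x \<eta> xi t"
  shows "storage v w z x \<eta> xi T1 \<le> max (storage v w z x \<eta> xi 0) (level \<delta>)"
proof (rule bounded_by_barrier[OF T])
  show "continuous_on {0..T1} (storage v w z x \<eta> xi)"
    unfolding storage_def[abs_def] by (rule LW_cont[OF v(1) cont])
  show "0 < c * \<delta>\<^sup>2" using c \<delta> by simp
  show "\<exists>D h. h > 0 \<and> (storage v w z x \<eta> xi has_real_derivative D) (at t within {t..<t+h}) \<and> D \<le> - (c * \<delta>\<^sup>2)"
    if "0 \<le> t" "t < T1" "storage v w z x \<eta> xi t > level \<delta>" for t
    by (rule storage_decreases[OF v(1) v(2)[OF that(1)] v(3) \<delta> ctrl[OF that(1,2)] that(3)])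
qed

lemma storage_ultimately:
  assumes v: "exo_trajectory S v" "\<And>t. 0 \<le> t \<Longrightarrow> v t \<in> VV" "w \<in> WW" and \<delta>: "0 < \<delta>"
    and cont: "continuous_on {0..} z" "continuous_on {0..} x" "continuous_on {0..} \<eta>" "continuous_on {0..} xi"
    and ctrl: "\<And>t. 0 \<le> t \<Longrightarrow> controlled_at \<delta> v w z x \<eta> xi t"
  shows "\<exists>t0\<ge>0. \<forall>t\<ge>t0. storage v w z x \<eta> xi t \<le> level \<delta>"
proof (rule eventually_below_barrier)
  show "continuous_on {0..} (storage v w z x \<eta> xi)"
    unfolding storage_def[abs_def] by (rule LW_cont[OF v(1) cont])
  show "0 < c * \<delta>\<^sup>2" using c \<delta> by simp
  show "0 \<le> storage v w z x \<eta> xi t" for t using LW_size unfolding storage_def by blast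
  show "0 \<le> level \<delta>" by (rule level_nonneg[OF \<delta>])
  show "\<exists>D h. h > 0 \<and> (storage v w z x \<eta> xi has_real_derivative D) (at t within {t..<t+h}) \<and> D \<le> - (c * \<delta>\<^sup>2)"
    if "0 \<le> t" "storage v w z x \<eta> xi t > level \<delta>" for t
    by (rule storage_decreases[OF v(1) v(2)[OF that(1)] v(3) \<delta> ctrl[OF that(1)] that(2)])
qed

lemma error_le_storage: "\<bar>x t $ ix 1 - q (v t) w\<bar> \<le> lw (storage v w z x \<eta> xi t)"
proof -
  have "\<bar>xi_check \<rho> (x t $ ix 1 - q (v t) w) (xi t) 1\<bar> \<le> error_size \<rho> (im_state v w t) (v t) w (z t) (x t) (\<eta> t) (xi t)"
    unfolding error_size_def using r_pos by (intro component_le_chain_size) auto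
  also have "\<dots> \<le> lw (storage v w z x \<eta> xi t)" using LW_size unfolding storage_def by blast
  finally show ?thesis by simp
qed

lemma exists_threshold:
  assumes "0 < \<epsilon>" obtains \<delta> where "0 < \<delta>" "lw (level \<delta>) \<le> \<epsilon>"
proof -
  obtain u where u: "0 < u" "lw u \<le> \<epsilon>" using lw assms unfolding vanishing_gain_def by blast
  obtain s where s: "0 < s" "up s \<le> u" using up u(1) unfolding vanishing_gain_def by blast
  define \<delta> where "\<delta> = s / sqrt (2 * c)"
  have \<delta>: "0 < \<delta>" "level \<delta> = up s" using s c by (auto simp: \<delta>_def level_def)
  have "lw (level \<delta>) \<le> lw u" unfolding \<delta>(2)
    using s gain_nonneg[OF vanishing_gain_gain[OF up]] by (intro gain_mono[OF vanishing_gain_gain[OF lw]]) auto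
  then show thesis using that \<delta> u(2) by (meson order_trans)
qed

end

section \<open>Trajectories of the closed loop\<close>

lemma half_open_subset:
  assumes "a \<le> ereal t" "ereal t < c"
  obtains h where "0 < h" "{t..<t+h} \<subseteq> {s. a \<le> ereal s \<and> ereal s < c}"
proof -
  obtain c' where c': "t < c'" "ereal c' \<le> c"
  proof (cases c)
    case (real x) then show ?thesis using assms(2) that[of x] by auto
  next
    case PInf then show ?thesis using that[of "t + 1"] by auto
  qed (use assms in auto)
  have "{t..<t+(c' - t)} \<subseteq> {s. a \<le> ereal s \<and> ereal s < c}"
  proof
    fix s assume "s \<in> {t..<t+(c' - t)}"
    then have "ereal t \<le> ereal s" "ereal s < ereal c'" by auto
    then show "s \<in> {s. a \<le> ereal s \<and> ereal s < c}"
      using order_trans[OF assms(1), of "ereal s"] less_le_trans[of "ereal s" "ereal c'" c] c'(2) by blast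
  qed
  with c' that[of "c' - t"] show thesis by simp
qed

lemma not_before_Inf:
  assumes "ereal t < Inf {ereal t |t. a < ereal t \<and> P t}" "a < ereal t" shows "\<not> P t"
proof
  assume "P t"
  then have "Inf {ereal t |t. a < ereal t \<and> P t} \<le> ereal t" using assms(2) by (intro Inf_lower) auto
  with assms(1) show False by simp
qed

context regulated_design
begin

text \<open>Between triggering times the triggering function is below \<open>\<delta>\<^sup>2\<close> by the definition of the
  next one; at the triggering time itself it is at most \<open>0\<close>, because all sampling errors vanish.\<close>

lemma trajectory_controlled:
  assumes traj: "closed_loop_trajectory f g b q M N \<Psi> lam \<rho> \<pi>r \<sigma> \<delta> v w z x \<eta> xi tk" and \<delta>: "0 < \<delta>" and t: "0 \<le> t"
  shows "controlled_at \<delta> v w z x \<eta> xi t"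
proof -
  define e where "e t = x t $ ix 1 - q (v t) w" for t
  define xc where "xc t = xi_check \<rho> (e t) (xi t) r" for t
  define hold where "hold k = real_of_ereal (tk k)" for k
  define u where "u k = - \<rho> r (xc (hold k)) * xc (hold k) + \<Psi> \<bullet> \<eta> (hold k)" for k
  let ?I = "\<lambda>k. {t. tk k \<le> ereal t \<and> ereal t < tk (Suc k)}"
  have tr: "\<forall>k. tk (Suc k) = Inf {ereal t |t. tk k < ereal t \<and>
          (- \<rho> r (xc (hold k)) * xc (hold k) + \<rho> r (xc t) * xc t)\<^sup>2
            + \<pi>r (\<eta> (hold k) - \<eta> t, e (hold k) - e t) - \<sigma>\<^sup>2 * \<rho> r (xc t) * (xc t)\<^sup>2 \<ge> \<delta>\<^sup>2}"
    and cover: "\<forall>t\<ge>0. \<exists>k. t \<in> ?I k"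
    and ode: "\<forall>k. \<forall>t\<in>?I k.
          (z has_vector_derivative f (z t) (x t $ ix 1) (v t) w) (at t within ?I k) \<and>
          (x has_vector_derivative x_field g b (z t) (x t) (v t) w (u k)) (at t within ?I k) \<and>
          (xi has_vector_derivative
             (A_obs lam *v xi t + e (hold k) *\<^sub>R lam
              + (u k - \<Psi> \<bullet> \<eta> (hold k)) *\<^sub>R B_obs)) (at t within ?I k) \<and>
          (\<eta> has_vector_derivative (M *v \<eta> t + u k *\<^sub>R N)) (at t within ?I k)"
    using traj unfolding closed_loop_trajectory_def Let_def r_card[symmetric] e_def[abs_def] xc_def[abs_def] hold_def u_def[abs_def] e_def
    by blast+
  obtain k where k: "t \<in> ?I k" using cover t by blast
  then have kt: "tk k \<le> ereal t" "ereal t < tk (Suc k)" by auto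
  obtain h where h: "0 < h" "{t..<t+h} \<subseteq> ?I k" by (rule half_open_subset[OF kt])
  note sub = has_vector_derivative_within_subset[OF _ h(2)]
  have trig: "(- \<rho> r (xc (hold k)) * xc (hold k) + \<rho> r (xc t) * xc t)\<^sup>2
            + \<pi>r (\<eta> (hold k) - \<eta> t, e (hold k) - e t) - \<sigma>\<^sup>2 * \<rho> r (xc t) * (xc t)\<^sup>2 < \<delta>\<^sup>2"
  proof (cases "tk k = ereal t")
    case True
    then have hk: "hold k = t" by (simp add: hold_def)
    have p0: "\<pi>r (0, 0) = 0" using \<pi>r(1) by (simp add: pos_def_fun_def zero_prod_def)
    have "0 \<le> \<sigma>\<^sup>2 * \<rho> r (xc t) * (xc t)\<^sup>2"
      using \<rho> r_pos by (intro mult_nonneg_nonneg) (auto simp: less_imp_le)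
    moreover have "0 < \<delta>\<^sup>2" using \<delta> by simp
    moreover have "(- \<rho> r (xc (hold k)) * xc (hold k) + \<rho> r (xc t) * xc t)\<^sup>2
            + \<pi>r (\<eta> (hold k) - \<eta> t, e (hold k) - e t) = 0" by (simp add: hk p0)
    ultimately show ?thesis by linarith
  next
    case False
    have "tk k < ereal t" by (rule le_neq_trans[OF kt(1) False])
    then show ?thesis using not_before_Inf[OF kt(2)[unfolded tr[rule_format, of k]]] by (simp add: not_le)
  qed
  show ?thesis
    unfolding controlled_at_def
  proof (intro exI conjI)
    show "0 < h" by (rule h)
    show "(z has_vector_derivative f (z t) (x t $ ix 1) (v t) w) (at t within {t..<t+h})"
      using ode k by (intro sub) blast
    show "(x has_vector_derivative x_field g b (z t) (x t) (v t) w (- \<rho> r (xc (hold k)) * xc (hold k) + \<Psi> \<bullet> \<eta> (hold k))) (at t within {t..<t+h})"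
      using ode k unfolding u_def by (intro sub) blast
    show "(\<eta> has_vector_derivative (M *v \<eta> t + (- \<rho> r (xc (hold k)) * xc (hold k) + \<Psi> \<bullet> \<eta> (hold k)) *\<^sub>R N)) (at t within {t..<t+h})"
      using ode k unfolding u_def by (intro sub) blast
    show "(xi has_vector_derivative (A_obs lam *v xi t + e (hold k) *\<^sub>R lam
          + ((- \<rho> r (xc (hold k)) * xc (hold k) + \<Psi> \<bullet> \<eta> (hold k)) - \<Psi> \<bullet> \<eta> (hold k)) *\<^sub>R B_obs)) (at t within {t..<t+h})"
      using ode k unfolding u_def by (intro sub) blast
    show "let e' = x t $ ix 1 - q (v t) w; y = xi_check \<rho> e' (xi t) r in
          (- \<rho> r (xc (hold k)) * xc (hold k) + \<rho> r y * y)\<^sup>2 + \<pi>r (\<eta> (hold k) - \<eta> t, e (hold k) - e') - \<sigma>\<^sup>2 * \<rho> r y * y\<^sup>2 < \<delta>\<^sup>2"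
      using trig unfolding Let_def xc_def e_def .
  qed
qed

lemma storage_sublevel_bounded:
  assumes v: "exo_trajectory S v" "\<And>t. 0 \<le> t \<Longrightarrow> v t \<in> VV" and c0: "0 \<le> c0"
  obtains R where "\<And>z x \<eta> xi t. 0 \<le> t \<Longrightarrow> storage v w z x \<eta> xi t \<le> c0 \<Longrightarrow> norm (z t, x t, \<eta> t, xi t) \<le> R"
proof -
  have sm: "\<forall>i\<in>{1..r}. smooth (\<rho> i)" using \<rho> by blast
  have lw0: "0 \<le> lw c0" by (rule gain_nonneg[OF vanishing_gain_gain[OF lw] c0])
  obtain R where R: "\<And>t z x \<eta> xi. 0 \<le> t \<Longrightarrow> error_size \<rho> (im_state v w t) (v t) w z x \<eta> xi \<le> lw c0 \<Longrightarrow>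
     norm (z, x, \<eta>, xi) \<le> R"
    using error_size_bounds_state[OF v sm lw0, of w] by metis
  show thesis
  proof (rule that, rule R)
    fix z x \<eta> xi and t :: real assume t: "0 \<le> t" and st: "storage v w z x \<eta> xi t \<le> c0"
    have "error_size \<rho> (im_state v w t) (v t) w (z t) (x t) (\<eta> t) (xi t) \<le> lw (storage v w z x \<eta> xi t)"
      using LW_size unfolding storage_def by blast
    also have "\<dots> \<le> lw c0"
      using LW_size st by (intro gain_mono[OF vanishing_gain_gain[OF lw]]) (auto simp: storage_def)
    finally show "error_size \<rho> (im_state v w t) (v t) w (z t) (x t) (\<eta> t) (xi t) \<le> lw c0" .
  qed
qed

lemma trajectory_bounded_and_regulated:
  assumes v: "exo_trajectory S v" "\<And>t. 0 \<le> t \<Longrightarrow> v t \<in> VV" "w \<in> WW" and \<delta>: "0 < \<delta>" "lw (level \<delta>) \<le> \<epsilon>"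
    and traj: "closed_loop_trajectory f g b q M N \<Psi> lam \<rho> \<pi>r \<sigma> \<delta> v w z x \<eta> xi tk"
  shows "bounded ((\<lambda>t. (z t, x t, \<eta> t, xi t)) ` {0..})"
    and "Limsup at_top (\<lambda>t. ereal \<bar>x t $ ix 1 - q (v t) w\<bar>) \<le> ereal \<epsilon>"
proof -
  have cont: "continuous_on {0..} z" "continuous_on {0..} x" "continuous_on {0..} \<eta>" "continuous_on {0..} xi"
    using traj unfolding closed_loop_trajectory_def Let_def by blast+
  have ctrl: "controlled_at \<delta> v w z x \<eta> xi t" if "0 \<le> t" for t
    by (rule trajectory_controlled[OF traj \<delta>(1) that])
  define c0 where "c0 = max (storage v w z x \<eta> xi 0) (level \<delta>)"
  have c0: "0 \<le> c0" using level_nonneg[OF \<delta>(1)] by (simp add: c0_def)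
  have st: "storage v w z x \<eta> xi t \<le> c0" if "0 \<le> t" for t
    unfolding c0_def
    by (rule storage_bounded[OF v \<delta>(1) that]) (auto intro: continuous_on_subset[OF cont(1)] continuous_on_subset[OF cont(2)]
        continuous_on_subset[OF cont(3)] continuous_on_subset[OF cont(4)] ctrl)
  obtain R where "\<And>z x \<eta> xi t. 0 \<le> t \<Longrightarrow> storage v w z x \<eta> xi t \<le> c0 \<Longrightarrow> norm (z t, x t, \<eta> t, xi t) \<le> R"
    using storage_sublevel_bounded[OF v(1,2) c0, of w] by metis
  then have "norm (z t, x t, \<eta> t, xi t) \<le> R" if "0 \<le> t" for t using st that by blast
  then show "bounded ((\<lambda>t. (z t, x t, \<eta> t, xi t)) ` {0..})" unfolding bounded_iff by (intro exI[of _ R]) auto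
  obtain t0 where t0: "0 \<le> t0" "\<And>t. t0 \<le> t \<Longrightarrow> storage v w z x \<eta> xi t \<le> level \<delta>"
    using storage_ultimately[OF v \<delta>(1) cont ctrl] by blast
  have "\<bar>x t $ ix 1 - q (v t) w\<bar> \<le> \<epsilon>" if "t0 \<le> t" for t
  proof -
    have "\<bar>x t $ ix 1 - q (v t) w\<bar> \<le> lw (storage v w z x \<eta> xi t)" by (rule error_le_storage)
    also have "\<dots> \<le> lw (level \<delta>)"
      using LW_size t0(2)[OF that] by (intro gain_mono[OF vanishing_gain_gain[OF lw]]) (auto simp: storage_def)
    finally show ?thesis using \<delta>(2) by simp
  qed
  then have "\<forall>\<^sub>F t in at_top. ereal \<bar>x t $ ix 1 - q (v t) w\<bar> \<le> ereal \<epsilon>"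
    unfolding eventually_at_top_linorder by (intro exI[of _ t0]) simp
  then show "Limsup at_top (\<lambda>t. ereal \<bar>x t $ ix 1 - q (v t) w\<bar>) \<le> ereal \<epsilon>" by (rule Limsup_bounded)
qed

definition check :: "real^'nw \<Rightarrow> ((real^'nz) \<times> 'r rvec \<times> 's rvec \<times> 'r rvec) \<times> (real^'nv) \<Rightarrow> nat \<Rightarrow> real" where
  "check w = (\<lambda>((z, x, \<eta>, xi), v) i. xi_check \<rho> (x $ ix 1 - q v w) xi i)"

definition feedback :: "real^'nw \<Rightarrow> ((real^'nz) \<times> 'r rvec \<times> 's rvec \<times> 'r rvec) \<times> (real^'nv) \<Rightarrow> real" where
  "feedback w p = - \<rho> r (check w p r) * check w p r"

text \<open>The closed loop as a function of two pairs, each of a closed-loop state and an exosystem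
  state: those at the last triggering time and the current ones.\<close>

definition field where
  "field w = (\<lambda>(p, (z, x :: 'r rvec, \<eta>, xi), v :: real^'nv).
     (f z (x $ ix 1) v w,
      x_field g b z x v w (feedback w p + \<Psi> \<bullet> fst (snd (snd (fst p)))),
      M *v \<eta> + (feedback w p + \<Psi> \<bullet> fst (snd (snd (fst p)))) *\<^sub>R N,
      A_obs lam *v xi + check w p 1 *\<^sub>R lam + feedback w p *\<^sub>R B_obs))"

definition trigger where
  "trigger w = (\<lambda>(p, m). (feedback w p - feedback w m)\<^sup>2
      + \<pi>r (fst (snd (snd (fst p))) - fst (snd (snd (fst m))), check w p 1 - check w m 1)
      - \<sigma>\<^sup>2 * \<rho> r (check w m r) * (check w m r)\<^sup>2)"

lemma smooth_check: "i \<le> r \<Longrightarrow> smooth (\<lambda>p. check w p i)"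
proof (induction i rule: induct_nat_012)
  case 1
  have "smooth (\<lambda>p :: ((real^'nz) \<times> 'r rvec \<times> 's rvec \<times> 'r rvec) \<times> (real^'nv). fst (snd (fst p)) $ ix 1 + (- 1) *\<^sub>R q (snd p) w)"
    by (intro smooth_add smooth_scaleR smooth_const smooth_compose[OF smooth_q] smooth_bounded_linear
        bounded_linear_compose[OF bounded_linear_vec_nth] bounded_linear_intros)
  then show ?case by (simp add: check_def case_prod_unfold)
next
  case (ge2 i)
  have IH: "smooth (\<lambda>p. check w p (Suc i))" using ge2 by simp
  have "smooth (\<rho> (Suc i))" using \<rho> ge2.prems by auto
  from smooth_compose[OF this IH] have "smooth (\<lambda>p. \<rho> (Suc i) (check w p (Suc i)) *\<^sub>R check w p (Suc i))"
    using IH by (intro smooth_scaleR)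
  moreover have "smooth (\<lambda>p :: ((real^'nz) \<times> 'r rvec \<times> 's rvec \<times> 'r rvec) \<times> (real^'nv). snd (snd (snd (fst p))) $ ix (Suc (Suc i)))"
    by (intro smooth_bounded_linear bounded_linear_compose[OF bounded_linear_vec_nth] bounded_linear_intros)
  ultimately have "smooth (\<lambda>p :: ((real^'nz) \<times> 'r rvec \<times> 's rvec \<times> 'r rvec) \<times> (real^'nv).
      snd (snd (snd (fst p))) $ ix (Suc (Suc i)) + \<rho> (Suc i) (check w p (Suc i)) *\<^sub>R check w p (Suc i))"
    by (intro smooth_add)
  then show ?case by (simp add: check_def case_prod_unfold)
qed (simp add: check_def case_prod_unfold smooth_const)

section \<open>Existence of trajectories\<close>

lemma smooth_f_compose:
  assumes "smooth z" "smooth y" "smooth v" shows "smooth (\<lambda>a. f (z a) (y a) (v a) w)"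
  using smooth_compose[OF f_smooth smooth_Pair[OF assms(1) smooth_Pair[OF assms(2) smooth_Pair[OF assms(3) smooth_const[of w]]]]] by simp

lemma smooth_g_compose:
  assumes "smooth z" "smooth y" "smooth v" "i \<in> {1..r}" shows "smooth (\<lambda>a. g i (z a) (y a) (v a) w)"
  using smooth_compose[OF g_smooth[OF assms(4)] smooth_Pair[OF assms(1) smooth_Pair[OF assms(2) smooth_Pair[OF assms(3) smooth_const[of w]]]]] by simp

lemma smooth_rho: "smooth (\<rho> r)"
  using \<rho> r_pos by simp

lemma smooth_feedback: "smooth (feedback w)"
proof -
  have "smooth (\<lambda>p. (- 1) *\<^sub>R (\<rho> r (check w p r) *\<^sub>R check w p r))"
    by (intro smooth_scaleR smooth_const smooth_compose[OF smooth_rho] smooth_check order_refl)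
  then show ?thesis by (simp add: feedback_def[abs_def])
qed

lemma smooth_check_1: "smooth (\<lambda>p. check w p 1)"
  using smooth_check[of 1] r_pos by simp

lemma smooth_x_field_compose:
  fixes x :: "'a::euclidean_space \<Rightarrow> 'r rvec"
  assumes "smooth z" "smooth x" "smooth v" "smooth u"
  shows "smooth (\<lambda>a. x_field g b (z a) (x a) (v a) w (u a))"
  unfolding x_field_def
proof (rule smooth_vec_lambda)
  fix i :: 'r
  have i: "pos i \<in> {1..r}" using pos_ge_1[of i] pos_le_card[of i] by (simp add: r_card)
  have "smooth (\<lambda>a. g (pos i) (z a) (x a $ ix 1) (v a) w)"
    by (intro smooth_g_compose smooth_vec_nth assms i)
  moreover have "smooth (\<lambda>a. if pos i < CARD('r) then x a $ ix (pos i + 1) else b w * u a)"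
  proof (cases "pos i < CARD('r)")
    case True
    then show ?thesis by (simp only: if_True) (intro smooth_vec_nth assms)
  next
    case False
    have "smooth (\<lambda>a. b w *\<^sub>R u a)" by (intro smooth_scaleR smooth_const assms)
    with False show ?thesis by simp
  qed
  ultimately show "smooth (\<lambda>a. g (pos i) (z a) (x a $ ix 1) (v a) w
      + (if pos i < CARD('r) then x a $ ix (pos i + 1) else b w * u a))"
    by (rule smooth_add)
qed

lemma smooth_field: "smooth (field w)"
  unfolding field_def case_prod_unfold
  by (intro smooth_Pair smooth_f_compose smooth_x_field_compose smooth_add smooth_scaleR smooth_const
      smooth_compose[OF smooth_feedback] smooth_compose[OF smooth_check_1] smooth_matrix_vector
      smooth_inner_right smooth_vec_nth smooth_fst smooth_snd smooth_id)

lemma continuous_trigger: "continuous_on UNIV (trigger w)"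
  unfolding trigger_def case_prod_unfold
  by (intro continuous_intros continuous_on_compose2[OF \<pi>r(2)] smooth_continuous_on
      smooth_compose[OF smooth_feedback] smooth_compose[OF smooth_check_1] smooth_compose[OF smooth_rho]
      smooth_compose[OF smooth_check] smooth_fst smooth_snd smooth_id subset_UNIV order_refl)

lemma trigger_refl: "trigger w (p, p) \<le> 0"
proof -
  have "\<pi>r (0, 0) = 0" using \<pi>r(1) by (simp add: pos_def_fun_def zero_prod_def)
  moreover have "0 \<le> \<sigma>\<^sup>2 * \<rho> r (check w p r) * (check w p r)\<^sup>2"
    using \<rho> r_pos by (intro mult_nonneg_nonneg) (auto simp: less_imp_le)
  ultimately show ?thesis by (simp add: trigger_def)
qed

text \<open>Replacing the state by its projection to a ball turns the closed loop into a system with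
  bounded and Lipschitz right-hand side. Its triggering function is uniformly continuous and at
  most \<open>0\<close> on the diagonal, so that it takes a uniform time to reach \<open>\<delta>\<^sup>2\<close>.\<close>

lemma truncated_solution:
  fixes v :: "real \<Rightarrow> real^'nv" and X0 :: "(real^'nz) \<times> 'r rvec \<times> 's rvec \<times> 'r rvec"
  assumes v: "exo_trajectory S v" "\<And>t. 0 \<le> t \<Longrightarrow> v t \<in> VV" and \<delta>: "0 < \<delta>" and R: "0 \<le> R"
  defines "\<And>X. P X \<equiv> closest_point (cball 0 R) (X :: (real^'nz) \<times> 'r rvec \<times> 's rvec \<times> 'r rvec)"
  obtains X and tk :: "nat \<Rightarrow> ereal" where "X 0 = X0" "continuous_on {0..} X" "tk 0 = 0"
    "\<And>k. tk (Suc k) = Inf {ereal t |t. tk k < ereal t \<and>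
        \<delta>\<^sup>2 \<le> trigger w ((P (X (real_of_ereal (tk k))), v (real_of_ereal (tk k))), (P (X t), v t))}"
    "\<And>t. 0 \<le> t \<Longrightarrow> \<exists>k. tk k \<le> ereal t \<and> ereal t < tk (Suc k)"
    "\<And>k t. tk k \<le> ereal t \<Longrightarrow> ereal t < tk (Suc k) \<Longrightarrow>
       (X has_vector_derivative
         field w ((P (X (real_of_ereal (tk k))), v (real_of_ereal (tk k))), (P (X t), v t)))
       (at t within {t. tk k \<le> ereal t \<and> ereal t < tk (Suc k)})"
proof -
  have ball: "convex (cball (0 :: (real^'nz) \<times> 'r rvec \<times> 's rvec \<times> 'r rvec) R)"
    "closed (cball (0 :: (real^'nz) \<times> 'r rvec \<times> 's rvec \<times> 'r rvec) R)"
    "cball (0 :: (real^'nz) \<times> 'r rvec \<times> 's rvec \<times> 'r rvec) R \<noteq> {}"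
    using R by auto
  have P_in: "P X \<in> cball 0 R" for X unfolding P_def by (rule closest_point_in_set[OF ball(2,3)])
  have P_lip: "norm (P X - P Y) \<le> norm (X - Y)" for X Y
    using closest_point_lipschitz[OF ball, of X Y] by (simp add: P_def dist_norm)
  have P_cont: "continuous_on UNIV P"
    unfolding P_def[abs_def] by (rule continuous_on_closest_point[OF ball])
  define K where "K = (cball (0 :: (real^'nz) \<times> 'r rvec \<times> 's rvec \<times> 'r rvec) R \<times> VV)
    \<times> (cball (0 :: (real^'nz) \<times> 'r rvec \<times> 's rvec \<times> 'r rvec) R \<times> VV)"
  have K: "compact K" unfolding K_def by (intro compact_Times compact_cball VV)
  obtain Q where Q: "\<And>y. y \<in> K \<Longrightarrow> norm y \<le> Q"
    using compact_imp_bounded[OF K] unfolding bounded_iff by blast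
  obtain L where L: "0 < L" "\<And>x y. norm x \<le> Q \<Longrightarrow> norm y \<le> Q \<Longrightarrow> norm (field w x - field w y) \<le> L * norm (x - y)"
    using C_1_lipschitz_on_ball[OF smooth_C_k[OF smooth_field, of 1]] by metis
  have "bounded (field w ` K)"
    by (rule compact_imp_bounded[OF compact_continuous_image[OF smooth_continuous_on[OF smooth_field] K]])
  then obtain C where C: "\<And>y. y \<in> K \<Longrightarrow> norm (field w y) \<le> C" unfolding bounded_iff by blast
  have Kp: "((P X, v s), (P Y, v t)) \<in> K" if "0 \<le> s" "0 \<le> t" for X Y s t
    using P_in v(2) that by (auto simp: K_def simp del: mem_cball_0)
  have v_cont: "continuous_on {0..} v"
    using v(1) unfolding exo_trajectory_def
    by (meson continuous_at_imp_continuous_on has_vector_derivative_continuous)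
  have arg_cont: "continuous_on ({0..} \<times> UNIV) (\<lambda>(t, X). ((P Xh, v th), (P X, v t)))" for Xh th
    unfolding case_prod_unfold
    by (intro continuous_intros continuous_on_compose2[OF P_cont] continuous_on_compose2[OF v_cont]) auto
  obtain Bv where Bv: "0 \<le> Bv" "\<And>t. 0 \<le> t \<Longrightarrow> norm (S *v v t) \<le> Bv"
  proof -
    have "bounded ((\<lambda>u. S *v u) ` VV)"
      by (intro compact_imp_bounded compact_continuous_image VV(1) linear_continuous_on matrix_vector_mul_bounded_linear)
    then obtain B where B: "\<And>u. u \<in> VV \<Longrightarrow> norm (S *v u) \<le> B" unfolding bounded_iff by blast
    show thesis
      by (rule that[of "\<bar>B\<bar>"]) (use B v(2) in \<open>auto intro: order_trans[OF _ abs_ge_self]\<close>)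
  qed
  have v_speed: "norm (v t - v s) \<le> Bv * (t - s)" if "0 \<le> s" "s \<le> t" for s t
  proof (rule norm_le_speed[where X' = "\<lambda>t. S *v v t"])
    show "(v has_vector_derivative S *v v u) (at u within {s..})" for u
      using v(1) unfolding exo_trajectory_def by (blast intro: has_vector_derivative_at_within)
  qed (use that Bv in auto)
  have C0: "0 \<le> C" using order_trans[OF norm_ge_zero C[OF Kp[of 0 0 X0 X0]]] by simp
  have "uniformly_continuous_on K (trigger w)"
    by (rule compact_uniformly_continuous[OF continuous_on_subset[OF continuous_trigger] K]) simp
  then obtain d where d: "0 < d" "\<And>y y'. y \<in> K \<Longrightarrow> y' \<in> K \<Longrightarrow> dist y' y < d \<Longrightarrow> dist (trigger w y') (trigger w y) < \<delta>\<^sup>2"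
    using \<delta> unfolding uniformly_continuous_on_def by (metis zero_less_power)
  \<comment> \<open>Within this time state and exosystem together move by less than \<open>d\<close>.\<close>
  define h where "h = d / (C + Bv + 1)"
  have h: "0 < h" "(C + Bv) * h < d"
    using C0 Bv(1) d(1) by (auto simp: h_def field_simps)
  show thesis
  proof (rule event_triggered_solution[where F = "\<lambda>Xh th t X. field w ((P Xh, v th), (P X, v t))"
      and Th = "\<lambda>Xh th t X. trigger w ((P Xh, v th), (P X, v t))" and L = L and C = C and h = h and c = "\<delta>\<^sup>2" and ?x0.0 = X0])
    show "0 < L" by (rule L(1))
    show "0 < h" by (rule h(1))
    show "continuous_on ({0..} \<times> UNIV) (\<lambda>(t, X). field w ((P Xh, v th), (P X, v t)))" for Xh th
      using continuous_on_compose2[OF smooth_continuous_on[OF smooth_field] arg_cont[of Xh th] subset_UNIV]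
      by (simp add: case_prod_unfold)
    show "continuous_on ({0..} \<times> UNIV) (\<lambda>(t, X). trigger w ((P Xh, v th), (P X, v t)))" for Xh th
      using continuous_on_compose2[OF continuous_trigger arg_cont[of Xh th] subset_UNIV]
      by (simp add: case_prod_unfold)
    show "norm (field w ((P Xh, v th), (P X, v t))) \<le> C" if "0 \<le> th" "0 \<le> t" for Xh th t X
      by (rule C[OF Kp[OF that]])
    show "norm (field w ((P Xh, v th), (P X, v t)) - field w ((P Xh, v th), (P Y, v t))) \<le> L * norm (X - Y)"
      if "0 \<le> th" "0 \<le> t" for Xh th t X Y
    proof -
      have "norm (field w ((P Xh, v th), (P X, v t)) - field w ((P Xh, v th), (P Y, v t)))
          \<le> L * norm (((P Xh, v th), (P X, v t)) - ((P Xh, v th), (P Y, v t)))"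
        by (intro L(2) Q Kp that)
      also have "\<dots> = L * norm (P X - P Y)" by (simp add: norm_Pair)
      also have "\<dots> \<le> L * norm (X - Y)" using P_lip L(1) by (intro mult_left_mono) auto
      finally show ?thesis .
    qed
    show "trigger w ((P Xh, v th), (P X, v t)) < \<delta>\<^sup>2"
      if "0 \<le> th" "th \<le> t" "t \<le> th + h" "norm (X - Xh) \<le> C * (t - th)" for Xh th t X
    proof -
      have t0: "0 \<le> t" using that by linarith
      have "dist ((P Xh, v th), (P X, v t)) ((P Xh, v th), (P Xh, v th)) = norm (P X - P Xh, v t - v th)"
        by (simp add: dist_norm norm_Pair)
      also have "\<dots> \<le> norm (P X - P Xh) + norm (v t - v th)" by (rule norm_Pair_le)
      also have "\<dots> \<le> C * (t - th) + Bv * (t - th)"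
        using order_trans[OF P_lip that(4)] v_speed[OF that(1,2)] by (rule add_mono)
      also have "\<dots> = (C + Bv) * (t - th)" by (simp add: algebra_simps)
      also have "\<dots> \<le> (C + Bv) * h" using that C0 Bv(1) by (intro mult_left_mono) auto
      also have "\<dots> < d" by (rule h(2))
      finally have "dist (trigger w ((P Xh, v th), (P X, v t))) (trigger w ((P Xh, v th), (P Xh, v th))) < \<delta>\<^sup>2"
        by (intro d(2) Kp that t0)
      then show ?thesis using trigger_refl[of w "(P Xh, v th)"] by (simp add: dist_real_def abs_less_iff)
    qed
  qed (use that in blast)
qed

lemma controlled_at_of_field:
  assumes X: "(X has_vector_derivative field w (p, (X t, v t))) (at t within {s. a \<le> ereal s \<and> ereal s < a'})"
    and t: "a \<le> ereal t" "ereal t < a'" and trig: "trigger w (p, (X t, v t)) < \<delta>\<^sup>2"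
  shows "controlled_at \<delta> v w (\<lambda>t. fst (X t)) (\<lambda>t. fst (snd (X t))) (\<lambda>t. fst (snd (snd (X t)))) (\<lambda>t. snd (snd (snd (X t)))) t"
proof -
  obtain h where h: "0 < h" "{t..<t+h} \<subseteq> {s. a \<le> ereal s \<and> ereal s < a'}" by (rule half_open_subset[OF t])
  note X' = has_vector_derivative_within_subset[OF X h(2)]
  note dfst = bounded_linear.has_vector_derivative[OF bounded_linear_fst]
    and dsnd = bounded_linear.has_vector_derivative[OF bounded_linear_snd]
  let ?u = "feedback w p + \<Psi> \<bullet> fst (snd (snd (fst p)))"
  show ?thesis
    unfolding controlled_at_def
  proof (intro exI conjI)
    show "0 < h" by (rule h)
    show "((\<lambda>t. fst (X t)) has_vector_derivative f (fst (X t)) (fst (snd (X t)) $ ix 1) (v t) w) (at t within {t..<t+h})"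
      using dfst[OF X'] by (simp add: field_def case_prod_unfold)
    show "((\<lambda>t. fst (snd (X t))) has_vector_derivative
        x_field g b (fst (X t)) (fst (snd (X t))) (v t) w (- \<rho> r (check w p r) * check w p r + \<Psi> \<bullet> fst (snd (snd (fst p)))))
        (at t within {t..<t+h})"
      using dfst[OF dsnd[OF X']] by (simp add: field_def case_prod_unfold feedback_def)
    show "((\<lambda>t. fst (snd (snd (X t)))) has_vector_derivative
        M *v fst (snd (snd (X t))) + (- \<rho> r (check w p r) * check w p r + \<Psi> \<bullet> fst (snd (snd (fst p)))) *\<^sub>R N)
        (at t within {t..<t+h})"
      using dfst[OF dsnd[OF dsnd[OF X']]] by (simp add: field_def case_prod_unfold feedback_def)
    show "((\<lambda>t. snd (snd (snd (X t)))) has_vector_derivative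
        A_obs lam *v snd (snd (snd (X t))) + check w p 1 *\<^sub>R lam
          + ((- \<rho> r (check w p r) * check w p r + \<Psi> \<bullet> fst (snd (snd (fst p)))) - \<Psi> \<bullet> fst (snd (snd (fst p)))) *\<^sub>R B_obs)
        (at t within {t..<t+h})"
      using dsnd[OF dsnd[OF dsnd[OF X']]] by (simp add: field_def case_prod_unfold feedback_def)
    show "let e = fst (snd (X t)) $ ix 1 - q (v t) w; y = xi_check \<rho> e (snd (snd (snd (X t)))) r in
        (- \<rho> r (check w p r) * check w p r + \<rho> r y * y)\<^sup>2
          + \<pi>r (fst (snd (snd (fst p))) - fst (snd (snd (X t))), check w p 1 - e) - \<sigma>\<^sup>2 * \<rho> r y * y\<^sup>2 < \<delta>\<^sup>2"
      using trig by (simp add: Let_def trigger_def feedback_def check_def case_prod_unfold)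
  qed
qed

text \<open>While the state stays in the ball of radius \<open>R'\<close> the truncated system is the closed loop,
  and the Lyapunov estimate keeps the state in the smaller ball of radius \<open>R\<close>. A first time on
  the boundary of the larger ball is therefore impossible.\<close>

lemma closed_loop_exists:
  fixes v :: "real \<Rightarrow> real^'nv"
  assumes v: "exo_trajectory S v" "\<And>t. 0 \<le> t \<Longrightarrow> v t \<in> VV" "w \<in> WW" and \<delta>: "0 < \<delta>"
  shows "\<exists>z x \<eta> xi tk. closed_loop_trajectory f g b q M N \<Psi> lam \<rho> \<pi>r \<sigma> \<delta> v w z x \<eta> xi tk \<and>
    z 0 = z0 \<and> x 0 = x0 \<and> \<eta> 0 = \<eta>0 \<and> xi 0 = xi0"
proof -
  define c0 where "c0 = max (LW (im_state v w 0) (v 0) w z0 x0 \<eta>0 xi0) (level \<delta>)"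
  have c0: "0 \<le> c0" using level_nonneg[OF \<delta>] by (simp add: c0_def)
  obtain R where R: "\<And>z x \<eta> xi t. 0 \<le> t \<Longrightarrow> storage v w z x \<eta> xi t \<le> c0 \<Longrightarrow> norm (z t, x t, \<eta> t, xi t) \<le> R"
    using storage_sublevel_bounded[OF v(1,2) c0, of w] by metis
  \<comment> \<open>The truncation is inactive at time \<open>0\<close> and wherever the a priori bound \<open>R\<close> holds.\<close>
  define R' where "R' = max R (norm (z0, x0, \<eta>0, xi0)) + 1"
  have R': "0 \<le> R'" "R < R'" "norm (z0, x0, \<eta>0, xi0) < R'"
    using norm_ge_zero[of "(z0, x0, \<eta>0, xi0)"] unfolding R'_def by linarith+
  define P where "P X = closest_point (cball 0 R') X" for X :: "(real^'nz) \<times> 'r rvec \<times> 's rvec \<times> 'r rvec"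
  have P_id: "P X = X" if "norm X \<le> R'" for X using that unfolding P_def by (intro closest_point_self) simp
  obtain X tk where X: "X 0 = (z0, x0, \<eta>0, xi0)" "continuous_on {0..} X" "tk 0 = 0"
    and tr: "\<And>k. tk (Suc k) = Inf {ereal t |t. tk k < ereal t \<and>
        \<delta>\<^sup>2 \<le> trigger w ((P (X (real_of_ereal (tk k))), v (real_of_ereal (tk k))), (P (X t), v t))}"
    and cover: "\<And>t. 0 \<le> t \<Longrightarrow> \<exists>k. tk k \<le> ereal t \<and> ereal t < tk (Suc k)"
    and ode: "\<And>k t. tk k \<le> ereal t \<Longrightarrow> ereal t < tk (Suc k) \<Longrightarrow>
       (X has_vector_derivative
         field w ((P (X (real_of_ereal (tk k))), v (real_of_ereal (tk k))), (P (X t), v t)))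
       (at t within {t. tk k \<le> ereal t \<and> ereal t < tk (Suc k)})"
    using truncated_solution[OF v(1,2) \<delta> R'(1), of "(z0, x0, \<eta>0, xi0)" w thesis] unfolding P_def by blast
  define hold where "hold k = real_of_ereal (tk k)" for k
  define z where "z t = fst (X t)" for t
  define x where "x t = fst (snd (X t))" for t
  define \<eta> where "\<eta> t = fst (snd (snd (X t)))" for t
  define xi where "xi t = snd (snd (snd (X t)))" for t
  have X_eq: "X t = (z t, x t, \<eta> t, xi t)" for t by (simp add: z_def x_def \<eta>_def xi_def)
  have cont: "continuous_on A z" "continuous_on A x" "continuous_on A \<eta>" "continuous_on A xi" if "A \<subseteq> {0..}" for A
    unfolding z_def[abs_def] x_def[abs_def] \<eta>_def[abs_def] xi_def[abs_def]
    by (intro continuous_intros continuous_on_subset[OF X(2) that])+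
  have tk_nonneg: "0 \<le> tk k" for k
  proof (induction k)
    case (Suc k)
    then show ?case unfolding tr[of k] by (intro Inf_greatest) (auto intro: order_trans less_imp_le)
  qed (simp add: X)
  have hold: "tk k = ereal (hold k)" "0 \<le> hold k" "hold k \<le> t" if "tk k \<le> ereal t" for k t
    using tk_nonneg[of k] that unfolding hold_def by (cases "tk k"; simp)+
  have ctrl: "controlled_at \<delta> v w z x \<eta> xi t"
    if t: "0 \<le> t" and inside: "\<And>s. 0 \<le> s \<Longrightarrow> s \<le> t \<Longrightarrow> norm (X s) \<le> R'" for t
  proof -
    obtain k where k: "tk k \<le> ereal t" "ereal t < tk (Suc k)" using cover[OF t] by blast
    note hk = hold[OF k(1)]
    have Pt: "P (X t) = X t" "P (X (hold k)) = X (hold k)" using inside[of t] inside[of "hold k"] t hk by (auto intro: P_id)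
    have "trigger w ((X (hold k), v (hold k)), (X t, v t)) < \<delta>\<^sup>2"
    proof (cases "tk k = ereal t")
      case True
      then have "hold k = t" using hk(1) by simp
      then show ?thesis using trigger_refl[of w "(X t, v t)"] \<delta> by (smt (verit) zero_less_power)
    next
      case False
      have "tk k < ereal t" by (rule le_neq_trans[OF k(1) False])
      from not_before_Inf[OF k(2)[unfolded tr] this] show ?thesis
        unfolding hold_def[symmetric] Pt by simp
    qed
    from controlled_at_of_field[where X = X and t = t and v = v, OF ode[OF k, unfolded hold_def[symmetric] Pt] k this]
    show ?thesis by (simp add: z_def[abs_def] x_def[abs_def] \<eta>_def[abs_def] xi_def[abs_def])
  qed
  have inside: "norm (X t) < R'" if t: "0 \<le> t" for t
  proof (rule ccontr)
    assume out: "\<not> norm (X t) < R'"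
    let ?A = "{0..t} \<inter> (\<lambda>s. norm (X s)) -` {R'..}"
    have "continuous_on {0..t} (\<lambda>s. norm (X s))"
      by (intro continuous_intros continuous_on_subset[OF X(2)]) auto
    then have "closed ?A" by (rule continuous_closed_preimage) auto
    then have "compact ?A" by (meson bounded_Int bounded_closed_interval compact_eq_bounded_closed)
    moreover have "t \<in> ?A" using t out by simp
    ultimately obtain T1 where T1: "T1 \<in> ?A" "\<And>s. s \<in> ?A \<Longrightarrow> T1 \<le> s"
      using compact_attains_inf[of ?A] by blast
    have before: "norm (X s) \<le> R'" if "0 \<le> s" "s < T1" for s
      using T1(2)[of s] T1(1) that by force
    have T10: "0 \<le> T1" using T1(1) by simp
    have "storage v w z x \<eta> xi T1 \<le> max (storage v w z x \<eta> xi 0) (level \<delta>)"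
    proof (rule storage_bounded[OF v \<delta> T10])
      show "controlled_at \<delta> v w z x \<eta> xi s" if "0 \<le> s" "s < T1" for s
        using before that by (intro ctrl) auto
    qed (auto intro!: cont)
    also have "\<dots> = c0" using X(1) by (simp add: c0_def storage_def z_def x_def \<eta>_def xi_def)
    finally have "norm (X T1) \<le> R" using R[OF T10] unfolding X_eq by blast
    then show False using T1(1) R'(2) by simp
  qed
  have Pid: "P (X t) = X t" if "0 \<le> t" for t by (rule P_id) (use inside[OF that] in simp)
  have trig_eq: "trigger w ((X s, v s), (X t, v t)) =
      (- \<rho> r (xi_check \<rho> (x s $ ix 1 - q (v s) w) (xi s) r) * xi_check \<rho> (x s $ ix 1 - q (v s) w) (xi s) r
         + \<rho> r (xi_check \<rho> (x t $ ix 1 - q (v t) w) (xi t) r) * xi_check \<rho> (x t $ ix 1 - q (v t) w) (xi t) r)\<^sup>2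
      + \<pi>r (\<eta> s - \<eta> t, (x s $ ix 1 - q (v s) w) - (x t $ ix 1 - q (v t) w))
      - \<sigma>\<^sup>2 * \<rho> r (xi_check \<rho> (x t $ ix 1 - q (v t) w) (xi t) r) * (xi_check \<rho> (x t $ ix 1 - q (v t) w) (xi t) r)\<^sup>2" for s t
    by (simp add: trigger_def feedback_def check_def X_eq)
  have tr': "tk (Suc k) = Inf {ereal t |t. tk k < ereal t \<and>
        \<delta>\<^sup>2 \<le> trigger w ((X (hold k), v (hold k)), (X t, v t))}" for k
  proof -
    have "{ereal t |t. tk k < ereal t \<and> \<delta>\<^sup>2 \<le> trigger w ((P (X (hold k)), v (hold k)), (P (X t), v t))}
        = {ereal t |t. tk k < ereal t \<and> \<delta>\<^sup>2 \<le> trigger w ((X (hold k), v (hold k)), (X t, v t))}"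
    proof (intro Collect_cong ex_cong1 conj_cong refl)
      fix t assume "tk k < ereal t"
      from hold[OF less_imp_le[OF this]] have "0 \<le> hold k" "0 \<le> t" by auto
      then show "\<delta>\<^sup>2 \<le> trigger w ((P (X (hold k)), v (hold k)), (P (X t), v t))
          \<longleftrightarrow> \<delta>\<^sup>2 \<le> trigger w ((X (hold k), v (hold k)), (X t, v t))" by (simp add: Pid)
    qed
    then show ?thesis unfolding tr[of k] hold_def[symmetric] by simp
  qed
  note dfst = bounded_linear.has_vector_derivative[OF bounded_linear_fst]
    and dsnd = bounded_linear.has_vector_derivative[OF bounded_linear_snd]
  have ode': "(X has_vector_derivative field w ((X (hold k), v (hold k)), (X t, v t)))
       (at t within {t. tk k \<le> ereal t \<and> ereal t < tk (Suc k)})"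
    if "tk k \<le> ereal t" "ereal t < tk (Suc k)" for k t
  proof -
    have "0 \<le> hold k" "0 \<le> t" using hold[OF that(1)] by auto
    then show ?thesis using ode[OF that] by (simp add: Pid hold_def[symmetric])
  qed
  have "closed_loop_trajectory f g b q M N \<Psi> lam \<rho> \<pi>r \<sigma> \<delta> v w z x \<eta> xi tk"
    unfolding closed_loop_trajectory_def Let_def r_card[symmetric] hold_def[symmetric]
  proof (intro conjI allI ballI impI)
    show "\<exists>k. t \<in> {t. tk k \<le> ereal t \<and> ereal t < tk (Suc k)}" if "0 \<le> t" for t using cover[OF that] by simp
    show "tk (Suc k) = Inf {ereal t |t. tk k < ereal t \<and> \<delta>\<^sup>2 \<le>
      (- \<rho> r (xi_check \<rho> (x (hold k) $ ix 1 - q (v (hold k)) w) (xi (hold k)) r) * xi_check \<rho> (x (hold k) $ ix 1 - q (v (hold k)) w) (xi (hold k)) r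
         + \<rho> r (xi_check \<rho> (x t $ ix 1 - q (v t) w) (xi t) r) * xi_check \<rho> (x t $ ix 1 - q (v t) w) (xi t) r)\<^sup>2
      + \<pi>r (\<eta> (hold k) - \<eta> t, (x (hold k) $ ix 1 - q (v (hold k)) w) - (x t $ ix 1 - q (v t) w))
      - \<sigma>\<^sup>2 * \<rho> r (xi_check \<rho> (x t $ ix 1 - q (v t) w) (xi t) r) * (xi_check \<rho> (x t $ ix 1 - q (v t) w) (xi t) r)\<^sup>2}" for k
      using tr'[of k] unfolding trig_eq .
  next
    fix k t assume "t \<in> {t. tk k \<le> ereal t \<and> ereal t < tk (Suc k)}"
    then have D: "(X has_vector_derivative field w ((X (hold k), v (hold k)), (X t, v t)))
       (at t within {t. tk k \<le> ereal t \<and> ereal t < tk (Suc k)})" by (intro ode') auto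
    note split = field_def feedback_def check_def case_prod_unfold
      z_def[abs_def] x_def[abs_def] \<eta>_def[abs_def] xi_def[abs_def]
    show "(z has_vector_derivative f (z t) (x t $ ix 1) (v t) w)
        (at t within {t. tk k \<le> ereal t \<and> ereal t < tk (Suc k)})"
      using dfst[OF D] by (simp add: split)
    show "(x has_vector_derivative x_field g b (z t) (x t) (v t) w
        (- \<rho> r (xi_check \<rho> (x (hold k) $ ix 1 - q (v (hold k)) w) (xi (hold k)) r) * xi_check \<rho> (x (hold k) $ ix 1 - q (v (hold k)) w) (xi (hold k)) r
          + \<Psi> \<bullet> \<eta> (hold k)))
        (at t within {t. tk k \<le> ereal t \<and> ereal t < tk (Suc k)})"
      using dfst[OF dsnd[OF D]] by (simp add: split)
    show "(\<eta> has_vector_derivative (M *v \<eta> t +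
        (- \<rho> r (xi_check \<rho> (x (hold k) $ ix 1 - q (v (hold k)) w) (xi (hold k)) r) * xi_check \<rho> (x (hold k) $ ix 1 - q (v (hold k)) w) (xi (hold k)) r
          + \<Psi> \<bullet> \<eta> (hold k)) *\<^sub>R N))
        (at t within {t. tk k \<le> ereal t \<and> ereal t < tk (Suc k)})"
      using dfst[OF dsnd[OF dsnd[OF D]]] by (simp add: split)
    show "(xi has_vector_derivative (A_obs lam *v xi t + (x (hold k) $ ix 1 - q (v (hold k)) w) *\<^sub>R lam +
        (- \<rho> r (xi_check \<rho> (x (hold k) $ ix 1 - q (v (hold k)) w) (xi (hold k)) r) * xi_check \<rho> (x (hold k) $ ix 1 - q (v (hold k)) w) (xi (hold k)) r
          + \<Psi> \<bullet> \<eta> (hold k) - \<Psi> \<bullet> \<eta> (hold k)) *\<^sub>R B_obs))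
        (at t within {t. tk k \<le> ereal t \<and> ereal t < tk (Suc k)})"
      using dsnd[OF dsnd[OF dsnd[OF D]]] by (simp add: split)
  qed (auto intro: cont X(3))
  then show ?thesis
    by (intro exI[of _ z] exI[of _ x] exI[of _ \<eta>] exI[of _ xi] exI[of _ tk])
      (simp add: X(1) z_def x_def \<eta>_def xi_def)
qed

lemma practical_regulation:
  assumes "0 < \<epsilon>"
  shows "\<exists>\<delta>>0. solves_practical_regulation f g b q S M N \<Psi> lam \<rho> \<pi>r \<sigma> \<delta> VV WW \<epsilon>"
proof -
  obtain \<delta> where \<delta>: "0 < \<delta>" "lw (level \<delta>) \<le> \<epsilon>" by (rule exists_threshold[OF assms])
  have "solves_practical_regulation f g b q S M N \<Psi> lam \<rho> \<pi>r \<sigma> \<delta> VV WW \<epsilon>"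
    unfolding solves_practical_regulation_def Let_def
  proof (intro allI impI conjI)
    fix v w z0 x0 \<eta>0 xi0
    assume "exo_trajectory S v \<and> (\<forall>t\<ge>0. v t \<in> VV) \<and> w \<in> WW"
    then have v: "exo_trajectory S v" "\<And>t. 0 \<le> t \<Longrightarrow> v t \<in> VV" "w \<in> WW" by auto
    show "\<exists>z x \<eta> xi tk. closed_loop_trajectory f g b q M N \<Psi> lam \<rho> \<pi>r \<sigma> \<delta> v w z x \<eta> xi tk \<and>
        z 0 = z0 \<and> x 0 = x0 \<and> \<eta> 0 = \<eta>0 \<and> xi 0 = xi0"
      by (rule closed_loop_exists[OF v \<delta>(1)])
    fix z x \<eta> xi tk
    assume "closed_loop_trajectory f g b q M N \<Psi> lam \<rho> \<pi>r \<sigma> \<delta> v w z x \<eta> xi tk \<and>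
        z 0 = z0 \<and> x 0 = x0 \<and> \<eta> 0 = \<eta>0 \<and> xi 0 = xi0"
    then have traj: "closed_loop_trajectory f g b q M N \<Psi> lam \<rho> \<pi>r \<sigma> \<delta> v w z x \<eta> xi tk" by blast
    show "bounded ((\<lambda>t. (z t, x t, \<eta> t, xi t)) ` {0..})"
      by (rule trajectory_bounded_and_regulated(1)[OF v \<delta> traj])
    show "Limsup at_top (\<lambda>t. ereal \<bar>x t $ ix 1 - q (v t) w\<bar>) \<le> ereal \<epsilon>"
      by (rule trajectory_bounded_and_regulated(2)[OF v \<delta> traj])
  qed
  with \<delta>(1) show ?thesis by blast
qed

end

theorem theorem3p1:
  fixes f :: "real^'nz \<Rightarrow> real \<Rightarrow> real^'nv \<Rightarrow> real^'nw \<Rightarrow> real^'nz"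
    and g :: "nat \<Rightarrow> real^'nz \<Rightarrow> real \<Rightarrow> real^'nv \<Rightarrow> real^'nw \<Rightarrow> real"
    and b :: "real^'nw \<Rightarrow> real"
    and q :: "real^'nv \<Rightarrow> real^'nw \<Rightarrow> real"
    and S :: "real^'nv^'nv"
    and zss :: "real^'nv \<Rightarrow> real^'nw \<Rightarrow> real^'nz"
    and rh N :: "('s::{finite,linorder}) rvec"
    and M T :: "'s sqmat"
    and lam :: "('r::{finite,linorder}) rvec"
    and VV :: "(real^'nv) set"
    and WW :: "(real^'nw) set"
  assumes f_smooth: "smooth (\<lambda>(z, y, v, w). f z y v w)"
    and g_smooth: "\<And>i. i \<in> {1..CARD('r)} \<Longrightarrow> smooth (\<lambda>(z, y, v, w). g i z y v w)"
    and b_smooth: "smooth b"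
    and q_smooth: "smooth (\<lambda>(v, w). q v w)"
    and q_zero: "\<And>w. q 0 w = 0"
    and f_zero: "\<And>w. f 0 0 0 w = 0"
    and g_zero: "\<And>i w. i \<in> {1..CARD('r)} \<Longrightarrow> g i 0 0 0 w = 0"
    and b_pos: "\<And>w. b w > 0"
    and A1: "assumption_A1 S"
    and A2: "assumption_A2 f S q zss"
    and A3: "polynomial_in_fst (steady_u CARD('r) g b S q zss)"
    and A4: "assumption_A4 f q zss"
    and im_coeffs: "internal_model_coeffs S (steady_u CARD('r) g b S q zss) rh"
    and M_Hurwitz: "Hurwitz M"
    and MN_controllable: "controllable M N"
    and T_solution: "is_sylvester_solution M N rh T"
    and T_nonsingular: "invertible T"
    and lam_Hurwitz: "Hurwitz (A_obs lam)"
    and VV: "compact VV" "0 \<in> VV"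
    and WW: "compact WW" "0 \<in> WW"
  shows "\<exists>(\<rho> :: nat \<Rightarrow> real \<Rightarrow> real) (\<pi>r :: 's rvec \<times> real \<Rightarrow> real) (\<sigma> :: real).
           (\<forall>i\<in>{1..CARD('r)}. smooth (\<rho> i) \<and> (\<forall>a. \<rho> i a > 0)) \<and>
           pos_def_fun \<pi>r \<and> 0 < \<sigma> \<and> \<sigma> < 1 \<and>
           (\<forall>\<epsilon>>0. \<exists>\<delta>>0.
              solves_practical_regulation f g b q S M N (Psi_row T) lam \<rho> \<pi>r \<sigma> \<delta> VV WW \<epsilon>)"
proof -
  interpret plant: output_regulation_plant f g b q S zss rh N M T lam VV WW "CARD('r)"
    by unfold_locales (use f_smooth g_smooth b_smooth q_smooth b_pos A2 A3 A4 im_coeffs M_Hurwitz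
      T_solution T_nonsingular lam_Hurwitz VV WW in auto)
  obtain \<rho> \<pi>r \<sigma> c up lw LW where
    design: "regulated_design f g b q S zss rh N M T lam VV WW CARD('r) \<rho> \<pi>r \<sigma> c up lw LW"
    using plant.stabilizing_design by blast
  interpret design: regulated_design f g b q S zss rh N M T lam VV WW "CARD('r)" \<rho> \<pi>r \<sigma> c up lw LW
    by (rule design)
  show ?thesis
    using design.\<rho> design.\<pi>r(1) design.\<sigma> design.practical_regulation by blast
qed

end
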